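(* Let $0\le m\le n$ be integers and let $r_{jk}:\mathbb{R}\to\mathbb{R}$ and $a_j,b_{jk}:[0,1]\times\mathbb{R}\to\mathbb{R}$ be $C^1$-smooth and $2\pi$-periodic in $t$. Suppose that $a_j(x,t)\neq 0$ for all $x\in[0,1]$, $t\in\mathbb{R}$, $j=1,\dots,n$, and that for all $1\le j\neq k\le n$ there exists $\tilde b_{jk}\in C^1([0,1]\times\mathbb{R})$ such that $b_{jk}(x,t)=\tilde b_{jk}(x,t)\,(a_k(x,t)-a_j(x,t))$ for all $x\in[0,1]$, $t\in\mathbb{R}$. Suppose further that $$R^0<1\quad\text{or}\quad S^0<1 .$$ For $f\in\mathcal{C}_n$ consider the problem (P) with right-hand side $f$, and let $\mathcal{K}$ be the vector space of all continuous solutions to (P) with $f=0$ (the problem (P), continuous and classical solutions, the space $\mathcal{C}_n$ and the numbers $R^0,S^0,R^1,S^1$ are defined in the context). Then the following is true: (i) $\dim\mathcal{K}<\infty$. (ii) The vector space of all $f\in\mathcal{C}_n$ such that there exists a continuous solution to (P) is a closed subspace of codimension $\dim\mathcal{K}$ in $\mathcal{C}_n$. (iii) Either $\dim\mathcal{K}>0$, or for any $f\in\mathcal{C}_n$ there exists exactly one continuous solution $u$ to (P). In the latter case the map $f\in\mathcal{C}_n\mapsto u\in\mathcal{C}_n$ is continuous. (iv) Suppose that the functions $f_j$ are continuously differentiable with respect to $t$ and that $$\max\{R^0,R^1\}<1\quad\text{or}\quad\max\{S^0,S^1\}<1 .$$ Then any continuous solution to (P) is a classical solution to (P). (v) If all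 coefficients $a_j$ are $t$-independent and if all functions $a_j,b_{jk},f_j$ and $r_{jk}$ are $C^\infty$-smooth, then any continuous solution to (P) is $C^\infty$-smooth.
   Context: **Problem (P).** For $u=(u_1,\dots,u_n):[0,1]\times\mathbb{R}\to\mathbb{R}^n$ and $f=(f_1,\dots,f_n)$, with $f_j:[0,1]\times\mathbb{R}\to\mathbb{R}$ being $2\pi$-periodic in $t$: $$\partial_tu_j+a_j(x,t)\partial_xu_j+\sum_{k=1}^n b_{jk}(x,t)u_k=f_j(x,t),\quad x\in(0,1),\ j=1,\dots,n,$$ $$u_j(x,t+2\pi)=u_j(x,t),\quad x\in[0,1],\ j=1,\dots,n,$$ $$u_j(0,t)=\sum_{k=m+1}^n r_{jk}(t)u_k(0,t),\ j=1,\dots,m,\qquad u_j(1,t)=\sum_{k=1}^m r_{jk}(t)u_k(1,t),\ j=m+1,\dots,n.$$ **Characteristics.** For $j=1,\dots,n$, $x\in[0,1]$, $t\in\mathbb{R}$, let $\xi\in[0,1]\mapsto\tau_j(\xi,x,t)\in\mathbb{R}$ be the solution of $$\partial_\xi\tau_j(\xi,x,t)=\frac{1}{a_j(\xi,\tau_j(\xi,x,t))},\qquad \tau_j(x,x,t)=t,$$ and set $$c_j(\xi,x,t)=\exp\int_x^\xi\frac{b_{jj}(\eta,\tau_j(\eta,x,t))}{a_j(\eta,\tau_j(\eta,x,t))}\,d\eta,\qquad d_j(\xi,x,t)=\frac{c_j(\xi,x,t)}{a_j(\xi,\tau_j(\xi,x,t))}.$$ **Space.** $\mathcal{C}_n$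 is the vector space of all continuous maps $u:[0,1]\times\mathbb{R}\to\mathbb{R}^n$ with $u(x,t+2\pi)=u(x,t)$, with norm $\|u\|_\infty=\max_{1\le j\le n}\max_{0\le x\le1}\max_{t\in\mathbb{R}}|u_j(x,t)|$. **Continuous solution.** A function $u\in\mathcal{C}_n$ is a continuous solution to (P) if for all $x\in[0,1]$, $t\in\mathbb{R}$: for $j=1,\dots,m$, $$u_j(x,t)=c_j(0,x,t)\sum_{k=m+1}^n r_{jk}(\tau_j(0,x,t))u_k(0,\tau_j(0,x,t))-\int_0^x d_j(\xi,x,t)\sum_{k\neq j}b_{jk}(\xi,\tau_j(\xi,x,t))u_k(\xi,\tau_j(\xi,x,t))\,d\xi+\int_0^x d_j(\xi,x,t)f_j(\xi,\tau_j(\xi,x,t))\,d\xi,$$ and for $j=m+1,\dots,n$, $$u_j(x,t)=c_j(1,x,t)\sum_{k=1}^m r_{jk}(\tau_j(1,x,t))u_k(1,\tau_j(1,x,t))+\int_x^1 d_j(\xi,x,t)\sum_{k\neq j}b_{jk}(\xi,\tau_j(\xi,x,t))u_k(\xi,\tau_j(\xi,x,t))\,d\xi-\int_x^1 d_j(\xi,x,t)f_j(\xi,\tau_j(\xi,x,t))\,d\xi,$$ where sums over $k\ne j$ run over $k\in\{1,\dots,n\}\setminus\{j\}$. **Classical solution.** A function $u\in C^1([0,1]\times\mathbb{R};\mathbb{R}^n)$ is a classical solution to (P) if it satisfies all equations of (P) pointwise. **Constants** (a maximum over an empty index set is taken to be $0$): $$R^0=\max_{m+1\le j\le n}\sum_{k=1}^m\exp\int_0^1\max_{\tau,t\in\mathbb{R}}\left(\frac{b_{jj}(\eta,\tau)}{a_j(\eta,\tau)}-\frac{b_{kk}(\eta,t)}{a_k(\eta,t)}\right)d\eta\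 \sum_{l=m+1}^n\max_{\tau,t\in\mathbb{R}}|r_{jk}(\tau)r_{kl}(t)|,$$ $$S^0=\max_{1\le j\le m}\sum_{k=m+1}^n\exp\int_0^1\max_{\tau,t\in\mathbb{R}}\left(\frac{b_{kk}(\eta,t)}{a_k(\eta,t)}-\frac{b_{jj}(\eta,\tau)}{a_j(\eta,\tau)}\right)d\eta\ \sum_{l=1}^m\max_{\tau,t\in\mathbb{R}}|r_{jk}(\tau)r_{kl}(t)|,$$ $$R^1=\max_{m+1\le j\le n}\sum_{k=1}^m\exp\int_0^1\max_{\tau,t\in\mathbb{R}}\left(\frac{b_{jj}(\eta,\tau)}{a_j(\eta,\tau)}-\frac{b_{kk}(\eta,t)}{a_k(\eta,t)}+\frac{\partial_ta_k(\eta,t)}{a_k(\eta,t)^2}-\frac{\partial_ta_j(\eta,\tau)}{a_j(\eta,\tau)^2}\right)d\eta\ \sum_{l=m+1}^n\max_{\tau,t\in\mathbb{R}}|r_{jk}(\tau)r_{kl}(t)|,$$ $$S^1=\max_{1\le j\le m}\sum_{k=m+1}^n\exp\int_0^1\max_{\tau,t\in\mathbb{R}}\left(\frac{b_{kk}(\eta,t)}{a_k(\eta,t)}-\frac{b_{jj}(\eta,\tau)}{a_j(\eta,\tau)}+\frac{\partial_ta_j(\eta,\tau)}{a_j(\eta,\tau)^2}-\frac{\partial_ta_k(\eta,t)}{a_k(\eta,t)^2}\right)d\eta\ \sum_{l=1}^m\max_{\tau,t\in\mathbb{R}}|r_{jk}(\tau)r_{kl}(t)|.$$ *)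

theory Defs
  imports "HOL-Analysis.Analysis" "HOL-Library.Function_Algebras"
begin

section \<open>Functions as a real vector space\<close>

instantiation "fun" :: (type, scaleR) scaleR
begin

definition "c *\<^sub>R f = (\<lambda>x. c *\<^sub>R f x)"

instance ..

end

lemma scaleR_fun_apply [simp]: "(c *\<^sub>R f) x = c *\<^sub>R f x"
  by (simp add: scaleR_fun_def)

instance "fun" :: (type, real_vector) real_vector
  by standard (simp_all add: fun_eq_iff algebra_simps)

definition finite_dim :: "'a::real_vector set \<Rightarrow> bool" where
  "finite_dim V \<longleftrightarrow> (\<exists>B. finite B \<and> span B = V)"

text \<open>The classes of the elements of \<open>B\<close> modulo \<open>V\<close> form a basis of the quotient space \<open>W/V\<close>
  (distinct elements of \<open>B\<close> have distinct classes by the independence condition).\<close>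

definition quotient_basis :: "'a::real_vector set \<Rightarrow> 'a set \<Rightarrow> 'a set \<Rightarrow> bool" where
  "quotient_basis V W B \<longleftrightarrow> finite B \<and> B \<subseteq> W
     \<and> (\<forall>w\<in>W. \<exists>g. w - (\<Sum>v\<in>B. g v *\<^sub>R v) \<in> V)
     \<and> (\<forall>g. (\<Sum>v\<in>B. g v *\<^sub>R v) \<in> V \<longrightarrow> (\<forall>v\<in>B. g v = 0))"

definition has_codim :: "'a::real_vector set \<Rightarrow> 'a set \<Rightarrow> nat \<Rightarrow> bool" where
  "has_codim V W d \<longleftrightarrow> subspace W \<and> subspace V \<and> V \<subseteq> W \<and> (\<exists>B. quotient_basis V W B \<and> card B = d)"


section \<open>Maxima, smoothness and periodicity\<close>

text \<open>Maxima over finite index sets, the empty maximum being \<open>0\<close>.  Maxima over real variables are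
  written \<open>SUP\<close>; they are attained for the continuous periodic functions they are applied to.\<close>

definition max_over :: "nat set \<Rightarrow> (nat \<Rightarrow> real) \<Rightarrow> real" where
  "max_over A g = (if A = {} then 0 else Max (g ` A))"

abbreviation strip :: "(real \<times> real) set" where
  "strip \<equiv> {0..1} \<times> UNIV"

text \<open>\<open>g\<close> is \<open>k\<close> times continuously differentiable on \<open>[0,1] \<times> \<real>\<close>, with one-sided
  \<open>x\<close>-derivatives at \<open>x = 0\<close> and \<open>x = 1\<close>.\<close>

fun Ck_strip :: "nat \<Rightarrow> (real \<Rightarrow> real \<Rightarrow> real) \<Rightarrow> bool" where
  "Ck_strip 0 g = continuous_on strip (\<lambda>(x, t). g x t)"
| "Ck_strip (Suc k) g = (continuous_on strip (\<lambda>(x, t). g x t) \<and>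
     (\<exists>gx gt. Ck_strip k gx \<and> Ck_strip k gt \<and>
       (\<forall>x\<in>{0..1}. \<forall>t.
          ((\<lambda>y. g y t) has_real_derivative gx x t) (at x within {0..1}) \<and>
          ((\<lambda>s. g x s) has_real_derivative gt x t) (at t))))"

definition smooth_strip :: "(real \<Rightarrow> real \<Rightarrow> real) \<Rightarrow> bool" where
  "smooth_strip g \<longleftrightarrow> (\<forall>k. Ck_strip k g)"

definition C1_in_time :: "(real \<Rightarrow> real \<Rightarrow> real) \<Rightarrow> bool" where
  "C1_in_time g \<longleftrightarrow> (\<exists>gt. Ck_strip 0 gt \<and>
     (\<forall>x\<in>{0..1}. \<forall>t. ((\<lambda>s. g x s) has_real_derivative gt x t) (at t)))"

definition smooth_real :: "(real \<Rightarrow> real) \<Rightarrow> bool" where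
  "smooth_real g \<longleftrightarrow> (\<forall>k t. ((deriv ^^ k) g) differentiable (at t))"

definition periodic_strip :: "(real \<Rightarrow> real \<Rightarrow> real) \<Rightarrow> bool" where
  "periodic_strip g \<longleftrightarrow> (\<forall>x\<in>{0..1}. \<forall>t. g x (t + 2 * pi) = g x t)"

definition periodic_real :: "(real \<Rightarrow> real) \<Rightarrow> bool" where
  "periodic_real g \<longleftrightarrow> (\<forall>t. g (t + 2 * pi) = g t)"


section \<open>The space of continuous periodic functions\<close>

text \<open>An element \<open>u\<close> of the space is written \<open>u j x t\<close> with \<open>1 \<le> j \<le> n\<close> and \<open>0 \<le> x \<le> 1\<close>.
  It is extended by \<open>0\<close> to all other \<open>j\<close> and \<open>x\<close>, so that equality of HOL functions is equality of
  functions on \<open>[0,1] \<times> \<real>\<close> with \<open>n\<close> components.\<close>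

type_synonym field = "nat \<Rightarrow> real \<Rightarrow> real \<Rightarrow> real"

definition Cper :: "nat \<Rightarrow> field set" where
  "Cper n = {u. (\<forall>j\<in>{1..n}. continuous_on strip (\<lambda>(x, t). u j x t) \<and> periodic_strip (u j))
     \<and> (\<forall>j x t. j \<notin> {1..n} \<or> x \<notin> {0..1} \<longrightarrow> u j x t = 0)}"

definition sup_norm :: "nat \<Rightarrow> field \<Rightarrow> real" where
  "sup_norm n u = max_over {1..n} (\<lambda>j. SUP x\<in>{0..1}. SUP t. \<bar>u j x t\<bar>)"

text \<open>The locale \<^locale>\<open>Metric_space\<close> requires a distance function that is nonnegative on
  the whole type, hence the default value outside the space.\<close>

definition Cper_dist :: "nat \<Rightarrow> field \<Rightarrow> field \<Rightarrow> real" where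
  "Cper_dist n u v = (if u \<in> Cper n \<and> v \<in> Cper n then sup_norm n (u - v) else 0)"

definition Cper_top :: "nat \<Rightarrow> field topology" where
  "Cper_top n = Metric_space.mtopology (Cper n) (Cper_dist n)"


lemma subspace_Cper: "subspace (Cper n)"
  unfolding subspace_def Cper_def periodic_strip_def
  by (auto simp: case_prod_unfold intro!: continuous_intros)

lemma periodic_strip_int:
  assumes "periodic_strip g" "x \<in> {0..1}"
  shows "g x (t + 2 * pi * of_int k) = g x t"
proof (induction k rule: int_induct[where k = 0])
  case base
  show ?case by simp
next
  case (step1 i)
  have "g x ((t + 2 * pi * of_int i) + 2 * pi) = g x (t + 2 * pi * of_int i)"
    using assms by (auto simp: periodic_strip_def)
  then show ?case using step1 by (simp add: algebra_simps)
next
  case (step2 i)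
  have "g x ((t + 2 * pi * of_int (i - 1)) + 2 * pi) = g x (t + 2 * pi * of_int (i - 1))"
    using assms by (auto simp: periodic_strip_def)
  then show ?case using step2 by (simp add: algebra_simps)
qed

lemma periodic_strip_bounded:
  assumes c: "continuous_on strip (\<lambda>(x, t). g x t)" and p: "periodic_strip g"
  shows "\<exists>B. \<forall>x\<in>{0..1}. \<forall>t. \<bar>g x t\<bar> \<le> B"
proof -
  have "compact ((\<lambda>(x, t). g x t) ` ({0..1} \<times> {0..2 * pi}))"
    by (intro compact_continuous_image continuous_on_subset[OF c] compact_Times) auto
  then obtain B where B: "\<And>y. y \<in> (\<lambda>(x, t). g x t) ` ({0..1} \<times> {0..2 * pi}) \<Longrightarrow> norm y \<le> B"
    using compact_imp_bounded bounded_iff by metis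
  have "\<bar>g x t\<bar> \<le> B" if x: "x \<in> {0..1}" for x t
  proof -
    define k where "k = \<lfloor>t / (2 * pi)\<rfloor>"
    define s where "s = t - 2 * pi * of_int k"
    have "of_int k \<le> t / (2 * pi)" "t / (2 * pi) < of_int k + 1"
      unfolding k_def by linarith+
    then have "s \<in> {0..2 * pi}"
      unfolding s_def by (auto simp: field_simps)
    then have "g x s \<in> (\<lambda>(x, t). g x t) ` ({0..1} \<times> {0..2 * pi})"
      using x by (auto intro!: image_eqI[where x = "(x, s)"])
    then have "\<bar>g x s\<bar> \<le> B"
      using B by fastforce
    moreover have "g x t = g x s"
      using periodic_strip_int[OF p x, of s k] by (simp add: s_def)
    ultimately show ?thesis by simp
  qed
  then show ?thesis by blast
qed

lemma Cper_bounded: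
  assumes "u \<in> Cper n" "j \<in> {1..n}"
  shows "\<exists>B. \<forall>x\<in>{0..1}. \<forall>t. \<bar>u j x t\<bar> \<le> B"
  using assms by (intro periodic_strip_bounded) (auto simp: Cper_def)

lemma sup_norm_upper:
  assumes u: "u \<in> Cper n" and j: "j \<in> {1..n}" and x: "x \<in> {0..1}"
  shows "\<bar>u j x t\<bar> \<le> sup_norm n u"
proof -
  obtain B where B: "\<And>x t. x \<in> {0..1} \<Longrightarrow> \<bar>u j x t\<bar> \<le> B"
    using Cper_bounded[OF u j] by blast
  have 1: "\<bar>u j x t\<bar> \<le> (SUP t. \<bar>u j x t\<bar>)"
    using B[OF x] by (intro cSUP_upper) (auto intro!: bdd_aboveI2)
  also have "\<dots> \<le> (SUP x\<in>{0..1}. SUP t. \<bar>u j x t\<bar>)"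
    using B x by (intro cSUP_upper bdd_aboveI2[where M = B] cSUP_least) auto
  also have "\<dots> \<le> sup_norm n u"
    using j by (auto simp: sup_norm_def max_over_def intro!: Max_ge)
  finally show ?thesis .
qed

lemma sup_norm_least:
  assumes B: "\<And>j x t. j \<in> {1..n} \<Longrightarrow> x \<in> {0..1} \<Longrightarrow> \<bar>u j x t\<bar> \<le> B" and "0 \<le> B"
  shows "sup_norm n u \<le> B"
proof (cases "n = 0")
  case True
  then show ?thesis using assms(2) by (simp add: sup_norm_def max_over_def)
next
  case False
  have "(SUP x\<in>{0..1}. SUP t. \<bar>u j x t\<bar>) \<le> B" if "j \<in> {1..n}" for j
    using B[OF that] by (intro cSUP_least) auto
  then show ?thesis using False
    by (auto simp: sup_norm_def max_over_def)
qed

lemma sup_norm_nonneg: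
  assumes "u \<in> Cper n"
  shows "0 \<le> sup_norm n u"
proof (cases "n = 0")
  case True
  then show ?thesis by (simp add: sup_norm_def max_over_def)
next
  case False
  then have "\<bar>u 1 0 0\<bar> \<le> sup_norm n u"
    using assms by (intro sup_norm_upper) auto
  then show ?thesis by linarith
qed

lemma sup_norm_eq_0_iff:
  assumes u: "u \<in> Cper n"
  shows "sup_norm n u = 0 \<longleftrightarrow> u = 0"
proof
  assume 0: "sup_norm n u = 0"
  have "u j x t = 0" for j x t
  proof (cases "j \<in> {1..n} \<and> x \<in> {0..1}")
    case True
    then show ?thesis using sup_norm_upper[OF u, of j x t] 0 by simp
  next
    case False
    then show ?thesis using u by (auto simp: Cper_def)
  qed
  then show "u = 0" by (simp add: fun_eq_iff)
next
  assume "u = 0"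
  then show "sup_norm n u = 0"
    using sup_norm_least[of n u 0] sup_norm_nonneg[OF u] by simp
qed

lemma Metric_space_Cper: "Metric_space (Cper n) (Cper_dist n)"
proof
  have diff: "u - v \<in> Cper n" if "u \<in> Cper n" "v \<in> Cper n" for u v
    using subspace_diff[OF subspace_Cper] that by blast
  show "0 \<le> Cper_dist n u v" for u v
    by (simp add: Cper_dist_def sup_norm_nonneg diff)
  show "Cper_dist n u v = Cper_dist n v u" for u v
    by (simp add: Cper_dist_def sup_norm_def abs_minus_commute)
  show "Cper_dist n u v = 0 \<longleftrightarrow> u = v" if "u \<in> Cper n" "v \<in> Cper n" for u v
    using that by (simp add: Cper_dist_def sup_norm_eq_0_iff diff)
  show "Cper_dist n u w \<le> Cper_dist n u v + Cper_dist n v w"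
    if u: "u \<in> Cper n" and v: "v \<in> Cper n" and w: "w \<in> Cper n" for u v w
  proof -
    have "sup_norm n (u - w) \<le> sup_norm n (u - v) + sup_norm n (v - w)"
    proof (rule sup_norm_least)
      fix j x t assume jx: "j \<in> {1..n}" "x \<in> {0..1::real}"
      show "\<bar>(u - w) j x t\<bar> \<le> sup_norm n (u - v) + sup_norm n (v - w)"
        using sup_norm_upper[OF diff[OF u v] jx, of t] sup_norm_upper[OF diff[OF v w] jx, of t]
        by simp
    qed (use sup_norm_nonneg diff u v w in auto)
    then show ?thesis using u v w by (simp add: Cper_dist_def)
  qed
qed


section \<open>Characteristics\<close>

definition is_characteristic :: "field \<Rightarrow> nat \<Rightarrow> real \<Rightarrow> real \<Rightarrow> (real \<Rightarrow> real) \<Rightarrow> bool" where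
  "is_characteristic a j x t \<phi> \<longleftrightarrow> \<phi> x = t \<and>
     (\<forall>\<xi>\<in>{0..1}. (\<phi> has_real_derivative 1 / a j \<xi> (\<phi> \<xi>)) (at \<xi> within {0..1}))"

definition char_time :: "field \<Rightarrow> nat \<Rightarrow> real \<Rightarrow> real \<Rightarrow> real \<Rightarrow> real" where
  "char_time a j \<xi> x t = (THE s. \<exists>\<phi>. is_characteristic a j x t \<phi> \<and> \<phi> \<xi> = s)"

definition c_coef ::
  "field \<Rightarrow> (nat \<Rightarrow> field) \<Rightarrow> nat \<Rightarrow> real \<Rightarrow> real \<Rightarrow> real \<Rightarrow> real" where
  "c_coef a b j \<xi> x t =
     exp (LBINT \<eta>=x..\<xi>. b j j \<eta> (char_time a j \<eta> x t) / a j \<eta> (char_time a j \<eta> x t))"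

definition d_coef ::
  "field \<Rightarrow> (nat \<Rightarrow> field) \<Rightarrow> nat \<Rightarrow> real \<Rightarrow> real \<Rightarrow> real \<Rightarrow> real" where
  "d_coef a b j \<xi> x t = c_coef a b j \<xi> x t / a j \<xi> (char_time a j \<xi> x t)"


section \<open>Continuous and classical solutions\<close>

definition continuous_solution ::
  "nat \<Rightarrow> nat \<Rightarrow> field \<Rightarrow> (nat \<Rightarrow> field) \<Rightarrow> (nat \<Rightarrow> nat \<Rightarrow> real \<Rightarrow> real) \<Rightarrow> field \<Rightarrow> field \<Rightarrow> bool" where
  "continuous_solution n m a b r f u \<longleftrightarrow> u \<in> Cper n \<and>
     (\<forall>x\<in>{0..1}. \<forall>t.
       (\<forall>j\<in>{1..m}. u j x t =
          c_coef a b j 0 x t *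
            (\<Sum>k=m+1..n. r j k (char_time a j 0 x t) * u k 0 (char_time a j 0 x t))
          - (LBINT \<xi>=0..x. d_coef a b j \<xi> x t *
              (\<Sum>k\<in>{1..n} - {j}. b j k \<xi> (char_time a j \<xi> x t) * u k \<xi> (char_time a j \<xi> x t)))
          + (LBINT \<xi>=0..x. d_coef a b j \<xi> x t * f j \<xi> (char_time a j \<xi> x t))) \<and>
       (\<forall>j\<in>{m+1..n}. u j x t =
          c_coef a b j 1 x t *
            (\<Sum>k=1..m. r j k (char_time a j 1 x t) * u k 1 (char_time a j 1 x t))
          + (LBINT \<xi>=x..1. d_coef a b j \<xi> x t *
              (\<Sum>k\<in>{1..n} - {j}. b j k \<xi> (char_time a j \<xi> x t) * u k \<xi> (char_time a j \<xi> x t)))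
          - (LBINT \<xi>=x..1. d_coef a b j \<xi> x t * f j \<xi> (char_time a j \<xi> x t))))"

definition homogeneous_solutions ::
  "nat \<Rightarrow> nat \<Rightarrow> field \<Rightarrow> (nat \<Rightarrow> field) \<Rightarrow> (nat \<Rightarrow> nat \<Rightarrow> real \<Rightarrow> real) \<Rightarrow> field set" where
  "homogeneous_solutions n m a b r = {u. continuous_solution n m a b r (\<lambda>_ _ _. 0) u}"

definition solvable_rhs ::
  "nat \<Rightarrow> nat \<Rightarrow> field \<Rightarrow> (nat \<Rightarrow> field) \<Rightarrow> (nat \<Rightarrow> nat \<Rightarrow> real \<Rightarrow> real) \<Rightarrow> field set" where
  "solvable_rhs n m a b r = {f \<in> Cper n. \<exists>u. continuous_solution n m a b r f u}"

definition classical_solution ::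
  "nat \<Rightarrow> nat \<Rightarrow> field \<Rightarrow> (nat \<Rightarrow> field) \<Rightarrow> (nat \<Rightarrow> nat \<Rightarrow> real \<Rightarrow> real) \<Rightarrow> field \<Rightarrow> field \<Rightarrow> bool" where
  "classical_solution n m a b r f u \<longleftrightarrow>
     (\<forall>j\<in>{1..n}. Ck_strip 1 (u j)) \<and>
     (\<forall>j\<in>{1..n}. \<forall>x\<in>{0<..<1}. \<forall>t.
        deriv (\<lambda>s. u j x s) t + a j x t * deriv (\<lambda>y. u j y t) x
          + (\<Sum>k=1..n. b j k x t * u k x t) = f j x t) \<and>
     (\<forall>j\<in>{1..n}. \<forall>x\<in>{0..1}. \<forall>t. u j x (t + 2 * pi) = u j x t) \<and>
     (\<forall>j\<in>{1..m}. \<forall>t. u j 0 t = (\<Sum>k=m+1..n. r j k t * u k 0 t)) \<and>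
     (\<forall>j\<in>{m+1..n}. \<forall>t. u j 1 t = (\<Sum>k=1..m. r j k t * u k 1 t))"


section \<open>The constants\<close>

definition R0 ::
  "nat \<Rightarrow> nat \<Rightarrow> field \<Rightarrow> (nat \<Rightarrow> field) \<Rightarrow> (nat \<Rightarrow> nat \<Rightarrow> real \<Rightarrow> real) \<Rightarrow> real" where
  "R0 n m a b r = max_over {m+1..n} (\<lambda>j. \<Sum>k=1..m.
     exp (LBINT \<eta>=0..1. (SUP (\<tau>, t)\<in>UNIV. b j j \<eta> \<tau> / a j \<eta> \<tau> - b k k \<eta> t / a k \<eta> t))
     * (\<Sum>l=m+1..n. (SUP (\<tau>, t)\<in>UNIV. \<bar>r j k \<tau> * r k l t\<bar>)))"

definition S0 ::
  "nat \<Rightarrow> nat \<Rightarrow> field \<Rightarrow> (nat \<Rightarrow> field) \<Rightarrow> (nat \<Rightarrow> nat \<Rightarrow> real \<Rightarrow> real) \<Rightarrow> real" where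
  "S0 n m a b r = max_over {1..m} (\<lambda>j. \<Sum>k=m+1..n.
     exp (LBINT \<eta>=0..1. (SUP (\<tau>, t)\<in>UNIV. b k k \<eta> t / a k \<eta> t - b j j \<eta> \<tau> / a j \<eta> \<tau>))
     * (\<Sum>l=1..m. (SUP (\<tau>, t)\<in>UNIV. \<bar>r j k \<tau> * r k l t\<bar>)))"

definition R1 ::
  "nat \<Rightarrow> nat \<Rightarrow> field \<Rightarrow> (nat \<Rightarrow> field) \<Rightarrow> (nat \<Rightarrow> nat \<Rightarrow> real \<Rightarrow> real) \<Rightarrow> real" where
  "R1 n m a b r = max_over {m+1..n} (\<lambda>j. \<Sum>k=1..m.
     exp (LBINT \<eta>=0..1. (SUP (\<tau>, t)\<in>UNIV.
       b j j \<eta> \<tau> / a j \<eta> \<tau> - b k k \<eta> t / a k \<eta> t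
       + deriv (a k \<eta>) t / (a k \<eta> t)\<^sup>2 - deriv (a j \<eta>) \<tau> / (a j \<eta> \<tau>)\<^sup>2))
     * (\<Sum>l=m+1..n. (SUP (\<tau>, t)\<in>UNIV. \<bar>r j k \<tau> * r k l t\<bar>)))"

definition S1 ::
  "nat \<Rightarrow> nat \<Rightarrow> field \<Rightarrow> (nat \<Rightarrow> field) \<Rightarrow> (nat \<Rightarrow> nat \<Rightarrow> real \<Rightarrow> real) \<Rightarrow> real" where
  "S1 n m a b r = max_over {1..m} (\<lambda>j. \<Sum>k=m+1..n.
     exp (LBINT \<eta>=0..1. (SUP (\<tau>, t)\<in>UNIV.
       b k k \<eta> t / a k \<eta> t - b j j \<eta> \<tau> / a j \<eta> \<tau>
       + deriv (a j \<eta>) \<tau> / (a j \<eta> \<tau>)\<^sup>2 - deriv (a k \<eta>) t / (a k \<eta> t)\<^sup>2))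
     * (\<Sum>l=1..m. (SUP (\<tau>, t)\<in>UNIV. \<bar>r j k \<tau> * r k l t\<bar>)))"

end

theory Submission imports Defs begin

text \<open>Write \<open>F\<^sub>j = 1 / a\<^sub>j\<close>. The \<open>j\<close>-th equation prescribes the derivative of \<open>u\<^sub>j\<close> along the curves of slope
  \<open>F\<^sub>j\<close>; a continuous solution satisfies it in integrated form along each curve, damped by \<open>b\<^sub>j\<^sub>j\<close> and
  starting at the boundary where the curve enters. With \<open>C u\<close> the boundary values carried along
  the characteristics, \<open>F\<close> the integration along them from the entry point, and \<open>B u\<close> the coupling terms
  \<open>\<Sum>\<^sub>k b\<^sub>j\<^sub>k u\<^sub>k\<close>, \<open>k \<noteq> j\<close>, the equation is \<open>u = C u + F (f - B u)\<close>.

  A characteristic connects the two boundaries. The values of \<open>u\<close> at the exits therefore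
  satisfy a linear functional equation with shifted arguments. If one of \<open>R\<^sup>0\<close>, \<open>S\<^sup>0\<close> is less than \<open>1\<close>,
  then running through the interval twice is a contraction, on the components \<open>j > m\<close> or \<open>j \<le> m\<close>.
  Hence \<open>I - C\<close> has a bounded inverse \<open>A\<close>, and the problem becomes \<open>u = A F (f - B u)\<close>.
  With \<open>v = f - B u\<close> it is \<open>(I + Q) v = f\<close>, where \<open>Q = B A F\<close>.

  The operator \<open>Q\<close> need not be compact, but \<open>Q\<^sup>2 = B A (F B A F)\<close> is, because \<open>F B\<close> regularises
  functions that have a derivative along their own characteristics. For \<open>k \<noteq> j\<close> the hypothesis on
  \<open>b\<^sub>j\<^sub>k\<close> gives \<open>b\<^sub>j\<^sub>k / a\<^sub>j = \<beta> (F\<^sub>j - F\<^sub>k)\<close> with \<open>\<beta>\<close> of class \<open>C\<^sup>1\<close>. If \<open>u\<^sub>k\<close> has the derivative \<open>g\<close> along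
  curves of slope \<open>F\<^sub>k\<close>, then formally \<open>(F\<^sub>j - F\<^sub>k) \<partial>\<^sub>t u\<^sub>k\<close> is the derivative of \<open>u\<^sub>k\<close> along curves of
  slope \<open>F\<^sub>j\<close> minus \<open>g\<close>. The time derivative of the integral of \<open>\<beta> (F\<^sub>j - F\<^sub>k) u\<^sub>k\<close> can thus be integrated
  by parts, and what remains contains \<open>u\<^sub>k\<close> and \<open>g\<close> only (\<open>damped_smoothing\<close>). So \<open>F B A F\<close> maps
  bounded sets to bounded sets of Lipschitz functions (\<open>compactness\<close>), and by a partition of unity it is
  a norm limit of operators of finite rank (\<open>finite_rank_approximation\<close>).

  An operator \<open>I + Q\<close> whose square \<open>Q\<^sup>2\<close> is the sum of a small operator and one of finite rank is an
  invertible operator plus one of finite rank (\<open>index0_of_square\<close>). Linear algebra in a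
  finite-dimensional space then gives the first three assertions (\<open>fredholm_alternative\<close>).

  For the fourth assertion, \<open>u - C u = F (f - B u)\<close> has a continuous time derivative by smoothing. The
  formally differentiated functional equation contains in addition the derivatives of the shifts,
  and its coefficients are controlled by \<open>R\<^sup>1\<close> or \<open>S\<^sup>1\<close>. So the series that solves the functional
  equation may be differentiated term by term (\<open>fp_C1\<close>), and the \<open>x\<close>-derivative follows from the
  derivative along the characteristics.

  If the speeds do not depend on \<open>t\<close>, the shifts have derivative \<open>1\<close>, and the condition for the
  differentiated equation is the original one. Moreover \<open>\<partial>\<^sub>t u\<close> solves a problem of the same kind, with
  inhomogeneous boundary conditions, so all time derivatives exist by induction. The equation along the
  characteristics exchanges time derivatives for \<open>x\<close>-derivatives (\<open>transport_gain\<close>).\<close>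

section \<open>Integrals with variable endpoints and parameters\<close>

text \<open>The oriented integral of \<open>g\<close> from \<open>a\<close> to \<open>b\<close>, pulled back to the fixed interval \<open>[0,1]\<close>:
  moving endpoints become parameters of the integrand, so that continuity and differentiation
  under the integral sign are needed for a fixed interval only.\<close>

definition ig :: "(real \<Rightarrow> real) \<Rightarrow> real \<Rightarrow> real \<Rightarrow> real" where
  "ig g a b = (b - a) * integral {0..1} (\<lambda>\<theta>. g (a + (b - a) * \<theta>))"

lemma segment_in_convex:
  fixes a b :: real
  assumes "convex S" "a \<in> S" "b \<in> S" "\<theta> \<in> {0..1}"
  shows "a + (b - a) * \<theta> \<in> S"
proof -
  have "(1 - \<theta>) *\<^sub>R a + \<theta> *\<^sub>R b \<in> S"
    using assms by (intro convexD) auto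
  then show ?thesis by (simp add: algebra_simps)
qed

lemma segment_in_unit: "a \<in> {0..1} \<Longrightarrow> b \<in> {0..1} \<Longrightarrow> \<theta> \<in> {0..1} \<Longrightarrow> a + (b - a) * \<theta> \<in> {0..1::real}"
  by (rule segment_in_convex) auto

lemma ig_same [simp]: "ig g a a = 0"
  by (simp add: ig_def)

lemma ig_FTC:
  assumes S: "convex S" "a \<in> S" "b \<in> S"
    and G: "\<And>x. x \<in> S \<Longrightarrow> (G has_real_derivative g x) (at x within S)"
  shows "ig g a b = G b - G a"
proof -
  have "((\<lambda>\<theta>. (b - a) * g (a + (b - a) * \<theta>)) has_integral G (a + (b - a) * 1) - G (a + (b - a) * 0)) {0..1}"
  proof (rule fundamental_theorem_of_calculus)
    fix x :: real assume x: "x \<in> {0..1}"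
    have "((G \<circ> (\<lambda>\<theta>. a + (b - a) * \<theta>)) has_real_derivative g (a + (b - a) * x) * (b - a)) (at x within {0..1})"
    proof (rule DERIV_image_chain)
      show "(G has_real_derivative g (a + (b - a) * x)) (at (a + (b - a) * x) within (\<lambda>\<theta>. a + (b - a) * \<theta>) ` {0..1})"
        by (rule has_field_derivative_subset[OF G]) (use segment_in_convex[OF S] x in auto)
      show "((\<lambda>\<theta>. a + (b - a) * \<theta>) has_real_derivative b - a) (at x within {0..1})"
        by (auto intro!: derivative_eq_intros)
    qed
    then show "((\<lambda>\<theta>. G (a + (b - a) * \<theta>)) has_vector_derivative (b - a) * g (a + (b - a) * x)) (at x within {0..1})"
      by (simp add: has_real_derivative_iff_has_vector_derivative o_def mult.commute)
  qed auto
  from integral_unique[OF this] show ?thesis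
    by (simp add: ig_def)
qed

text \<open>Antiderivatives reduce every statement about \<open>ig\<close> with moving endpoints to one about
  differentiable functions.\<close>

lemma continuous_antiderivative:
  assumes "continuous_on {c..d} (g :: real \<Rightarrow> real)"
  obtains G where "\<And>x. x \<in> {c..d} \<Longrightarrow> (G has_real_derivative g x) (at x within {c..d})"
  using antiderivative_continuous[OF assms] by (auto simp: has_real_derivative_iff_has_vector_derivative)

lemma ig_deriv:
  assumes g: "continuous_on {c..d} g" and a: "a \<in> {c..d}" and x: "x \<in> {c..d}"
  shows "((\<lambda>\<xi>. ig g a \<xi>) has_real_derivative g x) (at x within {c..d})"
proof -
  obtain G where G: "\<And>x. x \<in> {c..d} \<Longrightarrow> (G has_real_derivative g x) (at x within {c..d})"
    using continuous_antiderivative[OF g] by blast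
  have "((\<lambda>\<xi>. G \<xi> - G a) has_real_derivative g x) (at x within {c..d})"
    using G[OF x] by (auto intro!: derivative_eq_intros)
  then show ?thesis
    by (rule has_field_derivative_transform_within[where d = 1]) (use x a ig_FTC[OF _ a _ G] in auto)
qed

lemma ig_deriv_UNIV:
  assumes g: "continuous_on UNIV g"
  shows "((\<lambda>\<xi>. ig g a \<xi>) has_real_derivative g x) (at x)"
proof -
  have "((\<lambda>\<xi>. ig g a \<xi>) has_real_derivative g x) (at x within {min a x - 1..max a x + 1})"
    by (rule ig_deriv) (auto intro: continuous_on_subset[OF g])
  moreover have "at x within {min a x - 1..max a x + 1} = at x"
    by (rule at_within_interior) auto
  ultimately show ?thesis by simp
qed

lemma ig_LBINT:
  assumes g: "continuous_on {c..d} g" and a: "a \<in> {c..d}" and b: "b \<in> {c..d}"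
  shows "(LBINT y=ereal a..ereal b. g y) = ig g a b"
proof -
  obtain G where G: "\<And>x. x \<in> {c..d} \<Longrightarrow> (G has_real_derivative g x) (at x within {c..d})"
    using continuous_antiderivative[OF g] by blast
  have sub: "{min a b..max a b} \<subseteq> {c..d}" using a b by auto
  have "(LBINT y=ereal a..ereal b. g y) = G b - G a"
  proof (rule interval_integral_FTC_finite)
    show "continuous_on {min a b..max a b} g" by (rule continuous_on_subset[OF g sub])
    show "(G has_vector_derivative g x) (at x within {min a b..max a b})" if "min a b \<le> x" "x \<le> max a b" for x
      unfolding has_real_derivative_iff_has_vector_derivative[symmetric]
      by (rule has_field_derivative_subset[OF G sub]) (use that sub in auto)
  qed
  with ig_FTC[OF _ a b G] show ?thesis by simp
qed

lemma ig_split: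
  assumes g: "continuous_on {0..1} g" and "a \<in> {0..1}" "b \<in> {0..1}" "c \<in> {0..1}"
  shows "ig g a b + ig g b c = ig g a c"
proof -
  obtain G where G: "\<And>x. x \<in> {0..1} \<Longrightarrow> (G has_real_derivative g x) (at x within {0..1})"
    using continuous_antiderivative[OF g] by blast
  show ?thesis using assms ig_FTC[OF _ _ _ G] by auto
qed

lemma ig_cong:
  assumes "a \<in> {0..1}" "b \<in> {0..1}" "\<And>x. x \<in> {0..1} \<Longrightarrow> g x = h x"
  shows "ig g a b = ig h a b"
  unfolding ig_def using segment_in_unit[OF assms(1,2)] assms(3)
  by (auto intro!: integral_cong)

lemma continuous_on_segment:
  assumes "continuous_on {0..1} g" "a \<in> {0..1}" "b \<in> {0..1::real}"
  shows "continuous_on {0..1} (\<lambda>\<theta>. g (a + (b - a) * \<theta>))"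
  by (rule continuous_on_compose2[OF assms(1)])
    (auto simp only: image_subset_iff intro!: segment_in_unit assms continuous_intros)

lemma ig_add:
  assumes "continuous_on {0..1} g" "continuous_on {0..1} h" "a \<in> {0..1}" "b \<in> {0..1}"
  shows "ig (\<lambda>x. g x + h x) a b = ig g a b + ig h a b"
  unfolding ig_def
  by (subst integral_add[OF integrable_continuous_real integrable_continuous_real, OF continuous_on_segment continuous_on_segment])
    (use assms in \<open>simp_all add: distrib_left\<close>)

lemma ig_cmult: "ig (\<lambda>x. c * g x) a b = c * ig g a b"
  by (simp add: ig_def)

lemma ig_diff:
  assumes "continuous_on {0..1} g" "continuous_on {0..1} h" "a \<in> {0..1}" "b \<in> {0..1}"
  shows "ig (\<lambda>x. g x - h x) a b = ig g a b - ig h a b"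
  unfolding ig_def
  by (subst integral_diff[OF integrable_continuous_real integrable_continuous_real, OF continuous_on_segment continuous_on_segment])
    (use assms in \<open>simp_all add: right_diff_distrib\<close>)

lemma ig_bound:
  assumes "continuous_on {0..1} g" "a \<in> {0..1}" "b \<in> {0..1}" "\<And>x. x \<in> {0..1} \<Longrightarrow> \<bar>g x\<bar> \<le> C"
  shows "\<bar>ig g a b\<bar> \<le> C * \<bar>b - a\<bar>"
proof -
  have "norm (integral {0..1} (\<lambda>\<theta>. g (a + (b - a) * \<theta>))) \<le> C * (1 - 0)"
    by (rule integral_bound)
      (auto simp only: real_norm_def intro!: zero_le_one continuous_on_segment segment_in_unit assms)
  then have "\<bar>b - a\<bar> * \<bar>integral {0..1} (\<lambda>\<theta>. g (a + (b - a) * \<theta>))\<bar> \<le> \<bar>b - a\<bar> * C"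
    by (intro mult_left_mono) auto
  then show ?thesis by (simp add: ig_def abs_mult mult.commute)
qed

lemma ig_bound1:
  assumes "continuous_on {0..1} g" "a \<in> {0..1}" "b \<in> {0..1}" "\<And>x. x \<in> {0..1} \<Longrightarrow> \<bar>g x\<bar> \<le> C"
  shows "\<bar>ig g a b\<bar> \<le> C"
proof -
  have "0 \<le> C" using assms(4)[of 0] by auto
  moreover have "\<bar>b - a\<bar> \<le> 1" using assms by auto
  ultimately have "C * \<bar>b - a\<bar> \<le> C" by (simp add: mult_left_le)
  then show ?thesis using ig_bound[OF assms] by linarith
qed

lemma ig_mono:
  assumes "continuous_on {0..1} g" "continuous_on {0..1} h" "\<And>x. x \<in> {0..1} \<Longrightarrow> g x \<le> h x"
  shows "ig g 0 1 \<le> ig h 0 1"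
  unfolding ig_def
  using integral_le[OF integrable_continuous_real[OF assms(1)] integrable_continuous_real[OF assms(2)] assms(3)] by simp

lemma continuous_on_ig:
  assumes g: "continuous_on (U \<times> {0..1}) (\<lambda>(y, \<xi>). g y \<xi>)"
    and \<alpha>: "continuous_on U \<alpha>" "\<And>y. y \<in> U \<Longrightarrow> \<alpha> y \<in> {0..1}"
    and \<beta>: "continuous_on U \<beta>" "\<And>y. y \<in> U \<Longrightarrow> \<beta> y \<in> {0..1}"
  shows "continuous_on U (\<lambda>y. ig (g y) (\<alpha> y) (\<beta> y))"
proof -
  have "continuous_on (U \<times> cbox 0 1) (\<lambda>(y, \<theta>). g y (\<alpha> y + (\<beta> y - \<alpha> y) * \<theta>))"
  proof -
    have a: "continuous_on (U \<times> {0..1}) (\<lambda>p. (fst p, \<alpha> (fst p) + (\<beta> (fst p) - \<alpha> (fst p)) * snd p))"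
      by (intro continuous_intros continuous_on_compose2[OF \<alpha>(1)] continuous_on_compose2[OF \<beta>(1)]) auto
    have "continuous_on (U \<times> {0..1}) (\<lambda>p. (\<lambda>(y, \<xi>). g y \<xi>) (fst p, \<alpha> (fst p) + (\<beta> (fst p) - \<alpha> (fst p)) * snd p))"
      by (rule continuous_on_compose2[OF g a]) (auto simp only: mem_Sigma_iff fst_conv snd_conv image_subset_iff split_paired_all intro!: segment_in_unit \<alpha>(2) \<beta>(2))
    then show ?thesis by (simp add: case_prod_unfold)
  qed
  from integral_continuous_on_param[OF this] show ?thesis
    unfolding ig_def by (intro continuous_intros \<alpha> \<beta>) auto
qed

lemma ig_leibniz:
  assumes d: "\<And>s \<xi>. s \<in> U \<Longrightarrow> \<xi> \<in> {0..1} \<Longrightarrow> ((\<lambda>s. g s \<xi>) has_real_derivative g' s \<xi>) (at s within U)"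
    and c: "\<And>s. s \<in> U \<Longrightarrow> continuous_on {0..1} (g s)"
    and c': "continuous_on (U \<times> {0..1}) (\<lambda>(s, \<xi>). g' s \<xi>)"
    and U: "s \<in> U" "convex U" and ab: "a \<in> {0..1}" "b \<in> {0..1}"
  shows "((\<lambda>s. ig (g s) a b) has_real_derivative ig (g' s) a b) (at s within U)"
proof -
  have "((\<lambda>s. integral (cbox 0 1) (\<lambda>\<theta>. g s (a + (b - a) * \<theta>))) has_real_derivative
      integral (cbox 0 1) (\<lambda>\<theta>. g' s (a + (b - a) * \<theta>))) (at s within U)"
  proof (rule leibniz_rule_field_derivative[OF _ _ _ U])
    show "((\<lambda>s. g s (a + (b - a) * \<theta>)) has_real_derivative g' s (a + (b - a) * \<theta>)) (at s within U)"
      if "s \<in> U" "\<theta> \<in> cbox 0 1" for s \<theta>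
      using d[OF that(1)] segment_in_unit[OF ab] that by auto
    show "(\<lambda>\<theta>. g s (a + (b - a) * \<theta>)) integrable_on cbox 0 1" if "s \<in> U" for s
      using continuous_on_segment[OF c[OF that] ab] by (simp add: integrable_continuous_real)
    have "continuous_on (U \<times> {0..1}) (\<lambda>p. (\<lambda>(s, \<xi>). g' s \<xi>) (fst p, a + (b - a) * snd p))"
      by (rule continuous_on_compose2[OF c']) (auto simp only: mem_Sigma_iff fst_conv snd_conv image_subset_iff split_paired_all intro!: segment_in_unit ab continuous_intros)
    then show "continuous_on (U \<times> cbox 0 1) (\<lambda>(s, \<theta>). g' s (a + (b - a) * \<theta>))"
      by (simp add: case_prod_unfold)
  qed
  from DERIV_cmult[OF this, of "b - a"] show ?thesis
    unfolding ig_def by simp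
qed

section \<open>Continuous and time-differentiable functions on the strip\<close>

abbreviation cont :: "(real \<Rightarrow> real \<Rightarrow> real) \<Rightarrow> bool" where
  "cont g \<equiv> continuous_on strip (\<lambda>(x, t). g x t)"

text \<open>The second argument is the derivative itself, so that formulas for it can be carried
  through a proof. It is determined by the first one on the strip only.\<close>

definition t_deriv :: "(real \<Rightarrow> real \<Rightarrow> real) \<Rightarrow> (real \<Rightarrow> real \<Rightarrow> real) \<Rightarrow> bool" where
  "t_deriv g gt \<longleftrightarrow> cont g \<and> cont gt \<and>
     (\<forall>x\<in>{0..1}. \<forall>t. ((\<lambda>s. g x s) has_real_derivative gt x t) (at t))"

lemma cont_comp:
  assumes "cont g" "continuous_on S X" "continuous_on S Y" "\<And>p. p \<in> S \<Longrightarrow> X p \<in> {0..1}"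
  shows "continuous_on S (\<lambda>p. g (X p) (Y p))"
proof -
  have "continuous_on S (\<lambda>p. (\<lambda>(x, t). g x t) (X p, Y p))"
    by (rule continuous_on_compose2[OF assms(1)]) (use assms in \<open>auto intro!: continuous_intros\<close>)
  then show ?thesis by simp
qed

lemma cont_time: "cont g \<Longrightarrow> x \<in> {0..1} \<Longrightarrow> continuous_on S (\<lambda>t. g x t)"
  by (rule cont_comp) (auto intro!: continuous_intros)

lemma cont_const: "cont (\<lambda>x t. c)"
  by (simp add: case_prod_unfold)

lemma cont_of_time: "continuous_on UNIV h \<Longrightarrow> cont (\<lambda>x t. h t)"
  unfolding case_prod_unfold by (rule continuous_on_compose2[of UNIV h _ snd]) (auto intro!: continuous_intros)

lemma cont_add: "cont f \<Longrightarrow> cont g \<Longrightarrow> cont (\<lambda>x t. f x t + g x t)"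
  and cont_diff: "cont f \<Longrightarrow> cont g \<Longrightarrow> cont (\<lambda>x t. f x t - g x t)"
  and cont_mult: "cont f \<Longrightarrow> cont g \<Longrightarrow> cont (\<lambda>x t. f x t * g x t)"
  and cont_minus: "cont f \<Longrightarrow> cont (\<lambda>x t. - f x t)"
  and cont_exp: "cont f \<Longrightarrow> cont (\<lambda>x t. exp (f x t))"
  by (auto simp: case_prod_unfold intro!: continuous_intros)

lemma cont_sum: "(\<And>k. k \<in> K \<Longrightarrow> cont (f k)) \<Longrightarrow> cont (\<lambda>x t. \<Sum>k\<in>K. f k x t)"
  by (auto simp: case_prod_unfold intro!: continuous_intros)

lemma cont_divide: "cont f \<Longrightarrow> cont g \<Longrightarrow> (\<And>x t. x \<in> {0..1} \<Longrightarrow> g x t \<noteq> 0) \<Longrightarrow> cont (\<lambda>x t. f x t / g x t)"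
  by (auto simp: case_prod_unfold intro!: continuous_intros)

lemmas cont_rules = cont_add cont_diff cont_mult cont_minus cont_exp cont_sum cont_const

lemma cont_cong: "(\<And>x t. x \<in> {0..1} \<Longrightarrow> f x t = g x t) \<Longrightarrow> cont f \<longleftrightarrow> cont g"
  by (rule continuous_on_cong) auto

lemma t_derivD:
  assumes "t_deriv g gt"
  shows "cont g" "cont gt" "x \<in> {0..1} \<Longrightarrow> ((\<lambda>s. g x s) has_real_derivative gt x t) (at t)"
  using assms by (auto simp: t_deriv_def)

lemma t_derivI:
  assumes "cont g" "cont gt" "\<And>x t. x \<in> {0..1} \<Longrightarrow> ((\<lambda>s. g x s) has_real_derivative gt x t) (at t)"
  shows "t_deriv g gt"
  using assms unfolding t_deriv_def by blast

lemma t_deriv_add: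
  assumes "t_deriv f f'" "t_deriv g g'"
  shows "t_deriv (\<lambda>x t. f x t + g x t) (\<lambda>x t. f' x t + g' x t)"
  by (intro t_derivI cont_add DERIV_add t_derivD[OF assms(1)] t_derivD[OF assms(2)])

lemma t_deriv_diff:
  assumes "t_deriv f f'" "t_deriv g g'"
  shows "t_deriv (\<lambda>x t. f x t - g x t) (\<lambda>x t. f' x t - g' x t)"
  by (intro t_derivI cont_diff DERIV_diff t_derivD[OF assms(1)] t_derivD[OF assms(2)])

lemma t_deriv_mult:
  assumes "t_deriv f f'" "t_deriv g g'"
  shows "t_deriv (\<lambda>x t. f x t * g x t) (\<lambda>x t. f' x t * g x t + g' x t * f x t)"
  by (intro t_derivI cont_add cont_mult DERIV_mult t_derivD[OF assms(1)] t_derivD[OF assms(2)])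

lemma t_deriv_exp:
  assumes "t_deriv f f'"
  shows "t_deriv (\<lambda>x t. exp (f x t)) (\<lambda>x t. exp (f x t) * f' x t)"
  by (intro t_derivI cont_exp cont_mult DERIV_fun_exp t_derivD[OF assms(1)])

lemma t_deriv_sum:
  assumes "\<And>k. k \<in> K \<Longrightarrow> t_deriv (f k) (f' k)"
  shows "t_deriv (\<lambda>x t. \<Sum>k\<in>K. f k x t) (\<lambda>x t. \<Sum>k\<in>K. f' k x t)"
  by (intro t_derivI cont_sum DERIV_sum t_derivD[OF assms])

lemma t_deriv_divide:
  assumes "t_deriv f f'" "t_deriv g g'" "\<And>x t. x \<in> {0..1} \<Longrightarrow> g x t \<noteq> 0"
  shows "t_deriv (\<lambda>x t. f x t / g x t) (\<lambda>x t. (f' x t * g x t - f x t * g' x t) / (g x t * g x t))"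
  by (intro t_derivI cont_divide cont_diff cont_mult DERIV_divide t_derivD[OF assms(1)] t_derivD[OF assms(2)])
    (use assms(3) in auto)

lemma t_deriv_cong:
  assumes f: "t_deriv f f'" and eq: "\<And>x t. x \<in> {0..1} \<Longrightarrow> f x t = g x t" "\<And>x t. x \<in> {0..1} \<Longrightarrow> f' x t = g' x t"
  shows "t_deriv g g'"
proof (rule t_derivI)
  show "cont g" using t_derivD(1)[OF f] cont_cong[OF eq(1)] by simp
  show "cont g'" using t_derivD(2)[OF f] cont_cong[OF eq(2)] by simp
  fix x t :: real assume x: "x \<in> {0..1}"
  have "(\<lambda>s. f x s) = (\<lambda>s. g x s)" using eq(1)[OF x] by auto
  then show "((\<lambda>s. g x s) has_real_derivative g' x t) (at t)"
    using t_derivD(3)[OF f x, of t] eq(2)[OF x] by simp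
qed

lemma t_deriv_unique: "t_deriv f f' \<Longrightarrow> t_deriv f f'' \<Longrightarrow> x \<in> {0..1} \<Longrightarrow> f' x t = f'' x t"
  unfolding t_deriv_def by (blast intro: DERIV_unique)

lemma C1_in_time_t_deriv: "cont g \<Longrightarrow> C1_in_time g \<longleftrightarrow> (\<exists>gt. t_deriv g gt)"
  by (auto simp: C1_in_time_def t_deriv_def)

lemma C1_in_time_deriv:
  assumes "cont g" "C1_in_time g"
  shows "t_deriv g (\<lambda>x t. deriv (g x) t)"
proof -
  obtain gt where gt: "t_deriv g gt" using assms C1_in_time_t_deriv by blast
  then have "deriv (g x) t = gt x t" if "x \<in> {0..1}" for x t
    using that by (auto simp: t_deriv_def intro: DERIV_imp_deriv)
  then show ?thesis using t_deriv_cong[OF gt] by auto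
qed

lemma Ck1_t_deriv:
  assumes "Ck_strip (Suc k) g"
  shows "t_deriv g (\<lambda>x t. deriv (g x) t)"
proof (rule C1_in_time_deriv)
  have *: "Ck_strip k h \<Longrightarrow> cont h" for h by (cases k) auto
  show "cont g" using assms by simp
  show "C1_in_time g" using assms * unfolding C1_in_time_def by fastforce
qed

lemma periodic_t_deriv:
  assumes "periodic_strip g" "t_deriv g gt" shows "periodic_strip gt"
  unfolding periodic_strip_def
proof safe
  fix x t :: real assume x: "x \<in> {0..1}"
  have "((\<lambda>s. g x (s + 2 * pi)) has_real_derivative gt x (t + 2 * pi) * 1) (at t)"
    by (rule DERIV_chain2[OF t_derivD(3)[OF assms(2) x]]) (auto intro!: derivative_eq_intros)
  moreover have "(\<lambda>s. g x (s + 2 * pi)) = g x" using assms(1) x by (auto simp: periodic_strip_def)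
  ultimately have "((\<lambda>s. g x s) has_real_derivative gt x (t + 2 * pi)) (at t)" by simp
  then show "gt x (t + 2 * pi) = gt x t"
    by (rule DERIV_unique[OF _ t_derivD(3)[OF assms(2) x]])
qed

text \<open>Continuity is uniform on one period enlarged at both ends; after a common shift by a
  multiple of the period two close times lie in it.\<close>

lemma periodic_unif_cont:
  assumes g: "cont g" and p: "periodic_strip g" and \<epsilon>: "\<epsilon> > 0"
  shows "\<exists>\<delta>>0. \<forall>x\<in>{0..1}. \<forall>s t. \<bar>s - t\<bar> < \<delta> \<longrightarrow> \<bar>g x s - g x t\<bar> < \<epsilon>"
proof -
  have "uniformly_continuous_on ({0..1} \<times> {-1..2 * pi + 1}) (\<lambda>(x, t). g x t)"
    by (intro compact_uniformly_continuous continuous_on_subset[OF g] compact_Times) auto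
  then obtain d where d: "d > 0" "\<And>p q. p \<in> {0..1} \<times> {-1..2 * pi + 1} \<Longrightarrow> q \<in> {0..1} \<times> {-1..2 * pi + 1} \<Longrightarrow>
      dist p q < d \<Longrightarrow> dist ((\<lambda>(x, t). g x t) p) ((\<lambda>(x, t). g x t) q) < \<epsilon>"
    unfolding uniformly_continuous_on_def using \<epsilon> by blast
  show ?thesis
  proof (intro exI[of _ "min d 1"] conjI ballI allI impI)
    fix x s t :: real assume x: "x \<in> {0..1}" and st: "\<bar>s - t\<bar> < min d 1"
    define k where "k = \<lfloor>t / (2 * pi)\<rfloor>"
    define z where "z = 2 * pi * of_int (- k)"
    have "of_int k \<le> t / (2 * pi)" "t / (2 * pi) < of_int k + 1"
      unfolding k_def by linarith+
    then have t: "t + z \<in> {0..2 * pi}"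
      unfolding z_def by (auto simp: field_simps)
    have "s + z \<in> {-1..2 * pi + 1}" using t st by (auto simp: abs_less_iff)
    then have "dist (g x (s + z)) (g x (t + z)) < \<epsilon>"
      using d(2)[of "(x, s + z)" "(x, t + z)"] st t x by (auto simp: dist_Pair_Pair dist_real_def)
    then show "\<bar>g x s - g x t\<bar> < \<epsilon>"
      unfolding z_def periodic_strip_int[OF p x] by (simp add: dist_real_def)
  qed (use d in auto)
qed

lemma periodic_bound:
  assumes "cont g" "periodic_strip g"
  shows "\<exists>B\<ge>0. \<forall>x\<in>{0..1}. \<forall>t. \<bar>g x t\<bar> \<le> B"
proof -
  obtain B where B: "\<forall>x\<in>{0..1}. \<forall>t. \<bar>g x t\<bar> \<le> B"
    using periodic_strip_bounded[OF assms] by blast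
  have "\<bar>g 0 0\<bar> \<le> B" using B by simp
  then have "0 \<le> B" by linarith
  then show ?thesis using B by blast
qed

section \<open>Characteristic curves\<close>

definition curve :: "(real \<Rightarrow> real \<Rightarrow> real) \<Rightarrow> (real \<Rightarrow> real) \<Rightarrow> bool" where
  "curve F \<phi> \<longleftrightarrow> (\<forall>\<xi>\<in>{0..1}. (\<phi> has_real_derivative F \<xi> (\<phi> \<xi>)) (at \<xi> within {0..1}))"

text \<open>The description has the same form as the one in \<open>char_time\<close>, so that both agree by
  definition.\<close>

definition flow :: "(real \<Rightarrow> real \<Rightarrow> real) \<Rightarrow> real \<Rightarrow> real \<Rightarrow> real \<Rightarrow> real" where
  "flow F \<xi> x t = (THE s. \<exists>\<phi>. (\<phi> x = t \<and> curve F \<phi>) \<and> \<phi> \<xi> = s)"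

lemma unit_deriv_nonneg_mono:
  assumes h: "\<And>x. x \<in> {0..1} \<Longrightarrow> (h has_real_derivative h' x) (at x within {0..1})"
    and nonneg: "\<And>x. x \<in> {0..1} \<Longrightarrow> 0 \<le> h' x" and ab: "0 \<le> a" "a \<le> b" "b \<le> 1"
  shows "h a \<le> h b"
proof (cases "a = b")
  case False
  have "\<exists>x\<in>{a<..<b}. h b - h a = (\<lambda>y. h' x * y) (b - a)"
  proof (rule mvt_simple)
    show "a < b" using False ab by simp
    show "(h has_derivative (\<lambda>y. h' x * y)) (at x within {a..b})" if "a \<le> x" "x \<le> b" for x
      using has_field_derivative_subset[OF h[of x], of "{a..b}"] that ab
      by (auto simp: has_field_derivative_def)
  qed
  then obtain x where x: "x \<in> {a<..<b}" "h b - h a = h' x * (b - a)" by auto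
  have "0 \<le> h' x * (b - a)" using x(1) ab nonneg[of x] by (intro mult_nonneg_nonneg) auto
  then show ?thesis using x(2) by linarith
qed simp

lemma unit_deriv_zero_const:
  assumes "\<And>x. x \<in> {0..1} \<Longrightarrow> (h has_real_derivative 0) (at x within {0..1})" "a \<in> {0..1}" "b \<in> {0..1}"
  shows "h a = (h b :: real)"
  using ig_FTC[of "{0..1}" a b h "\<lambda>_. 0"] assms by (simp add: ig_def)

lemma ig_abs_le:
  assumes g: "continuous_on {0..1} g" and h: "continuous_on {0..1} h"
    and le: "\<And>x. x \<in> {0..1} \<Longrightarrow> \<bar>g x\<bar> \<le> h x" and ab: "a \<in> {0..1}" "b \<in> {0..1}" "a \<le> b"
  shows "\<bar>ig g a b\<bar> \<le> ig h a b"
proof -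
  have "norm (integral {0..1} (\<lambda>\<theta>. g (a + (b - a) * \<theta>))) \<le> integral {0..1} (\<lambda>\<theta>. h (a + (b - a) * \<theta>))"
  proof (rule integral_norm_bound_integral)
    show "norm (g (a + (b - a) * x)) \<le> h (a + (b - a) * x)" if "x \<in> {0..1}" for x
      using le[OF segment_in_unit[OF ab(1,2) that]] by simp
  qed (intro integrable_continuous_real continuous_on_segment g h ab)+
  then show ?thesis unfolding ig_def abs_mult using ab by (simp add: mult_left_mono)
qed

locale slope =
  fixes F Ft :: "real \<Rightarrow> real \<Rightarrow> real"
  assumes F_t: "t_deriv F Ft" and F_per: "periodic_strip F"
begin

lemmas contF = t_derivD(1)[OF F_t] and contFt = t_derivD(2)[OF F_t]

lemma Ft_per: "periodic_strip Ft"
  by (rule periodic_t_deriv[OF F_per F_t])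

definition M where "M = (SOME B. 0 \<le> B \<and> (\<forall>x\<in>{0..1}. \<forall>t. \<bar>F x t\<bar> \<le> B))"
definition L where "L = (SOME B. 0 \<le> B \<and> (\<forall>x\<in>{0..1}. \<forall>t. \<bar>Ft x t\<bar> \<le> B))"

lemma M: "0 \<le> M" "x \<in> {0..1} \<Longrightarrow> \<bar>F x t\<bar> \<le> M"
  using someI_ex[OF periodic_bound[OF contF F_per]] unfolding M_def by auto

lemma L: "0 \<le> L" "x \<in> {0..1} \<Longrightarrow> \<bar>Ft x t\<bar> \<le> L"
  using someI_ex[OF periodic_bound[OF contFt Ft_per]] unfolding L_def by auto

lemma F_lipschitz:
  assumes x: "x \<in> {0..1}" shows "\<bar>F x s - F x t\<bar> \<le> L * \<bar>s - t\<bar>"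
  using field_differentiable_bound[of UNIV "F x" "Ft x" L s t] t_derivD(3)[OF F_t x] L(2)[OF x] by auto

lemma curveD: "curve F \<phi> \<Longrightarrow> \<xi> \<in> {0..1} \<Longrightarrow> (\<phi> has_real_derivative F \<xi> (\<phi> \<xi>)) (at \<xi> within {0..1})"
  by (simp add: curve_def)

lemma curve_continuous: "curve F \<phi> \<Longrightarrow> continuous_on {0..1} \<phi>"
  unfolding continuous_on_eq_continuous_within by (blast intro: DERIV_continuous dest: curveD)

lemma curve_lipschitz:
  assumes "curve F \<phi>" "x \<in> {0..1}" "y \<in> {0..1}"
  shows "\<bar>\<phi> x - \<phi> y\<bar> \<le> M * \<bar>x - y\<bar>"
  using field_differentiable_bound[of "{0..1}" \<phi> "\<lambda>\<xi>. F \<xi> (\<phi> \<xi>)" M x y] curveD[OF assms(1)] M(2) assms(2,3) by auto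

text \<open>Uniqueness and continuous dependence in one estimate: the squared distance \<open>D\<close> of two curves
  satisfies \<open>\<bar>D'\<bar> \<le> 2 L D\<close>, so that \<open>D\<close> times \<open>exp (2 L \<xi>)\<close> increases and \<open>D\<close> times
  \<open>exp (- 2 L \<xi>)\<close> decreases; this covers both directions of \<open>\<xi>\<close>.\<close>

lemma curve_gronwall:
  assumes \<phi>: "curve F \<phi>" and \<psi>: "curve F \<psi>" and x: "x \<in> {0..1}" and \<xi>: "\<xi> \<in> {0..1}"
  shows "\<bar>\<phi> \<xi> - \<psi> \<xi>\<bar> \<le> exp L * \<bar>\<phi> x - \<psi> x\<bar>"
proof -
  define D where "D y = (\<phi> y - \<psi> y)\<^sup>2" for y
  define D' where "D' y = 2 * (\<phi> y - \<psi> y) * (F y (\<phi> y) - F y (\<psi> y))" for y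
  have D: "(D has_real_derivative D' y) (at y within {0..1})" if "y \<in> {0..1}" for y
    unfolding D_def D'_def
    by (rule derivative_eq_intros curveD[OF \<phi> that] curveD[OF \<psi> that] refl | simp)+
  have bd: "\<bar>D' y\<bar> \<le> 2 * L * D y" if "y \<in> {0..1}" for y
  proof -
    have "\<bar>D' y\<bar> = 2 * \<bar>\<phi> y - \<psi> y\<bar> * \<bar>F y (\<phi> y) - F y (\<psi> y)\<bar>" by (simp only: D'_def abs_mult abs_numeral)
    also have "\<dots> \<le> 2 * \<bar>\<phi> y - \<psi> y\<bar> * (L * \<bar>\<phi> y - \<psi> y\<bar>)"
      using F_lipschitz[OF that] by (intro mult_left_mono) auto
    also have "\<dots> = 2 * L * D y" by (simp add: D_def power2_eq_square abs_mult_self_eq)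
    finally show ?thesis .
  qed
  have Dx0: "0 \<le> D x" by (simp add: D_def)
  have "D \<xi> \<le> exp (2 * L) * D x"
  proof (cases "x \<le> \<xi>")
    case True
    have "- (D x * exp (- (2 * L * x))) \<le> - (D \<xi> * exp (- (2 * L * \<xi>)))"
    proof (rule unit_deriv_nonneg_mono[where h = "\<lambda>y. - (D y * exp (- (2 * L * y)))"])
      show "((\<lambda>y. - (D y * exp (- (2 * L * y)))) has_real_derivative
          (2 * L * D y - D' y) * exp (- (2 * L * y))) (at y within {0..1})" if "y \<in> {0..1}" for y
        by (rule derivative_eq_intros D[OF that] refl | simp add: algebra_simps)+
      show "0 \<le> (2 * L * D y - D' y) * exp (- (2 * L * y))" if "y \<in> {0..1}" for y
        using bd[OF that] by (intro mult_nonneg_nonneg) auto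
    qed (use True x \<xi> in auto)
    then have "D \<xi> * exp (- (2 * L * \<xi>)) * exp (2 * L * \<xi>) \<le> D x * exp (- (2 * L * x)) * exp (2 * L * \<xi>)"
      by (intro mult_right_mono) auto
    then have "D \<xi> \<le> D x * exp (2 * L * (\<xi> - x))" by (simp add: mult.assoc exp_add[symmetric] algebra_simps)
    also have "\<dots> \<le> D x * exp (2 * L)"
    proof -
      have "L * (\<xi> - x) \<le> L * 1" using x \<xi> L(1) by (intro mult_left_mono) auto
      then show ?thesis using Dx0 by (intro mult_left_mono) auto
    qed
    finally show ?thesis by (simp add: mult.commute)
  next
    case False
    have "D \<xi> * exp (2 * L * \<xi>) \<le> D x * exp (2 * L * x)"
    proof (rule unit_deriv_nonneg_mono[where h = "\<lambda>y. D y * exp (2 * L * y)"])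
      show "((\<lambda>y. D y * exp (2 * L * y)) has_real_derivative
          (2 * L * D y + D' y) * exp (2 * L * y)) (at y within {0..1})" if "y \<in> {0..1}" for y
        by (rule derivative_eq_intros D[OF that] refl | simp add: algebra_simps)+
      show "0 \<le> (2 * L * D y + D' y) * exp (2 * L * y)" if "y \<in> {0..1}" for y
        using bd[OF that] by (intro mult_nonneg_nonneg) auto
    qed (use False x \<xi> in auto)
    then have "D \<xi> * exp (2 * L * \<xi>) * exp (- (2 * L * \<xi>)) \<le> D x * exp (2 * L * x) * exp (- (2 * L * \<xi>))"
      by (intro mult_right_mono) auto
    then have "D \<xi> \<le> D x * exp (2 * L * (x - \<xi>))" by (simp add: mult.assoc exp_add[symmetric] algebra_simps)
    also have "\<dots> \<le> D x * exp (2 * L)"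
    proof -
      have "L * (x - \<xi>) \<le> L * 1" using x \<xi> L(1) by (intro mult_left_mono) auto
      then show ?thesis using Dx0 by (intro mult_left_mono) auto
    qed
    finally show ?thesis by (simp add: mult.commute)
  qed
  also have "exp (2 * L) * D x = (exp L * (\<phi> x - \<psi> x))\<^sup>2"
    by (simp add: D_def power_mult_distrib exp_double)
  finally have "\<bar>\<phi> \<xi> - \<psi> \<xi>\<bar> \<le> \<bar>exp L * (\<phi> x - \<psi> x)\<bar>"
    unfolding D_def abs_le_square_iff .
  then show ?thesis by (simp add: abs_mult)
qed

text \<open>Picard iteration contracts in the supremum norm weighted by \<open>exp (- (2 L + 1) \<xi>)\<close> on all of
  \<open>[0,1]\<close>; the unknown below is the weighted difference to the initial value, continued constantly
  beyond \<open>[0,1]\<close>.\<close>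

lemma curve_from_0: "\<exists>\<phi>. curve F \<phi> \<and> \<phi> 0 = s"
proof -
  define l where "l = 2 * L + 1"
  have l: "l > 0" "L / l \<le> 1 / 2" using L(1) by (auto simp: l_def field_simps)
  define cl :: "real \<Rightarrow> real" where "cl \<xi> = max 0 (min 1 \<xi>)" for \<xi>
  have cl: "cl \<xi> \<in> {0..1}" for \<xi> by (auto simp: cl_def)
  have cl_cont: "continuous_on UNIV cl" unfolding cl_def by (intro continuous_intros)
  define G where "G g \<eta> = F \<eta> (s + exp (l * \<eta>) * apply_bcontfun g \<eta>)" for g \<eta>
  define T where "T g \<xi> = exp (- (l * cl \<xi>)) * ig (G g) 0 (cl \<xi>)" for g \<xi>
  have Gc: "continuous_on {0..1} (G g)" for g
    unfolding G_def
    by (rule cont_comp[OF contF]) (auto intro!: continuous_intros continuous_on_apply_bcontfun)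
  have Tc: "continuous_on UNIV (T g)" for g
  proof -
    have "continuous_on (UNIV \<times> {0..1}) (\<lambda>p::real\<times>real. G g (snd p))"
      by (rule continuous_on_compose2[OF Gc]) (auto intro!: continuous_intros)
    then have "continuous_on UNIV (\<lambda>\<xi>. ig (G g) 0 (cl \<xi>))"
      by (intro continuous_on_ig cl cl_cont) (auto simp: case_prod_unfold intro: continuous_intros)
    then show ?thesis unfolding T_def by (intro continuous_intros cl_cont)
  qed
  have el: "exp (- (l * cl \<xi>)) \<le> 1" for \<xi> using l(1) cl[of \<xi>] by simp
  have Tb: "\<bar>T g \<xi>\<bar> \<le> M" for g \<xi>
  proof -
    have "\<bar>ig (G g) 0 (cl \<xi>)\<bar> \<le> M"
      by (rule ig_bound1[OF Gc _ cl]) (auto simp: G_def M)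
    then have "exp (- (l * cl \<xi>)) * \<bar>ig (G g) 0 (cl \<xi>)\<bar> \<le> 1 * M"
      by (intro mult_mono el) auto
    then show ?thesis by (simp add: T_def abs_mult)
  qed
  have T_in: "T g \<in> bcontfun" for g
    using Tc Tb by (intro bcontfun_normI) auto
  define P where "P g = Bcontfun (T g)" for g
  have P: "apply_bcontfun (P g) = T g" for g
    by (simp add: P_def Bcontfun_inverse[OF T_in])
  have contr: "dist (P g) (P h) \<le> 1 / 2 * dist g h" for g h
  proof (rule dist_bound)
    fix \<xi> :: real
    define c where "c = cl \<xi>"
    have c: "c \<in> {0..1}" "0 \<le> c" using cl[of \<xi>] by (auto simp: c_def)
    define d where "d = dist g h"
    have d: "0 \<le> d" by (simp add: d_def)
    have e: "continuous_on {0..1} (\<lambda>\<eta>. (L * d) * exp (l * \<eta>))" by (intro continuous_intros)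
    have "\<bar>ig (\<lambda>\<eta>. G g \<eta> - G h \<eta>) 0 c\<bar> \<le> ig (\<lambda>\<eta>. (L * d) * exp (l * \<eta>)) 0 c"
    proof (rule ig_abs_le[OF continuous_on_diff[OF Gc Gc] e])
      fix x :: real assume x: "x \<in> {0..1}"
      have "\<bar>G g x - G h x\<bar> \<le> L * \<bar>exp (l * x) * (apply_bcontfun g x - apply_bcontfun h x)\<bar>"
        using F_lipschitz[OF x, of "s + exp (l * x) * apply_bcontfun g x" "s + exp (l * x) * apply_bcontfun h x"]
        by (simp add: G_def algebra_simps)
      also have "\<dots> \<le> L * (exp (l * x) * d)"
        using dist_bounded[of g x h] L(1) by (intro mult_left_mono) (auto simp: abs_mult d_def dist_real_def)
      finally show "\<bar>G g x - G h x\<bar> \<le> L * d * exp (l * x)" by (simp add: mult_ac)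
    qed (use c in auto)
    also have "ig (\<lambda>\<eta>. (L * d) * exp (l * \<eta>)) 0 c = (L * d) * (exp (l * c) / l) - (L * d) * (exp (l * 0) / l)"
      by (rule ig_FTC[where S = UNIV and G = "\<lambda>\<eta>. (L * d) * (exp (l * \<eta>) / l)"])
        (use l in \<open>auto intro!: derivative_eq_intros\<close>)
    also have "\<dots> \<le> (L * d) * (exp (l * c) / l)" using L(1) d l by simp
    also have "\<dots> = (L / l) * d * exp (l * c)" by simp
    also have "\<dots> \<le> (1 / 2) * d * exp (l * c)" using l d by (intro mult_right_mono) auto
    finally have *: "\<bar>ig (G g) 0 c - ig (G h) 0 c\<bar> \<le> 1 / 2 * d * exp (l * c)"
      using ig_diff[OF Gc[of g] Gc[of h], of 0 c] c by simp
    have "\<bar>T g \<xi> - T h \<xi>\<bar> = exp (- (l * c)) * \<bar>ig (G g) 0 c - ig (G h) 0 c\<bar>"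
      by (simp add: T_def c_def abs_mult right_diff_distrib[symmetric])
    also have "\<dots> \<le> exp (- (l * c)) * (1 / 2 * d * exp (l * c))" using * by (intro mult_left_mono) auto
    also have "\<dots> = 1 / 2 * d" by (simp add: exp_minus field_simps)
    finally show "dist (apply_bcontfun (P g) \<xi>) (apply_bcontfun (P h) \<xi>) \<le> 1 / 2 * dist g h"
      by (simp add: P dist_real_def d_def)
  qed
  obtain g where "P g = g" using banach_fix_type[of "1/2" P] contr by auto
  then have fixed: "apply_bcontfun g \<xi> = T g \<xi>" for \<xi> by (metis P)
  define \<phi> where "\<phi> \<xi> = s + ig (G g) 0 \<xi>" for \<xi>
  have \<phi>: "s + exp (l * \<xi>) * apply_bcontfun g \<xi> = \<phi> \<xi>" if "\<xi> \<in> {0..1}" for \<xi>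
    using that by (simp add: \<phi>_def fixed T_def cl_def exp_minus)
  have "curve F \<phi>" unfolding curve_def
  proof
    fix \<xi> :: real assume \<xi>: "\<xi> \<in> {0..1}"
    have "(\<phi> has_real_derivative 0 + G g \<xi>) (at \<xi> within {0..1})"
      unfolding \<phi>_def by (intro DERIV_add DERIV_const ig_deriv[OF Gc]) (use \<xi> in auto)
    then show "(\<phi> has_real_derivative F \<xi> (\<phi> \<xi>)) (at \<xi> within {0..1})" by (simp add: G_def \<phi>[OF \<xi>])
  qed
  then show ?thesis by (auto simp: \<phi>_def)
qed

text \<open>A curve through an arbitrary point is found among the curves issuing from the line \<open>x = 0\<close>,
  by the intermediate value theorem in the initial value.\<close>

lemma curve_through:
  assumes x: "x \<in> {0..1}"
  obtains \<phi> where "curve F \<phi>" "\<phi> x = t"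
proof -
  obtain P where P: "\<And>s. curve F (P s)" "\<And>s. P s 0 = s" using curve_from_0 by metis
  have near: "\<bar>P s x - s\<bar> \<le> M" for s
  proof -
    have "M * \<bar>x - 0\<bar> \<le> M" using x M(1) by (simp add: mult_left_le)
    then show ?thesis using curve_lipschitz[OF P(1) x, of 0 s] P(2)[of s] by auto
  qed
  have "continuous_on UNIV (\<lambda>s. P s x)"
  proof (rule continuous_on_iff[THEN iffD2], intro ballI allI impI)
    fix s e :: real assume "0 < e"
    have "dist (P s' x) (P s x) \<le> exp L * dist s' s" for s'
      using curve_gronwall[OF P(1)[of s'] P(1)[of s] _ x, of 0] P(2) by (simp add: dist_real_def)
    moreover have "exp L * dist s' s < e" if "dist s' s < e / exp L" for s'
      using that by (simp add: field_simps)
    ultimately show "\<exists>d>0. \<forall>s'\<in>UNIV. dist s' s < d \<longrightarrow> dist (P s' x) (P s x) < e"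
      using \<open>0 < e\<close> by (intro exI[of _ "e / exp L"]) (auto intro: le_less_trans)
  qed
  then have "\<exists>s\<ge>t - M. s \<le> t + M \<and> P s x = t"
    using near[of "t - M"] near[of "t + M"] M(1)
    by (intro IVT') (auto intro: continuous_on_subset simp: abs_le_iff)
  then show ?thesis using that P(1) by blast
qed

lemma flow_eq:
  assumes \<phi>: "curve F \<phi>" and x: "x \<in> {0..1}" and \<xi>: "\<xi> \<in> {0..1}"
  shows "flow F \<xi> x (\<phi> x) = \<phi> \<xi>"
  unfolding flow_def
proof (rule the_equality)
  show "\<exists>\<psi>. (\<psi> x = \<phi> x \<and> curve F \<psi>) \<and> \<psi> \<xi> = \<phi> \<xi>" using \<phi> by blast
  fix s assume "\<exists>\<psi>. (\<psi> x = \<phi> x \<and> curve F \<psi>) \<and> \<psi> \<xi> = s"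
  then obtain \<psi> where \<psi>: "\<psi> x = \<phi> x" "curve F \<psi>" "\<psi> \<xi> = s" by blast
  show "s = \<phi> \<xi>" using curve_gronwall[OF \<psi>(2) \<phi> x \<xi>] \<psi> by simp
qed

abbreviation \<tau> where "\<tau> \<equiv> flow F"

lemma flow_curve:
  assumes x: "x \<in> {0..1}" shows "curve F (\<lambda>\<xi>. \<tau> \<xi> x t)"
proof -
  obtain \<phi> where \<phi>: "curve F \<phi>" "\<phi> x = t" using curve_through[OF x] by blast
  have eq: "\<tau> \<xi> x t = \<phi> \<xi>" if "\<xi> \<in> {0..1}" for \<xi>
    using flow_eq[OF \<phi>(1) x that] \<phi>(2) by simp
  show ?thesis unfolding curve_def
  proof
    fix \<xi> :: real assume \<xi>: "\<xi> \<in> {0..1}"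
    show "((\<lambda>\<xi>. \<tau> \<xi> x t) has_real_derivative F \<xi> (\<tau> \<xi> x t)) (at \<xi> within {0..1})"
      unfolding eq[OF \<xi>]
      by (rule has_field_derivative_transform_within[OF curveD[OF \<phi>(1) \<xi>], of 1]) (use \<xi> eq in auto)
  qed
qed

lemma flow_self: "x \<in> {0..1} \<Longrightarrow> \<tau> x x t = t"
  by (metis curve_through flow_eq)

lemma flow_flow: "x \<in> {0..1} \<Longrightarrow> \<xi> \<in> {0..1} \<Longrightarrow> \<eta> \<in> {0..1} \<Longrightarrow> \<tau> \<eta> \<xi> (\<tau> \<xi> x t) = \<tau> \<eta> x t"
  using flow_eq[OF flow_curve[of x t], of \<xi> \<eta>] by simp

lemma flow_lipschitz:
  assumes "\<xi> \<in> {0..1}" "x \<in> {0..1}" "\<xi>' \<in> {0..1}" "x' \<in> {0..1}"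
  shows "\<bar>\<tau> \<xi> x t - \<tau> \<xi>' x' t'\<bar> \<le> M * \<bar>\<xi> - \<xi>'\<bar> + exp L * (M * \<bar>x - x'\<bar> + \<bar>t - t'\<bar>)"
proof -
  have 1: "\<bar>\<tau> \<xi> x t - \<tau> \<xi>' x t\<bar> \<le> M * \<bar>\<xi> - \<xi>'\<bar>"
    using curve_lipschitz[OF flow_curve[OF assms(2)]] assms by blast
  have "\<bar>\<tau> \<xi>' x t - \<tau> \<xi>' x' t'\<bar> \<le> exp L * \<bar>\<tau> x' x t - \<tau> x' x' t'\<bar>"
    using curve_gronwall[OF flow_curve[OF assms(2)] flow_curve[OF assms(4)]] assms by blast
  also have "\<dots> \<le> exp L * (M * \<bar>x - x'\<bar> + \<bar>t - t'\<bar>)"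
  proof (rule mult_left_mono)
    have "\<bar>\<tau> x' x t - \<tau> x x t\<bar> \<le> M * \<bar>x' - x\<bar>"
      using curve_lipschitz[OF flow_curve[OF assms(2)]] assms by blast
    then show "\<bar>\<tau> x' x t - \<tau> x' x' t'\<bar> \<le> M * \<bar>x - x'\<bar> + \<bar>t - t'\<bar>"
      using flow_self[of x t] flow_self[of x' t'] assms by (simp add: abs_minus_commute)
  qed simp
  finally show ?thesis using 1 by linarith
qed

lemma flow_lipschitz_t:
  assumes "\<xi> \<in> {0..1}" "x \<in> {0..1}"
  shows "\<bar>\<tau> \<xi> x t - \<tau> \<xi> x t'\<bar> \<le> exp L * \<bar>t - t'\<bar>"
  using flow_lipschitz[OF assms assms, of t t'] by simp

lemma continuous_on_flow:
  "continuous_on ({0..1} \<times> {0..1} \<times> UNIV) (\<lambda>(\<xi>, x, t). \<tau> \<xi> x t)"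
proof (rule continuous_on_iff[THEN iffD2], intro ballI allI impI)
  fix p :: "real \<times> real \<times> real" and e :: real assume p: "p \<in> {0..1} \<times> {0..1} \<times> UNIV" and e: "0 < e"
  obtain \<xi> x t where [simp]: "p = (\<xi>, x, t)" by (cases p) auto
  define C where "C = M + exp L * (M + 1)"
  have C: "C > 0" using M(1) by (auto simp: C_def intro!: add_nonneg_pos)
  have "dist ((\<lambda>(\<xi>, x, t). \<tau> \<xi> x t) q) ((\<lambda>(\<xi>, x, t). \<tau> \<xi> x t) p) < e"
    if q: "q \<in> {0..1} \<times> {0..1} \<times> UNIV" "dist q p < e / C" for q
  proof -
    obtain \<xi>' x' t' where [simp]: "q = (\<xi>', x', t')" by (cases q) auto
    have d: "\<bar>\<xi>' - \<xi>\<bar> \<le> dist q p" "\<bar>x' - x\<bar> \<le> dist q p" "\<bar>t' - t\<bar> \<le> dist q p"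
    proof -
      have "dist (snd q) (snd p) \<le> dist q p" by (rule dist_snd_le)
      moreover have "dist (fst (snd q)) (fst (snd p)) \<le> dist (snd q) (snd p)"
        "dist (snd (snd q)) (snd (snd p)) \<le> dist (snd q) (snd p)" by (rule dist_fst_le dist_snd_le)+
      moreover have "dist (fst q) (fst p) \<le> dist q p" by (rule dist_fst_le)
      ultimately show "\<bar>\<xi>' - \<xi>\<bar> \<le> dist q p" "\<bar>x' - x\<bar> \<le> dist q p" "\<bar>t' - t\<bar> \<le> dist q p"
        by (auto simp: dist_real_def)
    qed
    have "\<bar>\<tau> \<xi>' x' t' - \<tau> \<xi> x t\<bar> \<le> M * \<bar>\<xi>' - \<xi>\<bar> + exp L * (M * \<bar>x' - x\<bar> + \<bar>t' - t\<bar>)"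
      using p q by (intro flow_lipschitz) auto
    also have "\<dots> \<le> M * dist q p + exp L * (M * dist q p + dist q p)"
      using d M(1) by (intro add_mono mult_left_mono) auto
    also have "\<dots> = C * dist q p" by (simp add: C_def algebra_simps)
    also have "\<dots> < e" using q(2) C by (simp add: field_simps)
    finally show ?thesis by (simp add: dist_real_def)
  qed
  then show "\<exists>d>0. \<forall>q\<in>{0..1} \<times> {0..1} \<times> UNIV. dist q p < d \<longrightarrow>
      dist ((\<lambda>(\<xi>, x, t). \<tau> \<xi> x t) q) ((\<lambda>(\<xi>, x, t). \<tau> \<xi> x t) p) < e"
    using e C by (intro exI[of _ "e / C"]) auto
qed

lemma flow_comp:
  assumes "continuous_on S A" "continuous_on S B" "continuous_on S C"
    "\<And>p. p \<in> S \<Longrightarrow> A p \<in> {0..1}" "\<And>p. p \<in> S \<Longrightarrow> B p \<in> {0..1}"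
  shows "continuous_on S (\<lambda>p. \<tau> (A p) (B p) (C p))"
proof -
  have "continuous_on S (\<lambda>p. (\<lambda>(\<xi>, x, t). \<tau> \<xi> x t) (A p, B p, C p))"
    by (rule continuous_on_compose2[OF continuous_on_flow]) (use assms in \<open>auto intro!: continuous_intros\<close>)
  then show ?thesis by simp
qed

lemma cont_flow_comp:
  assumes "cont g" "continuous_on S A" "continuous_on S B" "continuous_on S C"
    "\<And>p. p \<in> S \<Longrightarrow> A p \<in> {0..1}" "\<And>p. p \<in> S \<Longrightarrow> B p \<in> {0..1}"
  shows "continuous_on S (\<lambda>p. g (A p) (\<tau> (A p) (B p) (C p)))"
  by (rule cont_comp[OF assms(1,2) flow_comp]) (use assms in auto)

lemma cont_along:
  assumes "cont g" "x \<in> {0..1}" shows "continuous_on {0..1} (\<lambda>\<xi>. g \<xi> (\<tau> \<xi> x t))"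
  by (rule cont_flow_comp[OF assms(1)]) (use assms(2) in \<open>auto intro: continuous_intros\<close>)

lemma flow_shift:
  assumes x: "x \<in> {0..1}" and \<xi>: "\<xi> \<in> {0..1}"
  shows "\<tau> \<xi> x (t + 2 * pi) = \<tau> \<xi> x t + 2 * pi"
proof -
  have "curve F (\<lambda>\<xi>. \<tau> \<xi> x t + 2 * pi)" unfolding curve_def
  proof
    fix \<xi> :: real assume \<xi>: "\<xi> \<in> {0..1}"
    have "((\<lambda>\<xi>. \<tau> \<xi> x t + 2 * pi) has_real_derivative F \<xi> (\<tau> \<xi> x t) + 0) (at \<xi> within {0..1})"
      by (intro DERIV_add DERIV_const curveD[OF flow_curve[OF x] \<xi>])
    then show "((\<lambda>\<xi>. \<tau> \<xi> x t + 2 * pi) has_real_derivative F \<xi> (\<tau> \<xi> x t + 2 * pi)) (at \<xi> within {0..1})"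
      using F_per \<xi> by (simp add: periodic_strip_def)
  qed
  from flow_eq[OF this x \<xi>] show ?thesis by (simp add: flow_self[OF x])
qed

text \<open>The time derivative of the flow: it solves the linear variational equation along the
  curve.\<close>

definition TT where "TT \<xi> x t = exp (ig (\<lambda>\<eta>. Ft \<eta> (\<tau> \<eta> x t)) x \<xi>)"

lemma TT_self [simp]: "TT x x t = 1" by (simp add: TT_def)

lemma TT_bound:
  assumes "\<xi> \<in> {0..1}" "x \<in> {0..1}" shows "\<bar>TT \<xi> x t\<bar> \<le> exp L"
proof -
  have "\<bar>ig (\<lambda>\<eta>. Ft \<eta> (\<tau> \<eta> x t)) x \<xi>\<bar> \<le> L"
    by (rule ig_bound1) (use assms L cont_along[OF contFt] in auto)
  then show ?thesis by (simp add: TT_def)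
qed

lemma TT_deriv:
  assumes x: "x \<in> {0..1}" and \<xi>: "\<xi> \<in> {0..1}"
  shows "((\<lambda>\<xi>. TT \<xi> x t) has_real_derivative TT \<xi> x t * Ft \<xi> (\<tau> \<xi> x t)) (at \<xi> within {0..1})"
  unfolding TT_def
  by (intro DERIV_chain2[OF DERIV_exp] ig_deriv cont_along[OF contFt] x \<xi>)

lemma continuous_on_ig_flow:
  assumes g: "cont g" and "continuous_on S A" "continuous_on S B" "continuous_on S C" "continuous_on S X"
    "\<And>p. p \<in> S \<Longrightarrow> A p \<in> {0..1}" "\<And>p. p \<in> S \<Longrightarrow> B p \<in> {0..1}" "\<And>p. p \<in> S \<Longrightarrow> X p \<in> {0..1}"
  shows "continuous_on S (\<lambda>p. ig (\<lambda>\<eta>. g \<eta> (\<tau> \<eta> (X p) (C p))) (A p) (B p))"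
proof (rule continuous_on_ig)
  have "continuous_on (S \<times> {0..1}) (\<lambda>q. g (snd q) (\<tau> (snd q) (X (fst q)) (C (fst q))))"
    by (rule cont_flow_comp[OF g]) (use assms in \<open>auto intro!: continuous_intros continuous_on_compose2[OF _ continuous_on_fst]\<close>)
  then show "continuous_on (S \<times> {0..1}) (\<lambda>(p, \<eta>). g \<eta> (\<tau> \<eta> (X p) (C p)))"
    by (simp add: case_prod_unfold)
qed (use assms in auto)

lemma TT_comp:
  assumes "continuous_on S A" "continuous_on S B" "continuous_on S C"
    "\<And>p. p \<in> S \<Longrightarrow> A p \<in> {0..1}" "\<And>p. p \<in> S \<Longrightarrow> B p \<in> {0..1}"
  shows "continuous_on S (\<lambda>p. TT (A p) (B p) (C p))"
  unfolding TT_def by (intro continuous_on_exp continuous_on_ig_flow[OF contFt] assms) (use assms in auto)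

text \<open>The difference \<open>\<delta>\<close> of two curves solves the linear equation \<open>\<delta>' = m \<delta>\<close> with the difference
  quotient \<open>m\<close> of \<open>F\<close>, hence is an exponential; \<open>m\<close> tends to the time derivative of \<open>F\<close>.\<close>

lemma flow_deriv_t:
  assumes x: "x \<in> {0..1}" and \<xi>: "\<xi> \<in> {0..1}"
  shows "((\<lambda>t. \<tau> \<xi> x t) has_real_derivative TT \<xi> x t) (at t)"
proof -
  define \<delta> where "\<delta> h \<eta> = \<tau> \<eta> x (t + h) - \<tau> \<eta> x t" for h \<eta>
  define m where "m h \<eta> = (F \<eta> (\<tau> \<eta> x (t + h)) - F \<eta> (\<tau> \<eta> x t)) / \<delta> h \<eta>" for h \<eta>
  have nz: "\<delta> h \<eta> \<noteq> 0" if "h \<noteq> 0" "\<eta> \<in> {0..1}" for h \<eta>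
  proof
    assume "\<delta> h \<eta> = 0"
    moreover have "\<bar>\<tau> x x (t + h) - \<tau> x x t\<bar> \<le> exp L * \<bar>\<tau> \<eta> x (t + h) - \<tau> \<eta> x t\<bar>"
      by (rule curve_gronwall[OF flow_curve[OF x] flow_curve[OF x] that(2) x])
    ultimately show False using that(1) by (simp add: \<delta>_def flow_self[OF x])
  qed
  have \<delta>_bd: "\<bar>\<delta> h \<eta>\<bar> \<le> exp L * \<bar>h\<bar>" if "\<eta> \<in> {0..1}" for h \<eta>
    using flow_lipschitz_t[OF that x, of "t + h" t] by (simp add: \<delta>_def)
  have \<tau>c: "continuous_on {0..1} (\<lambda>\<eta>. \<tau> \<eta> x s)" for s
    by (rule curve_continuous[OF flow_curve[OF x]])
  have mc: "continuous_on {0..1} (m h)" if "h \<noteq> 0" for h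
    unfolding m_def using nz[OF that]
    by (intro continuous_on_divide continuous_on_diff cont_along[OF contF x]) (auto simp: \<delta>_def intro!: continuous_intros \<tau>c)
  have quot: "(\<tau> \<xi> x (t + h) - \<tau> \<xi> x t) / h = exp (ig (m h) x \<xi>)" if h: "h \<noteq> 0" for h
  proof -
    have "((\<lambda>\<eta>. \<delta> h \<eta> * exp (- ig (m h) x \<eta>)) has_real_derivative 0) (at \<eta> within {0..1})" if \<eta>: "\<eta> \<in> {0..1}" for \<eta>
    proof -
      have 1: "(\<delta> h has_real_derivative m h \<eta> * \<delta> h \<eta>) (at \<eta> within {0..1})"
        using DERIV_diff[OF curveD[OF flow_curve[OF x, of "t + h"] \<eta>] curveD[OF flow_curve[OF x, of t] \<eta>]] nz[OF h \<eta>]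
        by (simp add: \<delta>_def[abs_def] m_def)
      have 2: "((\<lambda>\<eta>. exp (- ig (m h) x \<eta>)) has_real_derivative exp (- ig (m h) x \<eta>) * (- m h \<eta>)) (at \<eta> within {0..1})"
        by (intro DERIV_chain2[OF DERIV_exp] DERIV_minus ig_deriv[OF mc[OF h]] x \<eta>)
      show ?thesis using DERIV_mult[OF 1 2] by (simp add: algebra_simps)
    qed
    from unit_deriv_zero_const[OF this \<xi> x] have "\<delta> h \<xi> * exp (- ig (m h) x \<xi>) = h"
      by (simp add: \<delta>_def flow_self[OF x])
    then show ?thesis using h by (simp add: \<delta>_def exp_minus field_simps)
  qed
  have "(\<lambda>h. ig (m h) x \<xi>) \<midarrow>0\<rightarrow> ig (\<lambda>\<eta>. Ft \<eta> (\<tau> \<eta> x t)) x \<xi>"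
  proof (rule LIM_I)
    fix e :: real assume e: "0 < e"
    obtain d where d: "d > 0" "\<And>y s s'. y \<in> {0..1} \<Longrightarrow> \<bar>s - s'\<bar> < d \<Longrightarrow> \<bar>Ft y s - Ft y s'\<bar> < e / 2"
      using periodic_unif_cont[OF contFt Ft_per, of "e / 2"] e by auto
    have "norm (ig (m h) x \<xi> - ig (\<lambda>\<eta>. Ft \<eta> (\<tau> \<eta> x t)) x \<xi>) < e"
      if h: "h \<noteq> 0 \<and> norm (h - 0) < d / exp L" for h
    proof -
      have "\<bar>m h \<eta> - Ft \<eta> (\<tau> \<eta> x t)\<bar> \<le> e / 2" if \<eta>: "\<eta> \<in> {0..1}" for \<eta>
      proof -
        have dl: "\<bar>\<delta> h \<eta>\<bar> < d" using \<delta>_bd[OF \<eta>, of h] h by (auto simp: field_simps)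
        have "\<exists>z. \<bar>z - \<tau> \<eta> x t\<bar> < d \<and> m h \<eta> = Ft \<eta> z"
        proof (cases "\<tau> \<eta> x t < \<tau> \<eta> x (t + h)")
          case True
          obtain z where z: "\<tau> \<eta> x t < z" "z < \<tau> \<eta> x (t + h)"
            "F \<eta> (\<tau> \<eta> x (t + h)) - F \<eta> (\<tau> \<eta> x t) = (\<tau> \<eta> x (t + h) - \<tau> \<eta> x t) * Ft \<eta> z"
            using MVT2[OF True, of "F \<eta>" "Ft \<eta>"] t_derivD(3)[OF F_t \<eta>] by blast
          then show ?thesis using dl by (intro exI[of _ z]) (auto simp: m_def \<delta>_def)
        next
          case False
          then have lt: "\<tau> \<eta> x (t + h) < \<tau> \<eta> x t" using nz[of h \<eta>] h \<eta> by (auto simp: \<delta>_def)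
          obtain z where z: "\<tau> \<eta> x (t + h) < z" "z < \<tau> \<eta> x t"
            "F \<eta> (\<tau> \<eta> x t) - F \<eta> (\<tau> \<eta> x (t + h)) = (\<tau> \<eta> x t - \<tau> \<eta> x (t + h)) * Ft \<eta> z"
            using MVT2[OF lt, of "F \<eta>" "Ft \<eta>"] t_derivD(3)[OF F_t \<eta>] by blast
          then have "m h \<eta> = Ft \<eta> z" using lt by (simp add: m_def \<delta>_def field_simps)
          then show ?thesis using z dl by (intro exI[of _ z]) (auto simp: \<delta>_def)
        qed
        then show ?thesis using d(2)[OF \<eta>] by (metis less_imp_le)
      qed
      then have "\<bar>ig (\<lambda>\<eta>. m h \<eta> - Ft \<eta> (\<tau> \<eta> x t)) x \<xi>\<bar> \<le> e / 2"
        using h by (intro ig_bound1 continuous_on_diff mc cont_along contFt x \<xi>) auto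
      then show ?thesis
        using ig_diff[OF mc cont_along[OF contFt x] x \<xi>, of h t] h e by simp
    qed
    then show "\<exists>s>0. \<forall>h. h \<noteq> 0 \<and> norm (h - 0) < s \<longrightarrow>
        norm (ig (m h) x \<xi> - ig (\<lambda>\<eta>. Ft \<eta> (\<tau> \<eta> x t)) x \<xi>) < e"
      using d(1) by (intro exI[of _ "d / exp L"]) auto
  qed
  then have "(\<lambda>h. exp (ig (m h) x \<xi>)) \<midarrow>0\<rightarrow> TT \<xi> x t"
    unfolding TT_def by (rule tendsto_exp)
  then have "(\<lambda>h. (\<tau> \<xi> x (t + h) - \<tau> \<xi> x t) / h) \<midarrow>0\<rightarrow> TT \<xi> x t"
    by (rule Lim_transform_eventually) (auto simp: eventually_at_filter quot)
  then show ?thesis by (simp add: DERIV_def)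
qed

end

section \<open>Transport along characteristics\<close>

text \<open>\<open>transport F v g\<close>: along every curve of slope \<open>F\<close> the derivative of \<open>v\<close> is \<open>g\<close>, which is the
  equation \<open>\<partial>\<^sub>x v + F \<partial>\<^sub>t v = g\<close> for functions \<open>v\<close> that are merely continuous.\<close>

definition transport ::
  "(real \<Rightarrow> real \<Rightarrow> real) \<Rightarrow> (real \<Rightarrow> real \<Rightarrow> real) \<Rightarrow> (real \<Rightarrow> real \<Rightarrow> real) \<Rightarrow> bool" where
  "transport F v g \<longleftrightarrow> (\<forall>\<phi>. curve F \<phi> \<longrightarrow>
     (\<forall>\<xi>\<in>{0..1}. ((\<lambda>\<xi>. v \<xi> (\<phi> \<xi>)) has_real_derivative g \<xi> (\<phi> \<xi>)) (at \<xi> within {0..1})))"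

lemma transportD:
  "transport F v g \<Longrightarrow> curve F \<phi> \<Longrightarrow> \<xi> \<in> {0..1} \<Longrightarrow>
    ((\<lambda>\<xi>. v \<xi> (\<phi> \<xi>)) has_real_derivative g \<xi> (\<phi> \<xi>)) (at \<xi> within {0..1})"
  by (simp add: transport_def)

lemma transportI:
  "(\<And>\<phi> \<xi>. curve F \<phi> \<Longrightarrow> \<xi> \<in> {0..1} \<Longrightarrow>
    ((\<lambda>\<xi>. v \<xi> (\<phi> \<xi>)) has_real_derivative g \<xi> (\<phi> \<xi>)) (at \<xi> within {0..1})) \<Longrightarrow> transport F v g"
  by (simp add: transport_def)

lemma transport_cong:
  assumes v: "transport F v g" and eq: "\<And>x t. x \<in> {0..1} \<Longrightarrow> v x t = w x t" "\<And>x t. x \<in> {0..1} \<Longrightarrow> g x t = h x t"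
  shows "transport F w h"
proof (rule transportI)
  fix \<phi> \<xi> assume "curve F \<phi>" and \<xi>: "\<xi> \<in> {0..1::real}"
  from transportD[OF v this] have "((\<lambda>\<xi>. v \<xi> (\<phi> \<xi>)) has_real_derivative h \<xi> (\<phi> \<xi>)) (at \<xi> within {0..1})"
    by (simp add: eq(2)[OF \<xi>])
  then show "((\<lambda>\<xi>. w \<xi> (\<phi> \<xi>)) has_real_derivative h \<xi> (\<phi> \<xi>)) (at \<xi> within {0..1})"
    by (rule has_field_derivative_transform_within[where d = 1]) (use \<xi> eq in auto)
qed

lemma transport_diff:
  assumes "transport F v g" "transport F w h"
  shows "transport F (\<lambda>x t. v x t - w x t) (\<lambda>x t. g x t - h x t)"
  by (rule transportI, rule DERIV_diff[OF transportD[OF assms(1)] transportD[OF assms(2)]])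

lemma transport_mult:
  assumes "transport F v g" "transport F w h"
  shows "transport F (\<lambda>x t. v x t * w x t) (\<lambda>x t. g x t * w x t + h x t * v x t)"
  by (rule transportI, rule DERIV_mult[OF transportD[OF assms(1)] transportD[OF assms(2)]])

lemma transport_exp:
  assumes "transport F v g"
  shows "transport F (\<lambda>x t. exp (v x t)) (\<lambda>x t. exp (v x t) * g x t)"
  by (rule transportI, rule DERIV_chain2[OF DERIV_exp transportD[OF assms]])

lemma transport_divide:
  assumes "transport F v g" "transport F w h" "\<And>x t. w x t \<noteq> 0"
  shows "transport F (\<lambda>x t. v x t / w x t) (\<lambda>x t. (g x t * w x t - v x t * h x t) / (w x t * w x t))"
  by (rule transportI, rule DERIV_divide[OF transportD[OF assms(1)] transportD[OF assms(2)] assms(3)])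

context slope
begin

lemma transport_along:
  "transport F v g \<Longrightarrow> x \<in> {0..1} \<Longrightarrow> \<xi> \<in> {0..1} \<Longrightarrow>
    ((\<lambda>\<xi>. v \<xi> (\<tau> \<xi> x t)) has_real_derivative g \<xi> (\<tau> \<xi> x t)) (at \<xi> within {0..1})"
  by (rule transportD[OF _ flow_curve])

lemma transport_repr:
  assumes "transport F v g" "e \<in> {0..1}" "x \<in> {0..1}"
  shows "v x t = v e (\<tau> e x t) + ig (\<lambda>\<xi>. g \<xi> (\<tau> \<xi> x t)) e x"
proof -
  have "ig (\<lambda>\<xi>. g \<xi> (\<tau> \<xi> x t)) e x = v x (\<tau> x x t) - v e (\<tau> e x t)"
    by (rule ig_FTC[where S = "{0..1}"]) (use assms transport_along in auto)
  then show ?thesis using flow_self[OF assms(3)] by simp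
qed

text \<open>The solution of \<open>\<partial>\<^sub>x v + F \<partial>\<^sub>t v = g\<close> with values \<open>z\<close> on the line \<open>x = e\<close>.\<close>

definition sol where "sol e z g x t = z (\<tau> e x t) + ig (\<lambda>\<xi>. g \<xi> (\<tau> \<xi> x t)) e x"

lemma sol_on_curve:
  assumes \<phi>: "curve F \<phi>" and e: "e \<in> {0..1}" and \<xi>: "\<xi> \<in> {0..1}"
  shows "sol e z g \<xi> (\<phi> \<xi>) = z (\<phi> e) + ig (\<lambda>\<eta>. g \<eta> (\<phi> \<eta>)) e \<xi>"
proof -
  have "ig (\<lambda>\<eta>. g \<eta> (\<tau> \<eta> \<xi> (\<phi> \<xi>))) e \<xi> = ig (\<lambda>\<eta>. g \<eta> (\<phi> \<eta>)) e \<xi>"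
    by (rule ig_cong[OF e \<xi>]) (simp add: flow_eq[OF \<phi> \<xi>])
  then show ?thesis by (simp add: sol_def flow_eq[OF \<phi> \<xi> e])
qed

lemma sol_entry: "e \<in> {0..1} \<Longrightarrow> sol e z g e t = z t"
  by (simp add: sol_def flow_self)

lemma transport_sol:
  assumes g: "cont g" and e: "e \<in> {0..1}"
  shows "transport F (sol e z g) g"
proof (rule transportI)
  fix \<phi> \<xi> assume \<phi>: "curve F \<phi>" and \<xi>: "\<xi> \<in> {0..1::real}"
  have c: "continuous_on {0..1} (\<lambda>\<eta>. g \<eta> (\<phi> \<eta>))"
    by (rule cont_comp[OF g _ curve_continuous[OF \<phi>]]) (auto intro: continuous_intros)
  have "((\<lambda>\<xi>. z (\<phi> e) + ig (\<lambda>\<eta>. g \<eta> (\<phi> \<eta>)) e \<xi>) has_real_derivative 0 + g \<xi> (\<phi> \<xi>)) (at \<xi> within {0..1})"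
    by (intro DERIV_add DERIV_const ig_deriv[OF c] e \<xi>)
  then have "((\<lambda>\<xi>. z (\<phi> e) + ig (\<lambda>\<eta>. g \<eta> (\<phi> \<eta>)) e \<xi>) has_real_derivative g \<xi> (\<phi> \<xi>)) (at \<xi> within {0..1})" by simp
  then show "((\<lambda>\<xi>. sol e z g \<xi> (\<phi> \<xi>)) has_real_derivative g \<xi> (\<phi> \<xi>)) (at \<xi> within {0..1})"
    by (rule has_field_derivative_transform_within[where d = 1]) (use \<xi> sol_on_curve[OF \<phi> e] in auto)
qed

lemma cont_sol:
  assumes g: "cont g" and z: "continuous_on UNIV z" and e: "e \<in> {0..1}"
  shows "cont (sol e z g)"
  unfolding sol_def case_prod_unfold
  by (intro continuous_on_add continuous_on_compose2[OF z] flow_comp continuous_on_ig_flow[OF g])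
    (use e in \<open>auto intro: continuous_intros\<close>)

lemma periodic_sol:
  assumes g: "periodic_strip g" and z: "periodic_real z" and e: "e \<in> {0..1}"
  shows "periodic_strip (sol e z g)"
  unfolding periodic_strip_def
proof (intro ballI allI)
  fix x t :: real assume x: "x \<in> {0..1}"
  have "ig (\<lambda>\<xi>. g \<xi> (\<tau> \<xi> x (t + 2 * pi))) e x = ig (\<lambda>\<xi>. g \<xi> (\<tau> \<xi> x t)) e x"
    by (rule ig_cong[OF e x]) (use g in \<open>simp add: flow_shift[OF x] periodic_strip_def\<close>)
  then show "sol e z g x (t + 2 * pi) = sol e z g x t"
    using z by (simp add: sol_def flow_shift[OF x e] periodic_real_def)
qed

lemma flow_chain_t:
  assumes g: "t_deriv g gt" and x: "x \<in> {0..1}" and \<xi>: "\<xi> \<in> {0..1}"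
  shows "((\<lambda>t. g \<xi> (\<tau> \<xi> x t)) has_real_derivative gt \<xi> (\<tau> \<xi> x t) * TT \<xi> x t) (at t)"
  by (rule DERIV_chain2[OF t_derivD(3)[OF g \<xi>] flow_deriv_t[OF x \<xi>]])

lemma continuous_on_flow_TT:
  assumes g: "cont g"
  shows "continuous_on (strip \<times> {0..1}) (\<lambda>(p, \<xi>). g \<xi> (\<tau> \<xi> (fst p) (snd p)) * TT \<xi> (fst p) (snd p))"
  unfolding case_prod_unfold
  by (intro continuous_on_mult cont_flow_comp[OF g] TT_comp) (auto intro!: continuous_intros)

lemma cont_ig_TT:
  assumes g: "cont g" and e: "e \<in> {0..1}"
  shows "cont (\<lambda>x t. ig (\<lambda>\<xi>. g \<xi> (\<tau> \<xi> x t) * TT \<xi> x t) e x)"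
  unfolding case_prod_unfold
  by (rule continuous_on_ig[OF continuous_on_flow_TT[OF g], of "\<lambda>_. e" fst])
    (use e in \<open>auto intro!: continuous_on_fst continuous_on_id continuous_on_const\<close>)

lemma ig_flow_deriv:
  assumes g: "t_deriv g gt" and e: "e \<in> {0..1}" and x: "x \<in> {0..1}"
  shows "((\<lambda>t. ig (\<lambda>\<xi>. g \<xi> (\<tau> \<xi> x t)) e x) has_real_derivative
    ig (\<lambda>\<xi>. gt \<xi> (\<tau> \<xi> x t) * TT \<xi> x t) e x) (at t)"
proof (rule ig_leibniz[where U = UNIV])
  have "continuous_on (UNIV \<times> {0..1}) (\<lambda>q. (\<lambda>(p, \<xi>). gt \<xi> (\<tau> \<xi> (fst p) (snd p)) * TT \<xi> (fst p) (snd p)) ((x, fst q), snd q))"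
    by (rule continuous_on_compose2[OF continuous_on_flow_TT[OF t_derivD(2)[OF g]]])
      (use x in \<open>auto intro!: continuous_intros\<close>)
  then show "continuous_on (UNIV \<times> {0..1}) (\<lambda>(s, \<xi>). gt \<xi> (\<tau> \<xi> x s) * TT \<xi> x s)"
    by (simp add: case_prod_unfold)
qed (use x e flow_chain_t[OF g x] cont_along[OF t_derivD(1)[OF g] x] in auto)

lemma t_deriv_ig_flow:
  assumes g: "t_deriv g gt" and e: "e \<in> {0..1}"
  shows "t_deriv (\<lambda>x t. ig (\<lambda>\<xi>. g \<xi> (\<tau> \<xi> x t)) e x) (\<lambda>x t. ig (\<lambda>\<xi>. gt \<xi> (\<tau> \<xi> x t) * TT \<xi> x t) e x)"
proof (rule t_derivI)
  show "cont (\<lambda>x t. ig (\<lambda>\<xi>. g \<xi> (\<tau> \<xi> x t)) e x)"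
    using cont_sol[OF t_derivD(1)[OF g], of "\<lambda>_. 0" e] e by (simp add: sol_def)
qed (use cont_ig_TT[OF t_derivD(2)[OF g] e] ig_flow_deriv[OF g e] in auto)

lemma t_deriv_entry:
  assumes z: "\<And>t. (z has_real_derivative z' t) (at t)" and z': "continuous_on UNIV z'" and e: "e \<in> {0..1}"
  shows "t_deriv (\<lambda>x t. z (\<tau> e x t)) (\<lambda>x t. z' (\<tau> e x t) * TT e x t)"
proof (rule t_derivI)
  have zc: "continuous_on UNIV z" using z by (meson DERIV_isCont continuous_at_imp_continuous_on)
  show "cont (\<lambda>x t. z (\<tau> e x t))" unfolding case_prod_unfold
    by (intro continuous_on_compose2[OF zc] flow_comp) (use e in \<open>auto intro: continuous_intros\<close>)
  show "cont (\<lambda>x t. z' (\<tau> e x t) * TT e x t)" unfolding case_prod_unfold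
    by (intro continuous_on_mult continuous_on_compose2[OF z'] flow_comp TT_comp) (use e in \<open>auto intro: continuous_intros\<close>)
  show "((\<lambda>t. z (\<tau> e x t)) has_real_derivative z' (\<tau> e x t) * TT e x t) (at t)" if "x \<in> {0..1}" for x t
    by (rule DERIV_chain2[OF z flow_deriv_t[OF that e]])
qed

lemma t_deriv_sol:
  assumes g: "t_deriv g gt" and z: "\<And>t. (z has_real_derivative z' t) (at t)" and z': "continuous_on UNIV z'" and e: "e \<in> {0..1}"
  shows "\<exists>w. t_deriv (sol e z g) w"
  using t_deriv_add[OF t_deriv_entry[OF z z' e] t_deriv_ig_flow[OF g e]] unfolding sol_def by blast

text \<open>The integrating factor of the equation \<open>\<partial>\<^sub>x v + F \<partial>\<^sub>t v + p v = f\<close>, and the solution of that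
  equation with values \<open>z\<close> on the line \<open>x = e\<close>.\<close>

definition E where "E p x t = exp (sol 0 (\<lambda>_. 0) p x t)"

definition dsol where
  "dsol p e z f x t = sol e (\<lambda>t. E p e t * z t) (\<lambda>x t. E p x t * f x t) x t / E p x t"

lemma E_nz: "E p x t \<noteq> 0" by (simp add: E_def)

lemma cont_E: "cont p \<Longrightarrow> cont (E p)"
  unfolding E_def[abs_def] by (intro cont_exp cont_sol) auto

lemma transport_E: "cont p \<Longrightarrow> transport F (E p) (\<lambda>x t. E p x t * p x t)"
  unfolding E_def[abs_def] by (intro transport_exp transport_sol) auto

lemma periodic_E: "periodic_strip p \<Longrightarrow> periodic_strip (E p)"
  using periodic_sol[of p "\<lambda>_. 0" 0] by (auto simp: E_def[abs_def] periodic_strip_def periodic_real_def)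

lemma t_deriv_E: "t_deriv p pt \<Longrightarrow> \<exists>Et. t_deriv (E p) Et"
proof -
  assume p: "t_deriv p pt"
  obtain w where "t_deriv (sol 0 (\<lambda>_. 0) p) w"
    using t_deriv_sol[OF p DERIV_const continuous_on_const, of 0 0] by auto
  from t_deriv_exp[OF this] show ?thesis unfolding E_def[abs_def] by blast
qed

lemma dsol_entry: "e \<in> {0..1} \<Longrightarrow> dsol p e z f e t = z t"
  by (simp add: dsol_def sol_entry E_nz)

lemma continuous_on_E_time: "cont p \<Longrightarrow> e \<in> {0..1} \<Longrightarrow> continuous_on UNIV (\<lambda>t. E p e t)"
  by (rule cont_time[OF cont_E])

lemma cont_dsol:
  assumes p: "cont p" and f: "cont f" and z: "continuous_on UNIV z" and e: "e \<in> {0..1}"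
  shows "cont (dsol p e z f)"
  unfolding dsol_def[abs_def]
  by (intro cont_divide cont_sol cont_mult cont_E p f e continuous_on_mult continuous_on_E_time z E_nz)

lemma periodic_dsol:
  assumes p: "periodic_strip p" and f: "periodic_strip f" and z: "periodic_real z" and e: "e \<in> {0..1}"
  shows "periodic_strip (dsol p e z f)"
proof -
  have "periodic_strip (sol e (\<lambda>t. E p e t * z t) (\<lambda>x t. E p x t * f x t))"
    by (rule periodic_sol) (use periodic_E[OF p] f z e in \<open>auto simp: periodic_strip_def periodic_real_def\<close>)
  then show ?thesis using periodic_E[OF p] by (auto simp: dsol_def[abs_def] periodic_strip_def)
qed

lemma transport_dsol:
  assumes p: "cont p" and f: "cont f" and e: "e \<in> {0..1}"
  shows "transport F (dsol p e z f) (\<lambda>x t. f x t - p x t * dsol p e z f x t)"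
proof -
  have "transport F (dsol p e z f) (\<lambda>x t. ((E p x t * f x t) * E p x t -
      sol e (\<lambda>t. E p e t * z t) (\<lambda>x t. E p x t * f x t) x t * (E p x t * p x t)) / (E p x t * E p x t))"
    unfolding dsol_def[abs_def]
    by (intro transport_divide transport_sol transport_E cont_mult cont_E p f e E_nz)
  then show ?thesis
    by (rule transport_cong) (simp_all add: dsol_def E_nz field_simps)
qed

text \<open>Multiplication by the integrating factor makes a solution constant along the curves.\<close>

lemma transport_damped_unique:
  assumes p: "cont p" and w: "transport F w (\<lambda>x t. - p x t * w x t)" and e: "e \<in> {0..1}" and x: "x \<in> {0..1}"
    and 0: "\<And>t. w e t = 0"
  shows "w x t = 0"
proof -
  have "transport F (\<lambda>x t. E p x t * w x t) (\<lambda>x t. 0)"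
    by (rule transport_cong[OF transport_mult[OF transport_E[OF p] w]]) (auto simp: algebra_simps)
  from transport_repr[OF this e x, of t] show ?thesis by (simp add: 0 ig_def E_nz)
qed

lemma dsol_unique:
  assumes p: "cont p" and f: "cont f" and e: "e \<in> {0..1}" and x: "x \<in> {0..1}"
    and u: "transport F u (\<lambda>x t. f x t - p x t * u x t)"
  shows "u x t = dsol p e (u e) f x t"
proof -
  have "transport F (\<lambda>x t. u x t - dsol p e (u e) f x t) (\<lambda>x t. - p x t * (u x t - dsol p e (u e) f x t))"
    by (rule transport_cong[OF transport_diff[OF u transport_dsol[OF p f e]]]) (auto simp: algebra_simps)
  from transport_damped_unique[OF p this e x, of t] show ?thesis by (simp add: dsol_entry[OF e])
qed

text \<open>The weight of the damped solution written as in the definition of \<open>c_coef\<close>; it is a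
  quotient of two values of the integrating factor.\<close>

definition cw where "cw p \<xi> x t = exp (ig (\<lambda>\<eta>. p \<eta> (\<tau> \<eta> x t)) x \<xi>)"

lemma cw_E:
  assumes p: "cont p" and x: "x \<in> {0..1}" and \<xi>: "\<xi> \<in> {0..1}"
  shows "cw p \<xi> x t = E p \<xi> (\<tau> \<xi> x t) / E p x t"
proof -
  let ?g = "\<lambda>\<eta>. p \<eta> (\<tau> \<eta> x t)"
  have 1: "E p \<xi> (\<tau> \<xi> x t) = exp (ig ?g 0 \<xi>)"
    using sol_on_curve[OF flow_curve[OF x] _ \<xi>, of 0 "\<lambda>_. 0" p t] by (simp add: E_def)
  have 2: "E p x t = exp (ig ?g 0 x)" by (simp add: E_def sol_def)
  have "ig ?g 0 x + ig ?g x \<xi> = ig ?g 0 \<xi>"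
    by (rule ig_split[OF cont_along[OF p x]]) (use x \<xi> in auto)
  then show ?thesis unfolding cw_def 1 2 by (simp add: exp_diff[symmetric])
qed

lemma dsol_cw:
  assumes p: "cont p" and x: "x \<in> {0..1}" and e: "e \<in> {0..1}"
  shows "dsol p e z f x t = cw p e x t * z (\<tau> e x t) + ig (\<lambda>\<xi>. cw p \<xi> x t * f \<xi> (\<tau> \<xi> x t)) e x"
proof -
  have "ig (\<lambda>\<xi>. cw p \<xi> x t * f \<xi> (\<tau> \<xi> x t)) e x
      = ig (\<lambda>\<xi>. inverse (E p x t) * (E p \<xi> (\<tau> \<xi> x t) * f \<xi> (\<tau> \<xi> x t))) e x"
    by (rule ig_cong[OF e x]) (simp add: cw_E[OF p x] divide_inverse)
  also have "\<dots> = ig (\<lambda>\<xi>. E p \<xi> (\<tau> \<xi> x t) * f \<xi> (\<tau> \<xi> x t)) e x / E p x t"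
    by (simp only: ig_cmult divide_inverse mult.commute)
  finally show ?thesis by (simp add: dsol_def sol_def cw_E[OF p x e] add_divide_distrib)
qed

lemma t_deriv_dsol:
  assumes p: "t_deriv p pt" and f: "t_deriv f ft" and z: "\<And>t. (z has_real_derivative z' t) (at t)"
    and z': "continuous_on UNIV z'" and e: "e \<in> {0..1}"
  shows "\<exists>w. t_deriv (dsol p e z f) w"
proof -
  obtain Et where Et: "t_deriv (E p) Et" using t_deriv_E[OF p] by blast
  have zc: "continuous_on UNIV z" using z by (meson DERIV_isCont continuous_at_imp_continuous_on)
  have "((\<lambda>t. E p e t * z t) has_real_derivative Et e t * z t + z' t * E p e t) (at t)" for t
    by (rule DERIV_mult[OF t_derivD(3)[OF Et e] z])
  moreover have "continuous_on UNIV (\<lambda>t. Et e t * z t + z' t * E p e t)"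
    by (intro continuous_on_add continuous_on_mult zc z' cont_time[OF _ e] t_derivD[OF Et])
  ultimately obtain w where "t_deriv (sol e (\<lambda>t. E p e t * z t) (\<lambda>x t. E p x t * f x t)) w"
    using t_deriv_sol[OF t_deriv_mult[OF Et f], of "\<lambda>t. E p e t * z t" "\<lambda>t. Et e t * z t + z' t * E p e t" e] e by blast
  from t_deriv_divide[OF this Et] show ?thesis unfolding dsol_def[abs_def] by (auto simp: E_nz)
qed

lemma flow_range: "x \<in> {0..1} \<Longrightarrow> \<xi> \<in> {0..1} \<Longrightarrow> \<bar>\<tau> \<xi> x t - t\<bar> \<le> M"
proof -
  assume x: "x \<in> {0..1}" and \<xi>: "\<xi> \<in> {0..1::real}"
  have "M * \<bar>\<xi> - x\<bar> \<le> M" using x \<xi> M(1) by (intro mult_left_le) auto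
  then show ?thesis using curve_lipschitz[OF flow_curve[OF x] \<xi> x, of t] by (simp add: flow_self[OF x])
qed

text \<open>The bound is local in time because \<open>h\<close> is not assumed to be periodic; curves move by at
  most \<open>M\<close>.\<close>

lemma bound_along_flow:
  assumes h: "cont h"
  shows "\<exists>C\<ge>0. \<forall>x\<in>{0..1}. \<forall>\<xi>\<in>{0..1}. \<forall>t. \<bar>t\<bar> \<le> K \<longrightarrow> \<bar>h \<xi> (\<tau> \<xi> x t)\<bar> \<le> C"
proof -
  have "compact ((\<lambda>(x, t). h x t) ` ({0..1} \<times> {-(K + M)..K + M}))"
    by (intro compact_continuous_image continuous_on_subset[OF h] compact_Times) auto
  then obtain B where B: "\<And>y. y \<in> (\<lambda>(x, t). h x t) ` ({0..1} \<times> {-(K + M)..K + M}) \<Longrightarrow> norm y \<le> B"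
    using compact_imp_bounded bounded_iff by metis
  have "\<bar>h \<xi> (\<tau> \<xi> x t)\<bar> \<le> max B 0" if "x \<in> {0..1}" "\<xi> \<in> {0..1}" "\<bar>t\<bar> \<le> K" for x \<xi> t
  proof -
    have "\<tau> \<xi> x t \<in> {-(K + M)..K + M}" using flow_range[OF that(1,2), of t] that(3) by auto
    then have "norm (h \<xi> (\<tau> \<xi> x t)) \<le> B" using that by (intro B image_eqI[of _ _ "(\<xi>, \<tau> \<xi> x t)"]) auto
    then show ?thesis by simp
  qed
  then show ?thesis by (intro exI[of _ "max B 0"]) auto
qed

section \<open>Approximation by functions differentiable in time\<close>

text \<open>Averaging over the labels of the curves commutes with the derivative along the curves.\<close>

definition avg where "avg \<delta> v x t = integral {0..1} (\<lambda>\<theta>. v x (\<tau> x 0 (\<tau> 0 x t + \<delta> * \<theta>)))"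

lemma avg_cont_aux:
  assumes v: "cont v"
  shows "continuous_on (strip \<times> cbox 0 1) (\<lambda>(p, \<theta>). v (fst p) (\<tau> (fst p) 0 (\<tau> 0 (fst p) (snd p) + \<delta> * \<theta>)))"
  unfolding case_prod_unfold
  by (intro cont_flow_comp[OF v] continuous_on_add flow_comp) (auto intro!: continuous_intros)

lemma cont_avg: "cont v \<Longrightarrow> cont (avg \<delta> v)"
  using integral_continuous_on_param[OF avg_cont_aux, of v \<delta>]
  by (simp add: avg_def[abs_def] case_prod_unfold)

lemma avg_near:
  assumes v: "cont v" and x: "x \<in> {0..1}" and \<delta>: "\<delta> \<ge> 0"
    and near: "\<And>s s'. \<bar>s - s'\<bar> \<le> exp L * \<delta> \<Longrightarrow> \<bar>v x s - v x s'\<bar> \<le> \<epsilon>"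
  shows "\<bar>avg \<delta> v x t - v x t\<bar> \<le> \<epsilon>"
proof -
  let ?f = "\<lambda>\<theta>. v x (\<tau> x 0 (\<tau> 0 x t + \<delta> * \<theta>))"
  have c: "continuous_on {0..1} ?f"
    by (intro cont_flow_comp[OF v]) (use x in \<open>auto intro!: continuous_intros\<close>)
  have "norm (integral {0..1} (\<lambda>\<theta>. ?f \<theta> - v x t)) \<le> \<epsilon> * (1 - 0)"
  proof (rule integral_bound)
    fix \<theta> :: real assume \<theta>: "\<theta> \<in> {0..1}"
    have "\<bar>\<tau> x 0 (\<tau> 0 x t + \<delta> * \<theta>) - \<tau> x 0 (\<tau> 0 x t)\<bar> \<le> exp L * \<bar>(\<tau> 0 x t + \<delta> * \<theta>) - \<tau> 0 x t\<bar>"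
      by (rule flow_lipschitz_t) (use x in auto)
    also have "\<dots> \<le> exp L * \<delta>" using \<theta> \<delta> by (auto simp: abs_mult mult_left_le)
    finally have "\<bar>\<tau> x 0 (\<tau> 0 x t + \<delta> * \<theta>) - t\<bar> \<le> exp L * \<delta>"
      using flow_flow[of x 0 x t] flow_self[OF x] x by simp
    from near[OF this] show "norm (?f \<theta> - v x t) \<le> \<epsilon>" by simp
  qed (use c in \<open>auto intro: continuous_intros\<close>)
  also have "integral {0..1} (\<lambda>\<theta>. ?f \<theta> - v x t) = avg \<delta> v x t - v x t"
    by (subst integral_diff) (auto simp: avg_def intro: integrable_continuous_real[OF c])
  finally show ?thesis by simp
qed

lemma transport_avg:
  assumes v: "cont v" and g: "cont g" and tr: "transport F v g"
  shows "transport F (avg \<delta> v) (avg \<delta> g)"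
proof (rule transportI)
  fix \<phi> \<xi> assume \<phi>: "curve F \<phi>" and \<xi>: "\<xi> \<in> {0..1::real}"
  have lab: "\<tau> 0 \<xi> (\<phi> \<xi>) = \<phi> 0" if "\<xi> \<in> {0..1}" for \<xi> by (rule flow_eq[OF \<phi> that]) auto
  let ?s = "\<phi> 0"
  have cg: "continuous_on ({0..1} \<times> cbox 0 1) (\<lambda>(\<xi>, \<theta>). h \<xi> (\<tau> \<xi> 0 (?s + \<delta> * \<theta>)))" if "cont h" for h
    unfolding case_prod_unfold by (intro cont_flow_comp[OF that]) (auto intro!: continuous_intros)
  have "((\<lambda>\<xi>. integral (cbox 0 1) (\<lambda>\<theta>. v \<xi> (\<tau> \<xi> 0 (?s + \<delta> * \<theta>)))) has_real_derivative
      integral (cbox 0 1) (\<lambda>\<theta>. g \<xi> (\<tau> \<xi> 0 (?s + \<delta> * \<theta>)))) (at \<xi> within {0..1})"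
  proof (rule leibniz_rule_field_derivative[OF _ _ cg[OF g] \<xi>])
    show "((\<lambda>\<xi>. v \<xi> (\<tau> \<xi> 0 (?s + \<delta> * \<theta>))) has_real_derivative g \<xi> (\<tau> \<xi> 0 (?s + \<delta> * \<theta>))) (at \<xi> within {0..1})"
      if "\<xi> \<in> {0..1}" for \<xi> \<theta> by (rule transport_along[OF tr _ that]) auto
    show "(\<lambda>\<theta>. v \<xi> (\<tau> \<xi> 0 (?s + \<delta> * \<theta>))) integrable_on cbox 0 1" if "\<xi> \<in> {0..1}" for \<xi>
      by (intro integrable_continuous cont_flow_comp[OF v]) (use that in \<open>auto intro!: continuous_intros\<close>)
  qed auto
  then have "((\<lambda>\<xi>. integral {0..1} (\<lambda>\<theta>. v \<xi> (\<tau> \<xi> 0 (?s + \<delta> * \<theta>)))) has_real_derivative avg \<delta> g \<xi> (\<phi> \<xi>)) (at \<xi> within {0..1})"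
    by (simp add: avg_def lab[OF \<xi>])
  then show "((\<lambda>\<xi>. avg \<delta> v \<xi> (\<phi> \<xi>)) has_real_derivative avg \<delta> g \<xi> (\<phi> \<xi>)) (at \<xi> within {0..1})"
    by (rule has_field_derivative_transform_within[where d = 1]) (use \<xi> lab in \<open>auto simp: avg_def\<close>)
qed

lemma t_deriv_avg:
  assumes v: "cont v" and \<delta>: "\<delta> > 0"
  shows "t_deriv (avg \<delta> v) (\<lambda>x t. (v x (\<tau> x 0 (\<tau> 0 x t + \<delta>)) - v x (\<tau> x 0 (\<tau> 0 x t))) / \<delta> * TT 0 x t)"
proof (rule t_derivI)
  show "cont (avg \<delta> v)" by (rule cont_avg[OF v])
  show "cont (\<lambda>x t. (v x (\<tau> x 0 (\<tau> 0 x t + \<delta>)) - v x (\<tau> x 0 (\<tau> 0 x t))) / \<delta> * TT 0 x t)"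
    unfolding case_prod_unfold
    by (intro continuous_on_mult continuous_on_divide continuous_on_diff cont_flow_comp[OF v] TT_comp continuous_on_add flow_comp)
      (use \<delta> in \<open>auto intro!: continuous_intros\<close>)
  fix x t :: real assume x: "x \<in> {0..1}"
  define y where "y s = v x (\<tau> x 0 s)" for s
  have y: "continuous_on UNIV y" unfolding y_def
    by (intro cont_flow_comp[OF v]) (use x in \<open>auto intro!: continuous_intros\<close>)
  define A where "A s = ig y 0 s" for s
  have A: "(A has_real_derivative y s) (at s)" for s unfolding A_def by (rule ig_deriv_UNIV[OF y])
  have "((\<lambda>s. (A (s + \<delta>) - A s) / \<delta>) has_real_derivative (y (s + \<delta>) * 1 - y s) / \<delta>) (at s)" for s
    by (intro DERIV_cdivide DERIV_diff DERIV_chain2[OF A] A) (auto intro!: derivative_eq_intros)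
  from DERIV_chain2[OF this flow_deriv_t[OF x, of 0 t]]
  have "((\<lambda>t. (A (\<tau> 0 x t + \<delta>) - A (\<tau> 0 x t)) / \<delta>) has_real_derivative
     (y (\<tau> 0 x t + \<delta>) * 1 - y (\<tau> 0 x t)) / \<delta> * TT 0 x t) (at t)" by simp
  moreover have "(A (s + \<delta>) - A s) / \<delta> = integral {0..1} (\<lambda>\<theta>. y (s + \<delta> * \<theta>))" for s
    using ig_FTC[of UNIV s "s + \<delta>" A y] A \<delta> by (simp add: ig_def field_simps)
  ultimately show "((\<lambda>t. avg \<delta> v x t) has_real_derivative
      (v x (\<tau> x 0 (\<tau> 0 x t + \<delta>)) - v x (\<tau> x 0 (\<tau> 0 x t))) / \<delta> * TT 0 x t) (at t)"
    by (simp add: avg_def y_def)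
qed

text \<open>Averages over short shifts of the labels at \<open>x = 0\<close> are differentiable in time, and
  periodicity makes their convergence uniform.\<close>

lemma approx_by_t_deriv:
  assumes v: "cont v" "periodic_strip v" and g: "cont g" "periodic_strip g" and tr: "transport F v g" and \<epsilon>: "\<epsilon> > 0"
  shows "\<exists>v' vt' g'. t_deriv v' vt' \<and> cont g' \<and> transport F v' g' \<and>
    (\<forall>x\<in>{0..1}. \<forall>t. \<bar>v' x t - v x t\<bar> \<le> \<epsilon> \<and> \<bar>g' x t - g x t\<bar> \<le> \<epsilon>)"
proof -
  obtain d1 where d1: "d1 > 0" "\<And>x s t. x \<in> {0..1} \<Longrightarrow> \<bar>s - t\<bar> < d1 \<Longrightarrow> \<bar>v x s - v x t\<bar> < \<epsilon>"
    using periodic_unif_cont[OF v \<epsilon>] by blast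
  obtain d2 where d2: "d2 > 0" "\<And>x s t. x \<in> {0..1} \<Longrightarrow> \<bar>s - t\<bar> < d2 \<Longrightarrow> \<bar>g x s - g x t\<bar> < \<epsilon>"
    using periodic_unif_cont[OF g \<epsilon>] by blast
  define \<delta> where "\<delta> = min d1 d2 / 2 / exp L"
  have \<delta>: "\<delta> > 0" "exp L * \<delta> < d1" "exp L * \<delta> < d2" using d1(1) d2(1) by (auto simp: \<delta>_def)
  have "\<bar>avg \<delta> v x t - v x t\<bar> \<le> \<epsilon> \<and> \<bar>avg \<delta> g x t - g x t\<bar> \<le> \<epsilon>" if x: "x \<in> {0..1}" for x t
  proof (intro conjI avg_near v(1) g(1) x)
    show "\<bar>v x s - v x s'\<bar> \<le> \<epsilon>" if "\<bar>s - s'\<bar> \<le> exp L * \<delta>" for s s'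
      using d1(2)[OF x, of s s'] that \<delta>(2) by linarith
    show "\<bar>g x s - g x s'\<bar> \<le> \<epsilon>" if "\<bar>s - s'\<bar> \<le> exp L * \<delta>" for s s'
      using d2(2)[OF x, of s s'] that \<delta>(3) by linarith
  qed (use \<delta>(1) in simp_all)
  then show ?thesis
    using t_deriv_avg[OF v(1) \<delta>(1)] cont_avg[OF g(1)] transport_avg[OF v(1) g(1) tr] by blast
qed

end

text \<open>Choosing approximations for a null sequence of errors reduces this to the theorem on
  uniform convergence of derivatives.\<close>

lemma deriv_unif_limit_on:
  fixes W Z :: "real \<Rightarrow> real"
  assumes S: "open S" "convex S" "s \<in> S" and
    ap: "\<And>\<epsilon>. \<epsilon> > 0 \<Longrightarrow> \<exists>w z. \<forall>s\<in>S. (w has_real_derivative z s) (at s) \<and> \<bar>w s - W s\<bar> \<le> \<epsilon> \<and> \<bar>z s - Z s\<bar> \<le> \<epsilon>"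
  shows "(W has_real_derivative Z s) (at s)"
proof -
  have "\<forall>n. \<exists>w z. \<forall>s\<in>S. (w has_real_derivative z s) (at s) \<and>
      \<bar>w s - W s\<bar> \<le> 1 / real (Suc n) \<and> \<bar>z s - Z s\<bar> \<le> 1 / real (Suc n)"
    by (intro allI ap) auto
  then obtain w z where wz: "\<And>n s. s \<in> S \<Longrightarrow> (w n has_real_derivative z n s) (at s)"
    "\<And>n s. s \<in> S \<Longrightarrow> \<bar>w n s - W s\<bar> \<le> 1 / real (Suc n)" "\<And>n s. s \<in> S \<Longrightarrow> \<bar>z n s - Z s\<bar> \<le> 1 / real (Suc n)"
    by metis
  have lim: "(\<lambda>n. w n s) \<longlonglongrightarrow> W s" if "s \<in> S" for s
  proof (rule LIM_zero_cancel, rule Lim_null_comparison)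
    show "\<forall>\<^sub>F n in sequentially. norm (w n s - W s) \<le> 1 / real (Suc n)" using wz(2)[OF that] by auto
    show "(\<lambda>n. 1 / real (Suc n)) \<longlonglongrightarrow> 0" by (rule LIMSEQ_inverse_real_of_nat[unfolded inverse_eq_divide])
  qed
  have "\<exists>g. \<forall>x\<in>S. (\<lambda>n. w n x) \<longlonglongrightarrow> g x \<and> (g has_derivative (\<lambda>h. Z x * h)) (at x within S)"
  proof (rule has_derivative_sequence[where f = w and f' = "\<lambda>n x h. z n x * h" and g' = "\<lambda>x h. Z x * h",
        OF S(2) _ _ S(3) lim[OF S(3)]])
    show "(w n has_derivative (\<lambda>h. z n x * h)) (at x within S)" if "x \<in> S" for n x
      using wz(1)[OF that, of n] by (simp add: has_field_derivative_def has_derivative_at_withinI)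
    fix e :: real assume "e > 0"
    then obtain N where N: "1 / real (Suc N) < e" by (metis nat_approx_posE)
    have "\<bar>z n x - Z x\<bar> \<le> e" if "n \<ge> N" "x \<in> S" for n x
    proof -
      have "1 / real (Suc n) \<le> 1 / real (Suc N)" using that by (simp add: frac_le)
      then show ?thesis using wz(3)[OF that(2), of n] N by linarith
    qed
    then show "\<forall>\<^sub>F n in sequentially. \<forall>x\<in>S. \<forall>h. norm (z n x * h - Z x * h) \<le> e * norm h"
      unfolding eventually_sequentially
      by (intro exI[of _ N] allI impI ballI) (auto simp: left_diff_distrib[symmetric] abs_mult mult_right_mono)
  qed
  then obtain g where g: "\<And>x. x \<in> S \<Longrightarrow> (\<lambda>n. w n x) \<longlonglongrightarrow> g x"
    "\<And>x. x \<in> S \<Longrightarrow> (g has_derivative (\<lambda>h. Z x * h)) (at x within S)" by auto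
  have "(g has_real_derivative Z s) (at s)"
    using g(2)[OF S(3)] at_within_open[OF S(3,1)] by (simp add: has_field_derivative_def)
  then show ?thesis
    by (rule has_field_derivative_transform_within_open[OF _ S(1,3)]) (use LIMSEQ_unique[OF g(1) lim] in auto)
qed

section \<open>The smoothing effect of integration along a second family of curves\<close>

locale two_slopes = F: slope F Ft + G: slope G Gt for F Ft G Gt
begin

text \<open>For a function differentiable in time the derivatives along two families of curves differ by
  the time derivative times the difference of the slopes.\<close>

lemma transport_change_slope:
  assumes v: "t_deriv v vt" and tr: "transport G v g"
  shows "transport F v (\<lambda>x t. g x t + (F x t - G x t) * vt x t)"
proof (rule transportI)
  fix \<phi> x assume \<phi>: "curve F \<phi>" and x: "x \<in> {0..1::real}"
  define \<psi> where "\<psi> \<xi> = flow G \<xi> x (\<phi> x)" for \<xi>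
  have \<psi>: "curve G \<psi>" "\<psi> x = \<phi> x"
    using G.flow_curve[OF x] G.flow_self[OF x] by (auto simp: \<psi>_def[abs_def])
  define \<kappa> where "\<kappa> \<xi> = integral {0..1} (\<lambda>\<theta>. vt \<xi> (\<psi> \<xi> + (\<phi> \<xi> - \<psi> \<xi>) * \<theta>))" for \<xi>
  have diff: "v \<xi> (\<phi> \<xi>) - v \<xi> (\<psi> \<xi>) = (\<phi> \<xi> - \<psi> \<xi>) * \<kappa> \<xi>" if "\<xi> \<in> {0..1}" for \<xi>
    using ig_FTC[of UNIV "\<psi> \<xi>" "\<phi> \<xi>" "v \<xi>" "vt \<xi>"] t_derivD(3)[OF v that] by (simp add: ig_def \<kappa>_def)
  have \<phi>c: "continuous_on {0..1} \<phi>" and \<psi>c: "continuous_on {0..1} \<psi>"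
    by (rule F.curve_continuous[OF \<phi>] G.curve_continuous[OF \<psi>(1)])+
  have "continuous_on ({0..1} \<times> cbox 0 1) (\<lambda>(\<xi>, \<theta>). vt \<xi> (\<psi> \<xi> + (\<phi> \<xi> - \<psi> \<xi>) * \<theta>))"
    unfolding case_prod_unfold
    by (rule cont_comp[OF t_derivD(2)[OF v]])
      (auto intro!: continuous_intros continuous_on_compose2[OF \<phi>c] continuous_on_compose2[OF \<psi>c])
  from integral_continuous_on_param[OF this] have "continuous_on {0..1} \<kappa>" by (simp add: \<kappa>_def[abs_def])
  then have \<kappa>: "(\<kappa> \<longlongrightarrow> \<kappa> x) (at x within {0..1})" using x by (simp add: continuous_on)
  have "((\<lambda>\<xi>. \<phi> \<xi> - \<psi> \<xi>) has_real_derivative F x (\<phi> x) - G x (\<phi> x)) (at x within {0..1})"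
    using DERIV_diff[OF F.curveD[OF \<phi> x] G.curveD[OF \<psi>(1) x]] \<psi>(2) by simp
  then have "((\<lambda>\<xi>. (\<phi> \<xi> - \<psi> \<xi>) / (\<xi> - x)) \<longlongrightarrow> F x (\<phi> x) - G x (\<phi> x)) (at x within {0..1})"
    by (simp add: has_field_derivative_iff \<psi>(2))
  from tendsto_mult[OF this \<kappa>]
  have "((\<lambda>\<xi>. (\<phi> \<xi> - \<psi> \<xi>) * \<kappa> \<xi>) has_real_derivative (F x (\<phi> x) - G x (\<phi> x)) * \<kappa> x) (at x within {0..1})"
    by (simp add: has_field_derivative_iff \<psi>(2))
  moreover have "\<kappa> x = vt x (\<phi> x)" by (simp add: \<kappa>_def \<psi>(2))
  ultimately have "((\<lambda>\<xi>. v \<xi> (\<psi> \<xi>) + (\<phi> \<xi> - \<psi> \<xi>) * \<kappa> \<xi>) has_real_derivative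
      g x (\<psi> x) + (F x (\<phi> x) - G x (\<phi> x)) * vt x (\<phi> x)) (at x within {0..1})"
    by (intro DERIV_add transportD[OF tr \<psi>(1) x]) simp
  then have "((\<lambda>\<xi>. v \<xi> (\<psi> \<xi>) + (\<phi> \<xi> - \<psi> \<xi>) * \<kappa> \<xi>) has_real_derivative
      g x (\<phi> x) + (F x (\<phi> x) - G x (\<phi> x)) * vt x (\<phi> x)) (at x within {0..1})" by (simp add: \<psi>(2))
  then show "((\<lambda>\<xi>. v \<xi> (\<phi> \<xi>)) has_real_derivative g x (\<phi> x) + (F x (\<phi> x) - G x (\<phi> x)) * vt x (\<phi> x)) (at x within {0..1})"
  proof (rule has_field_derivative_transform_within[where d = 1])
    show "v \<xi> (\<psi> \<xi>) + (\<phi> \<xi> - \<psi> \<xi>) * \<kappa> \<xi> = v \<xi> (\<phi> \<xi>)" if "\<xi> \<in> {0..1}" for \<xi>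
      using diff[OF that] by linarith
  qed (use x in auto)
qed

end

lemma slope_zero: "slope (\<lambda>_ _. 0) (\<lambda>_ _. 0)"
  by standard (auto simp: t_deriv_def periodic_strip_def cont_const)

lemma curve_const: "curve (\<lambda>_ _. 0) (\<lambda>_. t)"
  by (simp add: curve_def)

context slope
begin

text \<open>The lines on which \<open>t\<close> is constant are the curves of slope \<open>0\<close>; partial derivatives in \<open>x\<close>
  are thus derivatives along one more family of curves.\<close>

lemma transport_of_partials:
  assumes v: "t_deriv v vt"
    and vx: "\<And>x t. x \<in> {0..1} \<Longrightarrow> ((\<lambda>y. v y t) has_real_derivative vx x t) (at x within {0..1})"
  shows "transport F v (\<lambda>x t. vx x t + F x t * vt x t)"
proof -
  interpret Z: slope "\<lambda>_ _. 0" "\<lambda>_ _. 0" by (rule slope_zero)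
  interpret two_slopes F Ft "\<lambda>_ _. 0" "\<lambda>_ _. 0" ..
  have "transport (\<lambda>_ _. 0) v vx"
  proof (rule transportI)
    fix \<phi> \<xi> assume \<phi>: "curve (\<lambda>_ _. 0) \<phi>" and \<xi>: "\<xi> \<in> {0..1::real}"
    have const: "\<phi> \<eta> = \<phi> \<xi>" if "\<eta> \<in> {0..1}" for \<eta>
      using unit_deriv_zero_const[of \<phi> \<eta> \<xi>] \<phi> that \<xi> by (simp add: curve_def)
    show "((\<lambda>\<xi>. v \<xi> (\<phi> \<xi>)) has_real_derivative vx \<xi> (\<phi> \<xi>)) (at \<xi> within {0..1})"
    proof (rule has_field_derivative_transform_within[OF vx[OF \<xi>], where d = 1])
      show "v \<eta> (\<phi> \<xi>) = v \<eta> (\<phi> \<eta>)" if "\<eta> \<in> {0..1}" for \<eta> using const[OF that] by simp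
    qed (use \<xi> in auto)
  qed
  from transport_change_slope[OF v this] show ?thesis by simp
qed

lemma x_deriv_of_transport:
  assumes v: "t_deriv v vt" and tr: "transport F v g" and x: "x \<in> {0..1}"
  shows "((\<lambda>y. v y t) has_real_derivative g x t - F x t * vt x t) (at x within {0..1})"
proof -
  interpret Z: slope "\<lambda>_ _. 0" "\<lambda>_ _. 0" by (rule slope_zero)
  interpret two_slopes "\<lambda>_ _. 0" "\<lambda>_ _. 0" F Ft ..
  show ?thesis using transportD[OF transport_change_slope[OF v tr] curve_const x, of t] by simp
qed

end

context two_slopes
begin

text \<open>The time derivative of the integral of \<open>\<beta> (F - G) v\<close> along the \<open>F\<close>-curves, expressed by \<open>v\<close> and
  its derivative \<open>g\<close> along the \<open>G\<close>-curves. If \<open>v\<close> is differentiable in time, then \<open>(F - G) \<partial>\<^sub>t v\<close> is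
  the derivative of \<open>v\<close> along \<open>F\<close>-curves minus \<open>g\<close>, and integration by parts removes the former.\<close>

definition Zop where
  "Zop \<beta> \<beta>t \<beta>F e v g x t = \<beta> x t * v x t - F.TT e x t * (\<beta> e (flow F e x t) * v e (flow F e x t))
    + ig (\<lambda>\<xi>. (\<lambda>x t. (\<beta>t x t * (F x t - G x t) + (Ft x t - Gt x t) * \<beta> x t - (Ft x t * \<beta> x t + \<beta>F x t)) * v x t
        - \<beta> x t * g x t) \<xi> (flow F \<xi> x t) * F.TT \<xi> x t) e x"

abbreviation Wop where
  "Wop \<beta> e v x t \<equiv> ig (\<lambda>\<xi>. \<beta> \<xi> (flow F \<xi> x t) * (F \<xi> (flow F \<xi> x t) - G \<xi> (flow F \<xi> x t)) * v \<xi> (flow F \<xi> x t)) e x"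

context
  fixes \<beta> \<beta>t \<beta>F e
  assumes \<beta>: "t_deriv \<beta> \<beta>t" "transport F \<beta> \<beta>F" "cont \<beta>F" and e: "e \<in> {0..1::real}"
begin

abbreviation (input) Zo where "Zo \<equiv> Zop \<beta> \<beta>t \<beta>F e"

text \<open>The factor of \<open>v\<close> that is left after the integration by parts.\<close>

definition k1 where "k1 x t = \<beta>t x t * (F x t - G x t) + (Ft x t - Gt x t) * \<beta> x t - (Ft x t * \<beta> x t + \<beta>F x t)"

lemma Zop_k1: "Zo v g x t = \<beta> x t * v x t - F.TT e x t * (\<beta> e (flow F e x t) * v e (flow F e x t))
    + ig (\<lambda>\<xi>. (\<lambda>x t. k1 x t * v x t - \<beta> x t * g x t) \<xi> (flow F \<xi> x t) * F.TT \<xi> x t) e x"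
  by (simp only: Zop_def k1_def)

lemma t_deriv_q: "t_deriv (\<lambda>x t. \<beta> x t * (F x t - G x t)) (\<lambda>x t. \<beta>t x t * (F x t - G x t) + (Ft x t - Gt x t) * \<beta> x t)"
  by (intro t_deriv_mult t_deriv_diff \<beta> F.F_t G.F_t)

lemma cont_k1: "cont k1"
  unfolding k1_def[abs_def]
  by (intro cont_diff cont_add cont_mult \<beta>(3) t_derivD[OF \<beta>(1)] F.contF F.contFt G.contF G.contFt)

lemma cont_kernel: "cont v \<Longrightarrow> cont g \<Longrightarrow> cont (\<lambda>x t. k1 x t * v x t - \<beta> x t * g x t)"
  by (intro cont_diff cont_mult cont_k1 t_derivD[OF \<beta>(1)])

lemma continuous_kernel:
  assumes "cont v" "cont g" "x \<in> {0..1}"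
  shows "continuous_on {0..1} (\<lambda>\<xi>. (\<lambda>x t. k1 x t * v x t - \<beta> x t * g x t) \<xi> (flow F \<xi> x t) * F.TT \<xi> x t)"
  by (intro continuous_on_mult F.cont_along[OF cont_kernel] F.TT_comp) (use assms in \<open>auto intro: continuous_intros\<close>)

lemma cont_Zop:
  assumes v: "cont v" and g: "cont g"
  shows "cont (Zo v g)"
proof -
  have 1: "cont (\<lambda>x t. \<beta> x t * v x t)" by (intro cont_mult t_derivD[OF \<beta>(1)] v)
  have "cont (\<lambda>x t. F.TT e x t * (\<beta> e (flow F e x t) * v e (flow F e x t)))"
    unfolding case_prod_unfold
    by (intro continuous_on_mult F.TT_comp F.cont_flow_comp[OF t_derivD(1)[OF \<beta>(1)]] F.cont_flow_comp[OF v])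
      (use e in \<open>auto intro: continuous_intros\<close>)
  from cont_add[OF cont_diff[OF 1 this] F.cont_ig_TT[OF cont_kernel[OF v g] e]]
  show ?thesis by (simp add: Zop_k1[abs_def])
qed

lemma Zop_diff:
  assumes "cont v" "cont g" "cont v'" "cont g'" and x: "x \<in> {0..1}"
  shows "Zo v' g' x t - Zo v g x t = Zo (\<lambda>x t. v' x t - v x t) (\<lambda>x t. g' x t - g x t) x t"
proof -
  have "ig (\<lambda>\<xi>. (\<lambda>x t. k1 x t * (v' x t - v x t) - \<beta> x t * (g' x t - g x t)) \<xi> (flow F \<xi> x t) * F.TT \<xi> x t) e x
    = ig (\<lambda>\<xi>. (\<lambda>x t. k1 x t * v' x t - \<beta> x t * g' x t) \<xi> (flow F \<xi> x t) * F.TT \<xi> x t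
        - (\<lambda>x t. k1 x t * v x t - \<beta> x t * g x t) \<xi> (flow F \<xi> x t) * F.TT \<xi> x t) e x"
    by (rule ig_cong[OF e x]) (simp add: algebra_simps)
  also have "\<dots> = ig (\<lambda>\<xi>. (\<lambda>x t. k1 x t * v' x t - \<beta> x t * g' x t) \<xi> (flow F \<xi> x t) * F.TT \<xi> x t) e x
      - ig (\<lambda>\<xi>. (\<lambda>x t. k1 x t * v x t - \<beta> x t * g x t) \<xi> (flow F \<xi> x t) * F.TT \<xi> x t) e x"
    by (intro ig_diff continuous_kernel assms e)
  finally show ?thesis by (simp add: Zop_k1 algebra_simps)
qed

lemma Zop_bound:
  "\<exists>C\<ge>0. \<forall>v g A. cont v \<longrightarrow> cont g \<longrightarrow> (\<forall>x\<in>{0..1}. \<forall>t. \<bar>v x t\<bar> \<le> A \<and> \<bar>g x t\<bar> \<le> A) \<longrightarrow>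
     (\<forall>x\<in>{0..1}. \<forall>t. \<bar>t\<bar> \<le> K \<longrightarrow> \<bar>Zo v g x t\<bar> \<le> C * A)"
proof -
  obtain B1 where B1: "B1 \<ge> 0" "\<And>x \<xi> t. x \<in> {0..1} \<Longrightarrow> \<xi> \<in> {0..1} \<Longrightarrow> \<bar>t\<bar> \<le> K \<Longrightarrow> \<bar>\<beta> \<xi> (flow F \<xi> x t)\<bar> \<le> B1"
    using F.bound_along_flow[OF t_derivD(1)[OF \<beta>(1)], of K] by blast
  obtain B2 where B2: "B2 \<ge> 0" "\<And>x \<xi> t. x \<in> {0..1} \<Longrightarrow> \<xi> \<in> {0..1} \<Longrightarrow> \<bar>t\<bar> \<le> K \<Longrightarrow> \<bar>k1 \<xi> (flow F \<xi> x t)\<bar> \<le> B2"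
    using F.bound_along_flow[OF cont_k1, of K] by blast
  have "\<bar>Zo v g x t\<bar> \<le> (B1 + exp F.L * B1 + (B2 + B1) * exp F.L) * A"
    if vg: "cont v" "cont g" and A: "\<forall>x\<in>{0..1}. \<forall>t. \<bar>v x t\<bar> \<le> A \<and> \<bar>g x t\<bar> \<le> A"
      and x: "x \<in> {0..1}" and t: "\<bar>t\<bar> \<le> K" for v g A x t
  proof -
    have 1: "\<bar>\<beta> x t * v x t\<bar> \<le> B1 * A"
      using B1(2)[OF x x t] A x by (auto simp: abs_mult F.flow_self[OF x] intro!: mult_mono B1(1))
    have 2: "\<bar>F.TT e x t * (\<beta> e (flow F e x t) * v e (flow F e x t))\<bar> \<le> exp F.L * (B1 * A)"
      unfolding abs_mult using A e B1(1) by (intro mult_mono F.TT_bound B1(2) x t) auto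
    have 3: "\<bar>ig (\<lambda>\<xi>. (\<lambda>x t. k1 x t * v x t - \<beta> x t * g x t) \<xi> (flow F \<xi> x t) * F.TT \<xi> x t) e x\<bar> \<le> (B2 * A + B1 * A) * exp F.L"
    proof (rule ig_bound1[OF continuous_kernel[OF vg x] e x])
      fix \<xi> :: real assume \<xi>: "\<xi> \<in> {0..1}"
      let ?s = "flow F \<xi> x t"
      have "\<bar>k1 \<xi> ?s * v \<xi> ?s\<bar> \<le> B2 * A" "\<bar>\<beta> \<xi> ?s * g \<xi> ?s\<bar> \<le> B1 * A"
        unfolding abs_mult using A \<xi> B1(1) B2(1) by (auto intro!: mult_mono B1(2) B2(2) x t)
      then have "\<bar>k1 \<xi> ?s * v \<xi> ?s - \<beta> \<xi> ?s * g \<xi> ?s\<bar> \<le> B2 * A + B1 * A" by linarith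
      moreover have "\<bar>F.TT \<xi> x t\<bar> \<le> exp F.L" by (rule F.TT_bound[OF \<xi> x])
      moreover have "0 \<le> A" using A x abs_ge_zero order_trans by blast
      ultimately show "\<bar>(\<lambda>x t. k1 x t * v x t - \<beta> x t * g x t) \<xi> ?s * F.TT \<xi> x t\<bar> \<le> (B2 * A + B1 * A) * exp F.L"
        unfolding abs_mult using B1(1) B2(1) by (intro mult_mono) auto
    qed
    show ?thesis unfolding Zop_k1 using 1 2 3 by (simp add: algebra_simps)
  qed
  then show ?thesis using B1(1) B2(1) by (intro exI[of _ "B1 + exp F.L * B1 + (B2 + B1) * exp F.L"]) auto
qed

lemma Wop_bound:
  "\<exists>C\<ge>0. \<forall>v A. cont v \<longrightarrow> (\<forall>x\<in>{0..1}. \<forall>t. \<bar>v x t\<bar> \<le> A) \<longrightarrow>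
     (\<forall>x\<in>{0..1}. \<forall>t. \<bar>t\<bar> \<le> K \<longrightarrow> \<bar>Wop \<beta> e v x t\<bar> \<le> C * A)"
proof -
  obtain B where B: "B \<ge> 0" "\<And>x \<xi> t. x \<in> {0..1} \<Longrightarrow> \<xi> \<in> {0..1} \<Longrightarrow> \<bar>t\<bar> \<le> K \<Longrightarrow>
      \<bar>(\<lambda>x t. \<beta> x t * (F x t - G x t)) \<xi> (flow F \<xi> x t)\<bar> \<le> B"
    using F.bound_along_flow[OF t_derivD(1)[OF t_deriv_q], of K] by blast
  have "\<bar>Wop \<beta> e v x t\<bar> \<le> B * A"
    if v: "cont v" and A: "\<forall>x\<in>{0..1}. \<forall>t. \<bar>v x t\<bar> \<le> A" and x: "x \<in> {0..1}" and t: "\<bar>t\<bar> \<le> K" for v A x t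
  proof (rule ig_bound1[OF _ e x])
    show "continuous_on {0..1} (\<lambda>\<xi>. \<beta> \<xi> (flow F \<xi> x t) * (F \<xi> (flow F \<xi> x t) - G \<xi> (flow F \<xi> x t)) * v \<xi> (flow F \<xi> x t))"
      using F.cont_along[OF cont_mult[OF t_derivD(1)[OF t_deriv_q] v] x] by simp
    show "\<bar>\<beta> \<xi> (flow F \<xi> x t) * (F \<xi> (flow F \<xi> x t) - G \<xi> (flow F \<xi> x t)) * v \<xi> (flow F \<xi> x t)\<bar> \<le> B * A"
      if "\<xi> \<in> {0..1}" for \<xi>
      using B(2)[OF x that t] A that B(1) by (subst abs_mult) (intro mult_mono, auto)
  qed
  then show ?thesis using B(1) by (intro exI[of _ B]) auto
qed

lemma Wop_deriv_smooth:
  assumes v: "t_deriv v vt" and tr: "transport G v g" and g: "cont g" and x: "x \<in> {0..1}"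
  shows "((\<lambda>t. Wop \<beta> e v x t) has_real_derivative Zo v g x t) (at t)"
proof -
  let ?\<tau> = "\<lambda>\<xi>. flow F \<xi> x t"
  let ?qt = "\<lambda>x t. \<beta>t x t * (F x t - G x t) + (Ft x t - Gt x t) * \<beta> x t"
  let ?D = "\<lambda>x t. (Ft x t * \<beta> x t + \<beta>F x t) * v x t + \<beta> x t * (g x t + (F x t - G x t) * vt x t)"
  note trF = transport_change_slope[OF v tr]
  have "((\<lambda>\<xi>. F.TT \<xi> x t * (\<beta> \<xi> (?\<tau> \<xi>) * v \<xi> (?\<tau> \<xi>))) has_real_derivative ?D \<xi> (?\<tau> \<xi>) * F.TT \<xi> x t) (at \<xi> within {0..1})"
    if \<xi>: "\<xi> \<in> {0..1}" for \<xi>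
    using DERIV_mult[OF F.TT_deriv[OF x \<xi>, of t] F.transport_along[OF transport_mult[OF \<beta>(2) trF] x \<xi>, of t]]
    by (simp add: algebra_simps)
  from ig_FTC[OF _ e x this] have parts: "ig (\<lambda>\<xi>. ?D \<xi> (?\<tau> \<xi>) * F.TT \<xi> x t) e x =
      \<beta> x t * v x t - F.TT e x t * (\<beta> e (?\<tau> e) * v e (?\<tau> e))"
    by (simp add: F.flow_self[OF x])
  have cD: "cont ?D"
    by (intro cont_add cont_mult cont_diff F.contF F.contFt G.contF \<beta>(3) t_derivD[OF \<beta>(1)] t_derivD[OF v] g)
  have cDT: "continuous_on {0..1} (\<lambda>\<xi>. ?D \<xi> (?\<tau> \<xi>) * F.TT \<xi> x t)"
    by (rule continuous_on_mult[OF F.cont_along[OF cD x] F.TT_comp]) (use x in \<open>auto intro: continuous_intros\<close>)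
  have "ig (\<lambda>\<xi>. (?qt \<xi> (?\<tau> \<xi>) * v \<xi> (?\<tau> \<xi>) + vt \<xi> (?\<tau> \<xi>) * (\<beta> \<xi> (?\<tau> \<xi>) * (F \<xi> (?\<tau> \<xi>) - G \<xi> (?\<tau> \<xi>)))) * F.TT \<xi> x t) e x
    = ig (\<lambda>\<xi>. (\<lambda>x t. k1 x t * v x t - \<beta> x t * g x t) \<xi> (?\<tau> \<xi>) * F.TT \<xi> x t + ?D \<xi> (?\<tau> \<xi>) * F.TT \<xi> x t) e x"
    by (rule ig_cong[OF e x]) (simp add: k1_def algebra_simps)
  also have "\<dots> = Zo v g x t"
    using ig_add[OF continuous_kernel[OF t_derivD(1)[OF v] g x] cDT e x] parts
    by (simp add: Zop_k1)
  finally show ?thesis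
    using F.ig_flow_deriv[OF t_deriv_mult[OF t_deriv_q v] e x, of t] by simp
qed

text \<open>The formula extends to all continuous \<open>v\<close> with continuous derivative along the \<open>G\<close>-curves, since
  it does not contain the time derivative of \<open>v\<close>.\<close>

lemma t_deriv_Wop:
  assumes v: "cont v" "periodic_strip v" and g: "cont g" "periodic_strip g" and tr: "transport G v g"
  shows "t_deriv (\<lambda>x t. Wop \<beta> e v x t) (Zo v g)"
proof (rule t_derivI)
  show "cont (\<lambda>x t. Wop \<beta> e v x t)"
    using F.cont_sol[OF cont_mult[OF t_derivD(1)[OF t_deriv_q] v(1)], of "\<lambda>_. 0" e] e
    by (simp add: F.sol_def[abs_def])
  show "cont (Zo v g)" by (rule cont_Zop[OF v(1) g(1)])
  fix x t :: real assume x: "x \<in> {0..1}"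
  define K where "K = \<bar>t\<bar> + 1"
  obtain C1 where C1: "C1 \<ge> 0" "\<And>v g A x t. cont v \<Longrightarrow> cont g \<Longrightarrow> (\<forall>x\<in>{0..1}. \<forall>t. \<bar>v x t\<bar> \<le> A \<and> \<bar>g x t\<bar> \<le> A) \<Longrightarrow>
     x \<in> {0..1} \<Longrightarrow> \<bar>t\<bar> \<le> K \<Longrightarrow> \<bar>Zo v g x t\<bar> \<le> C1 * A" using Zop_bound[of K] by blast
  obtain C2 where C2: "C2 \<ge> 0" "\<And>v A x t. cont v \<Longrightarrow> (\<forall>x\<in>{0..1}. \<forall>t. \<bar>v x t\<bar> \<le> A) \<Longrightarrow>
     x \<in> {0..1} \<Longrightarrow> \<bar>t\<bar> \<le> K \<Longrightarrow> \<bar>Wop \<beta> e v x t\<bar> \<le> C2 * A" using Wop_bound[of K] by blast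
  show "((\<lambda>t. Wop \<beta> e v x t) has_real_derivative Zo v g x t) (at t)"
  proof (rule deriv_unif_limit_on[of "{-K<..<K}"])
    fix \<epsilon> :: real assume \<epsilon>: "\<epsilon> > 0"
    define \<eta> where "\<eta> = \<epsilon> / (C1 + C2 + 1)"
    have \<eta>: "\<eta> > 0" "C1 * \<eta> \<le> \<epsilon>" "C2 * \<eta> \<le> \<epsilon>"
      using \<epsilon> C1(1) C2(1) by (auto simp: \<eta>_def field_simps)
    obtain v' vt' g' where a: "t_deriv v' vt'" "cont g'" "transport G v' g'"
      "\<forall>x\<in>{0..1}. \<forall>t. \<bar>v' x t - v x t\<bar> \<le> \<eta> \<and> \<bar>g' x t - g x t\<bar> \<le> \<eta>"
      using G.approx_by_t_deriv[OF v g tr \<eta>(1)] by blast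
    note v' = t_derivD(1)[OF a(1)]
    have "\<bar>Wop \<beta> e v' x s - Wop \<beta> e v x s\<bar> \<le> \<epsilon> \<and> \<bar>Zo v' g' x s - Zo v g x s\<bar> \<le> \<epsilon>" if "\<bar>s\<bar> \<le> K" for s
    proof
      have q: "continuous_on {0..1} (\<lambda>\<xi>. \<beta> \<xi> (flow F \<xi> x s) * (F \<xi> (flow F \<xi> x s) - G \<xi> (flow F \<xi> x s)) * w \<xi> (flow F \<xi> x s))"
        if "cont w" for w
        using F.cont_along[OF cont_mult[OF t_derivD(1)[OF t_deriv_q] that] x] by simp
      have "Wop \<beta> e v' x s - Wop \<beta> e v x s = Wop \<beta> e (\<lambda>x t. v' x t - v x t) x s"
        using ig_diff[OF q[OF v'] q[OF v(1)] e x] by (simp add: right_diff_distrib)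
      moreover have "\<bar>Wop \<beta> e (\<lambda>x t. v' x t - v x t) x s\<bar> \<le> C2 * \<eta>"
        by (rule C2(2)) (use a(4) x that in \<open>auto intro!: cont_diff v' v\<close>)
      ultimately show "\<bar>Wop \<beta> e v' x s - Wop \<beta> e v x s\<bar> \<le> \<epsilon>" using \<eta>(3) by linarith
      have "\<bar>Zo (\<lambda>x t. v' x t - v x t) (\<lambda>x t. g' x t - g x t) x s\<bar> \<le> C1 * \<eta>"
        by (rule C1(2)) (use a(4) x that in \<open>auto intro!: cont_diff v' v a(2) g\<close>)
      then show "\<bar>Zo v' g' x s - Zo v g x s\<bar> \<le> \<epsilon>"
        using Zop_diff[OF v(1) g(1) v' a(2) x, of s] \<eta>(2) by linarith
    qed
    moreover have "((\<lambda>t. Wop \<beta> e v' x t) has_real_derivative Zo v' g' x s) (at s)" for s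
      by (rule Wop_deriv_smooth[OF a(1,3,2) x])
    ultimately show "\<exists>w z. \<forall>s\<in>{- K<..<K}. (w has_real_derivative z s) (at s) \<and>
        \<bar>w s - Wop \<beta> e v x s\<bar> \<le> \<epsilon> \<and> \<bar>z s - Zo v g x s\<bar> \<le> \<epsilon>"
      by (intro exI[of _ "\<lambda>t. Wop \<beta> e v' x t"] exI[of _ "\<lambda>t. Zo v' g' x t"] ballI) (auto simp: abs_le_iff)
  qed (auto simp: K_def)
qed

end

text \<open>The same for the damped equation, whose integrating factor is absorbed into \<open>\<beta>\<close>.\<close>

lemma damped_smoothing:
  assumes p: "t_deriv p pt" and \<beta>: "t_deriv \<beta> \<beta>t" "transport F \<beta> \<beta>F" "cont \<beta>F" and e: "e \<in> {0..1}"
  shows "\<exists>Z. (\<forall>v g. cont v \<longrightarrow> periodic_strip v \<longrightarrow> cont g \<longrightarrow> periodic_strip g \<longrightarrow> transport G v g \<longrightarrow>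
      t_deriv (F.dsol p e (\<lambda>_. 0) (\<lambda>x t. \<beta> x t * (F x t - G x t) * v x t)) (Z v g)) \<and>
    (\<forall>K. \<exists>C\<ge>0. \<forall>v g A. cont v \<longrightarrow> cont g \<longrightarrow> (\<forall>x\<in>{0..1}. \<forall>t. \<bar>v x t\<bar> \<le> A \<and> \<bar>g x t\<bar> \<le> A) \<longrightarrow>
      (\<forall>x\<in>{0..1}. \<forall>t. \<bar>t\<bar> \<le> K \<longrightarrow> \<bar>Z v g x t\<bar> \<le> C * A))"
proof -
  obtain Et where Et: "t_deriv (F.E p) Et" using F.t_deriv_E[OF p] by blast
  note pc = t_derivD(1)[OF p]
  let ?B = "\<lambda>x t. F.E p x t * \<beta> x t"
  let ?Bt = "\<lambda>x t. Et x t * \<beta> x t + \<beta>t x t * F.E p x t"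
  let ?BF = "\<lambda>x t. F.E p x t * p x t * \<beta> x t + \<beta>F x t * F.E p x t"
  have B: "t_deriv ?B ?Bt" by (rule t_deriv_mult[OF Et \<beta>(1)])
  have BF: "transport F ?B ?BF" by (rule transport_mult[OF F.transport_E[OF pc] \<beta>(2)])
  have cBF: "cont ?BF" by (intro cont_add cont_mult F.cont_E pc \<beta>(3) t_derivD[OF \<beta>(1)])
  define Z where "Z v g x t = (Zop ?B ?Bt ?BF e v g x t * F.E p x t - Wop ?B e v x t * Et x t) / (F.E p x t * F.E p x t)" for v g x t
  have 1: "t_deriv (F.dsol p e (\<lambda>_. 0) (\<lambda>x t. \<beta> x t * (F x t - G x t) * v x t)) (Z v g)"
    if "cont v" "periodic_strip v" "cont g" "periodic_strip g" "transport G v g" for v g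
    unfolding Z_def
    by (rule t_deriv_cong[OF t_deriv_divide[OF t_deriv_Wop[OF B BF cBF e that] Et F.E_nz]])
      (simp_all add: F.dsol_def F.sol_def mult.assoc)
  have 2: "\<exists>C\<ge>0. \<forall>v g A. cont v \<longrightarrow> cont g \<longrightarrow> (\<forall>x\<in>{0..1}. \<forall>t. \<bar>v x t\<bar> \<le> A \<and> \<bar>g x t\<bar> \<le> A) \<longrightarrow>
      (\<forall>x\<in>{0..1}. \<forall>t. \<bar>t\<bar> \<le> K \<longrightarrow> \<bar>Z v g x t\<bar> \<le> C * A)" for K
  proof -
    obtain C1 where C1: "C1 \<ge> 0" "\<And>v g A x t. cont v \<Longrightarrow> cont g \<Longrightarrow> (\<forall>x\<in>{0..1}. \<forall>t. \<bar>v x t\<bar> \<le> A \<and> \<bar>g x t\<bar> \<le> A) \<Longrightarrow>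
       x \<in> {0..1} \<Longrightarrow> \<bar>t\<bar> \<le> K \<Longrightarrow> \<bar>Zop ?B ?Bt ?BF e v g x t\<bar> \<le> C1 * A"
      using Zop_bound[OF B BF cBF e, of K] by blast
    obtain C2 where C2: "C2 \<ge> 0" "\<And>v A x t. cont v \<Longrightarrow> (\<forall>x\<in>{0..1}. \<forall>t. \<bar>v x t\<bar> \<le> A) \<Longrightarrow>
       x \<in> {0..1} \<Longrightarrow> \<bar>t\<bar> \<le> K \<Longrightarrow> \<bar>Wop ?B e v x t\<bar> \<le> C2 * A"
      using Wop_bound[OF B BF cBF e, of K] by blast
    have c3: "cont (\<lambda>x t. 1 / F.E p x t)" by (intro cont_divide cont_const F.cont_E pc F.E_nz)
    obtain C3 where C3: "C3 \<ge> 0" "\<And>x t. x \<in> {0..1} \<Longrightarrow> \<bar>t\<bar> \<le> K \<Longrightarrow> \<bar>1 / F.E p x t\<bar> \<le> C3"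
      using F.bound_along_flow[OF c3, of K] F.flow_self by metis
    have c4: "cont (\<lambda>x t. Et x t / (F.E p x t * F.E p x t))"
      by (intro cont_divide cont_mult t_derivD[OF Et] F.cont_E pc) (simp add: F.E_nz)
    obtain C4 where C4: "C4 \<ge> 0" "\<And>x t. x \<in> {0..1} \<Longrightarrow> \<bar>t\<bar> \<le> K \<Longrightarrow> \<bar>Et x t / (F.E p x t * F.E p x t)\<bar> \<le> C4"
      using F.bound_along_flow[OF c4, of K] F.flow_self by metis
    have "\<bar>Z v g x t\<bar> \<le> (C1 * C3 + C2 * C4) * A"
      if vg: "cont v" "cont g" and A: "\<forall>x\<in>{0..1}. \<forall>t. \<bar>v x t\<bar> \<le> A \<and> \<bar>g x t\<bar> \<le> A"
        and x: "x \<in> {0..1}" and t: "\<bar>t\<bar> \<le> K" for v g A x t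
    proof -
      have A0: "0 \<le> A" using A x abs_ge_zero order_trans by blast
      have "Z v g x t = Zop ?B ?Bt ?BF e v g x t * (1 / F.E p x t) - Wop ?B e v x t * (Et x t / (F.E p x t * F.E p x t))"
        by (simp add: Z_def F.E_nz diff_divide_distrib)
      moreover have "\<bar>Zop ?B ?Bt ?BF e v g x t * (1 / F.E p x t)\<bar> \<le> (C1 * A) * C3"
        unfolding abs_mult using A0 C1(1) by (intro mult_mono C1(2) C3(2) vg A x t) auto
      moreover have "\<bar>Wop ?B e v x t * (Et x t / (F.E p x t * F.E p x t))\<bar> \<le> (C2 * A) * C4"
        unfolding abs_mult[of "Wop ?B e v x t"] using A A0 C2(1) by (intro mult_mono C2(2) C4(2) vg x t) auto
      moreover have "(C1 * A) * C3 + (C2 * A) * C4 = (C1 * C3 + C2 * C4) * A" by (simp add: algebra_simps)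
      ultimately show ?thesis by linarith
    qed
    then show ?thesis using C1(1) C2(1) C3(1) C4(1) by (intro exI[of _ "C1 * C3 + C2 * C4"]) auto
  qed
  show ?thesis
  proof (intro exI[of _ Z] conjI allI)
    show "cont v \<longrightarrow> periodic_strip v \<longrightarrow> cont g \<longrightarrow> periodic_strip g \<longrightarrow> transport G v g \<longrightarrow>
      t_deriv (F.dsol p e (\<lambda>_. 0) (\<lambda>x t. \<beta> x t * (F x t - G x t) * v x t)) (Z v g)" for v g
      by (intro impI 1)
  qed (rule 2)
qed

end

section \<open>Functional equations on the boundary\<close>

text \<open>Linear functional equations with shifted arguments; the shifts \<open>\<theta>\<close> come from following
  characteristics from one boundary to the other and back.\<close>

locale functional_equation =
  fixes Q :: "nat set" and D :: "'p set" and A :: "nat \<Rightarrow> 'p \<Rightarrow> real \<Rightarrow> real"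
    and l :: "'p \<Rightarrow> nat" and \<theta> :: "nat \<Rightarrow> 'p \<Rightarrow> real \<Rightarrow> real" and q :: real
  assumes fin: "finite D" and l: "\<And>p. p \<in> D \<Longrightarrow> l p \<in> Q" and q: "0 \<le> q" "q < 1"
    and A_sum: "\<And>j t. j \<in> Q \<Longrightarrow> (\<Sum>p\<in>D. \<bar>A j p t\<bar>) \<le> q"
    and A_cont: "\<And>j p. j \<in> Q \<Longrightarrow> p \<in> D \<Longrightarrow> continuous_on UNIV (A j p)"
    and \<theta>_cont: "\<And>j p. j \<in> Q \<Longrightarrow> p \<in> D \<Longrightarrow> continuous_on UNIV (\<theta> j p)"
begin

definition W where "W z j t = (\<Sum>p\<in>D. A j p t * z (l p) (\<theta> j p t))"

lemma W_bound:
  assumes j: "j \<in> Q" and z: "\<And>j t. j \<in> Q \<Longrightarrow> \<bar>z j t\<bar> \<le> B"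
  shows "\<bar>W z j t\<bar> \<le> q * B"
proof -
  have B: "0 \<le> B" using z[OF j, of 0] by linarith
  have "\<bar>W z j t\<bar> \<le> (\<Sum>p\<in>D. \<bar>A j p t\<bar> * B)"
    unfolding W_def
    by (rule order_trans[OF sum_abs]) (auto intro!: sum_mono mult_left_mono z l simp: abs_mult)
  also have "\<dots> \<le> q * B"
    unfolding sum_distrib_right[symmetric] by (rule mult_right_mono[OF A_sum[OF j] B])
  finally show ?thesis .
qed

lemma solution_bound:
  assumes z: "\<And>j t. j \<in> Q \<Longrightarrow> \<bar>z j t\<bar> \<le> B" and eq: "\<And>j t. j \<in> Q \<Longrightarrow> z j t = W z j t + h j t"
    and h: "\<And>j t. j \<in> Q \<Longrightarrow> \<bar>h j t\<bar> \<le> H" and j: "j \<in> Q"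
  shows "\<bar>z j t\<bar> \<le> H / (1 - q)"
proof -
  have B: "0 \<le> B" using z[OF j, of 0] by linarith
  define X where "X = H / (1 - q)"
  have H: "H = (1 - q) * X" using q by (simp add: X_def)
  have "\<bar>z j t\<bar> \<le> q ^ n * B + X" if "j \<in> Q" for n j t
    using that
  proof (induction n arbitrary: j t)
    case 0
    have "0 \<le> H" using h[OF 0, of 0] by linarith
    then have "0 \<le> X" using q by (simp add: X_def)
    then show ?case using z[OF 0, of t] by simp
  next
    case (Suc n)
    have "\<bar>z j t\<bar> \<le> \<bar>W z j t\<bar> + \<bar>h j t\<bar>" using eq[OF Suc.prems, of t] by linarith
    also have "\<dots> \<le> q * (q ^ n * B + X) + H"
      by (intro add_mono W_bound Suc h)
    also have "\<dots> = q ^ Suc n * B + X"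
      unfolding H by (simp add: algebra_simps)
    finally show ?case .
  qed
  then have "\<bar>z j t\<bar> \<le> q ^ n * B + X" for n using j by blast
  moreover have "(\<lambda>n. q ^ n * B + X) \<longlonglongrightarrow> 0 * B + X"
    using q by (intro tendsto_intros LIMSEQ_realpow_zero)
  ultimately show ?thesis
    unfolding X_def[symmetric]
    by (intro LIMSEQ_le_const[of "\<lambda>n. q ^ n * B + X"]) auto
qed

lemma W_diff: "W z j t - W y j t = W (\<lambda>j t. z j t - y j t) j t"
  by (simp add: W_def sum_subtractf[symmetric] right_diff_distrib)

text \<open>The difference of two bounded solutions solves the homogeneous equation, so its bound
  shrinks by the factor \<open>q\<close> as often as one likes.\<close>

lemma solution_unique:
  assumes z: "\<And>j t. j \<in> Q \<Longrightarrow> \<bar>z j t\<bar> \<le> B" "\<And>j t. j \<in> Q \<Longrightarrow> z j t = W z j t + h j t"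
    and y: "\<And>j t. j \<in> Q \<Longrightarrow> \<bar>y j t\<bar> \<le> B'" "\<And>j t. j \<in> Q \<Longrightarrow> y j t = W y j t + h j t" and j: "j \<in> Q"
  shows "z j t = y j t"
proof -
  have "\<bar>(\<lambda>j t. z j t - y j t) j t\<bar> \<le> 0 / (1 - q)"
  proof (rule solution_bound[where z = "\<lambda>j t. z j t - y j t" and B = "B + B'" and h = "\<lambda>_ _. 0"])
    show "\<bar>z j t - y j t\<bar> \<le> B + B'" if "j \<in> Q" for j t
      using z(1)[OF that, of t] y(1)[OF that, of t] by linarith
    show "z j t - y j t = W (\<lambda>j t. z j t - y j t) j t + 0" if "j \<in> Q" for j t
      using z(2)[OF that, of t] y(2)[OF that, of t] W_diff[of z j t y] by linarith
  qed (use j in auto)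
  then show ?thesis by simp
qed

definition iter where "iter h n = (W ^^ n) h"

lemma iter_0 [simp]: "iter h 0 = h" by (simp add: iter_def)
lemma iter_Suc: "iter h (Suc n) j t = (\<Sum>p\<in>D. A j p t * iter h n (l p) (\<theta> j p t))"
  by (simp add: iter_def W_def)

lemma iter_bound:
  assumes "\<And>j t. j \<in> Q \<Longrightarrow> \<bar>h j t\<bar> \<le> H" "j \<in> Q"
  shows "\<bar>iter h n j t\<bar> \<le> q ^ n * H"
  using assms(2)
proof (induction n arbitrary: j t)
  case 0 then show ?case using assms(1) by simp
next
  case (Suc n)
  have "\<bar>W (iter h n) j t\<bar> \<le> q * (q ^ n * H)" by (rule W_bound) (use Suc in auto)
  then show ?case by (simp add: iter_def mult.assoc)
qed

lemma iter_cont: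
  assumes "\<And>j. j \<in> Q \<Longrightarrow> continuous_on UNIV (h j)" "j \<in> Q"
  shows "continuous_on UNIV (iter h n j)"
  using assms(2)
proof (induction n arbitrary: j)
  case 0 then show ?case using assms(1) by simp
next
  case (Suc n)
  have "continuous_on UNIV (\<lambda>t. \<Sum>p\<in>D. A j p t * iter h n (l p) (\<theta> j p t))"
  proof (intro continuous_on_sum continuous_on_mult)
    fix p assume p: "p \<in> D"
    show "continuous_on UNIV (A j p)" by (rule A_cont[OF Suc.prems p])
    show "continuous_on UNIV (\<lambda>t. iter h n (l p) (\<theta> j p t))"
      by (rule continuous_on_compose2[OF Suc.IH[OF l[OF p]] \<theta>_cont[OF Suc.prems p]]) auto
  qed
  then show ?case by (simp add: iter_Suc[abs_def])
qed

text \<open>The Neumann series.\<close>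

definition fp where "fp h j t = (\<Sum>n. iter h n j t)"

context
  fixes h :: "nat \<Rightarrow> real \<Rightarrow> real" and H :: real
  assumes hb: "\<And>j t. j \<in> Q \<Longrightarrow> \<bar>h j t\<bar> \<le> H" and hc: "\<And>j. j \<in> Q \<Longrightarrow> continuous_on UNIV (h j)"
begin

lemma iter_summable: "j \<in> Q \<Longrightarrow> summable (\<lambda>n. iter h n j t)"
  by (rule summable_comparison_test'[of "\<lambda>n. q ^ n * H" 0])
    (use q iter_bound[OF hb] in \<open>auto intro!: summable_mult2 summable_geometric\<close>)

lemma fp_cont:
  assumes j: "j \<in> Q" shows "continuous_on UNIV (fp h j)"
proof -
  have "uniform_limit UNIV (\<lambda>n t. \<Sum>i<n. iter h i j t) (\<lambda>t. \<Sum>i. iter h i j t) sequentially"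
    by (rule Weierstrass_m_test[where M = "\<lambda>n. q ^ n * H"])
      (use q iter_bound[OF hb j] in \<open>auto intro!: summable_mult2 summable_geometric\<close>)
  then show ?thesis
    unfolding fp_def[abs_def]
    by (rule uniform_limit_theorem[rotated]) (auto intro!: always_eventually continuous_on_sum iter_cont hc j)
qed

lemma fp_eq:
  assumes j: "j \<in> Q" shows "fp h j t = W (fp h) j t + h j t"
proof -
  have "(\<Sum>n. iter h (Suc n) j t) = (\<Sum>n. \<Sum>p\<in>D. A j p t * iter h n (l p) (\<theta> j p t))"
    by (simp add: iter_Suc)
  also have "\<dots> = (\<Sum>p\<in>D. \<Sum>n. A j p t * iter h n (l p) (\<theta> j p t))"
    by (rule suminf_sum) (intro summable_mult iter_summable l)
  also have "\<dots> = W (fp h) j t"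
    unfolding W_def fp_def by (intro sum.cong refl suminf_mult iter_summable l)
  finally show ?thesis
    using suminf_split_head[OF iter_summable[OF j, of t]] by (simp add: fp_def)
qed

lemma fp_bound: "j \<in> Q \<Longrightarrow> \<bar>fp h j t\<bar> \<le> H / (1 - q)"
proof -
  assume j: "j \<in> Q"
  have s: "summable (\<lambda>n. q ^ n * H)" using q by (intro summable_mult2 summable_geometric) auto
  have n: "summable (\<lambda>n. \<bar>iter h n j t\<bar>)"
    by (rule summable_comparison_test'[OF s, of 0]) (use iter_bound[OF hb j] in auto)
  have "\<bar>fp h j t\<bar> \<le> (\<Sum>n. \<bar>iter h n j t\<bar>)" unfolding fp_def by (rule summable_rabs[OF n])
  also have "\<dots> \<le> (\<Sum>n. q ^ n * H)" by (rule suminf_le[OF iter_bound[OF hb j] n s])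
  also have "\<dots> = H / (1 - q)" using q suminf_mult2[of "\<lambda>n. q ^ n" H] suminf_geometric[of q] by simp
  finally show ?thesis .
qed

text \<open>If the coefficients of the equation differentiated formally satisfy the same bound, then the
  series of derivatives converges geometrically as well, with any ratio in \<open>(q, 1)\<close>.\<close>

lemma fp_C1:
  fixes A' \<theta>' :: "nat \<Rightarrow> 'p \<Rightarrow> real \<Rightarrow> real" and h' :: "nat \<Rightarrow> real \<Rightarrow> real"
  assumes A': "\<And>j p t. j \<in> Q \<Longrightarrow> p \<in> D \<Longrightarrow> (A j p has_real_derivative A' j p t) (at t)"
      "\<And>j p. j \<in> Q \<Longrightarrow> p \<in> D \<Longrightarrow> continuous_on UNIV (A' j p)"
      "\<And>j t. j \<in> Q \<Longrightarrow> (\<Sum>p\<in>D. \<bar>A' j p t\<bar>) \<le> CA"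
    and \<theta>': "\<And>j p t. j \<in> Q \<Longrightarrow> p \<in> D \<Longrightarrow> (\<theta> j p has_real_derivative \<theta>' j p t) (at t)"
      "\<And>j p. j \<in> Q \<Longrightarrow> p \<in> D \<Longrightarrow> continuous_on UNIV (\<theta>' j p)"
      "\<And>j t. j \<in> Q \<Longrightarrow> (\<Sum>p\<in>D. \<bar>A j p t * \<theta>' j p t\<bar>) \<le> q"
    and h': "\<And>j t. j \<in> Q \<Longrightarrow> (h j has_real_derivative h' j t) (at t)"
      "\<And>j. j \<in> Q \<Longrightarrow> continuous_on UNIV (h' j)" "\<And>j t. j \<in> Q \<Longrightarrow> \<bar>h' j t\<bar> \<le> H'"
  shows "\<exists>z'. \<forall>j\<in>Q. continuous_on UNIV (z' j) \<and> (\<forall>t. (fp h j has_real_derivative z' j t) (at t))"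
proof -
  define V where "V n = rec_nat h' (\<lambda>n v j t. \<Sum>p\<in>D. A' j p t * iter h n (l p) (\<theta> j p t) + A j p t * \<theta>' j p t * v (l p) (\<theta> j p t)) n" for n
  have V0: "V 0 = h'" by (simp add: V_def)
  have VS: "V (Suc n) j t = (\<Sum>p\<in>D. A' j p t * iter h n (l p) (\<theta> j p t) + A j p t * \<theta>' j p t * V n (l p) (\<theta> j p t))" for n j t
    by (simp add: V_def)
  have Vd: "(iter h n j has_real_derivative V n j t) (at t)" if "j \<in> Q" for n j t
    using that
  proof (induction n arbitrary: j t)
    case 0 then show ?case using h'(1) by (simp add: V0)
  next
    case (Suc n)
    have "((\<lambda>t. \<Sum>p\<in>D. A j p t * iter h n (l p) (\<theta> j p t)) has_real_derivative
        (\<Sum>p\<in>D. A' j p t * iter h n (l p) (\<theta> j p t) + V n (l p) (\<theta> j p t) * \<theta>' j p t * A j p t)) (at t)"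
    proof (rule DERIV_sum)
      fix p assume p: "p \<in> D"
      show "((\<lambda>t. A j p t * iter h n (l p) (\<theta> j p t)) has_real_derivative
          A' j p t * iter h n (l p) (\<theta> j p t) + V n (l p) (\<theta> j p t) * \<theta>' j p t * A j p t) (at t)"
        by (rule DERIV_mult[OF A'(1)[OF Suc.prems p] DERIV_chain2[OF Suc.IH[OF l[OF p]] \<theta>'(1)[OF Suc.prems p]]])
    qed
    then show ?case by (simp add: iter_Suc[abs_def] VS mult_ac)
  qed
  have Vc: "continuous_on UNIV (V n j)" if "j \<in> Q" for n j
    using that
  proof (induction n arbitrary: j)
    case 0 then show ?case using h'(2) by (simp add: V0)
  next
    case (Suc n)
    have "continuous_on UNIV (\<lambda>t. \<Sum>p\<in>D. A' j p t * iter h n (l p) (\<theta> j p t) + A j p t * \<theta>' j p t * V n (l p) (\<theta> j p t))"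
    proof (intro continuous_on_sum continuous_on_add continuous_on_mult)
      fix p assume p: "p \<in> D"
      show "continuous_on UNIV (A' j p)" "continuous_on UNIV (A j p)" "continuous_on UNIV (\<theta>' j p)"
        by (rule A'(2)[OF Suc.prems p] A_cont[OF Suc.prems p] \<theta>'(2)[OF Suc.prems p])+
      show "continuous_on UNIV (\<lambda>t. iter h n (l p) (\<theta> j p t))"
        by (rule continuous_on_compose2[OF iter_cont[OF hc l[OF p]] \<theta>_cont[OF Suc.prems p]]) auto
      show "continuous_on UNIV (\<lambda>t. V n (l p) (\<theta> j p t))"
        by (rule continuous_on_compose2[OF Suc.IH[OF l[OF p]] \<theta>_cont[OF Suc.prems p]]) auto
    qed
    then show ?case by (simp add: VS[abs_def])
  qed
  define s where "s = (1 + q) / 2"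
  have s: "q \<le> s" "0 < s - q" "0 < s" "s < 1" using q by (auto simp: s_def)
  define K where "K = max \<bar>H'\<bar> (\<bar>CA\<bar> * \<bar>H\<bar> / (s - q))"
  have K: "\<bar>H'\<bar> \<le> K" "0 \<le> K" by (auto simp: K_def)
  have "\<bar>CA\<bar> * \<bar>H\<bar> / (s - q) \<le> K" by (simp add: K_def)
  then have KC: "\<bar>CA\<bar> * \<bar>H\<bar> + q * K \<le> s * K" using s(2) by (simp add: field_simps)
  have Vb: "\<bar>V n j t\<bar> \<le> s ^ n * K" if "j \<in> Q" for n j t
    using that
  proof (induction n arbitrary: j t)
    case 0 then show ?case using h'(3)[OF 0, of t] K(1) by (simp add: V0)
  next
    case (Suc n)
    have "\<bar>V (Suc n) j t\<bar> \<le> (\<Sum>p\<in>D. \<bar>A' j p t\<bar> * (s ^ n * \<bar>H\<bar>)) + (\<Sum>p\<in>D. \<bar>A j p t * \<theta>' j p t\<bar> * (s ^ n * K))"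
      unfolding VS sum.distrib[symmetric]
    proof (rule order_trans[OF sum_abs sum_mono])
      fix p assume p: "p \<in> D"
      have "\<bar>iter h n (l p) (\<theta> j p t)\<bar> \<le> q ^ n * H" by (rule iter_bound[OF hb l[OF p]])
      also have "\<dots> \<le> q ^ n * \<bar>H\<bar>" using q by (intro mult_left_mono) auto
      also have "\<dots> \<le> s ^ n * \<bar>H\<bar>" using s q by (intro mult_right_mono power_mono) auto
      finally have "\<bar>A' j p t * iter h n (l p) (\<theta> j p t)\<bar> \<le> \<bar>A' j p t\<bar> * (s ^ n * \<bar>H\<bar>)"
        unfolding abs_mult by (intro mult_left_mono) auto
      moreover have "\<bar>A j p t * \<theta>' j p t * V n (l p) (\<theta> j p t)\<bar> \<le> \<bar>A j p t * \<theta>' j p t\<bar> * (s ^ n * K)"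
        unfolding abs_mult[of _ "V n (l p) (\<theta> j p t)"] by (intro mult_left_mono Suc.IH l p) auto
      ultimately show "\<bar>A' j p t * iter h n (l p) (\<theta> j p t) + A j p t * \<theta>' j p t * V n (l p) (\<theta> j p t)\<bar>
          \<le> \<bar>A' j p t\<bar> * (s ^ n * \<bar>H\<bar>) + \<bar>A j p t * \<theta>' j p t\<bar> * (s ^ n * K)" by linarith
    qed
    also have "\<dots> \<le> \<bar>CA\<bar> * (s ^ n * \<bar>H\<bar>) + q * (s ^ n * K)"
      unfolding sum_distrib_right[symmetric]
      using A'(3)[OF Suc.prems, of t] \<theta>'(3)[OF Suc.prems, of t] s K(2) by (intro add_mono mult_right_mono) auto
    also have "\<dots> = s ^ n * (\<bar>CA\<bar> * \<bar>H\<bar> + q * K)" by (simp add: algebra_simps)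
    also have "\<dots> \<le> s ^ n * (s * K)" using KC s(3) by (intro mult_left_mono) auto
    finally show ?case by (simp add: mult_ac)
  qed
  have sm: "summable (\<lambda>n. s ^ n * K)" using s by (intro summable_mult2 summable_geometric) auto
  have ul: "uniform_limit UNIV (\<lambda>n t. \<Sum>i<n. V i j t) (\<lambda>t. \<Sum>i. V i j t) sequentially" if "j \<in> Q" for j
    by (rule Weierstrass_m_test[OF _ sm]) (use Vb[OF that] in auto)
  show ?thesis
  proof (intro exI[of _ "\<lambda>j t. \<Sum>i. V i j t"] ballI conjI allI)
    fix j assume j: "j \<in> Q"
    show "continuous_on UNIV (\<lambda>t. \<Sum>i. V i j t)"
      by (rule uniform_limit_theorem[OF _ ul[OF j]]) (auto intro!: always_eventually continuous_on_sum Vc j)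
    fix t :: real
    have "((\<lambda>x. \<Sum>n. iter h n j x) has_field_derivative (\<Sum>n. V n j t)) (at t)"
    proof (rule has_field_derivative_series'(2)[where S = UNIV and ?x0.0 = 0])
      show "uniformly_convergent_on UNIV (\<lambda>n x. \<Sum>i<n. V i j x)"
        using ul[OF j] uniformly_convergent_on_def by blast
    qed (use Vd[OF j] iter_summable[OF j] in auto)
    then show "(fp h j has_real_derivative (\<Sum>i. V i j t)) (at t)" by (simp add: fp_def[abs_def])
  qed
qed

end

end

section \<open>Fredholm operators of index zero\<close>

text \<open>Operators on function spaces are given by formulas that are linear only on a subspace.
  Linearity on the whole type makes the library on linear maps applicable.\<close>

lemma linear_extension:
  fixes f :: "'a::real_vector \<Rightarrow> 'b::real_vector"
  assumes X: "subspace X" and add: "\<And>x y. x \<in> X \<Longrightarrow> y \<in> X \<Longrightarrow> f (x + y) = f x + f y"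
    and scale: "\<And>c x. x \<in> X \<Longrightarrow> f (c *\<^sub>R x) = c *\<^sub>R f x"
  shows "\<exists>g. linear g \<and> (\<forall>x\<in>X. g x = f x)"
proof -
  obtain B where B: "B \<subseteq> X" "independent B" "X \<subseteq> span B"
    using maximal_independent_subset[of X] by blast
  obtain g where g: "linear g" "\<forall>x\<in>B. g x = f x"
    using linear_independent_extend[OF B(2), of f] by blast
  have f0: "f 0 = 0" using scale[OF subspace_0[OF X], of 0] by simp
  have "x \<in> X \<and> g x = f x" if "x \<in> span B" for x
    using that
  proof (induction rule: span_induct_alt)
    case base show ?case using f0 linear_0[OF g(1)] subspace_0[OF X] by simp
  next
    case (step c x y)
    then show ?case using B(1) g X
      by (auto simp: linear_add linear_scale add scale subspace_add subspace_scale)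
  qed
  then show ?thesis using g(1) B(3) by blast
qed

lemma span_Int_span:
  fixes B :: "'a::real_vector set"
  assumes "independent B" "finite B" "C \<subseteq> B" "x \<in> span C" "x \<in> span (B - C)"
  shows "x = 0"
proof -
  have fin: "finite C" "finite (B - C)" using assms finite_subset by auto
  obtain f where f: "x = (\<Sum>v\<in>C. f v *\<^sub>R v)" using assms(4) span_finite[OF fin(1)] by auto
  obtain g where g: "x = (\<Sum>v\<in>B - C. g v *\<^sub>R v)" using assms(5) span_finite[OF fin(2)] by auto
  define u where "u v = (if v \<in> C then f v else - g v)" for v
  have "(\<Sum>v\<in>B. u v *\<^sub>R v) = (\<Sum>v\<in>C. u v *\<^sub>R v) + (\<Sum>v\<in>B - C. u v *\<^sub>R v)"
    using sum.subset_diff[OF assms(3,2), of "\<lambda>v. u v *\<^sub>R v"] by (simp add: add.commute)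
  also have "(\<Sum>v\<in>C. u v *\<^sub>R v) = x" unfolding f by (rule sum.cong) (auto simp: u_def)
  also have "(\<Sum>v\<in>B - C. u v *\<^sub>R v) = - x" unfolding g sum_negf[symmetric] by (rule sum.cong) (auto simp: u_def)
  finally have "(\<Sum>v\<in>B. u v *\<^sub>R v) = 0" by simp
  then have u0: "u v = 0" if "v \<in> B" for v using independentD[OF assms(1,2) order_refl _ that] by blast
  have "f v = 0" if "v \<in> C" for v using u0[of v] that assms(3) by (auto simp: u_def)
  then have "(\<Sum>v\<in>C. f v *\<^sub>R v) = 0" by (intro sum.neutral) simp
  then show ?thesis using f by simp
qed

text \<open>A complete normed space whose points form a subspace of a type that has no norm itself.
  Below, \<open>bop\<close>, \<open>frank\<close> and \<open>inv_op\<close> are the bounded operators, those of finite rank, and those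
  with a bounded inverse.\<close>

locale banach_carrier =
  fixes X :: "'a::real_vector set" and N :: "'a \<Rightarrow> real"
  assumes sub: "subspace X"
    and N_ge0: "\<And>x. x \<in> X \<Longrightarrow> 0 \<le> N x"
    and N_eq0: "\<And>x. x \<in> X \<Longrightarrow> N x = 0 \<Longrightarrow> x = 0"
    and N_tri: "\<And>x y. x \<in> X \<Longrightarrow> y \<in> X \<Longrightarrow> N (x + y) \<le> N x + N y"
    and N_scale: "\<And>c x. x \<in> X \<Longrightarrow> N (c *\<^sub>R x) = \<bar>c\<bar> * N x"
    and complete: "\<And>s. (\<And>n. s n \<in> X) \<Longrightarrow> (\<And>e. e > 0 \<Longrightarrow> \<exists>n0::nat. \<forall>m\<ge>n0. \<forall>n\<ge>n0. N (s m - s n) < e) \<Longrightarrow>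
      \<exists>x\<in>X. (\<lambda>n. N (s n - x)) \<longlonglongrightarrow> 0"
begin

lemmas X_add = subspace_add[OF sub] and X_diff = subspace_diff[OF sub] and X_scale = subspace_scale[OF sub]
  and X_0 = subspace_0[OF sub] and X_sum = subspace_sum[OF sub]

lemma N_0 [simp]: "N 0 = 0" using N_scale[OF X_0, of 0] by simp

lemma N_minus: "x \<in> X \<Longrightarrow> N (- x) = N x" using N_scale[of x "-1"] by simp

lemma N_diff_commute: "x \<in> X \<Longrightarrow> y \<in> X \<Longrightarrow> N (x - y) = N (y - x)"
  using N_minus[OF X_diff[of y x]] by simp

lemma N_diff_tri: "x \<in> X \<Longrightarrow> y \<in> X \<Longrightarrow> N (x - y) \<le> N x + N y"
  using N_tri[of x "- y"] N_minus[of y] subspace_neg[OF sub, of y] by simp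

lemma N_sum:
  assumes "\<And>i. i \<in> I \<Longrightarrow> f i \<in> X" shows "N (sum f I) \<le> (\<Sum>i\<in>I. N (f i))"
proof (cases "finite I")
  case True
  then show ?thesis using assms
  proof (induction I)
    case (insert i I)
    have "N (f i + sum f I) \<le> N (f i) + N (sum f I)" using insert by (intro N_tri X_sum) auto
    then show ?case using insert by fastforce
  qed simp
qed simp

lemma N_limit_unique:
  assumes s: "\<And>n::nat. s n \<in> X" and x: "x \<in> X" "(\<lambda>n. N (s n - x)) \<longlonglongrightarrow> 0" and y: "y \<in> X" "(\<lambda>n. N (s n - y)) \<longlonglongrightarrow> 0"
  shows "x = y"
proof -
  have "(\<lambda>n. N (s n - x) + N (s n - y)) \<longlonglongrightarrow> 0 + 0" by (intro tendsto_add x y)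
  moreover have "N (x - y) \<le> N (s n - x) + N (s n - y)" for n
    using N_tri[of "x - s n" "s n - y"] N_diff_commute[of x "s n"] s x y X_diff by simp
  ultimately have "N (x - y) \<le> 0" by (intro LIMSEQ_le_const) auto
  then show ?thesis using N_ge0[of "x - y"] N_eq0[of "x - y"] X_diff x y by force
qed

definition bop :: "('a \<Rightarrow> 'a) \<Rightarrow> bool" where
  "bop G \<longleftrightarrow> linear G \<and> (\<forall>x\<in>X. G x \<in> X) \<and> (\<exists>C\<ge>0. \<forall>x\<in>X. N (G x) \<le> C * N x)"

lemma bopD:
  assumes "bop G"
  shows "linear G" "x \<in> X \<Longrightarrow> G x \<in> X" "\<exists>C\<ge>0. \<forall>x\<in>X. N (G x) \<le> C * N x"
  using assms by (auto simp: bop_def)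

lemma bopI:
  assumes "linear G" "\<And>x. x \<in> X \<Longrightarrow> G x \<in> X" "\<And>x. x \<in> X \<Longrightarrow> N (G x) \<le> C * N x" "C \<ge> 0"
  shows "bop G"
  using assms by (auto simp: bop_def)

lemma bop_id: "bop (\<lambda>x. x)"
  by (rule bopI[of _ 1]) (auto intro: linear_id[unfolded id_def])

lemma bop_add:
  assumes "bop G" "bop H" shows "bop (\<lambda>x. G x + H x)"
proof -
  obtain C D where "C \<ge> 0" "D \<ge> 0" and CD: "\<forall>x\<in>X. N (G x) \<le> C * N x" "\<forall>x\<in>X. N (H x) \<le> D * N x"
    using bopD(3)[OF assms(1)] bopD(3)[OF assms(2)] by blast
  show ?thesis
  proof (rule bopI[of _ "C + D"])
    show "N (G x + H x) \<le> (C + D) * N x" if "x \<in> X" for x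
      using N_tri[OF bopD(2)[OF assms(1) that] bopD(2)[OF assms(2) that]] CD that
      by (smt (verit) distrib_right)
  qed (use assms \<open>C \<ge> 0\<close> \<open>D \<ge> 0\<close> bopD X_add in \<open>auto intro: linear_compose_add\<close>)
qed

lemma bop_scale:
  assumes "bop G" shows "bop (\<lambda>x. c *\<^sub>R G x)"
proof -
  obtain C where C: "C \<ge> 0" "\<forall>x\<in>X. N (G x) \<le> C * N x" using bopD(3)[OF assms] by blast
  show ?thesis
  proof (rule bopI[of _ "\<bar>c\<bar> * C"])
    show "N (c *\<^sub>R G x) \<le> \<bar>c\<bar> * C * N x" if "x \<in> X" for x
      using C that N_scale[OF bopD(2)[OF assms that], of c] by (simp add: mult.assoc mult_left_mono)
    show "linear (\<lambda>x. c *\<^sub>R G x)" using bopD(1)[OF assms] by (rule linear_compose_scale_right)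
  qed (use C bopD[OF assms] X_scale in auto)
qed

lemma bop_diff: "bop G \<Longrightarrow> bop H \<Longrightarrow> bop (\<lambda>x. G x - H x)"
  using bop_add[OF _ bop_scale[of H "-1"]] by simp

lemma bop_comp:
  assumes "bop G" "bop H" shows "bop (\<lambda>x. G (H x))"
proof -
  obtain C D where CD: "C \<ge> 0" "D \<ge> 0" "\<forall>x\<in>X. N (G x) \<le> C * N x" "\<forall>x\<in>X. N (H x) \<le> D * N x"
    using bopD(3)[OF assms(1)] bopD(3)[OF assms(2)] by blast
  show ?thesis
  proof (rule bopI[of _ "C * D"])
    show "linear (\<lambda>x. G (H x))" using linear_compose[OF bopD(1)[OF assms(2)] bopD(1)[OF assms(1)]] by (simp add: o_def)
    show "N (G (H x)) \<le> C * D * N x" if "x \<in> X" for x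
    proof -
      have "N (G (H x)) \<le> C * N (H x)" using CD bopD(2)[OF assms(2) that] by blast
      also have "\<dots> \<le> C * (D * N x)" using CD that by (intro mult_left_mono) auto
      finally show ?thesis by (simp add: mult.assoc)
    qed
  qed (use CD bopD assms in auto)
qed

lemma bop_tendsto:
  assumes G: "bop G" and s: "\<And>n. s n \<in> X" and x: "x \<in> X" and lim: "(\<lambda>n. N (s n - x)) \<longlonglongrightarrow> 0"
  shows "(\<lambda>n. N (G (s n) - G x)) \<longlonglongrightarrow> 0"
proof -
  obtain C where C: "C \<ge> 0" "\<forall>x\<in>X. N (G x) \<le> C * N x" using bopD(3)[OF G] by blast
  have lim0: "(\<lambda>n. C * N (s n - x)) \<longlonglongrightarrow> 0" using tendsto_mult[OF tendsto_const[of C] lim] by simp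
  have "norm (N (G (s n) - G x)) \<le> C * N (s n - x)" for n
  proof -
    have d: "s n - x \<in> X" by (rule X_diff[OF s x])
    have "G (s n) - G x = G (s n - x)" by (rule linear_diff[OF bopD(1)[OF G], symmetric])
    then show ?thesis using C(2) d N_ge0[OF bopD(2)[OF G d]] by simp
  qed
  then show ?thesis
    by (rule Lim_null_comparison[OF always_eventually[OF allI] lim0])
qed

text \<open>The partial sums of the geometric series form a Cauchy sequence; the inverse obtained
  pointwise is linear by uniqueness and extends to a linear map.\<close>

lemma neumann:
  assumes G: "bop G" and q: "0 \<le> q" "q < 1" and bd: "\<And>x. x \<in> X \<Longrightarrow> N (G x) \<le> q * N x"
  shows "\<exists>R. bop R \<and> (\<forall>x\<in>X. R (x - G x) = x \<and> R x - G (R x) = x \<and> N (R x) \<le> N x / (1 - q))"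
proof -
  note lin = bopD(1)[OF G]
  have inj: "x = y" if "x \<in> X" "y \<in> X" "x - G x = y - G y" for x y
  proof -
    have "G (x - y) = x - y" using that(3) by (simp add: linear_diff[OF lin] algebra_simps)
    then have "N (x - y) \<le> q * N (x - y)" using bd[OF X_diff[OF that(1,2)]] by simp
    then have "(1 - q) * N (x - y) \<le> 0" by (simp add: algebra_simps)
    then have "N (x - y) \<le> 0" using q by (simp add: mult_le_0_iff)
    then have "x - y = 0" using N_ge0 N_eq0 X_diff[OF that(1,2)] by force
    then show ?thesis by simp
  qed
  have ex: "\<exists>x\<in>X. x - G x = y" if y: "y \<in> X" for y
  proof -
    define s where "s n = (\<Sum>i<n. (G ^^ i) y)" for n
    have pX: "(G ^^ i) y \<in> X" for i by (induction i) (use y bopD(2)[OF G] in auto)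
    have pN: "N ((G ^^ i) y) \<le> q ^ i * N y" for i
    proof (induction i)
      case (Suc i)
      have "N (G ((G ^^ i) y)) \<le> q * N ((G ^^ i) y)" by (rule bd[OF pX])
      also have "\<dots> \<le> q * (q ^ i * N y)" by (intro mult_left_mono Suc q)
      finally show ?case by (simp add: mult.assoc)
    qed simp
    have sX: "s n \<in> X" for n unfolding s_def by (intro X_sum pX)
    have tail: "N (s n - s m) \<le> (\<Sum>i=m..<n. q ^ i * N y)" if "m \<le> n" for m n
    proof -
      have "s n - s m = (\<Sum>i=m..<n. (G ^^ i) y)"
        using that sum_diff_nat_ivl[of 0 m n "\<lambda>i. (G ^^ i) y"] by (simp add: s_def atLeast0LessThan)
      then show ?thesis using order_trans[OF N_sum[of "{m..<n}" "\<lambda>i. (G ^^ i) y"] sum_mono[OF pN]] pX by simp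
    qed
    have sm: "summable (\<lambda>i. q ^ i * N y)" using q by (intro summable_mult2 summable_geometric) auto
    have cau: "\<exists>n0. \<forall>m\<ge>n0. \<forall>n\<ge>n0. N (s m - s n) < e" if e: "e > 0" for e
    proof -
      obtain n0 where n0: "\<And>m n. m \<ge> n0 \<Longrightarrow> norm (\<Sum>i=m..<n. q ^ i * N y) < e"
        using sm e unfolding summable_Cauchy by blast
      have lt: "N (s n - s m) < e" if "n0 \<le> m" "m \<le> n" for m n
        using tail[OF that(2)] n0[OF that(1), of n] by force
      show ?thesis
      proof (intro exI[of _ n0] allI impI)
        fix m n assume "n0 \<le> m" "n0 \<le> n"
        then show "N (s m - s n) < e"
          using lt[of m n] lt[of n m] N_diff_commute[OF sX sX, of m n] by (cases "m \<le> n") auto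
      qed
    qed
    obtain x where x: "x \<in> X" "(\<lambda>n. N (s n - x)) \<longlonglongrightarrow> 0" using complete[OF sX cau] by blast
    have rec: "s (Suc n) = y + G (s n)" for n
      unfolding s_def sum.lessThan_Suc_shift by (simp add: linear_sum[OF lin])
    have "(\<lambda>n. N (G (s n) - G x)) \<longlonglongrightarrow> 0" by (rule bop_tendsto[OF G sX x])
    then have "(\<lambda>n. N (s (Suc n) - (y + G x))) \<longlonglongrightarrow> 0" by (simp add: rec)
    moreover have "(\<lambda>n. N (s (Suc n) - x)) \<longlonglongrightarrow> 0" using x(2) by (rule LIMSEQ_Suc)
    ultimately have "x = y + G x"
      using x y by (intro N_limit_unique[of "\<lambda>n. s (Suc n)"] sX X_add bopD(2)[OF G]) auto
    then show ?thesis using x(1) by (intro bexI[of _ x]) (auto simp: algebra_simps)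
  qed
  define r where "r y = (THE x. x \<in> X \<and> x - G x = y)" for y
  have r: "r y \<in> X" "r y - G (r y) = y" if "y \<in> X" for y
  proof -
    have "\<exists>!x. x \<in> X \<and> x - G x = y" using ex[OF that] inj by blast
    from theI'[OF this] show "r y \<in> X" "r y - G (r y) = y" by (auto simp: r_def)
  qed
  have r_eq: "r (x - G x) = x" if "x \<in> X" for x
    using inj[OF _ that] r[OF X_diff[OF that bopD(2)[OF G that]]] by blast
  have "\<exists>R. linear R \<and> (\<forall>x\<in>X. R x = r x)"
  proof (rule linear_extension[OF sub])
    show "r (x + y) = r x + r y" if "x \<in> X" "y \<in> X" for x y
    proof (rule inj)
      have "r x + r y - G (r x + r y) = (r x - G (r x)) + (r y - G (r y))" by (simp add: linear_add[OF lin])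
      then show "r (x + y) - G (r (x + y)) = r x + r y - G (r x + r y)"
        using r(2)[OF that(1)] r(2)[OF that(2)] r(2)[OF X_add[OF that]] by simp
    qed (use r that X_add in auto)
    show "r (c *\<^sub>R x) = c *\<^sub>R r x" if "x \<in> X" for c x
    proof (rule inj)
      show "r (c *\<^sub>R x) - G (r (c *\<^sub>R x)) = c *\<^sub>R r x - G (c *\<^sub>R r x)"
        using r(2)[OF that] r(2)[OF X_scale[OF that, of c]]
        by (simp add: linear_scale[OF lin] scaleR_diff_right[symmetric])
    qed (use r that X_scale in auto)
  qed
  then obtain R where R: "linear R" "\<And>x. x \<in> X \<Longrightarrow> R x = r x" by blast
  have RN: "N (R x) \<le> N x / (1 - q)" if x: "x \<in> X" for x
  proof -
    have "N (r x) \<le> N x + N (G (r x))"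
      using N_tri[OF x bopD(2)[OF G r(1)[OF x]]] r(2)[OF x] by (metis diff_add_cancel)
    also have "\<dots> \<le> N x + q * N (r x)" using bd[OF r(1)[OF x]] by simp
    finally show ?thesis using q R(2)[OF x] by (simp add: field_simps)
  qed
  have "bop R" by (rule bopI[of _ "1 / (1 - q)"]) (use R r RN q in auto)
  then show ?thesis using R(2) r r_eq RN X_diff bopD(2)[OF G] by (intro exI[of _ R]) auto
qed

definition inv_op :: "('a \<Rightarrow> 'a) \<Rightarrow> bool" where
  "inv_op V \<longleftrightarrow> bop V \<and> (\<exists>V'. bop V' \<and> (\<forall>x\<in>X. V' (V x) = x \<and> V (V' x) = x))"

definition frank :: "('a \<Rightarrow> 'a) \<Rightarrow> bool" where
  "frank G \<longleftrightarrow> bop G \<and> (\<exists>B. finite B \<and> B \<subseteq> X \<and> G ` X \<subseteq> span B)"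

text \<open>By the theory of Fredholm operators this characterises the index \<open>0\<close>.\<close>

definition index0 :: "('a \<Rightarrow> 'a) \<Rightarrow> bool" where
  "index0 T \<longleftrightarrow> (\<exists>V G. inv_op V \<and> frank G \<and> (\<forall>x\<in>X. T x = V x + G x))"

lemma frank_bop: "frank G \<Longrightarrow> bop G" by (simp add: frank_def)

lemma frank_add:
  assumes "frank G" "frank H" shows "frank (\<lambda>x. G x + H x)"
proof -
  obtain B C where B: "finite B" "B \<subseteq> X" "G ` X \<subseteq> span B" and C: "finite C" "C \<subseteq> X" "H ` X \<subseteq> span C"
    using assms by (auto simp: frank_def)
  have "(\<lambda>x. G x + H x) ` X \<subseteq> span (B \<union> C)"
    using B(3) C(3) span_mono[of B "B \<union> C"] span_mono[of C "B \<union> C"] by (auto intro!: span_add)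
  then show ?thesis using B C assms bop_add unfolding frank_def by (metis Un_least finite_UnI)
qed

lemma frank_comp_left:
  assumes A: "bop A" and G: "frank G" shows "frank (\<lambda>x. A (G x))"
proof -
  obtain B where B: "finite B" "B \<subseteq> X" "G ` X \<subseteq> span B" using G by (auto simp: frank_def)
  have "A (G x) \<in> span (A ` B)" if "x \<in> X" for x
    unfolding linear_span_image[OF bopD(1)[OF A]] using B(3) that by blast
  moreover have "A ` B \<subseteq> X" using B(2) bopD(2)[OF A] by blast
  ultimately show ?thesis
    unfolding frank_def using B(1) bop_comp[OF A frank_bop[OF G]] by (intro conjI exI[of _ "A ` B"]) auto
qed

lemma frank_comp_right:
  assumes G: "frank G" and A: "bop A" shows "frank (\<lambda>x. G (A x))"
proof -
  obtain B where B: "finite B" "B \<subseteq> X" "G ` X \<subseteq> span B" using G by (auto simp: frank_def)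
  have "G (A x) \<in> span B" if "x \<in> X" for x using B(3) bopD(2)[OF A that] by blast
  then show ?thesis
    unfolding frank_def using B(1,2) bop_comp[OF frank_bop[OF G] A] by (intro conjI exI[of _ B]) auto
qed

lemma frank_scale: "frank G \<Longrightarrow> frank (\<lambda>x. c *\<^sub>R G x)"
  using frank_comp_left[OF bop_scale[OF bop_id]] by simp

text \<open>The index is constant along the segment from the identity to \<open>I + Q\<close>. Each \<open>I + s Q\<close> has the right
  parametrix \<open>R = (I - s Q) (I - s\<^sup>2 E)\<^sup>-\<^sup>1\<close>, bounded uniformly in \<open>s\<close>. If a nearby \<open>I + s' Q\<close> is an
  invertible operator plus a finite-rank one, then so is \<open>R\<close>, and hence \<open>I + s Q\<close>.\<close>

lemma index0_of_square:
  assumes Q: "bop Q" and E: "bop E" and Fk: "frank Fk"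
    and dec: "\<And>x. x \<in> X \<Longrightarrow> Q (Q x) = E x + Fk x" and small: "\<And>x. x \<in> X \<Longrightarrow> N (E x) \<le> 1 / 2 * N x"
  shows "index0 (\<lambda>x. x + Q x)"
proof -
  note lQ = bopD(1)[OF Q] and lE = bopD(1)[OF E] and lF = bopD(1)[OF frank_bop[OF Fk]]
  obtain CQ where CQ: "CQ \<ge> 0" "\<forall>x\<in>X. N (Q x) \<le> CQ * N x" using bopD(3)[OF Q] by blast
  \<comment> \<open>The steps \<open>1 / n\<close> are so short that \<open>(s' - s) Q R\<close> has norm at most \<open>1 / 2\<close>, for the bound
    \<open>2 (1 + CQ)\<close> of \<open>R\<close>.\<close>
  obtain n :: nat where n: "n > 0" "CQ * (2 * (1 + CQ)) / real n \<le> 1 / 2"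
  proof -
    obtain k :: nat where k: "real k > 2 * (CQ * (2 * (1 + CQ)))" using reals_Archimedean2 by blast
    then have "real k > 0" using CQ(1) by (smt (verit) mult_nonneg_nonneg)
    then show ?thesis using k by (intro that[of k]) (auto simp: field_simps)
  qed
  have step: "index0 (\<lambda>x. x + s' *\<^sub>R Q x)"
    if I: "index0 (\<lambda>x. x + s *\<^sub>R Q x)" and s: "0 \<le> s'" "s' \<le> 1" "s' - s = 1 / real n" for s s'
  proof -
    have sq: "0 \<le> s'\<^sup>2" "s'\<^sup>2 \<le> 1" using s by (auto intro: power_le_one)
    have smallE: "N (s'\<^sup>2 *\<^sub>R E x) \<le> 1 / 2 * N x" if "x \<in> X" for x
    proof -
      have "N (s'\<^sup>2 *\<^sub>R E x) = s'\<^sup>2 * N (E x)" using N_scale[OF bopD(2)[OF E that]] sq by simp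
      also have "\<dots> \<le> 1 * (1 / 2 * N x)" using sq small[OF that] N_ge0[OF bopD(2)[OF E that]] by (intro mult_mono) auto
      finally show ?thesis by simp
    qed
    obtain Bi where Bi: "bop Bi" "\<forall>x\<in>X. Bi (x - s'\<^sup>2 *\<^sub>R E x) = x \<and> Bi x - s'\<^sup>2 *\<^sub>R E (Bi x) = x \<and> N (Bi x) \<le> N x / (1 - 1 / 2)"
      using neumann[OF bop_scale[OF E] _ _ smallE] by force
    define R where "R x = Bi x - s' *\<^sub>R Q (Bi x)" for x
    have R: "bop R" unfolding R_def[abs_def] by (intro bop_diff bop_scale bop_comp[OF Q] Bi)
    note lR = bopD(1)[OF R]
    have RN: "N (R x) \<le> 2 * (1 + CQ) * N x" if x: "x \<in> X" for x
    proof -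
      have b: "Bi x \<in> X" by (rule bopD(2)[OF Bi(1) x])
      have "N (R x) \<le> N (Bi x) + N (s' *\<^sub>R Q (Bi x))"
        unfolding R_def by (intro N_diff_tri X_scale b bopD(2)[OF Q])
      also have "N (s' *\<^sub>R Q (Bi x)) \<le> 1 * (CQ * N (Bi x))"
      proof -
        have "N (s' *\<^sub>R Q (Bi x)) = s' * N (Q (Bi x))" using N_scale[OF bopD(2)[OF Q b], of s'] s(1) by simp
        also have "\<dots> \<le> 1 * (CQ * N (Bi x))"
          by (intro mult_mono s) (use CQ b N_ge0[OF bopD(2)[OF Q b]] in auto)
        finally show ?thesis .
      qed
      also have "N (Bi x) + 1 * (CQ * N (Bi x)) = (1 + CQ) * N (Bi x)" by (simp add: algebra_simps)
      also have "\<dots> \<le> (1 + CQ) * (2 * N x)" using Bi(2) x CQ(1) by (intro mult_left_mono) auto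
      finally show ?thesis by (simp add: mult_ac)
    qed
    define F1 where "F1 x = s'\<^sup>2 *\<^sub>R Fk (Bi x)" for x
    have F1: "frank F1" unfolding F1_def[abs_def] by (intro frank_scale frank_comp_right[OF Fk] Bi)
    have TR: "R x + s' *\<^sub>R Q (R x) = x - F1 x" if x: "x \<in> X" for x
    proof -
      have b: "Bi x \<in> X" by (rule bopD(2)[OF Bi(1) x])
      have "R x + s' *\<^sub>R Q (R x) = Bi x - s'\<^sup>2 *\<^sub>R Q (Q (Bi x))"
        by (simp add: R_def linear_diff[OF lQ] linear_scale[OF lQ] algebra_simps power2_eq_square)
      also have "\<dots> = (Bi x - s'\<^sup>2 *\<^sub>R E (Bi x)) - F1 x" using dec[OF b] by (simp add: F1_def algebra_simps)
      finally show ?thesis using Bi(2) x by simp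
    qed
    have small2: "N ((s' - s) *\<^sub>R Q (R x)) \<le> 1 / 2 * N x" if x: "x \<in> X" for x
    proof -
      have "N ((s' - s) *\<^sub>R Q (R x)) = 1 / real n * N (Q (R x))"
        using N_scale[OF bopD(2)[OF Q bopD(2)[OF R x]], of "s' - s"] s(3) n by simp
      also have "\<dots> \<le> 1 / real n * (CQ * (2 * (1 + CQ) * N x))"
      proof (rule mult_left_mono)
        have "N (Q (R x)) \<le> CQ * N (R x)" using CQ bopD(2)[OF R x] by blast
        also have "\<dots> \<le> CQ * (2 * (1 + CQ) * N x)" by (intro mult_left_mono RN x CQ)
        finally show "N (Q (R x)) \<le> CQ * (2 * (1 + CQ) * N x)" .
      qed simp
      also have "\<dots> = CQ * (2 * (1 + CQ)) / real n * N x" by simp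
      also have "\<dots> \<le> 1 / 2 * N x" by (intro mult_right_mono n N_ge0 x)
      finally show ?thesis .
    qed
    obtain Ci where Ci: "bop Ci" "\<forall>x\<in>X. Ci (x - (s' - s) *\<^sub>R Q (R x)) = x \<and> Ci x - (s' - s) *\<^sub>R Q (R (Ci x)) = x"
      using neumann[OF bop_scale[OF bop_comp[OF Q R]] _ _ small2] by force
    obtain V G where V: "inv_op V" and G: "frank G" and VG: "\<forall>x\<in>X. x + s *\<^sub>R Q x = V x + G x"
      using I by (auto simp: index0_def)
    obtain V' where bV: "bop V" and V': "bop V'" "\<forall>x\<in>X. V' (V x) = x \<and> V (V' x) = x"
      using V by (auto simp: inv_op_def)
    note lV' = bopD(1)[OF V'(1)]
    define Wi where "Wi x = Ci (V x)" for x
    define Wo where "Wo x = V' (x - (s' - s) *\<^sub>R Q (R x))" for x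
    define F5 where "F5 x = V' (F1 x + G (R x))" for x
    have Wi: "bop Wi" unfolding Wi_def[abs_def] by (rule bop_comp[OF Ci(1) bV])
    have Wo: "bop Wo" unfolding Wo_def[abs_def] by (intro bop_comp[OF V'(1)] bop_diff bop_id bop_scale bop_comp[OF Q R])
    have F5: "frank F5" unfolding F5_def[abs_def] by (intro frank_comp_left[OF V'(1)] frank_add F1 frank_comp_right[OF G] R)
    have WW: "Wo (Wi x) = x" "Wi (Wo x) = x" if x: "x \<in> X" for x
    proof -
      have "V x \<in> X" by (rule bopD(2)[OF bV x])
      then show "Wo (Wi x) = x" using Ci(2) V'(2) x by (simp add: Wo_def Wi_def)
      have "x - (s' - s) *\<^sub>R Q (R x) \<in> X" by (intro X_diff X_scale bopD(2)[OF Q] bopD(2)[OF R] x)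
      then show "Wi (Wo x) = x" using Ci(2) V'(2) x by (simp add: Wo_def Wi_def)
    qed
    have Rdec: "R x = Wo x - F5 x" if x: "x \<in> X" for x
    proof -
      have Rx: "R x \<in> X" by (rule bopD(2)[OF R x])
      have "V (R x) + G (R x) = R x + s *\<^sub>R Q (R x)" using VG Rx by simp
      also have "\<dots> = x - F1 x - (s' - s) *\<^sub>R Q (R x)" using TR[OF x] by (simp add: algebra_simps)
      finally have "V (R x) = (x - (s' - s) *\<^sub>R Q (R x)) - (F1 x + G (R x))" by (simp add: algebra_simps)
      then have "V' (V (R x)) = Wo x - F5 x" by (simp add: Wo_def F5_def linear_diff[OF lV'])
      then show ?thesis using V'(2) Rx by simp
    qed
    define H where "H x = F5 (Wi x) + s' *\<^sub>R Q (F5 (Wi x)) + (- 1) *\<^sub>R F1 (Wi x)" for x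
    have H: "frank H" unfolding H_def[abs_def]
      by (intro frank_add frank_scale frank_comp_left[OF Q] frank_comp_right[OF F5] frank_comp_right[OF F1] Wi)
    have "x + s' *\<^sub>R Q x = Wi x + H x" if x: "x \<in> X" for x
    proof -
      have w: "Wi x \<in> X" by (rule bopD(2)[OF Wi x])
      have "R (Wi x) + F5 (Wi x) = x" using Rdec[OF w] WW(1)[OF x] by simp
      then have "x + s' *\<^sub>R Q x = (R (Wi x) + F5 (Wi x)) + s' *\<^sub>R Q (R (Wi x) + F5 (Wi x))" by simp
      also have "\<dots> = (R (Wi x) + s' *\<^sub>R Q (R (Wi x))) + (F5 (Wi x) + s' *\<^sub>R Q (F5 (Wi x)))"
        by (simp add: linear_add[OF lQ] scaleR_add_right)
      finally have "x + s' *\<^sub>R Q x = (R (Wi x) + s' *\<^sub>R Q (R (Wi x))) + (F5 (Wi x) + s' *\<^sub>R Q (F5 (Wi x)))" .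
      then show ?thesis using TR[OF w] by (simp add: H_def algebra_simps)
    qed
    moreover have "inv_op Wi" unfolding inv_op_def
      using WW by (intro conjI Wi exI[of _ Wo] Wo ballI) auto
    ultimately show ?thesis unfolding index0_def
      using H by (intro exI[of _ Wi] exI[of _ H]) auto
  qed
  have "index0 (\<lambda>x. x + (real k / real n) *\<^sub>R Q x)" if "k \<le> n" for k
    using that
  proof (induction k)
    case 0
    have "inv_op (\<lambda>x. x)" unfolding inv_op_def using bop_id by blast
    moreover have "frank (\<lambda>x. 0)"
      unfolding frank_def by (intro conjI bopI[of _ 0] exI[of _ "{}"]) (auto simp: X_0 linear_0 module_hom_zero)
    ultimately show ?case unfolding index0_def by (intro exI[of _ "\<lambda>x. x"] exI[of _ "\<lambda>x. 0"]) auto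
  next
    case (Suc k)
    show ?case
      by (rule step[OF Suc.IH]) (use Suc.prems n in \<open>auto simp: diff_divide_distrib[symmetric]\<close>)
  qed
  from this[of n] show ?thesis using n by simp
qed

end

context banach_carrier
begin

definition closedX :: "'a set \<Rightarrow> bool" where
  "closedX Y \<longleftrightarrow> (\<forall>s x. (\<forall>n::nat. s n \<in> Y) \<longrightarrow> x \<in> X \<longrightarrow> (\<lambda>n. N (s n - x)) \<longlonglongrightarrow> 0 \<longrightarrow> x \<in> Y)"

lemma closedXD: "closedX Y \<Longrightarrow> (\<And>n::nat. s n \<in> Y) \<Longrightarrow> x \<in> X \<Longrightarrow> (\<lambda>n. N (s n - x)) \<longlonglongrightarrow> 0 \<Longrightarrow> x \<in> Y"
  unfolding closedX_def by blast

lemma span_in_X: "B \<subseteq> X \<Longrightarrow> span B \<subseteq> X"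
  by (rule span_minimal[OF _ sub])

text \<open>Bounded coordinates make a convergent sequence in the span converge coordinatewise.\<close>

lemma closed_span:
  assumes B: "finite B" "B \<subseteq> X" and c: "\<And>g b. b \<in> B \<Longrightarrow> \<bar>g b\<bar> \<le> c * N (\<Sum>v\<in>B. g v *\<^sub>R v)" "c \<ge> 0"
  shows "closedX (span B)"
  unfolding closedX_def
proof (intro allI impI)
  fix s :: "nat \<Rightarrow> 'a" and x assume s: "\<forall>n. s n \<in> span B" and x: "x \<in> X" and lim: "(\<lambda>n. N (s n - x)) \<longlonglongrightarrow> 0"
  have "\<forall>n. \<exists>g. s n = (\<Sum>v\<in>B. g v *\<^sub>R v)" using s span_finite[OF B(1)] by auto
  then obtain g where g: "\<And>n. s n = (\<Sum>v\<in>B. g n v *\<^sub>R v)" by metis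
  have sX: "s n \<in> X" for n using s span_in_X[OF B(2)] by blast
  have conv: "\<exists>l. (\<lambda>n. g n b) \<longlonglongrightarrow> l" if b: "b \<in> B" for b
  proof -
    have "Cauchy (\<lambda>n. g n b)"
    proof (rule metric_CauchyI)
      fix e :: real assume e: "e > 0"
      define \<epsilon> where "\<epsilon> = e / (2 * (c + 1))"
      have \<epsilon>: "\<epsilon> > 0" using e c(2) by (simp add: \<epsilon>_def)
      obtain n0 where n0: "\<And>n. n \<ge> n0 \<Longrightarrow> N (s n - x) < \<epsilon>"
        using LIMSEQ_D[OF lim \<epsilon>] by force
      have "dist (g m b) (g n b) < e" if mn: "m \<ge> n0" "n \<ge> n0" for m n
      proof -
        have "\<bar>g m b - g n b\<bar> \<le> c * N (\<Sum>v\<in>B. (g m v - g n v) *\<^sub>R v)" by (rule c(1)[OF b])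
        also have "(\<Sum>v\<in>B. (g m v - g n v) *\<^sub>R v) = s m - s n"
          unfolding g by (simp add: sum_subtractf[symmetric] scaleR_left_diff_distrib)
        also have "c * N (s m - s n) \<le> c * (\<epsilon> + \<epsilon>)"
        proof (rule mult_left_mono[OF _ c(2)])
          have "N (s m - s n) \<le> N (s m - x) + N (s n - x)"
            using N_diff_tri[OF X_diff[OF sX[of m] x] X_diff[OF sX[of n] x]] by simp
          then show "N (s m - s n) \<le> \<epsilon> + \<epsilon>" using n0[OF mn(1)] n0[OF mn(2)] by linarith
        qed
        also have "\<dots> < (c + 1) * (\<epsilon> + \<epsilon>)" using \<epsilon> by simp
        also have "\<dots> = (2 * (c + 1)) * \<epsilon>" by (simp add: algebra_simps)
        also have "\<dots> = e" using c(2) by (simp only: \<epsilon>_def) simp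
        finally show ?thesis by (simp add: dist_real_def)
      qed
      then show "\<exists>M. \<forall>m\<ge>M. \<forall>n\<ge>M. dist (g m b) (g n b) < e" by blast
    qed
    then show ?thesis using Cauchy_convergent convergent_def by blast
  qed
  then obtain \<gamma> where \<gamma>: "\<And>b. b \<in> B \<Longrightarrow> (\<lambda>n. g n b) \<longlonglongrightarrow> \<gamma> b" by metis
  define y where "y = (\<Sum>v\<in>B. \<gamma> v *\<^sub>R v)"
  have y: "y \<in> span B" unfolding y_def by (intro span_sum span_scale span_base)
  have yX: "y \<in> X" using y span_in_X[OF B(2)] by blast
  have "(\<lambda>n. \<Sum>v\<in>B. \<bar>g n v - \<gamma> v\<bar> * N v) \<longlonglongrightarrow> (\<Sum>v\<in>B. 0 * N v)"
    by (intro tendsto_sum tendsto_mult tendsto_const tendsto_rabs_zero LIM_zero \<gamma>)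
  then have lim2: "(\<lambda>n. \<Sum>v\<in>B. \<bar>g n v - \<gamma> v\<bar> * N v) \<longlonglongrightarrow> 0" by simp
  have bound: "norm (N (s n - y)) \<le> (\<Sum>v\<in>B. \<bar>g n v - \<gamma> v\<bar> * N v)" for n
  proof -
    have "s n - y = (\<Sum>v\<in>B. (g n v - \<gamma> v) *\<^sub>R v)"
      unfolding g y_def by (simp add: sum_subtractf[symmetric] scaleR_left_diff_distrib)
    moreover have "N (\<Sum>v\<in>B. (g n v - \<gamma> v) *\<^sub>R v) \<le> (\<Sum>v\<in>B. N ((g n v - \<gamma> v) *\<^sub>R v))"
      by (rule N_sum) (use B(2) X_scale in blast)
    moreover have "(\<Sum>v\<in>B. N ((g n v - \<gamma> v) *\<^sub>R v)) = (\<Sum>v\<in>B. \<bar>g n v - \<gamma> v\<bar> * N v)"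
      by (rule sum.cong) (use B(2) N_scale in auto)
    ultimately show ?thesis using N_ge0[OF X_diff[OF sX[of n] yX]] by simp
  qed
  have "(\<lambda>n. N (s n - y)) \<longlonglongrightarrow> 0"
    by (rule Lim_null_comparison[OF always_eventually[OF allI[OF bound]] lim2])
  then have "x = y" by (rule N_limit_unique[OF sX x lim yX])
  then show "x \<in> span B" using y by simp
qed

text \<open>By induction on the dimension: the span of the other vectors is closed, hence has a
  positive distance from the new one, which bounds the coordinate of the new one.\<close>

lemma coords_bounded:
  assumes "finite B" "B \<subseteq> X" "independent B"
  shows "\<exists>c\<ge>0. \<forall>g. \<forall>b\<in>B. \<bar>g b\<bar> \<le> c * N (\<Sum>v\<in>B. g v *\<^sub>R v)"
  using assms
proof (induction B)
  case empty then show ?case by auto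
next
  case (insert b B)
  have B: "B \<subseteq> X" "b \<in> X" "independent B" "b \<notin> span B"
    using insert.prems insert.hyps independent_insert[of b B] by auto
  obtain c where c: "c \<ge> 0" "\<And>g v. v \<in> B \<Longrightarrow> \<bar>g v\<bar> \<le> c * N (\<Sum>v\<in>B. g v *\<^sub>R v)"
    using insert.IH B by blast
  have cl: "closedX (span B)" by (rule closed_span[OF insert.hyps(1) B(1) c(2,1)])
  have "\<exists>\<delta>>0. \<forall>y\<in>span B. \<delta> \<le> N (b - y)"
  proof (rule ccontr)
    assume "\<not> ?thesis"
    then have "\<forall>n::nat. \<exists>y\<in>span B. N (b - y) < 1 / real (Suc n)" by (meson not_le of_nat_0_less_iff zero_less_Suc zero_less_divide_1_iff)
    then obtain s where s: "\<And>n. s n \<in> span B" "\<And>n. N (b - s n) < 1 / real (Suc n)" by metis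
    have sX: "s n \<in> X" for n using s(1) span_in_X[OF B(1)] by blast
    have b1: "norm (N (s n - b)) \<le> 1 / real (Suc n)" for n
      using s(2)[of n] N_diff_commute[OF sX B(2)] N_ge0[OF X_diff[OF sX B(2)], of n] by simp
    have "(\<lambda>n. N (s n - b)) \<longlonglongrightarrow> 0"
      by (rule Lim_null_comparison[OF always_eventually[OF allI[OF b1]] LIMSEQ_inverse_real_of_nat[unfolded inverse_eq_divide]])
    then have "b \<in> span B" by (rule closedXD[OF cl s(1) B(2)])
    then show False using B(4) by simp
  qed
  then obtain \<delta> where \<delta>: "\<delta> > 0" "\<And>y. y \<in> span B \<Longrightarrow> \<delta> \<le> N (b - y)" by blast
  define C where "C = max (1 / \<delta>) (c * (1 + N b / \<delta>))"
  have "\<bar>g v\<bar> \<le> C * N (\<Sum>v\<in>insert b B. g v *\<^sub>R v)" if v: "v \<in> insert b B" for g v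
  proof -
    define S' where "S' = (\<Sum>v\<in>B. g v *\<^sub>R v)"
    define S where "S = g b *\<^sub>R b + S'"
    have sum_eq: "(\<Sum>v\<in>insert b B. g v *\<^sub>R v) = S"
      using insert.hyps by (simp add: S_def S'_def)
    have S': "S' \<in> span B" unfolding S'_def by (intro span_sum span_scale span_base)
    then have S'X: "S' \<in> X" using span_in_X[OF B(1)] by blast
    have SX: "S \<in> X" unfolding S_def by (intro X_add X_scale B(2) S'X)
    have gb: "\<bar>g b\<bar> * \<delta> \<le> N S"
    proof (cases "g b = 0")
      case True then show ?thesis using N_ge0[OF SX] by simp
    next
      case False
      define y where "y = (- (1 / g b)) *\<^sub>R S'"
      have y: "y \<in> span B" unfolding y_def by (rule span_scale[OF S'])
      have "S = g b *\<^sub>R (b - y)" using False by (simp add: S_def y_def scaleR_add_right)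
      then have "N S = \<bar>g b\<bar> * N (b - y)"
        using N_scale[OF X_diff[OF B(2), of y], of "g b"] y span_in_X[OF B(1)] by auto
      then show ?thesis using \<delta>(2)[OF y] by (simp add: mult_left_mono)
    qed
    have gb': "\<bar>g b\<bar> \<le> 1 / \<delta> * N S" using gb \<delta>(1) by (simp add: field_simps)
    have "N S' \<le> (1 + N b / \<delta>) * N S"
    proof -
      have "S' = S - g b *\<^sub>R b" by (simp add: S_def)
      then have "N S' \<le> N S + N (g b *\<^sub>R b)" using N_diff_tri[OF SX X_scale[OF B(2)], of "g b"] by simp
      also have "N (g b *\<^sub>R b) = \<bar>g b\<bar> * N b" by (rule N_scale[OF B(2)])
      also have "\<dots> \<le> (1 / \<delta> * N S) * N b" by (rule mult_right_mono[OF gb' N_ge0[OF B(2)]])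
      finally show ?thesis by (simp add: algebra_simps)
    qed
    then have gS: "c * N S' \<le> c * ((1 + N b / \<delta>) * N S)" by (rule mult_left_mono[OF _ c(1)])
    show ?thesis unfolding sum_eq
    proof (cases "v = b")
      case True
      have "1 / \<delta> * N S \<le> C * N S" unfolding C_def by (intro mult_right_mono N_ge0 SX) auto
      then show "\<bar>g v\<bar> \<le> C * N S" using order_trans[OF gb'] True by simp
    next
      case False
      then have "\<bar>g v\<bar> \<le> c * N S'" using c(2)[of v g] v by (simp add: S'_def)
      also have "\<dots> \<le> (c * (1 + N b / \<delta>)) * N S" using gS by (simp add: mult.assoc)
      also have "\<dots> \<le> C * N S" unfolding C_def by (intro mult_right_mono N_ge0 SX) auto
      finally show "\<bar>g v\<bar> \<le> C * N S" .
    qed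
  qed
  moreover have "0 \<le> C" using \<delta>(1) unfolding C_def by (intro max.coboundedI1) simp
  ultimately show ?case by (intro exI[of _ C]) auto
qed

lemma closed_finite_span: "finite B \<Longrightarrow> B \<subseteq> X \<Longrightarrow> independent B \<Longrightarrow> closedX (span B)"
  using coords_bounded[of B] closed_span[of B] by blast

text \<open>The properties of an operator of index zero: a basis of its kernel, a basis of a complement of
  its closed range with as many elements, and boundedness of the inverse if there is one.\<close>

definition fredholm0 :: "('a \<Rightarrow> 'a) \<Rightarrow> 'a set \<Rightarrow> 'a set \<Rightarrow> bool" where
  "fredholm0 T K C \<longleftrightarrow> finite K \<and> independent K \<and> span K = {x\<in>X. T x = 0} \<and>
     quotient_basis (T ` X) X C \<and> card C = card K \<and> closedX (T ` X) \<and>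
     (K = {} \<longrightarrow> T ` X = X \<and> (\<exists>c\<ge>0. \<forall>x\<in>X. N x \<le> c * N (T x)))"

text \<open>For \<open>I + H\<close> with \<open>H\<close> of finite rank everything happens in the finite-dimensional space \<open>Y\<close> that
  contains the range of \<open>H\<close>: it contains the kernel, it is invariant, and \<open>y\<close> is in the range of \<open>I + H\<close>
  iff \<open>H y\<close> is in the image of \<open>Y\<close>.\<close>

lemma fredholm0_frank:
  assumes H: "frank H"
  shows "\<exists>K C. fredholm0 (\<lambda>x. x + H x) K C"
proof -
  define S where "S x = x + H x" for x
  note bH = frank_bop[OF H]
  note lH = bopD(1)[OF bH]
  have bS: "bop S" unfolding S_def[abs_def] by (rule bop_add[OF bop_id bH])
  note lS = bopD(1)[OF bS]
  obtain B where B: "finite B" "B \<subseteq> X" "H ` X \<subseteq> span B" using H by (auto simp: frank_def)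
  define Y where "Y = span B"
  have YX: "Y \<subseteq> X" unfolding Y_def by (rule span_in_X[OF B(2)])
  have subY: "subspace Y" unfolding Y_def by (rule subspace_span)
  have HY: "H x \<in> Y" if "x \<in> X" for x using B(3) that by (auto simp: Y_def)
  have SY: "S y \<in> Y" if "y \<in> Y" for y
    unfolding S_def using subspace_add[OF subY that HY] that YX by blast
  define Kr where "Kr = {x\<in>X. S x = 0}"
  have KrY: "Kr \<subseteq> Y"
  proof
    fix x assume x: "x \<in> Kr"
    then have "x = - H x" by (simp add: Kr_def S_def eq_neg_iff_add_eq_0)
    then show "x \<in> Y" using HY[of x] x subspace_neg[OF subY, of "H x"] by (simp add: Kr_def)
  qed
  have subKr: "subspace Kr"
    unfolding subspace_def Kr_def
    by (auto simp: X_0 X_add X_scale linear_0[OF lS] linear_add[OF lS] linear_scale[OF lS])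
  obtain K0 where K0: "K0 \<subseteq> Kr" "independent K0" "Kr \<subseteq> span K0"
    using maximal_independent_subset[of Kr] by blast
  have spK0: "span K0 = Kr" using K0(3) span_minimal[OF K0(1) subKr] by blast
  obtain KB where KB: "K0 \<subseteq> KB" "KB \<subseteq> Y" "independent KB" "Y \<subseteq> span KB"
    using maximal_independent_subset_extend[OF order_trans[OF K0(1) KrY] K0(2)] by blast
  have finKB: "finite KB" using independent_span_bound[OF B(1) KB(3)] KB(2) by (simp add: Y_def)
  have spKB: "span KB = Y" using KB(4) span_minimal[OF KB(2) subY] by blast
  define K1 where "K1 = KB - K0"
  have K1: "finite K1" "K1 \<subseteq> Y" "independent K1"
    using finKB KB(2) independent_mono[OF KB(3), of K1] by (auto simp: K1_def)
  have K1Y: "span K1 \<subseteq> Y" by (rule span_minimal[OF K1(2) subY])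
  have zero: "x = 0" if "x \<in> span K1" "S x = 0" for x
  proof (rule span_Int_span[OF KB(3) finKB KB(1)])
    show "x \<in> span K0" unfolding spK0 Kr_def using that K1Y YX by blast
    show "x \<in> span (KB - K0)" using that by (simp add: K1_def)
  qed
  have inj: "inj_on S (span K1)"
  proof (rule inj_onI)
    fix x y assume xy: "x \<in> span K1" "y \<in> span K1" "S x = S y"
    have "x - y = 0" by (rule zero[OF span_diff[OF xy(1,2)]]) (simp add: linear_diff[OF lS] xy(3))
    then show "x = y" by simp
  qed
  have injK1: "inj_on S K1" by (rule inj_on_subset[OF inj span_superset])
  have ind: "independent (S ` K1)" by (rule linear_independent_injective_image[OF lS K1(3) inj])
  have SK1Y: "S ` K1 \<subseteq> Y" using SY K1(2) by blast
  obtain D where D: "S ` K1 \<subseteq> D" "D \<subseteq> Y" "independent D" "Y \<subseteq> span D"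
    using maximal_independent_subset_extend[OF SK1Y ind] by blast
  have D': "finite D" "card D \<le> card KB"
    using independent_span_bound[OF finKB D(3)] D(2) spKB by auto
  have "card KB \<le> card D" using independent_span_bound[OF D'(1) KB(3)] KB(2) D(4) by auto
  then have cardD: "card D = card KB" using D'(2) by simp
  have spD: "span D = Y" using D(4) span_minimal[OF D(2) subY] by blast
  define C where "C = D - S ` K1"
  have finC: "finite C" and CY: "C \<subseteq> Y" using D'(1) D(2) by (auto simp: C_def)
  have cardC: "card C = card K0"
  proof -
    have "card C = card D - card (S ` K1)" unfolding C_def by (rule card_Diff_subset) (use K1(1) D(1) in auto)
    also have "card (S ` K1) = card K1" by (rule card_image[OF injK1])
    also have "card K1 = card KB - card K0" unfolding K1_def
      by (rule card_Diff_subset) (use finKB KB(1) finite_subset in auto)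
    finally show ?thesis using cardD card_mono[OF finKB KB(1)] by simp
  qed
  have split: "\<exists>k x1. y = k + x1 \<and> k \<in> Kr \<and> x1 \<in> span K1" if "y \<in> Y" for y
  proof -
    have "KB = K0 \<union> K1" using KB(1) by (auto simp: K1_def)
    then have "y \<in> {a + b |a b. a \<in> span K0 \<and> b \<in> span K1}" using that spKB span_Un[of K0 K1] by simp
    then show ?thesis using spK0 by blast
  qed
  have SYspan: "S y \<in> span (S ` K1)" if y: "y \<in> Y" for y
  proof -
    obtain k x1 where "y = k + x1" "k \<in> Kr" "x1 \<in> span K1" using split[OF y] by blast
    then show ?thesis unfolding linear_span_image[OF lS] by (simp add: linear_add[OF lS] Kr_def)
  qed
  have spanSY: "span (S ` K1) \<subseteq> S ` Y"
    unfolding linear_span_image[OF lS] using K1Y by blast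
  have range_iff: "y \<in> S ` X \<longleftrightarrow> H y \<in> span (S ` K1)" if y: "y \<in> X" for y
  proof
    assume "y \<in> S ` X"
    then obtain x where x: "x \<in> X" "y = S x" by blast
    have "H y = S (H x)" unfolding x(2) S_def by (simp add: linear_add[OF lH])
    then show "H y \<in> span (S ` K1)" using SYspan[OF HY[OF x(1)]] by simp
  next
    assume "H y \<in> span (S ` K1)"
    then obtain z where z: "z \<in> Y" "H y = S z" using spanSY by blast
    have "S (y - z) = y + H y - S z" using linear_diff[OF lS, of y z] by (simp add: S_def)
    then have "y = S (y - z)" using z(2) by simp
    moreover have "y - z \<in> X" using X_diff[OF y] z(1) YX by blast
    ultimately show "y \<in> S ` X" by blast
  qed
  have closed: "closedX (S ` X)"
    unfolding closedX_def
  proof (intro allI impI)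
    fix s :: "nat \<Rightarrow> 'a" and x assume s: "\<forall>n. s n \<in> S ` X" and x: "x \<in> X" and lim: "(\<lambda>n. N (s n - x)) \<longlonglongrightarrow> 0"
    have sX: "s n \<in> X" for n
    proof -
      obtain y where "y \<in> X" "s n = S y" using s by blast
      then show ?thesis using bopD(2)[OF bS, of y] by simp
    qed
    have cl: "closedX (span (S ` K1))"
      by (rule closed_finite_span) (use K1(1) SK1Y YX ind in auto)
    have "H x \<in> span (S ` K1)"
    proof (rule closedXD[OF cl _ bopD(2)[OF bH x] bop_tendsto[OF bH sX x lim]])
      show "H (s n) \<in> span (S ` K1)" for n using s range_iff[OF sX[of n]] by simp
    qed
    then show "x \<in> S ` X" using range_iff[OF x] by blast
  qed
  have subR: "subspace (S ` X)" by (rule linear_subspace_image[OF lS sub])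
  have qb: "quotient_basis (S ` X) X C"
    unfolding quotient_basis_def
  proof (intro conjI ballI allI impI)
    show "finite C" by (rule finC)
    show "C \<subseteq> X" using CY YX by blast
    fix w assume w: "w \<in> X"
    have "- H w \<in> span (S ` K1 \<union> C)"
    proof -
      have "S ` K1 \<union> C = D" using D(1) by (auto simp: C_def)
      then show ?thesis using HY[OF w] spD subspace_neg[OF subY] by simp
    qed
    then obtain a c where ac: "- H w = a + c" "a \<in> span (S ` K1)" "c \<in> span C"
      unfolding span_Un by blast
    obtain g where g: "c = (\<Sum>v\<in>C. g v *\<^sub>R v)" using ac(3) span_finite[OF finC] by auto
    have "w - c = S w + a" using ac(1) by (simp add: S_def algebra_simps eq_neg_iff_add_eq_0 neg_eq_iff_add_eq_0)
    moreover have "S w + a \<in> S ` X"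
      using subspace_add[OF subR imageI[OF w]] ac(2) spanSY YX by blast
    ultimately show "\<exists>g. w - (\<Sum>v\<in>C. g v *\<^sub>R v) \<in> S ` X"
      unfolding g by (intro exI[of _ g]) simp
  next
    fix g v assume "(\<Sum>v\<in>C. g v *\<^sub>R v) \<in> S ` X" and v: "v \<in> C"
    then obtain x where x: "x \<in> X" "(\<Sum>v\<in>C. g v *\<^sub>R v) = S x" by blast
    have sC: "(\<Sum>v\<in>C. g v *\<^sub>R v) \<in> span C" by (intro span_sum span_scale span_base)
    have "span C \<subseteq> Y" by (rule span_minimal[OF CY subY])
    then have "S x \<in> Y" using sC x(2) by auto
    then have "x \<in> Y" using subspace_diff[OF subY _ HY[OF x(1)], of "S x"] by (simp add: S_def)
    from SYspan[OF this] have "(\<Sum>v\<in>C. g v *\<^sub>R v) = 0"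
      using sC x(2) by (intro span_Int_span[OF D(3) D'(1) D(1)]) (auto simp: C_def)
    then show "g v = 0"
      using independentD[OF independent_mono[OF D(3)] finC order_refl _ v, of g] by (auto simp: C_def)
  qed
  have inv: "S ` X = X \<and> (\<exists>c\<ge>0. \<forall>x\<in>X. N x \<le> c * N (S x))" if "K0 = {}"
  proof
    have "C = {}" using cardC finC that by simp
    then show "S ` X = X" using qb bopD(2)[OF bS] by (auto simp: quotient_basis_def)
    have KBK1: "KB = K1" using that by (simp add: K1_def)
    obtain c where c: "c \<ge> 0" "\<And>g b. b \<in> S ` K1 \<Longrightarrow> \<bar>g b\<bar> \<le> c * N (\<Sum>v\<in>S ` K1. g v *\<^sub>R v)"
      using coords_bounded[of "S ` K1"] K1(1) SK1Y YX ind by blast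
    obtain CH where CH: "CH \<ge> 0" "\<forall>x\<in>X. N (H x) \<le> CH * N x" using bopD(3)[OF bH] by blast
    define A where "A = (\<Sum>v\<in>K1. N v)"
    have A: "A \<ge> 0" unfolding A_def by (intro sum_nonneg N_ge0) (use K1(2) YX in blast)
    have bound: "N x \<le> (1 + c * CH * A) * N (S x)" if x: "x \<in> X" for x
    proof -
      have Sx: "S x \<in> X" by (rule bopD(2)[OF bS x])
      have Hx: "H x \<in> span K1" using HY[OF x] spKB KBK1 by simp
      obtain g where g: "H x = (\<Sum>v\<in>K1. g v *\<^sub>R v)" using Hx span_finite[OF K1(1)] by auto
      define g' where "g' w = g (inv_into K1 S w)" for w
      have "H (S x) = S (H x)" unfolding S_def by (simp add: linear_add[OF lH])
      also have "\<dots> = (\<Sum>v\<in>K1. g v *\<^sub>R S v)" unfolding g by (simp add: linear_sum[OF lS] linear_scale[OF lS])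
      also have "\<dots> = (\<Sum>w\<in>S ` K1. g' w *\<^sub>R w)"
        unfolding sum.reindex[OF injK1] by (rule sum.cong) (auto simp: g'_def inv_into_f_f[OF injK1])
      finally have HS: "H (S x) = (\<Sum>w\<in>S ` K1. g' w *\<^sub>R w)" .
      have gv: "\<bar>g v\<bar> \<le> c * (CH * N (S x))" if v: "v \<in> K1" for v
      proof -
        have "\<bar>g' (S v)\<bar> \<le> c * N (H (S x))" unfolding HS by (rule c(2)) (use v in blast)
        also have "\<dots> \<le> c * (CH * N (S x))" using CH Sx by (intro mult_left_mono c) auto
        finally show ?thesis using v by (simp add: g'_def inv_into_f_f[OF injK1])
      qed
      have "N (H x) \<le> (\<Sum>v\<in>K1. N (g v *\<^sub>R v))" unfolding g by (rule N_sum) (use K1(2) YX X_scale in blast)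
      also have "\<dots> \<le> (\<Sum>v\<in>K1. c * (CH * N (S x)) * N v)"
      proof (rule sum_mono)
        fix v assume v: "v \<in> K1"
        then have vX: "v \<in> X" using K1(2) YX by blast
        show "N (g v *\<^sub>R v) \<le> c * (CH * N (S x)) * N v"
          unfolding N_scale[OF vX] by (rule mult_right_mono[OF gv[OF v] N_ge0[OF vX]])
      qed
      also have "\<dots> = c * CH * A * N (S x)" by (simp add: A_def sum_distrib_left mult_ac)
      finally have HN: "N (H x) \<le> c * CH * A * N (S x)" .
      have "N x \<le> N (S x) + N (H x)"
        using N_diff_tri[OF Sx bopD(2)[OF bH x]] by (simp add: S_def)
      then show ?thesis using HN by (simp add: algebra_simps)
    qed
    show "\<exists>c\<ge>0. \<forall>x\<in>X. N x \<le> c * N (S x)"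
      by (intro exI[of _ "1 + c * CH * A"] conjI ballI bound) (use c(1) CH(1) A in simp)
  qed
  have "fredholm0 S K0 C"
    unfolding fredholm0_def
    using finite_subset[OF KB(1) finKB] K0(2) spK0 qb cardC closed inv by (simp add: Kr_def)
  then show ?thesis unfolding S_def[abs_def] by blast
qed

text \<open>From \<open>T = V + G = V (I + V\<^sup>-\<^sup>1 G)\<close> the properties of \<open>I + V\<^sup>-\<^sup>1 G\<close> are carried over by the
  isomorphism \<open>V\<close>.\<close>

lemma index0_fredholm0:
  assumes T: "bop T" and I: "index0 T"
  shows "\<exists>K C. fredholm0 T K C"
proof -
  obtain V G where V: "inv_op V" and G: "frank G" and VG: "\<forall>x\<in>X. T x = V x + G x"
    using I by (auto simp: index0_def)
  obtain V' where bV: "bop V" and V': "bop V'" "\<forall>x\<in>X. V' (V x) = x \<and> V (V' x) = x"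
    using V by (auto simp: inv_op_def)
  note lV = bopD(1)[OF bV] and lV' = bopD(1)[OF V'(1)]
  define S where "S x = x + V' (G x)" for x
  obtain K C where f: "fredholm0 S K C"
    using fredholm0_frank[OF frank_comp_left[OF V'(1) G]] unfolding S_def[abs_def] by blast
  have GX: "G x \<in> X" if "x \<in> X" for x by (rule bopD(2)[OF frank_bop[OF G] that])
  have SX: "S x \<in> X" if "x \<in> X" for x
    unfolding S_def by (rule X_add[OF that bopD(2)[OF V'(1) GX[OF that]]])
  have TS: "T x = V (S x)" if "x \<in> X" for x
    using VG V'(2) that GX[OF that] by (simp add: S_def linear_add[OF lV])
  have ST: "S x = V' (T x)" if "x \<in> X" for x
    using TS[OF that] V'(2) SX[OF that] by simp
  have img: "T ` X = V ` (S ` X)" using TS by (auto simp: image_image)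
  have "T x = 0 \<longleftrightarrow> S x = 0" if x: "x \<in> X" for x
  proof
    show "S x = 0" if "T x = 0" using ST[OF x] linear_0[OF lV'] that by simp
    show "T x = 0" if "S x = 0" using TS[OF x] linear_0[OF lV] that by simp
  qed
  then have "{x\<in>X. T x = 0} = {x\<in>X. S x = 0}" by blast
  then have 1: "finite K" "independent K" "span K = {x\<in>X. T x = 0}" using f by (auto simp: fredholm0_def)
  have qbS: "quotient_basis (S ` X) X C" and cardC: "card C = card K" and clS: "closedX (S ` X)"
    and invS: "K = {} \<longrightarrow> S ` X = X \<and> (\<exists>c\<ge>0. \<forall>x\<in>X. N x \<le> c * N (S x))"
    using f by (auto simp: fredholm0_def)
  have finC: "finite C" and CX: "C \<subseteq> X" using qbS by (auto simp: quotient_basis_def)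
  have injV: "x = y" if "x \<in> X" "y \<in> X" "V x = V y" for x y using V'(2) that by metis
  have injC: "inj_on V C" using injV CX by (meson inj_onI subsetD)
  have sumV: "(\<Sum>v\<in>V ` C. g v *\<^sub>R v) = V (\<Sum>c\<in>C. g (V c) *\<^sub>R c)" for g
    unfolding sum.reindex[OF injC] by (simp add: linear_sum[OF lV] linear_scale[OF lV])
  have sumX: "(\<Sum>c\<in>C. g c *\<^sub>R c) \<in> X" for g by (intro X_sum X_scale) (use CX in blast)
  have qb: "quotient_basis (T ` X) X (V ` C)"
    unfolding quotient_basis_def
  proof (intro conjI ballI allI impI)
    show "finite (V ` C)" using finC by simp
    show "V ` C \<subseteq> X" by (intro image_subsetI bopD(2)[OF bV]) (use CX in blast)
    fix w assume w: "w \<in> X"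
    have "\<forall>w\<in>X. \<exists>g. w - (\<Sum>c\<in>C. g c *\<^sub>R c) \<in> S ` X" using qbS unfolding quotient_basis_def by blast
    then obtain g where g: "V' w - (\<Sum>c\<in>C. g c *\<^sub>R c) \<in> S ` X"
      using bopD(2)[OF V'(1) w] by blast
    have "(\<Sum>c\<in>C. g (V' (V c)) *\<^sub>R c) = (\<Sum>c\<in>C. g c *\<^sub>R c)"
      by (rule sum.cong) (use V'(2) CX in auto)
    then have "w - (\<Sum>v\<in>V ` C. g (V' v) *\<^sub>R v) = V (V' w - (\<Sum>c\<in>C. g c *\<^sub>R c))"
      using V'(2) w by (simp add: sumV linear_diff[OF lV])
    then show "\<exists>g. w - (\<Sum>v\<in>V ` C. g v *\<^sub>R v) \<in> T ` X"
      using g by (intro exI[of _ "\<lambda>v. g (V' v)"]) (simp add: img)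
  next
    fix g v assume a: "(\<Sum>v\<in>V ` C. g v *\<^sub>R v) \<in> T ` X" and v: "v \<in> V ` C"
    then obtain x where x: "x \<in> X" "V (\<Sum>c\<in>C. g (V c) *\<^sub>R c) = V (S x)" using TS by (auto simp: sumV)
    have "(\<Sum>c\<in>C. g (V c) *\<^sub>R c) = S x" by (rule injV[OF sumX SX[OF x(1)] x(2)])
    then have "(\<Sum>c\<in>C. g (V c) *\<^sub>R c) \<in> S ` X" using x(1) by blast
    moreover have "\<forall>h. (\<Sum>c\<in>C. h c *\<^sub>R c) \<in> S ` X \<longrightarrow> (\<forall>c\<in>C. h c = 0)"
      using qbS by (simp add: quotient_basis_def)
    ultimately have "\<forall>c\<in>C. g (V c) = 0" by (drule_tac x = "\<lambda>c. g (V c)" in spec) auto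
    then show "g v = 0" using v by blast
  qed
  have cl: "closedX (T ` X)"
    unfolding closedX_def
  proof (intro allI impI)
    fix s :: "nat \<Rightarrow> 'a" and x assume s: "\<forall>n. s n \<in> T ` X" and x: "x \<in> X" and lim: "(\<lambda>n. N (s n - x)) \<longlonglongrightarrow> 0"
    have sX: "s n \<in> X" for n
    proof -
      obtain y where "y \<in> X" "s n = T y" using s by blast
      then show ?thesis using bopD(2)[OF T, of y] by simp
    qed
    have "V' x \<in> S ` X"
    proof (rule closedXD[OF clS _ bopD(2)[OF V'(1) x] bop_tendsto[OF V'(1) sX x lim]])
      fix n
      obtain y where y: "y \<in> X" "s n = T y" using s by blast
      then have "V' (s n) = S y" using ST[of y] by simp
      then show "V' (s n) \<in> S ` X" using y(1) by blast
    qed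
    then have "V (V' x) \<in> T ` X" unfolding img by blast
    then show "x \<in> T ` X" using V'(2) x by simp
  qed
  have inv: "T ` X = X \<and> (\<exists>c\<ge>0. \<forall>x\<in>X. N x \<le> c * N (T x))" if K: "K = {}"
  proof
    obtain c where c: "c \<ge> 0" "\<forall>x\<in>X. N x \<le> c * N (S x)" and SXX: "S ` X = X" using invS K by blast
    show "T ` X = X" unfolding img SXX
    proof
      show "V ` X \<subseteq> X" by (intro image_subsetI bopD(2)[OF bV])
      show "X \<subseteq> V ` X"
      proof
        fix x assume "x \<in> X"
        then have "x = V (V' x)" "V' x \<in> X" using V'(2) bopD(2)[OF V'(1)] by auto
        then show "x \<in> V ` X" by blast
      qed
    qed
    obtain d where d: "d \<ge> 0" "\<forall>x\<in>X. N (V' x) \<le> d * N x" using bopD(3)[OF V'(1)] by blast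
    have "N x \<le> c * d * N (T x)" if x: "x \<in> X" for x
    proof -
      have "N x \<le> c * N (S x)" using c(2) x by blast
      also have "c * N (S x) = c * N (V' (T x))" by (simp only: ST[OF x])
      also have "\<dots> \<le> c * (d * N (T x))" using d(2) bopD(2)[OF T x] by (intro mult_left_mono c) auto
      finally show ?thesis by (simp add: mult.assoc)
    qed
    then show "\<exists>c\<ge>0. \<forall>x\<in>X. N x \<le> c * N (T x)" using c(1) d(1) by (intro exI[of _ "c * d"]) auto
  qed
  have "card (V ` C) = card K" using card_image[OF injC] cardC by simp
  then have "fredholm0 T K (V ` C)"
    unfolding fredholm0_def using 1 qb cl inv by simp
  then show ?thesis by blast
qed

text \<open>The alternative for equations \<open>u = P (f - B u)\<close>: with \<open>v = f - B u\<close> they become \<open>v + B P v = f\<close>,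
  and \<open>u \<mapsto> B u\<close> identifies the solutions for \<open>f = 0\<close> with the kernel of \<open>I + B P\<close>.\<close>

lemma fredholm_alternative:
  assumes P: "bop P" and B: "bop B" and I: "index0 (\<lambda>v. v + B (P v))"
  defines "solves f u \<equiv> u \<in> X \<and> u = P (f - B u)"
  defines "\<K> \<equiv> {u. solves 0 u}" and "\<R> \<equiv> {f\<in>X. \<exists>u. solves f u}"
  shows "finite_dim \<K>" "closedX \<R>" "has_codim \<R> X (dim \<K>)"
    "(dim \<K> > 0) \<noteq> (\<forall>f\<in>X. \<exists>!u. solves f u)"
    "(\<forall>f\<in>X. \<exists>!u. solves f u) \<Longrightarrow>
       \<exists>c\<ge>0. \<forall>f\<in>X. \<forall>g\<in>X. \<forall>u v. solves f u \<longrightarrow> solves g v \<longrightarrow> N (u - v) \<le> c * N (f - g)"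
proof -
  note lP = bopD(1)[OF P] and lB = bopD(1)[OF B] and PX = bopD(2)[OF P] and BX = bopD(2)[OF B]
  define T where "T v = v + B (P v)" for v
  have T: "bop T" unfolding T_def[abs_def] by (rule bop_add[OF bop_id bop_comp[OF B P]])
  note lT = bopD(1)[OF T]
  obtain K C where f0: "fredholm0 T K C" using index0_fredholm0[OF T] I unfolding T_def[abs_def] by blast
  have K: "finite K" "independent K" "span K = {x\<in>X. T x = 0}" and qb: "quotient_basis (T ` X) X C"
    and cardC: "card C = card K" and cl: "closedX (T ` X)"
    and inv: "K = {} \<Longrightarrow> T ` X = X \<and> (\<exists>c\<ge>0. \<forall>x\<in>X. N x \<le> c * N (T x))"
    using f0 by (auto simp: fredholm0_def)
  have sol_T: "T (f - B u) = f \<and> f - B u \<in> X \<and> P (f - B u) = u" if "f \<in> X" "solves f u" for f u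
    using that BX X_diff by (auto simp: solves_def T_def)
  have T_sol: "solves (T v) (P v)" if "v \<in> X" for v
    using that PX by (simp add: solves_def T_def)
  have R: "\<R> = T ` X"
  proof
    show "\<R> \<subseteq> T ` X"
    proof
      fix f assume "f \<in> \<R>"
      then obtain u where "f \<in> X" "solves f u" by (auto simp: \<R>_def)
      from sol_T[OF this] show "f \<in> T ` X" by (intro image_eqI[of f T "f - B u"]) simp_all
    qed
    show "T ` X \<subseteq> \<R>"
    proof
      fix f assume "f \<in> T ` X"
      then obtain v where v: "v \<in> X" "f = T v" by blast
      then show "f \<in> \<R>" using T_sol[OF v(1)] bopD(2)[OF T v(1)] by (auto simp: \<R>_def)
    qed
  qed
  define J where "J v = - P v" for v
  have lJ: "linear J" unfolding J_def[abs_def] by (rule linear_compose_neg[OF lP])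
  have KJ: "\<K> = J ` span K"
  proof (intro set_eqI iffI)
    fix u assume "u \<in> \<K>"
    then have u: "solves 0 u" by (simp add: \<K>_def)
    have T0: "T (- B u) = 0" and P0: "P (- B u) = u" using sol_T[OF X_0 u] by simp_all
    have "u \<in> X" using u by (simp add: solves_def)
    moreover have "T (B u) = 0" using T0 linear_neg[OF lT, of "B u"] by simp
    ultimately have "B u \<in> span K" unfolding K(3) using BX by simp
    moreover have "J (B u) = u" using P0 linear_neg[OF lP, of "B u"] by (simp add: J_def)
    ultimately have "B u \<in> span K" "J (B u) = u" by simp_all
    then show "u \<in> J ` span K" by (intro image_eqI[of u J "B u"]) simp_all
  next
    fix u assume "u \<in> J ` span K"
    then obtain v where v: "v \<in> X" "T v = 0" "u = - P v" using K(3) by (auto simp: J_def)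
    have "solves 0 (P v)" using T_sol[OF v(1)] v(2) by simp
    then have Pv: "P v \<in> X" "P v = P (0 - B (P v))" by (auto simp: solves_def)
    have "P (0 - B (P v)) = - P (B (P v))" using linear_neg[OF lP, of "B (P v)"] by simp
    from trans[OF Pv(2) this] have "P (B (P v)) = - P v" by (rule equation_minus_iff[THEN iffD1])
    moreover have "0 - B u = B (P v)" unfolding v(3) using linear_neg[OF lB, of "P v"] by simp
    ultimately have "P (0 - B u) = u" by (simp add: v(3))
    then show "u \<in> \<K>" using Pv(1) subspace_neg[OF sub] by (simp add: \<K>_def solves_def v(3))
  qed
  have injJ: "inj_on J (span K)"
  proof (rule inj_onI)
    fix v w assume vw: "v \<in> span K" "w \<in> span K" "J v = J w"
    have "T v = 0" "T w = 0" using vw(1,2) unfolding K(3) by simp_all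
    then have "v + B (P v) = 0" "w + B (P w) = 0" by (simp_all only: T_def)
    moreover have "P v = P w" using vw(3) unfolding J_def by (simp only: neg_equal_iff_equal)
    ultimately have "v + B (P w) = w + B (P w)" by (simp only:)
    then show "v = w" by (rule add_right_imp_eq)
  qed
  have span_JK: "span (J ` K) = \<K>" unfolding KJ by (rule linear_span_image[OF lJ])
  have ind: "independent (J ` K)" by (rule linear_independent_injective_image[OF lJ K(2) injJ])
  have cardJ: "card (J ` K) = card K" by (rule card_image[OF inj_on_subset[OF injJ span_superset]])
  show "finite_dim \<K>" unfolding finite_dim_def
    by (intro exI[of _ "J ` K"] conjI span_JK finite_imageI K(1))
  have dimK: "dim \<K> = card K"
    using dim_span_eq_card_independent[OF ind] unfolding span_JK cardJ .
  show "closedX \<R>" unfolding R by (rule cl)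
  have "subspace (T ` X)" by (rule linear_subspace_image[OF lT sub])
  moreover have "T ` X \<subseteq> X" by (intro image_subsetI bopD(2)[OF T])
  ultimately show "has_codim \<R> X (dim \<K>)"
    unfolding has_codim_def R dimK by (intro conjI sub exI[of _ C] qb cardC)
  have uniq_lip: "\<exists>c\<ge>0. \<forall>f\<in>X. \<forall>g\<in>X. \<forall>u v. solves f u \<longrightarrow> solves g v \<longrightarrow> N (u - v) \<le> c * N (f - g)"
    if Ke: "K = {}"
  proof -
    obtain c where c: "c \<ge> 0" "\<forall>x\<in>X. N x \<le> c * N (T x)" using inv[OF Ke] by blast
    obtain d where d: "d \<ge> 0" "\<forall>x\<in>X. N (P x) \<le> d * N x" using bopD(3)[OF P] by blast
    have "N (u - v) \<le> d * c * N (f - g)" if fg: "f \<in> X" "g \<in> X" "solves f u" "solves g v" for f g u v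
    proof -
      define x where "x = (f - B u) - (g - B v)"
      have xX: "x \<in> X" unfolding x_def using sol_T[OF fg(1,3)] sol_T[OF fg(2,4)] X_diff by blast
      have "T x = f - g" "P x = u - v"
        unfolding x_def using sol_T[OF fg(1,3)] sol_T[OF fg(2,4)] by (simp_all add: linear_diff[OF lT] linear_diff[OF lP])
      then have "N (u - v) \<le> d * N x" "N x \<le> c * N (f - g)" using d(2) c(2) xX by force+
      then show ?thesis using mult_left_mono[OF _ d(1), of "N x" "c * N (f - g)"] by (simp add: mult.assoc)
    qed
    then show ?thesis using c(1) d(1) by (intro exI[of _ "d * c"]) auto
  qed
  have ex1: "\<exists>!u. solves f u" if Ke: "K = {}" and f: "f \<in> X" for f
  proof -
    obtain v where "v \<in> X" "f = T v" using inv[OF Ke] f by blast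
    then have ex: "solves f (P v)" using T_sol by simp
    obtain c where c: "\<forall>f\<in>X. \<forall>g\<in>X. \<forall>u v. solves f u \<longrightarrow> solves g v \<longrightarrow> N (u - v) \<le> c * N (f - g)"
      using uniq_lip[OF Ke] by blast
    have "u = P v" if u: "solves f u" for u
    proof -
      have "N (u - P v) \<le> 0" using c \<open>f \<in> X\<close> u ex by force
      moreover have "u - P v \<in> X" using u ex X_diff by (auto simp: solves_def)
      ultimately have "u - P v = 0" using N_ge0 N_eq0 by force
      then show ?thesis by simp
    qed
    then show ?thesis using ex by blast
  qed
  have empty: "K = {}" if "\<forall>f\<in>X. \<exists>!u. solves f u"
  proof -
    have s0: "solves 0 0" using X_0 linear_0[OF lB] linear_0[OF lP] by (simp add: solves_def)
    have "\<K> \<subseteq> {0}" using that X_0 s0 unfolding \<K>_def by blast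
    then have "J ` K \<subseteq> {0}" using span_JK span_superset by blast
    moreover have "0 \<notin> J ` K" using ind dependent_zero by blast
    ultimately have "J ` K = {}" by (metis subset_singletonD insertI1)
    then show ?thesis by (simp only: image_is_empty)
  qed
  have iff: "(\<forall>f\<in>X. \<exists>!u. solves f u) \<longleftrightarrow> K = {}"
  proof
    assume "K = {}"
    then show "\<forall>f\<in>X. \<exists>!u. solves f u" by (intro ballI ex1)
  qed (rule empty)
  show "(dim \<K> > 0) \<noteq> (\<forall>f\<in>X. \<exists>!u. solves f u)"
    unfolding dimK iff using K(1) by (simp add: card_gt_0_iff)
  show "\<exists>c\<ge>0. \<forall>f\<in>X. \<forall>g\<in>X. \<forall>u v. solves f u \<longrightarrow> solves g v \<longrightarrow> N (u - v) \<le> c * N (f - g)"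
    if "\<forall>f\<in>X. \<exists>!u. solves f u"
    by (rule uniq_lip[OF empty[OF that]])
qed

end

section \<open>The Banach space of continuous periodic functions\<close>

text \<open>Elements of \<open>Cper n\<close> vanish outside the strip and for other indices.\<close>

definition rs :: "nat \<Rightarrow> field \<Rightarrow> field" where
  "rs n u = (\<lambda>j x t. if j \<in> {1..n} \<and> x \<in> {0..1} then u j x t else 0)"

lemma rs_apply: "j \<in> {1..n} \<Longrightarrow> x \<in> {0..1} \<Longrightarrow> rs n u j x t = u j x t"
  by (simp add: rs_def)

lemma rs_in_Cper:
  assumes "\<And>j. j \<in> {1..n} \<Longrightarrow> cont (u j)" "\<And>j. j \<in> {1..n} \<Longrightarrow> periodic_strip (u j)"
  shows "rs n u \<in> Cper n"
proof -
  have "cont (rs n u j)" if "j \<in> {1..n}" for j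
    using cont_cong[of "rs n u j" "u j"] assms(1)[OF that] rs_apply[OF that] by simp
  moreover have "periodic_strip (rs n u j)" if "j \<in> {1..n}" for j
    using assms(2)[OF that] rs_apply[OF that] by (simp add: periodic_strip_def)
  ultimately show ?thesis unfolding Cper_def by (auto simp: rs_def)
qed

lemma CperD:
  assumes "u \<in> Cper n"
  shows "j \<in> {1..n} \<Longrightarrow> cont (u j)" "j \<in> {1..n} \<Longrightarrow> periodic_strip (u j)"
    "\<not> (j \<in> {1..n} \<and> x \<in> {0..1}) \<Longrightarrow> u j x t = 0"
  using assms unfolding Cper_def by blast+

lemma Cper_eqI:
  assumes "u \<in> Cper n" "v \<in> Cper n" "\<And>j x t. j \<in> {1..n} \<Longrightarrow> x \<in> {0..1} \<Longrightarrow> u j x t = v j x t"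
  shows "u = v"
proof (intro ext)
  show "u j x t = v j x t" for j x t
    using assms(3)[of j x t] CperD(3)[OF assms(1), of j x t] CperD(3)[OF assms(2), of j x t] by metis
qed

lemma Cper_complete:
  assumes s: "\<And>k. s k \<in> Cper n"
    and cauchy: "\<And>e. e > 0 \<Longrightarrow> \<exists>n0::nat. \<forall>k\<ge>n0. \<forall>l\<ge>n0. sup_norm n (s k - s l) < e"
  shows "\<exists>u\<in>Cper n. (\<lambda>k. sup_norm n (s k - u)) \<longlonglongrightarrow> 0"
proof -
  have diff: "s k - s l \<in> Cper n" for k l by (rule subspace_diff[OF subspace_Cper s s])
  have pt: "\<bar>s k j x t - s l j x t\<bar> \<le> sup_norm n (s k - s l)" if "j \<in> {1..n}" "x \<in> {0..1}" for k l j x t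
    using sup_norm_upper[OF diff that, of k l t] by simp
  have conv: "convergent (\<lambda>k. s k j x t)" if jx: "j \<in> {1..n}" "x \<in> {0..1}" for j x t
  proof (rule Cauchy_convergent, rule metric_CauchyI)
    fix e :: real assume "e > 0"
    then obtain n0 where n0: "\<forall>k\<ge>n0. \<forall>l\<ge>n0. sup_norm n (s k - s l) < e" using cauchy by blast
    then show "\<exists>M. \<forall>k\<ge>M. \<forall>l\<ge>M. dist (s k j x t) (s l j x t) < e"
      using pt[OF jx, of _ t] unfolding dist_real_def by (meson le_less_trans)
  qed
  define v where "v j x t = lim (\<lambda>k. s k j x t)" for j x t
  have lim: "(\<lambda>k. s k j x t) \<longlonglongrightarrow> v j x t" if "j \<in> {1..n}" "x \<in> {0..1}" for j x t
    using conv[OF that] unfolding v_def convergent_LIMSEQ_iff .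
  have unif: "\<exists>n0. \<forall>k\<ge>n0. \<forall>j\<in>{1..n}. \<forall>x\<in>{0..1}. \<forall>t. \<bar>s k j x t - v j x t\<bar> \<le> e" if e: "e > 0" for e
  proof -
    obtain n0 where n0: "\<forall>k\<ge>n0. \<forall>l\<ge>n0. sup_norm n (s k - s l) < e" using cauchy[OF e] by blast
    have "\<bar>s k j x t - v j x t\<bar> \<le> e" if k: "k \<ge> n0" and jx: "j \<in> {1..n}" "x \<in> {0..1}" for k j x t
    proof (rule LIMSEQ_le_const2)
      show "(\<lambda>l. \<bar>s k j x t - s l j x t\<bar>) \<longlonglongrightarrow> \<bar>s k j x t - v j x t\<bar>"
        by (intro tendsto_rabs tendsto_diff tendsto_const lim jx)
      have "\<bar>s k j x t - s l j x t\<bar> \<le> e" if "l \<ge> n0" for l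
        using pt[OF jx, of k t l] n0 k that by (meson le_less_trans less_imp_le)
      then show "\<exists>N. \<forall>l\<ge>N. \<bar>s k j x t - s l j x t\<bar> \<le> e" by blast
    qed
    then show ?thesis by blast
  qed
  have "cont (v j)" if j: "j \<in> {1..n}" for j
  proof (rule uniform_limit_theorem[where f = "\<lambda>k p. s k j (fst p) (snd p)" and F = sequentially])
    show "\<forall>\<^sub>F k in sequentially. continuous_on strip (\<lambda>p. s k j (fst p) (snd p))"
      using CperD(1)[OF s j] by (simp add: case_prod_unfold)
    show "uniform_limit strip (\<lambda>k p. s k j (fst p) (snd p)) (\<lambda>(x, t). v j x t) sequentially"
    proof (rule uniform_limitI)
      fix e :: real assume "e > 0"
      then obtain n0 where n0: "\<forall>k\<ge>n0. \<forall>j\<in>{1..n}. \<forall>x\<in>{0..1}. \<forall>t. \<bar>s k j x t - v j x t\<bar> \<le> e / 2"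
        using unif[of "e / 2"] by auto
      have "dist (s k j (fst p) (snd p)) ((\<lambda>(x, t). v j x t) p) < e" if "k \<ge> n0" "p \<in> strip" for k p
      proof -
        have "\<bar>s k j (fst p) (snd p) - v j (fst p) (snd p)\<bar> \<le> e / 2" using n0 that j by auto
        then show ?thesis using \<open>e > 0\<close> by (simp add: dist_real_def case_prod_unfold)
      qed
      then show "\<forall>\<^sub>F k in sequentially. \<forall>p\<in>strip. dist (s k j (fst p) (snd p)) ((\<lambda>(x, t). v j x t) p) < e"
        unfolding eventually_sequentially by blast
    qed
  qed simp
  moreover have "periodic_strip (v j)" if j: "j \<in> {1..n}" for j
    using CperD(2)[OF s j] by (simp add: periodic_strip_def v_def)
  ultimately have u: "rs n v \<in> Cper n" by (intro rs_in_Cper)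
  have "(\<lambda>k. sup_norm n (s k - rs n v)) \<longlonglongrightarrow> 0"
  proof (rule LIMSEQ_I)
    fix e :: real assume e: "e > 0"
    then obtain n0 where n0: "\<forall>k\<ge>n0. \<forall>j\<in>{1..n}. \<forall>x\<in>{0..1}. \<forall>t. \<bar>s k j x t - v j x t\<bar> \<le> e / 2"
      using unif[of "e / 2"] by auto
    have "norm (sup_norm n (s k - rs n v) - 0) < e" if "k \<ge> n0" for k
    proof -
      have "sup_norm n (s k - rs n v) \<le> e / 2"
        by (rule sup_norm_least) (use n0 that e in \<open>auto simp: rs_apply\<close>)
      then show ?thesis using e sup_norm_nonneg[OF subspace_diff[OF subspace_Cper s u]] by simp
    qed
    then show "\<exists>n0. \<forall>k\<ge>n0. norm (sup_norm n (s k - rs n v) - 0) < e" by blast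
  qed
  then show ?thesis using u by blast
qed

lemma sup_norm_scale:
  assumes u: "u \<in> Cper n" shows "sup_norm n (c *\<^sub>R u) = \<bar>c\<bar> * sup_norm n u"
proof -
  have le: "sup_norm n (c *\<^sub>R u) \<le> \<bar>c\<bar> * sup_norm n u" if u: "u \<in> Cper n" for c u
    by (rule sup_norm_least)
      (use sup_norm_upper[OF u] sup_norm_nonneg[OF u] in \<open>auto simp: abs_mult intro!: mult_left_mono\<close>)
  show ?thesis
  proof (cases "c = 0")
    case True then show ?thesis using le[OF u, of 0] sup_norm_nonneg[OF subspace_scale[OF subspace_Cper u], of 0] by simp
  next
    case False
    have "\<bar>c\<bar> * sup_norm n u = \<bar>c\<bar> * sup_norm n ((1 / c) *\<^sub>R (c *\<^sub>R u))" using False by simp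
    also have "\<dots> \<le> \<bar>c\<bar> * (\<bar>1 / c\<bar> * sup_norm n (c *\<^sub>R u))"
      by (intro mult_left_mono le subspace_scale[OF subspace_Cper u]) simp
    also have "\<dots> = sup_norm n (c *\<^sub>R u)" using False by (simp add: abs_divide)
    finally show ?thesis using le[OF u, of c] by simp
  qed
qed

lemma sup_norm_tri:
  assumes u: "u \<in> Cper n" and v: "v \<in> Cper n" shows "sup_norm n (u + v) \<le> sup_norm n u + sup_norm n v"
proof (rule sup_norm_least)
  fix j x t assume jx: "j \<in> {1..n}" "x \<in> {0..1::real}"
  show "\<bar>(u + v) j x t\<bar> \<le> sup_norm n u + sup_norm n v"
    using sup_norm_upper[OF u jx, of t] sup_norm_upper[OF v jx, of t] by simp
qed (use sup_norm_nonneg u v in auto)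

lemma banach_Cper: "banach_carrier (Cper n) (sup_norm n)"
  by standard
    (use subspace_Cper sup_norm_nonneg sup_norm_eq_0_iff sup_norm_tri sup_norm_scale Cper_complete in auto)

lemma periodic_strip_add: "periodic_strip f \<Longrightarrow> periodic_strip g \<Longrightarrow> periodic_strip (\<lambda>x t. f x t + g x t)"
  and periodic_strip_diff: "periodic_strip f \<Longrightarrow> periodic_strip g \<Longrightarrow> periodic_strip (\<lambda>x t. f x t - g x t)"
  and periodic_strip_mult: "periodic_strip f \<Longrightarrow> periodic_strip g \<Longrightarrow> periodic_strip (\<lambda>x t. f x t * g x t)"
  and periodic_strip_divide: "periodic_strip f \<Longrightarrow> periodic_strip g \<Longrightarrow> periodic_strip (\<lambda>x t. f x t / g x t)"
  by (auto simp: periodic_strip_def)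

lemma periodic_strip_sum: "(\<And>k. k \<in> K \<Longrightarrow> periodic_strip (f k)) \<Longrightarrow> periodic_strip (\<lambda>x t. \<Sum>k\<in>K. f k x t)"
  by (auto simp: periodic_strip_def intro!: sum.cong)

lemma reduce_to_period:
  obtains k :: int where "t + 2 * pi * of_int k \<in> {0..2 * pi}"
proof -
  define k where "k = \<lfloor>t / (2 * pi)\<rfloor>"
  have "of_int k \<le> t / (2 * pi)" "t / (2 * pi) < of_int k + 1"
    unfolding k_def by linarith+
  then show ?thesis using that[of "- k"] by (auto simp: field_simps)
qed

lemma periodic_strip_bound_ext:
  assumes p: "periodic_strip h" and b: "\<And>t. \<bar>t\<bar> \<le> 2 * pi \<Longrightarrow> \<bar>h x t\<bar> \<le> C" and x: "x \<in> {0..1}"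
  shows "\<bar>h x t\<bar> \<le> C"
proof -
  obtain k :: int where k: "t + 2 * pi * of_int k \<in> {0..2 * pi}" by (rule reduce_to_period)
  then have "\<bar>h x (t + 2 * pi * of_int k)\<bar> \<le> C" by (intro b) auto
  then show ?thesis unfolding periodic_strip_int[OF p x] .
qed

section \<open>Finite-rank approximation on Lipschitz functions\<close>

definition lipschitz_field :: "nat \<Rightarrow> real \<Rightarrow> field \<Rightarrow> bool" where
  "lipschitz_field n K u \<longleftrightarrow> (\<forall>j\<in>{1..n}. \<forall>x\<in>{0..1}. \<forall>y\<in>{0..1}. \<forall>s t.
     \<bar>u j x s - u j y t\<bar> \<le> K * (\<bar>x - y\<bar> + \<bar>s - t\<bar>))"

lemma sin_half_period:
  fixes t :: real shows "\<bar>sin ((t + 2 * pi - s) / 2)\<bar> = \<bar>sin ((t - s) / 2)\<bar>"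
proof -
  have "(t + 2 * pi - s) / 2 = (t - s) / 2 + pi" by (simp add: field_simps)
  then show ?thesis by (simp only: sin_periodic_pi abs_minus_cancel)
qed

text \<open>\<open>\<bar>sin ((t - s) / 2)\<bar>\<close> serves as a continuous measure of the distance of \<open>t\<close> and \<open>s\<close> modulo
  the period.\<close>

lemma sin_half_small:
  fixes t s :: real
  assumes \<epsilon>: "0 < \<epsilon>" "\<epsilon> \<le> 1" and small: "\<bar>sin ((t - s) / 2)\<bar> < sin (\<epsilon> / 2)"
  obtains k :: int where "\<bar>t + 2 * pi * of_int k - s\<bar> < \<epsilon>"
proof -
  obtain k :: int where k: "(t - s + pi) + 2 * pi * of_int k \<in> {0..2 * pi}" by (rule reduce_to_period)
  define \<theta> where "\<theta> = t - s + 2 * pi * of_int k"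
  have \<theta>: "- pi \<le> \<theta>" "\<theta> \<le> pi" using k by (auto simp: \<theta>_def)
  have per: "periodic_strip (\<lambda>x t. \<bar>sin ((t - s) / 2)\<bar>)"
    by (simp add: periodic_strip_def sin_half_period)
  have "\<bar>sin ((t + 2 * pi * of_int k - s) / 2)\<bar> = \<bar>sin ((t - s) / 2)\<bar>"
    using periodic_strip_int[OF per, of 0 t k] by simp
  then have sm: "\<bar>sin (\<theta> / 2)\<bar> < sin (\<epsilon> / 2)" using small by (simp add: \<theta>_def algebra_simps)
  have "\<bar>\<theta>\<bar> < \<epsilon>"
  proof (rule ccontr)
    assume "\<not> \<bar>\<theta>\<bar> < \<epsilon>"
    then have "sin (\<epsilon> / 2) \<le> sin (\<bar>\<theta>\<bar> / 2)"
      using \<theta> \<epsilon> pi_gt3 by (intro sin_monotone_2pi_le) auto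
    also have "\<dots> \<le> \<bar>sin (\<theta> / 2)\<bar>" by (cases "\<theta> \<ge> 0") auto
    finally show False using sm by simp
  qed
  then show ?thesis using that[of k] by (simp add: \<theta>_def algebra_simps)
qed

lemma (in banach_carrier) frankI:
  assumes "bop G" "finite B" "B \<subseteq> X" "\<And>x. x \<in> X \<Longrightarrow> G x \<in> span B" shows "frank G"
  unfolding frank_def using assms by (intro conjI exI[of _ B]) auto

lemma sum_fun_apply3: "(\<Sum>i\<in>I. f i) j x t = (\<Sum>i\<in>I. f i j x (t :: real) :: real)"
  by (induction I rule: infinite_finite_induct) auto

text \<open>A partition of unity that respects the period turns samples at finitely many points into a
  function near the given one.\<close>

lemma finite_rank_approximation:
  assumes \<epsilon>: "0 < \<epsilon>" "\<epsilon> \<le> 1"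
  shows "\<exists>S. banach_carrier.frank (Cper n) (sup_norm n) S \<and>
    (\<forall>u\<in>Cper n. \<forall>K\<ge>0. lipschitz_field n K u \<longrightarrow> sup_norm n (S u - u) \<le> K * (2 * \<epsilon>))"
proof -
  interpret banach_carrier "Cper n" "sup_norm n" by (rule banach_Cper)
  define \<eta> where "\<eta> = sin (\<epsilon> / 2)"
  have \<eta>: "\<eta> > 0" unfolding \<eta>_def using \<epsilon> pi_gt3 by (intro sin_gt_zero) auto
  define \<phi> where "\<phi> p x t = max 0 (\<epsilon> - \<bar>x - fst p\<bar>) * max 0 (\<eta> - \<bar>sin ((t - snd p) / 2)\<bar>)" for p :: "real \<times> real" and x t
  have \<phi>0: "0 \<le> \<phi> p x t" for p x t by (simp add: \<phi>_def)
  have \<phi>_cont: "cont (\<phi> p)" for p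
    unfolding \<phi>_def[abs_def] case_prod_unfold by (intro continuous_intros) auto
  have \<phi>_per: "periodic_strip (\<phi> p)" for p by (simp add: periodic_strip_def \<phi>_def sin_half_period)
  have "compact ({0..1} \<times> {0..2 * pi} :: (real \<times> real) set)" by (intro compact_Times) auto
  then obtain G where G: "finite G" "G \<subseteq> {0..1} \<times> {0..2 * pi}"
    "{0..1} \<times> {0..2 * pi} \<subseteq> (\<Union>p\<in>G. {y. \<phi> p (fst y) (snd y) > 0})"
  proof (rule compactE_image)
    show "open {y. \<phi> p (fst y) (snd y) > 0}" for p
      unfolding \<phi>_def by (intro open_Collect_less continuous_intros) auto
    show "{0..1} \<times> {0..2 * pi} \<subseteq> (\<Union>p\<in>{0..1} \<times> {0..2 * pi}. {y. \<phi> p (fst y) (snd y) > 0})"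
      using \<epsilon>(1) \<eta> by (force simp: \<phi>_def)
  qed auto
  define \<Sigma> where "\<Sigma> x t = (\<Sum>p\<in>G. \<phi> p x t)" for x t
  have \<Sigma>_per: "periodic_strip \<Sigma>" unfolding \<Sigma>_def[abs_def] by (intro periodic_strip_sum \<phi>_per)
  have \<Sigma>pos: "\<Sigma> x t > 0" if x: "x \<in> {0..1}" for x t
  proof -
    obtain k :: int where k: "t + 2 * pi * of_int k \<in> {0..2 * pi}" by (rule reduce_to_period)
    define t' where "t' = t + 2 * pi * of_int k"
    have "(x, t') \<in> {0..1} \<times> {0..2 * pi}" using x k by (simp add: t'_def)
    then obtain p where p: "p \<in> G" "\<phi> p x t' > 0" using G(3) by force
    have "\<Sigma> x t' > 0" unfolding \<Sigma>_def by (rule sum_pos2[OF G(1) p(1)]) (use p(2) \<phi>0 in auto)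
    then show ?thesis using periodic_strip_int[OF \<Sigma>_per x, of t k] by (simp add: t'_def)
  qed
  define \<omega> where "\<omega> p x t = \<phi> p x t / \<Sigma> x t" for p x t
  have \<omega>0: "0 \<le> \<omega> p x t" if "x \<in> {0..1}" for p x t using \<Sigma>pos[OF that, of t] \<phi>0[of p x t] by (simp add: \<omega>_def)
  have \<omega>1: "(\<Sum>p\<in>G. \<omega> p x t) = 1" if "x \<in> {0..1}" for x t
    using \<Sigma>pos[OF that, of t] by (simp add: \<omega>_def sum_divide_distrib[symmetric] \<Sigma>_def[symmetric])
  have \<omega>_cont: "cont (\<omega> p)" for p
    unfolding \<omega>_def[abs_def]
  proof (rule cont_divide[OF \<phi>_cont])
    show "cont \<Sigma>" unfolding \<Sigma>_def[abs_def] by (rule cont_sum[OF \<phi>_cont])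
    show "\<Sigma> x t \<noteq> 0" if "x \<in> {0..1}" for x t using \<Sigma>pos[OF that, of t] by simp
  qed
  have \<omega>_per: "periodic_strip (\<omega> p)" for p
    unfolding \<omega>_def[abs_def] by (rule periodic_strip_divide[OF \<phi>_per \<Sigma>_per])
  define S where "S u = rs n (\<lambda>j x t. \<Sum>p\<in>G. \<omega> p x t * u j (fst p) (snd p))" for u
  have lin: "linear S"
    by (rule linearI) (auto simp: S_def rs_def fun_eq_iff sum.distrib[symmetric] distrib_left sum_distrib_left mult_ac)
  have SX: "S u \<in> Cper n" if "u \<in> Cper n" for u
    unfolding S_def
    by (intro rs_in_Cper cont_sum cont_mult \<omega>_cont cont_const periodic_strip_sum periodic_strip_mult \<omega>_per) (simp add: periodic_strip_def)
  have SN: "sup_norm n (S u) \<le> 1 * sup_norm n u" if u: "u \<in> Cper n" for u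
  proof (rule sup_norm_least)
    fix j x t assume jx: "j \<in> {1..n}" "x \<in> {0..1::real}"
    have "\<bar>S u j x t\<bar> \<le> (\<Sum>p\<in>G. \<bar>\<omega> p x t * u j (fst p) (snd p)\<bar>)"
      unfolding S_def rs_apply[OF jx] by (rule sum_abs)
    also have "\<dots> \<le> (\<Sum>p\<in>G. \<omega> p x t * sup_norm n u)"
    proof (rule sum_mono)
      fix p assume "p \<in> G"
      then have "fst p \<in> {0..1}" using G(2) by auto
      then have "\<bar>u j (fst p) (snd p)\<bar> \<le> sup_norm n u" by (rule sup_norm_upper[OF u jx(1)])
      then show "\<bar>\<omega> p x t * u j (fst p) (snd p)\<bar> \<le> \<omega> p x t * sup_norm n u"
        using \<omega>0[OF jx(2), of p t] by (simp add: abs_mult mult_left_mono)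
    qed
    also have "\<dots> = 1 * sup_norm n u" unfolding sum_distrib_right[symmetric] \<omega>1[OF jx(2)] ..
    finally show "\<bar>S u j x t\<bar> \<le> 1 * sup_norm n u" .
  qed (use sup_norm_nonneg[OF u] in simp)
  have bS: "bop S" by (rule bopI[OF lin SX SN]) auto
  define bf where "bf q = rs n (\<lambda>j x t. if j = fst q then \<omega> (snd q) x t else 0)" for q :: "nat \<times> real \<times> real"
  have bfX: "bf q \<in> Cper n" for q
    unfolding bf_def
  proof (rule rs_in_Cper)
    show "cont (\<lambda>x t. if j = fst q then \<omega> (snd q) x t else 0)" for j
      by (cases "j = fst q") (simp_all add: \<omega>_cont cont_const)
    show "periodic_strip (\<lambda>x t. if j = fst q then \<omega> (snd q) x t else 0)" for j
      by (cases "j = fst q") (simp_all add: \<omega>_per, simp add: periodic_strip_def)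
  qed
  have fr: "frank S"
  proof (rule frankI[OF bS])
    show "finite (bf ` ({1..n} \<times> G))" using G(1) by simp
    show "bf ` ({1..n} \<times> G) \<subseteq> Cper n" using bfX by blast
    fix u assume "u \<in> Cper n"
    have "S u = (\<Sum>q\<in>{1..n} \<times> G. u (fst q) (fst (snd q)) (snd (snd q)) *\<^sub>R bf q)"
    proof (intro ext)
      fix j x t
      have "(\<Sum>q\<in>{1..n} \<times> G. u (fst q) (fst (snd q)) (snd (snd q)) *\<^sub>R bf q) j x t
          = (\<Sum>i\<in>{1..n}. \<Sum>p\<in>G. u i (fst p) (snd p) * bf (i, p) j x t)"
        by (simp add: sum_fun_apply3 sum.cartesian_product case_prod_unfold)
      also have "\<dots> = S u j x t"
      proof (cases "j \<in> {1..n} \<and> x \<in> {0..1}")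
        case True
        have "(\<Sum>p\<in>G. u i (fst p) (snd p) * bf (i, p) j x t) = (if i = j then S u j x t else 0)" for i
          using True by (auto simp: bf_def S_def rs_def mult.commute)
        then show ?thesis using True by (simp add: sum.delta)
      next
        case False
        then show ?thesis by (auto simp: bf_def S_def rs_def)
      qed
      finally show "S u j x t = (\<Sum>q\<in>{1..n} \<times> G. u (fst q) (fst (snd q)) (snd (snd q)) *\<^sub>R bf q) j x t" by simp
    qed
    then show "S u \<in> span (bf ` ({1..n} \<times> G))"
      by (simp only:) (intro span_sum span_scale span_base imageI)
  qed
  have near: "sup_norm n (S u - u) \<le> K * (2 * \<epsilon>)" if u: "u \<in> Cper n" and K: "K \<ge> 0" and lip: "lipschitz_field n K u" for u K
  proof (rule sup_norm_least)
    fix j x t assume jx: "j \<in> {1..n}" "x \<in> {0..1::real}"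
    have "(S u - u) j x t = (\<Sum>p\<in>G. \<omega> p x t * u j (fst p) (snd p)) - (\<Sum>p\<in>G. \<omega> p x t) * u j x t"
      by (simp add: S_def rs_apply[OF jx] \<omega>1[OF jx(2)])
    also have "\<dots> = (\<Sum>p\<in>G. \<omega> p x t * (u j (fst p) (snd p) - u j x t))"
      by (simp add: sum_distrib_right sum_subtractf[symmetric] right_diff_distrib)
    finally have "\<bar>(S u - u) j x t\<bar> \<le> (\<Sum>p\<in>G. \<bar>\<omega> p x t * (u j (fst p) (snd p) - u j x t)\<bar>)"
      by (simp only: sum_abs)
    also have "\<dots> \<le> (\<Sum>p\<in>G. \<omega> p x t * (K * (2 * \<epsilon>)))"
    proof (rule sum_mono)
      fix p assume p: "p \<in> G"
      then have p1: "fst p \<in> {0..1}" using G(2) by auto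
      show "\<bar>\<omega> p x t * (u j (fst p) (snd p) - u j x t)\<bar> \<le> \<omega> p x t * (K * (2 * \<epsilon>))"
      proof (cases "\<phi> p x t = 0")
        case True then show ?thesis by (simp add: \<omega>_def)
      next
        case False
        then have c: "\<bar>x - fst p\<bar> < \<epsilon>" "\<bar>sin ((t - snd p) / 2)\<bar> < sin (\<epsilon> / 2)"
          by (auto simp: \<phi>_def \<eta>_def max_def split: if_splits)
        obtain k :: int where k: "\<bar>t + 2 * pi * of_int k - snd p\<bar> < \<epsilon>"
          by (rule sin_half_small[OF \<epsilon> c(2)])
        have "\<bar>u j (fst p) (snd p) - u j x t\<bar> = \<bar>u j (fst p) (snd p) - u j x (t + 2 * pi * of_int k)\<bar>"
          using periodic_strip_int[OF CperD(2)[OF u jx(1)] jx(2), of t k] by simp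
        also have "\<dots> \<le> K * (\<bar>fst p - x\<bar> + \<bar>snd p - (t + 2 * pi * of_int k)\<bar>)"
          using lip p1 jx unfolding lipschitz_field_def by blast
        also have "\<dots> \<le> K * (2 * \<epsilon>)" using c(1) k K by (intro mult_left_mono) auto
        finally show ?thesis using \<omega>0[OF jx(2), of p t] by (simp add: abs_mult mult_left_mono)
      qed
    qed
    also have "\<dots> = K * (2 * \<epsilon>)" unfolding sum_distrib_right[symmetric] \<omega>1[OF jx(2)] by simp
    finally show "\<bar>(S u - u) j x t\<bar> \<le> K * (2 * \<epsilon>)" .
  qed (use K \<epsilon> in simp)
  show ?thesis using fr near by blast
qed

section \<open>The hyperbolic system along its characteristics\<close>

text \<open>Bounds for finitely many components are replaced by a common one.\<close>

lemma uniform_constant: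
  assumes "finite I" "\<And>i. i \<in> I \<Longrightarrow> \<exists>C\<ge>0. P i C" and mono: "\<And>i C D. P i C \<Longrightarrow> C \<le> D \<Longrightarrow> P i D"
  shows "\<exists>C\<ge>(0::real). \<forall>i\<in>I. P i C"
  using assms(1,2)
proof (induction I)
  case empty then show ?case by auto
next
  case (insert i I)
  obtain C where C: "C \<ge> 0" "\<forall>i\<in>I. P i C" using insert by blast
  obtain D where D: "D \<ge> 0" "P i D" using insert.prems by blast
  have "P k (max C D)" if "k \<in> insert i I" for k
    using that C(2) D(2) mono[of _ _ "max C D"] by (metis insertE max.cobounded1 max.cobounded2)
  then show ?case using C(1) by (intro exI[of _ "max C D"]) auto
qed

lemma periodic_bounds:
  assumes "finite I" "\<And>i. i \<in> I \<Longrightarrow> cont (g i)" "\<And>i. i \<in> I \<Longrightarrow> periodic_strip (g i)"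
  shows "\<exists>C\<ge>0. \<forall>i\<in>I. \<forall>x\<in>{0..1}. \<forall>t. \<bar>g i x t\<bar> \<le> C"
proof (rule uniform_constant[OF assms(1)])
  show "\<exists>C\<ge>0. \<forall>x\<in>{0..1}. \<forall>t. \<bar>g i x t\<bar> \<le> C" if "i \<in> I" for i
    by (rule periodic_bound[OF assms(2)[OF that] assms(3)[OF that]])
qed (meson order_trans)

lemma ig_swap:
  assumes "continuous_on {0..1} g" "x \<in> {0..1}" "y \<in> {0..1}"
  shows "ig g x y = - ig g y x"
  using ig_split[OF assms assms(2)] by simp

lemma t_deriv_const: "t_deriv (\<lambda>x t. c) (\<lambda>x t. 0)"
  by (intro t_derivI cont_const DERIV_const)

text \<open>Stated with \<open>deriv\<close>, which avoids existential quantifiers over derivatives in the closure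
  rules.\<close>

definition C1R :: "(real \<Rightarrow> real) \<Rightarrow> bool" where
  "C1R h \<longleftrightarrow> (\<forall>t. (h has_real_derivative deriv h t) (at t)) \<and> continuous_on UNIV (deriv h)"

lemma C1RI:
  assumes "\<And>t. (h has_real_derivative h' t) (at t)" "continuous_on UNIV h'"
  shows "C1R h"
proof -
  have "deriv h = h'" using assms(1) by (intro ext DERIV_imp_deriv)
  then show ?thesis using assms by (simp add: C1R_def)
qed

lemma C1RD: "C1R h \<Longrightarrow> (h has_real_derivative deriv h t) (at t)" "C1R h \<Longrightarrow> continuous_on UNIV (deriv h)"
  by (simp_all add: C1R_def)

lemma C1R_continuous: "C1R h \<Longrightarrow> continuous_on UNIV h"
  by (meson C1RD(1) DERIV_isCont continuous_at_imp_continuous_on)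

lemma C1R_mult:
  assumes "C1R g" "C1R h" shows "C1R (\<lambda>t. g t * h t)"
  by (rule C1RI[OF DERIV_mult[OF C1RD(1)[OF assms(1)] C1RD(1)[OF assms(2)]]])
    (intro continuous_on_add continuous_on_mult C1R_continuous C1RD(2) assms)

lemma C1R_add:
  assumes "C1R g" "C1R h" shows "C1R (\<lambda>t. g t + h t)"
  by (rule C1RI[OF DERIV_add[OF C1RD(1)[OF assms(1)] C1RD(1)[OF assms(2)]]])
    (intro continuous_on_add C1RD(2) assms)

lemma C1R_const: "C1R (\<lambda>t. c)"
  by (rule C1RI[OF DERIV_const]) simp

lemma C1R_sum:
  assumes "\<And>k. k \<in> K \<Longrightarrow> C1R (h k)" shows "C1R (\<lambda>t. \<Sum>k\<in>K. h k t)"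
  by (rule C1RI[OF DERIV_sum[OF C1RD(1)[OF assms]]]) (auto intro!: continuous_on_sum C1RD(2) assms)

lemma C1R_comp:
  assumes "C1R g" "C1R h" shows "C1R (\<lambda>t. g (h t))"
proof (rule C1RI[OF DERIV_chain2[OF C1RD(1)[OF assms(1)] C1RD(1)[OF assms(2)]]])
  have "continuous_on UNIV (\<lambda>t. deriv g (h t))"
    by (rule continuous_on_compose2[OF C1RD(2)[OF assms(1)] C1R_continuous[OF assms(2)]]) simp
  then show "continuous_on UNIV (\<lambda>t. deriv g (h t) * deriv h t)"
    by (rule continuous_on_mult[OF _ C1RD(2)[OF assms(2)]])
qed

lemma C1R_t_deriv: "t_deriv g gt \<Longrightarrow> x \<in> {0..1} \<Longrightarrow> C1R (\<lambda>t. g x t)"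
  by (rule C1RI[of _ "gt x"]) (auto intro: t_derivD cont_time)

lemma t_deriv_C1R: "C1R h \<Longrightarrow> t_deriv (\<lambda>x t. h t) (\<lambda>x t. deriv h t)"
  by (intro t_derivI cont_of_time C1R_continuous C1RD)

lemma periodic_real_bound:
  assumes "continuous_on UNIV h" "periodic_real h" shows "\<exists>B\<ge>0. \<forall>t. \<bar>h t\<bar> \<le> B"
  using periodic_bound[OF cont_of_time[OF assms(1)]] assms(2)
  by (auto simp: periodic_strip_def periodic_real_def)

lemma periodic_real_bounds:
  assumes "finite I" "\<And>i. i \<in> I \<Longrightarrow> continuous_on UNIV (h i)" "\<And>i. i \<in> I \<Longrightarrow> periodic_real (h i)"
  shows "\<exists>C\<ge>0. \<forall>i\<in>I. \<forall>t. \<bar>h i t\<bar> \<le> C"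
proof (rule uniform_constant[OF assms(1)])
  show "\<exists>C\<ge>0. \<forall>t. \<bar>h i t\<bar> \<le> C" if "i \<in> I" for i
    by (rule periodic_real_bound[OF assms(2)[OF that] assms(3)[OF that]])
qed (meson order_trans)

lemma periodic_real_deriv:
  assumes "C1R h" "periodic_real h" shows "periodic_real (deriv h)"
  using periodic_t_deriv[OF _ t_deriv_C1R[OF assms(1)]] assms(2)
  by (force simp: periodic_strip_def periodic_real_def)

locale hyp =
  fixes n m :: nat and a :: field and b :: "nat \<Rightarrow> field" and r :: "nat \<Rightarrow> nat \<Rightarrow> real \<Rightarrow> real"
  assumes mn: "m \<le> n"
    and a1: "\<forall>j\<in>{1..n}. Ck_strip 1 (a j) \<and> periodic_strip (a j)"
    and b1: "\<forall>j\<in>{1..n}. \<forall>k\<in>{1..n}. Ck_strip 1 (b j k) \<and> periodic_strip (b j k)"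
    and r1: "\<forall>(j, k) \<in> {1..m} \<times> {m+1..n} \<union> {m+1..n} \<times> {1..m}.
           r j k C1_differentiable_on UNIV \<and> periodic_real (r j k)"
    and anz: "\<forall>j\<in>{1..n}. \<forall>x\<in>{0..1}. \<forall>t. a j x t \<noteq> 0"
    and bt: "\<forall>j\<in>{1..n}. \<forall>k\<in>{1..n}. j \<noteq> k \<longrightarrow>
           (\<exists>b'. Ck_strip 1 b' \<and> (\<forall>x\<in>{0..1}. \<forall>t. b j k x t = b' x t * (a k x t - a j x t)))"
begin

definition F where "F j x t = 1 / a j x t"
definition Ft where "Ft j x t = - deriv (a j x) t / (a j x t)\<^sup>2"
definition p where "p j x t = b j j x t / a j x t"
text \<open>Characteristics of the component \<open>j\<close> enter at \<open>x = e j\<close> and leave at \<open>x = xo j\<close>; the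
  boundary condition at the entry involves the components in \<open>opp j\<close>, which leave there.\<close>

definition e :: "nat \<Rightarrow> real" where "e j = (if j \<le> m then 0 else 1)"
definition xo :: "nat \<Rightarrow> real" where "xo j = (if j \<le> m then 1 else 0)"
definition opp :: "nat \<Rightarrow> nat set" where "opp j = (if j \<le> m then {m+1..n} else {1..m})"

lemma e_unit: "e j \<in> {0..1}" and xo_unit: "xo j \<in> {0..1}"
  by (simp_all add: e_def xo_def)

lemma opp: "k \<in> opp j \<Longrightarrow> k \<in> {1..n}" "k \<in> opp j \<Longrightarrow> xo k = e j" "finite (opp j)"
  using mn by (auto simp: opp_def xo_def e_def split: if_splits)

lemma a_t_deriv:
  assumes j: "j \<in> {1..n}" shows "t_deriv (a j) (\<lambda>x t. deriv (a j x) t)"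
  by (rule Ck1_t_deriv[of 0]) (use a1 j in auto)

lemma b_t_deriv:
  assumes "j \<in> {1..n}" "k \<in> {1..n}" shows "t_deriv (b j k) (\<lambda>x t. deriv (b j k x) t)"
  by (rule Ck1_t_deriv[of 0]) (use b1 assms in auto)

lemma a_nz: "j \<in> {1..n} \<Longrightarrow> x \<in> {0..1} \<Longrightarrow> a j x t \<noteq> 0"
  using anz by blast

lemma cont_a: "j \<in> {1..n} \<Longrightarrow> cont (a j)" by (rule t_derivD(1)[OF a_t_deriv])
lemma cont_b: "j \<in> {1..n} \<Longrightarrow> k \<in> {1..n} \<Longrightarrow> cont (b j k)" by (rule t_derivD(1)[OF b_t_deriv])
lemma per_a: "j \<in> {1..n} \<Longrightarrow> periodic_strip (a j)" using a1 by blast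
lemma per_b: "j \<in> {1..n} \<Longrightarrow> k \<in> {1..n} \<Longrightarrow> periodic_strip (b j k)" using b1 by blast

lemma F_t_deriv:
  assumes j: "j \<in> {1..n}" shows "t_deriv (F j) (Ft j)"
  by (rule t_deriv_cong[OF t_deriv_divide[OF t_deriv_const[of 1] a_t_deriv[OF j] a_nz[OF j]]])
    (simp_all add: F_def Ft_def power2_eq_square)

lemma slope_F: assumes j: "j \<in> {1..n}" shows "slope (F j) (Ft j)"
  by standard (use F_t_deriv[OF j] per_a[OF j] in \<open>auto simp: periodic_strip_def F_def\<close>)

lemma p_t_deriv: assumes j: "j \<in> {1..n}" shows "\<exists>pt. t_deriv (p j) pt"
  using t_deriv_divide[OF b_t_deriv[OF j j] a_t_deriv[OF j] a_nz[OF j]] unfolding p_def[abs_def] by blast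

lemma cont_p: assumes j: "j \<in> {1..n}" shows "cont (p j)"
  using p_t_deriv[OF j] t_derivD(1) by blast

lemma per_p: assumes j: "j \<in> {1..n}" shows "periodic_strip (p j)"
  unfolding p_def[abs_def] by (intro periodic_strip_divide per_a per_b j)

lemma r_C1: assumes "j \<in> {1..n}" "k \<in> opp j" shows "C1R (r j k)" "periodic_real (r j k)"
proof -
  have "(j, k) \<in> {1..m} \<times> {m+1..n} \<union> {m+1..n} \<times> {1..m}" using assms by (auto simp: opp_def split: if_splits)
  then have *: "r j k C1_differentiable_on UNIV" "periodic_real (r j k)" using r1 by blast+
  obtain D where "\<forall>t. (r j k has_vector_derivative D t) (at t)" "continuous_on UNIV D"
    using *(1) unfolding C1_differentiable_on_def by blast
  then show "C1R (r j k)" by (intro C1RI) (auto simp: has_real_derivative_iff_has_vector_derivative)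
  show "periodic_real (r j k)" by (rule *(2))
qed

lemma char_time_flow: "char_time a j \<xi> x t = flow (F j) \<xi> x t"
  by (simp add: char_time_def flow_def is_characteristic_def curve_def F_def)

abbreviation cwj where "cwj j \<equiv> slope.cw (F j) (p j)"
abbreviation D where "D j \<equiv> slope.dsol (F j) (p j) (e j)"

lemma c_coef_cw:
  assumes j: "j \<in> {1..n}" and x: "x \<in> {0..1}" and \<xi>: "\<xi> \<in> {0..1}"
  shows "c_coef a b j \<xi> x t = cwj j \<xi> x t"
proof -
  interpret S: slope "F j" "Ft j" by (rule slope_F[OF j])
  have "(LBINT \<eta>=ereal x..ereal \<xi>. p j \<eta> (flow (F j) \<eta> x t)) = ig (\<lambda>\<eta>. p j \<eta> (flow (F j) \<eta> x t)) x \<xi>"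
    by (rule ig_LBINT[OF S.cont_along[OF cont_p[OF j] x] x \<xi>])
  then show ?thesis by (simp add: c_coef_def char_time_flow S.cw_def p_def)
qed

lemma d_coef_continuous:
  assumes j: "j \<in> {1..n}" and x: "x \<in> {0..1}" and h: "cont h"
  shows "continuous_on {0..1} (\<lambda>\<xi>. d_coef a b j \<xi> x t * h \<xi> (char_time a j \<xi> x t))"
proof -
  interpret S: slope "F j" "Ft j" by (rule slope_F[OF j])
  have c: "cont (\<lambda>x t. S.E (p j) x t * F j x t * h x t)"
    by (intro cont_mult S.cont_E cont_p j S.contF h)
  have "continuous_on {0..1} (\<lambda>\<xi>. 1 / S.E (p j) x t * (\<lambda>x t. S.E (p j) x t * F j x t * h x t) \<xi> (flow (F j) \<xi> x t))"
    by (intro continuous_on_mult continuous_on_const S.cont_along[OF c x])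
  then show ?thesis
    by (rule continuous_on_cong[THEN iffD1, rotated -1])
      (auto simp: d_coef_def c_coef_cw[OF j x] char_time_flow S.cw_E[OF cont_p[OF j] x] F_def)
qed

text \<open>The integrals with \<open>c_coef\<close> and \<open>d_coef\<close> are the damped solution, since \<open>d_coef\<close> is
  \<open>c_coef\<close> times the slope.\<close>

lemma dsol_coefs:
  assumes j: "j \<in> {1..n}" and x: "x \<in> {0..1}" and h: "cont h1" "cont h2" and c: "c \<in> {0..1}"
  shows "slope.dsol (F j) (p j) c z (\<lambda>x t. (h2 x t - h1 x t) / a j x t) x t =
    c_coef a b j c x t * z (char_time a j c x t)
    - ig (\<lambda>\<xi>. d_coef a b j \<xi> x t * h1 \<xi> (char_time a j \<xi> x t)) c x
    + ig (\<lambda>\<xi>. d_coef a b j \<xi> x t * h2 \<xi> (char_time a j \<xi> x t)) c x"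
proof -
  interpret S: slope "F j" "Ft j" by (rule slope_F[OF j])
  have "ig (\<lambda>\<xi>. cwj j \<xi> x t * (\<lambda>x t. (h2 x t - h1 x t) / a j x t) \<xi> (flow (F j) \<xi> x t)) c x
    = ig (\<lambda>\<xi>. d_coef a b j \<xi> x t * h2 \<xi> (char_time a j \<xi> x t) - d_coef a b j \<xi> x t * h1 \<xi> (char_time a j \<xi> x t)) c x"
    by (rule ig_cong[OF c x])
      (simp add: d_coef_def c_coef_cw[OF j x] char_time_flow diff_divide_distrib right_diff_distrib)
  also have "\<dots> = ig (\<lambda>\<xi>. d_coef a b j \<xi> x t * h2 \<xi> (char_time a j \<xi> x t)) c x
      - ig (\<lambda>\<xi>. d_coef a b j \<xi> x t * h1 \<xi> (char_time a j \<xi> x t)) c x"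
    by (intro ig_diff d_coef_continuous j x h c)
  finally show ?thesis
    using S.dsol_cw[OF cont_p[OF j] x c, of z "\<lambda>x t. (h2 x t - h1 x t) / a j x t" t]
    by (simp add: c_coef_cw[OF j x c] char_time_flow)
qed

definition zeta where "zeta u j t = (\<Sum>k\<in>opp j. r j k t * u k (e j) t)" for u :: field
definition Bf :: "field \<Rightarrow> field" where "Bf u j x t = (\<Sum>k\<in>{1..n} - {j}. b j k x t * u k x t)"

lemma cont_Bf: "j \<in> {1..n} \<Longrightarrow> (\<And>k. k \<in> {1..n} \<Longrightarrow> cont (u k)) \<Longrightarrow> cont (Bf u j)"
  unfolding Bf_def[abs_def] by (intro cont_sum cont_mult cont_b) auto

lemma per_Bf: "j \<in> {1..n} \<Longrightarrow> (\<And>k. k \<in> {1..n} \<Longrightarrow> periodic_strip (u k)) \<Longrightarrow> periodic_strip (Bf u j)"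
  unfolding Bf_def[abs_def] by (intro periodic_strip_sum periodic_strip_mult per_b) auto

text \<open>Both groups of integral equations take the same form: \<open>u\<^sub>j\<close> is the damped solution whose
  entry values are given by the boundary condition.\<close>

lemma continuous_solution_iff:
  assumes f: "\<And>j. j \<in> {1..n} \<Longrightarrow> cont (f j)"
  shows "continuous_solution n m a b r f u \<longleftrightarrow> u \<in> Cper n \<and>
    (\<forall>j\<in>{1..n}. \<forall>x\<in>{0..1}. \<forall>t. u j x t = D j (zeta u j) (\<lambda>x t. (f j x t - Bf u j x t) / a j x t) x t)"
proof (cases "u \<in> Cper n")
  case u: True
  have B: "cont (Bf u j)" if "j \<in> {1..n}" for j by (rule cont_Bf[OF that CperD(1)[OF u]])
  have I: "c_coef a b j 0 x t * (\<Sum>k=m+1..n. r j k (char_time a j 0 x t) * u k 0 (char_time a j 0 x t))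
          - (LBINT \<xi>=0..x. d_coef a b j \<xi> x t *
              (\<Sum>k\<in>{1..n} - {j}. b j k \<xi> (char_time a j \<xi> x t) * u k \<xi> (char_time a j \<xi> x t)))
          + (LBINT \<xi>=0..x. d_coef a b j \<xi> x t * f j \<xi> (char_time a j \<xi> x t))
        = D j (zeta u j) (\<lambda>x t. (f j x t - Bf u j x t) / a j x t) x t"
    if jm: "j \<in> {1..m}" and x: "x \<in> {0..1}" for j x t
  proof -
    have j: "j \<in> {1..n}" using jm mn by auto
    have L: "(LBINT \<xi>=0..x. d_coef a b j \<xi> x t * h \<xi> (char_time a j \<xi> x t))
        = ig (\<lambda>\<xi>. d_coef a b j \<xi> x t * h \<xi> (char_time a j \<xi> x t)) 0 x" if "cont h" for h
      unfolding zero_ereal_def by (rule ig_LBINT[OF d_coef_continuous[OF j x that]]) (use x in auto)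
    show ?thesis
      using dsol_coefs[OF j x B[OF j] f[OF j], of 0 "zeta u j" t] jm L[OF B[OF j]] L[OF f[OF j]]
      by (simp add: e_def zeta_def opp_def Bf_def)
  qed
  have J: "c_coef a b j 1 x t * (\<Sum>k=1..m. r j k (char_time a j 1 x t) * u k 1 (char_time a j 1 x t))
          + (LBINT \<xi>=x..1. d_coef a b j \<xi> x t *
              (\<Sum>k\<in>{1..n} - {j}. b j k \<xi> (char_time a j \<xi> x t) * u k \<xi> (char_time a j \<xi> x t)))
          - (LBINT \<xi>=x..1. d_coef a b j \<xi> x t * f j \<xi> (char_time a j \<xi> x t))
        = D j (zeta u j) (\<lambda>x t. (f j x t - Bf u j x t) / a j x t) x t"
    if jm: "j \<in> {m+1..n}" and x: "x \<in> {0..1}" for j x t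
  proof -
    have j: "j \<in> {1..n}" using jm mn by auto
    have L: "(LBINT \<xi>=x..1. d_coef a b j \<xi> x t * h \<xi> (char_time a j \<xi> x t))
        = - ig (\<lambda>\<xi>. d_coef a b j \<xi> x t * h \<xi> (char_time a j \<xi> x t)) 1 x" if "cont h" for h
    proof -
      note c = d_coef_continuous[OF j x that]
      have one: "(1::real) \<in> {0..1}" by simp
      show ?thesis unfolding one_ereal_def ig_LBINT[OF c x one] by (rule ig_swap[OF c x one])
    qed
    show ?thesis
      using dsol_coefs[OF j x B[OF j] f[OF j], of 1 "zeta u j" t] jm L[OF B[OF j]] L[OF f[OF j]]
      by (simp add: e_def zeta_def opp_def Bf_def)
  qed
  show ?thesis
  proof
    assume cs: "continuous_solution n m a b r f u"
    have "u j x t = D j (zeta u j) (\<lambda>x t. (f j x t - Bf u j x t) / a j x t) x t"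
      if j: "j \<in> {1..n}" and x: "x \<in> {0..1}" for j x t
    proof (cases "j \<le> m")
      case True
      then have jm: "j \<in> {1..m}" using j by simp
      show ?thesis unfolding I[OF jm x, symmetric]
        using cs jm x unfolding continuous_solution_def by blast
    next
      case False
      then have jm: "j \<in> {m+1..n}" using j by simp
      show ?thesis unfolding J[OF jm x, symmetric]
        using cs jm x unfolding continuous_solution_def by blast
    qed
    then show "u \<in> Cper n \<and> (\<forall>j\<in>{1..n}. \<forall>x\<in>{0..1}. \<forall>t. u j x t = D j (zeta u j) (\<lambda>x t. (f j x t - Bf u j x t) / a j x t) x t)"
      using u by blast
  next
    assume H: "u \<in> Cper n \<and> (\<forall>j\<in>{1..n}. \<forall>x\<in>{0..1}. \<forall>t. u j x t = D j (zeta u j) (\<lambda>x t. (f j x t - Bf u j x t) / a j x t) x t)"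
    show "continuous_solution n m a b r f u"
      unfolding continuous_solution_def
    proof (intro conjI ballI allI u)
      fix x t j assume x: "x \<in> {0..1::real}" and jm: "j \<in> {1..m}"
      have "j \<in> {1..n}" using jm mn by simp
      then have "u j x t = D j (zeta u j) (\<lambda>x t. (f j x t - Bf u j x t) / a j x t) x t" using H x by blast
      from trans[OF this I[OF jm x, symmetric]]
      show "u j x t = c_coef a b j 0 x t * (\<Sum>k=m+1..n. r j k (char_time a j 0 x t) * u k 0 (char_time a j 0 x t))
          - (LBINT \<xi>=0..x. d_coef a b j \<xi> x t *
              (\<Sum>k\<in>{1..n} - {j}. b j k \<xi> (char_time a j \<xi> x t) * u k \<xi> (char_time a j \<xi> x t)))
          + (LBINT \<xi>=0..x. d_coef a b j \<xi> x t * f j \<xi> (char_time a j \<xi> x t))" .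
    next
      fix x t j assume x: "x \<in> {0..1::real}" and jm: "j \<in> {m+1..n}"
      have "j \<in> {1..n}" using jm by simp
      then have "u j x t = D j (zeta u j) (\<lambda>x t. (f j x t - Bf u j x t) / a j x t) x t" using H x by blast
      from trans[OF this J[OF jm x, symmetric]]
      show "u j x t = c_coef a b j 1 x t * (\<Sum>k=1..m. r j k (char_time a j 1 x t) * u k 1 (char_time a j 1 x t))
          + (LBINT \<xi>=x..1. d_coef a b j \<xi> x t *
              (\<Sum>k\<in>{1..n} - {j}. b j k \<xi> (char_time a j \<xi> x t) * u k \<xi> (char_time a j \<xi> x t)))
          - (LBINT \<xi>=x..1. d_coef a b j \<xi> x t * f j \<xi> (char_time a j \<xi> x t))" .
    qed
  qed
qed (simp add: continuous_solution_def)

text \<open>Damping and entry time of the characteristic through \<open>(x, t)\<close>; below, \<open>kx\<close> and \<open>sx\<close> are the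
  same for a characteristic that leaves at time \<open>t\<close>, and \<open>TTx\<close> is the derivative of \<open>sx\<close>.\<close>

definition kap where "kap j x t = cwj j (e j) x t"
definition sig where "sig j x t = flow (F j) (e j) x t"
definition kx where "kx j t = kap j (xo j) t"
definition sx where "sx j t = sig j (xo j) t"

lemma D_split:
  assumes j: "j \<in> {1..n}" and x: "x \<in> {0..1}"
  shows "D j z f x t = kap j x t * z (sig j x t) + D j (\<lambda>_. 0) f x t"
proof -
  interpret S: slope "F j" "Ft j" by (rule slope_F[OF j])
  show ?thesis
    using S.dsol_cw[OF cont_p[OF j] x e_unit, of j z f t] S.dsol_cw[OF cont_p[OF j] x e_unit, of j "\<lambda>_. 0" f t]
    by (simp add: kap_def sig_def)
qed

lemma D_entry:
  assumes j: "j \<in> {1..n}" and x: "x \<in> {0..1}"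
  shows "D j z (\<lambda>_ _. 0) x t = kap j x t * z (sig j x t)"
proof -
  interpret S: slope "F j" "Ft j" by (rule slope_F[OF j])
  show ?thesis
    using S.dsol_cw[OF cont_p[OF j] x e_unit, of j z "\<lambda>_ _. 0" t] by (simp add: kap_def sig_def ig_def)
qed

lemma cont_D: "j \<in> {1..n} \<Longrightarrow> cont f \<Longrightarrow> continuous_on UNIV z \<Longrightarrow> cont (D j z f)"
  by (rule slope.cont_dsol[OF slope_F cont_p _ _ e_unit])

lemma per_D: "j \<in> {1..n} \<Longrightarrow> periodic_strip f \<Longrightarrow> periodic_real z \<Longrightarrow> periodic_strip (D j z f)"
  by (rule slope.periodic_dsol[OF slope_F per_p _ _ e_unit])

lemma kap_D: "j \<in> {1..n} \<Longrightarrow> x \<in> {0..1} \<Longrightarrow> kap j x t = D j (\<lambda>_. 1) (\<lambda>_ _. 0) x t"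
  by (simp add: D_entry)

lemma cont_kap: assumes j: "j \<in> {1..n}" shows "cont (kap j)"
  using cont_cong[of "kap j" "D j (\<lambda>_. 1) (\<lambda>_ _. 0)"] kap_D[OF j] cont_D[OF j cont_const[of 0] continuous_on_const[of UNIV 1]] by blast

lemma per_kap: assumes j: "j \<in> {1..n}" shows "periodic_strip (kap j)"
  using per_D[OF j, of "\<lambda>_ _. 0" "\<lambda>_. 1"] kap_D[OF j] by (simp add: periodic_strip_def periodic_real_def)

lemma kap_t_deriv: assumes j: "j \<in> {1..n}" shows "\<exists>w. t_deriv (kap j) w"
proof -
  interpret S: slope "F j" "Ft j" by (rule slope_F[OF j])
  obtain pt where "t_deriv (p j) pt" using p_t_deriv[OF j] by blast
  from S.t_deriv_dsol[OF this t_deriv_const[of 0] DERIV_const[of 1] continuous_on_const e_unit[of j]]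
  obtain w where "t_deriv (D j (\<lambda>_. 1) (\<lambda>_ _. 0)) w" by blast
  from t_deriv_cong[OF this, of "kap j" w] show ?thesis using kap_D[OF j] by auto
qed

lemma continuous_sx: assumes j: "j \<in> {1..n}" shows "continuous_on UNIV (sx j)"
proof -
  interpret S: slope "F j" "Ft j" by (rule slope_F[OF j])
  show ?thesis unfolding sx_def[abs_def] sig_def
    by (rule S.flow_comp) (use e_unit xo_unit in \<open>auto intro: continuous_intros\<close>)
qed

lemma cont_sig: assumes j: "j \<in> {1..n}" shows "cont (sig j)"
proof -
  interpret S: slope "F j" "Ft j" by (rule slope_F[OF j])
  show ?thesis unfolding sig_def[abs_def] case_prod_unfold
    by (rule S.flow_comp) (use e_unit in \<open>auto intro: continuous_intros\<close>)
qed

lemma sig_shift: "j \<in> {1..n} \<Longrightarrow> x \<in> {0..1} \<Longrightarrow> sig j x (t + 2 * pi) = sig j x t + 2 * pi"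
  unfolding sig_def by (rule slope.flow_shift[OF slope_F _ e_unit])

lemma sx_shift: "j \<in> {1..n} \<Longrightarrow> sx j (t + 2 * pi) = sx j t + 2 * pi"
  unfolding sx_def by (rule sig_shift[OF _ xo_unit])

definition TTx where "TTx j t = slope.TT (F j) (Ft j) (e j) (xo j) t"

lemma sx_deriv: assumes j: "j \<in> {1..n}" shows "(sx j has_real_derivative TTx j t) (at t)"
  unfolding sx_def[abs_def] sig_def TTx_def by (rule slope.flow_deriv_t[OF slope_F[OF j] xo_unit e_unit])

lemma continuous_TTx: assumes j: "j \<in> {1..n}" shows "continuous_on UNIV (TTx j)"
proof -
  interpret S: slope "F j" "Ft j" by (rule slope_F[OF j])
  show ?thesis unfolding TTx_def[abs_def]
    by (rule S.TT_comp) (use e_unit xo_unit in \<open>auto intro: continuous_intros\<close>)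
qed

lemma C1R_sx: "j \<in> {1..n} \<Longrightarrow> C1R (sx j)"
  by (rule C1RI[OF sx_deriv continuous_TTx])

lemma C1R_kx: "j \<in> {1..n} \<Longrightarrow> C1R (kx j)"
  using kap_t_deriv[of j] C1R_t_deriv[OF _ xo_unit] unfolding kx_def[abs_def] by blast

lemma per_kx: "j \<in> {1..n} \<Longrightarrow> periodic_real (kx j)"
  using per_kap[of j] xo_unit[of j] by (simp add: periodic_strip_def periodic_real_def kx_def)

lemma kap_bound: "\<exists>C\<ge>0. \<forall>j\<in>{1..n}. \<forall>x\<in>{0..1}. \<forall>t. \<bar>kap j x t\<bar> \<le> C"
  by (rule periodic_bounds[OF finite_atLeastAtMost cont_kap per_kap])

lemma r_bound: "\<exists>C\<ge>0. \<forall>j\<in>{1..n}. \<forall>k\<in>opp j. \<forall>t. \<bar>r j k t\<bar> \<le> C"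
proof (rule uniform_constant[OF finite_atLeastAtMost])
  show "\<exists>C\<ge>0. \<forall>k\<in>opp j. \<forall>t. \<bar>r j k t\<bar> \<le> C" if j: "j \<in> {1..n}" for j
    by (rule periodic_real_bounds[OF opp(3) C1R_continuous[OF r_C1(1)[OF j]] r_C1(2)[OF j]])
qed (meson order_trans)

lemma card_opp: "card (opp j) \<le> n" using mn by (auto simp: opp_def)

end

section \<open>Solving the boundary conditions\<close>

text \<open>The hypothesis on the boundary data: running through the interval twice, starting and ending at
  components in \<open>Q\<close>, is a contraction in the supremum norm.\<close>

locale hypQ = hyp +
  fixes Q :: "nat set" and q :: real
  assumes Q: "Q = {1..m} \<or> Q = {m+1..n}" and q01: "0 \<le> q" "q < 1"
    and contr: "\<And>j t. j \<in> Q \<Longrightarrow> (\<Sum>pr\<in>({1..n} - Q) \<times> Q.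
      \<bar>kx j t * r j (fst pr) (sx j t) * (kx (fst pr) (sx j t) * r (fst pr) (snd pr) (sx (fst pr) (sx j t)))\<bar>) \<le> q"
begin

abbreviation P where "P \<equiv> {1..n} - Q"

lemma Qn: "Q \<subseteq> {1..n}" using Q mn by auto
lemma oppQ: "j \<in> Q \<Longrightarrow> opp j = P" using Q mn by (auto simp: opp_def)
lemma oppP: "j \<in> P \<Longrightarrow> opp j = Q" using Q mn by (auto simp: opp_def)
lemma finQ: "finite Q" using Qn finite_subset by blast

text \<open>Coefficients and shifts of the functional equation. A pair \<open>(k, l)\<close> stands for a passage
  backwards in \<open>x\<close>-direction along the component \<open>j \<in> Q\<close>, a reflection into \<open>k \<notin> Q\<close>, a passage
  along \<open>k\<close>, and a reflection into \<open>l \<in> Q\<close>.\<close>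

definition Aco where
  "Aco j pr t = kx j t * r j (fst pr) (sx j t) * (kx (fst pr) (sx j t) * r (fst pr) (snd pr) (sx (fst pr) (sx j t)))"
definition th where "th j pr t = sx (fst pr) (sx j t)" for pr :: "nat \<times> nat"

lemma C1R_Aco:
  assumes j: "j \<in> Q" and pr: "pr \<in> P \<times> Q" shows "C1R (Aco j pr)"
proof -
  obtain k l where [simp]: "pr = (k, l)" by (cases pr)
  have jn: "j \<in> {1..n}" and k: "k \<in> {1..n}" "k \<in> opp j" and l: "l \<in> opp k"
    using j pr Qn oppQ[OF j] oppP[of k] by auto
  show ?thesis unfolding Aco_def[abs_def]
    using k l by (auto intro!: C1R_mult C1R_kx jn C1R_comp[OF r_C1(1)] C1R_comp[OF C1R_kx] C1R_sx C1R_comp[OF C1R_sx])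
qed

lemma C1R_th:
  assumes "j \<in> Q" "pr \<in> P \<times> Q" shows "C1R (th j pr)"
  unfolding th_def[abs_def] by (rule C1R_comp[OF C1R_sx C1R_sx]) (use assms Qn in auto)

lemma per_Aco:
  assumes j: "j \<in> Q" and pr: "pr \<in> P \<times> Q" shows "periodic_real (Aco j pr)"
proof -
  obtain k l where [simp]: "pr = (k, l)" by (cases pr)
  have jn: "j \<in> {1..n}" and k: "k \<in> {1..n}" "k \<in> opp j" and l: "l \<in> opp k"
    using j pr Qn oppQ[OF j] oppP[of k] by auto
  show ?thesis
    using per_kx[OF jn] per_kx[OF k(1)] r_C1(2)[OF jn k(2)] r_C1(2)[OF k(1) l]
    by (simp add: periodic_real_def Aco_def sx_shift[OF jn] sx_shift[OF k(1)])
qed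

sublocale fe: functional_equation Q "P \<times> Q" Aco snd th q
proof
  show "finite (P \<times> Q)" using finQ by simp
  show "snd pr \<in> Q" if "pr \<in> P \<times> Q" for pr using that by auto
  show "(\<Sum>pr\<in>P \<times> Q. \<bar>Aco j pr t\<bar>) \<le> q" if "j \<in> Q" for j t using contr[OF that] by (simp add: Aco_def)
qed (use q01 C1R_Aco C1R_th C1R_continuous in auto)

text \<open>The inhomogeneity \<open>hh\<close> of the functional equation, and the exit values \<open>zz\<close> of all
  components, those outside \<open>Q\<close> being computed from the others.\<close>

definition hh where "hh g j t = g j (xo j) t + kx j t * (\<Sum>k\<in>P. r j k (sx j t) * g k (xo k) (sx j t))" for g :: field
definition zz where "zz g j t = (if j \<in> Q then fe.fp (hh g) j t
    else kx j t * (\<Sum>l\<in>Q. r j l (sx j t) * fe.fp (hh g) l (sx j t)) + g j (xo j) t)" for g :: field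

lemma zzQ: "j \<in> Q \<Longrightarrow> zz g j t = fe.fp (hh g) j t" by (simp add: zz_def)
lemma zzP: "j \<in> P \<Longrightarrow> zz g j t = kx j t * (\<Sum>l\<in>Q. r j l (sx j t) * fe.fp (hh g) l (sx j t)) + g j (xo j) t"
  by (simp add: zz_def)

text \<open>Eliminating the components outside \<open>Q\<close> turns the system for the boundary values at the exits
  into the functional equation.\<close>

lemma elimination:
  assumes y: "\<And>k s. k \<in> P \<Longrightarrow> y k s = kx k s * (\<Sum>l\<in>Q. r k l (sx k s) * w l (sx k s)) + g k (xo k) s"
  shows "kx j t * (\<Sum>k\<in>P. r j k (sx j t) * y k (sx j t)) + g j (xo j) t = fe.W w j t + hh g j t"
proof -
  have "kx j t * (\<Sum>k\<in>P. r j k (sx j t) * y k (sx j t))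
    = kx j t * (\<Sum>k\<in>P. r j k (sx j t) * (kx k (sx j t) * (\<Sum>l\<in>Q. r k l (sx k (sx j t)) * w l (sx k (sx j t))) + g k (xo k) (sx j t)))"
    by (simp add: y)
  also have "\<dots> = (\<Sum>k\<in>P. \<Sum>l\<in>Q. Aco j (k, l) t * w l (th j (k, l) t))
      + kx j t * (\<Sum>k\<in>P. r j k (sx j t) * g k (xo k) (sx j t))"
    by (simp add: Aco_def th_def distrib_left sum.distrib sum_distrib_left mult_ac)
  also have "(\<Sum>k\<in>P. \<Sum>l\<in>Q. Aco j (k, l) t * w l (th j (k, l) t)) = fe.W w j t"
    unfolding fe.W_def sum.cartesian_product by (simp add: case_prod_unfold)
  finally show ?thesis by (simp add: hh_def)
qed

context
  fixes g :: field and B :: real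
  assumes g: "\<And>j. j \<in> {1..n} \<Longrightarrow> cont (g j)" "\<And>j. j \<in> {1..n} \<Longrightarrow> periodic_strip (g j)"
    and gB: "\<And>j x t. j \<in> {1..n} \<Longrightarrow> x \<in> {0..1} \<Longrightarrow> \<bar>g j x t\<bar> \<le> B"
begin

lemma g_time: "k \<in> {1..n} \<Longrightarrow> continuous_on UNIV (g k (xo k))"
  by (rule cont_time[OF g(1) xo_unit])

lemma hh_continuous:
  assumes j: "j \<in> Q" shows "continuous_on UNIV (hh g j)"
proof -
  have jn: "j \<in> {1..n}" using j Qn by auto
  show ?thesis unfolding hh_def[abs_def]
  proof (intro continuous_on_add continuous_on_mult continuous_on_sum g_time jn C1R_continuous[OF C1R_kx])
    fix k assume k: "k \<in> P"
    then have kn: "k \<in> {1..n}" and ko: "k \<in> opp j" using oppQ[OF j] by auto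
    show "continuous_on UNIV (\<lambda>t. r j k (sx j t))"
      by (rule C1R_continuous[OF C1R_comp[OF r_C1(1)[OF jn ko] C1R_sx[OF jn]]])
    show "continuous_on UNIV (\<lambda>t. g k (xo k) (sx j t))"
      by (rule continuous_on_compose2[OF g_time[OF kn] continuous_sx[OF jn]]) simp
  qed
qed

lemma hh_periodic:
  assumes j: "j \<in> Q" shows "hh g j (t + 2 * pi) = hh g j t"
proof -
  have jn: "j \<in> {1..n}" using j Qn by auto
  have "r j k (s + 2 * pi) * g k (xo k) (s + 2 * pi) = r j k s * g k (xo k) s" if "k \<in> P" for k s
    using r_C1(2)[OF jn, of k] oppQ[OF j] that g(2)[of k] xo_unit[of k] by (simp add: periodic_real_def periodic_strip_def)
  then show ?thesis
    using g(2)[OF jn] xo_unit[of j] per_kx[OF jn]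
    by (simp add: hh_def sx_shift[OF jn] periodic_real_def periodic_strip_def)
qed

context
  fixes Ck Cr :: real
  assumes Ck: "Ck \<ge> 0" "\<And>j x t. j \<in> {1..n} \<Longrightarrow> x \<in> {0..1} \<Longrightarrow> \<bar>kap j x t\<bar> \<le> Ck"
    and Cr: "Cr \<ge> 0" "\<And>j k t. j \<in> {1..n} \<Longrightarrow> k \<in> opp j \<Longrightarrow> \<bar>r j k t\<bar> \<le> Cr" and B0: "B \<ge> 0"
begin

lemma boundary_sum_bound:
  assumes j: "j \<in> {1..n}" and x: "x \<in> {0..1}" and w: "\<And>k. k \<in> opp j \<Longrightarrow> \<bar>w k\<bar> \<le> A" and A: "A \<ge> 0"
  shows "\<bar>kap j x t * (\<Sum>k\<in>opp j. r j k s * w k)\<bar> \<le> Ck * Cr * n * A"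
proof -
  have "\<bar>\<Sum>k\<in>opp j. r j k s * w k\<bar> \<le> (\<Sum>k\<in>opp j. \<bar>r j k s * w k\<bar>)" by (rule sum_abs)
  also have "\<dots> \<le> (\<Sum>k\<in>opp j. Cr * A)"
    unfolding abs_mult by (intro sum_mono mult_mono Cr(2)[OF j] w) (use Cr(1) in auto)
  also have "\<dots> \<le> n * (Cr * A)"
    using card_opp[of j] Cr(1) A by (simp add: mult_right_mono)
  finally have "\<bar>kap j x t\<bar> * \<bar>\<Sum>k\<in>opp j. r j k s * w k\<bar> \<le> Ck * (n * (Cr * A))"
    by (intro mult_mono Ck(2)[OF j x] Ck(1)) auto
  then show ?thesis by (simp add: abs_mult mult_ac)
qed

lemma hh_bound:
  assumes j: "j \<in> Q" shows "\<bar>hh g j t\<bar> \<le> (1 + Ck * Cr * n) * B"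
proof -
  have jn: "j \<in> {1..n}" using j Qn by auto
  have "\<bar>kap j (xo j) t * (\<Sum>k\<in>opp j. r j k (sx j t) * g k (xo k) (sx j t))\<bar> \<le> Ck * Cr * n * B"
    by (rule boundary_sum_bound[OF jn xo_unit _ B0]) (rule gB[OF opp(1) xo_unit])
  then show ?thesis using gB[OF jn xo_unit, of j t] by (simp add: hh_def kx_def oppQ[OF j] algebra_simps)
qed

lemma zz_eq:
  assumes j: "j \<in> {1..n}"
  shows "zz g j t = kx j t * (\<Sum>k\<in>opp j. r j k (sx j t) * zz g k (sx j t)) + g j (xo j) t"
proof (cases "j \<in> Q")
  case True
  have "kx j t * (\<Sum>k\<in>P. r j k (sx j t) * zz g k (sx j t)) + g j (xo j) t = fe.W (fe.fp (hh g)) j t + hh g j t"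
    by (rule elimination[OF zzP])
  also have "\<dots> = fe.fp (hh g) j t" by (rule fe.fp_eq[OF hh_bound hh_continuous True, symmetric])
  finally show ?thesis using True by (simp add: oppQ zzQ)
next
  case False
  then have jP: "j \<in> P" using j by simp
  have "(\<Sum>k\<in>Q. r j k (sx j t) * zz g k (sx j t)) = (\<Sum>k\<in>Q. r j k (sx j t) * fe.fp (hh g) k (sx j t))"
    by (simp add: zzQ)
  then show ?thesis unfolding oppP[OF jP] using zzP[OF jP] by simp
qed

lemma fp_periodic:
  assumes j: "j \<in> Q" shows "fe.fp (hh g) j (t + 2 * pi) = fe.fp (hh g) j t"
proof -
  have "(\<lambda>j t. fe.fp (hh g) j (t + 2 * pi)) j t = fe.fp (hh g) j t"
  proof (rule fe.solution_unique[where h = "hh g" and z = "\<lambda>j t. fe.fp (hh g) j (t + 2 * pi)" and y = "fe.fp (hh g)"])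
    show "\<bar>fe.fp (hh g) j (t + 2 * pi)\<bar> \<le> (1 + Ck * Cr * n) * B / (1 - q)" if "j \<in> Q" for j t
      by (rule fe.fp_bound[OF hh_bound hh_continuous that])
    show "\<bar>fe.fp (hh g) j t\<bar> \<le> (1 + Ck * Cr * n) * B / (1 - q)" if "j \<in> Q" for j t
      by (rule fe.fp_bound[OF hh_bound hh_continuous that])
    show "fe.fp (hh g) j t = fe.W (fe.fp (hh g)) j t + hh g j t" if "j \<in> Q" for j t
      by (rule fe.fp_eq[OF hh_bound hh_continuous that])
    show "fe.fp (hh g) j (t + 2 * pi) = fe.W (\<lambda>j t. fe.fp (hh g) j (t + 2 * pi)) j t + hh g j t" if j: "j \<in> Q" for j t
    proof -
      have "Aco j pr (t + 2 * pi) * fe.fp (hh g) (snd pr) (th j pr (t + 2 * pi))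
          = Aco j pr t * fe.fp (hh g) (snd pr) (th j pr t + 2 * pi)" if pr: "pr \<in> P \<times> Q" for pr
      proof -
        have "fst pr \<in> {1..n}" "j \<in> {1..n}" using pr j Qn by auto
        then show ?thesis using per_Aco[OF j pr] by (simp add: periodic_real_def th_def sx_shift)
      qed
      then have "fe.W (fe.fp (hh g)) j (t + 2 * pi) = fe.W (\<lambda>j t. fe.fp (hh g) j (t + 2 * pi)) j t"
        unfolding fe.W_def by (rule sum.cong[OF refl])
      moreover have "fe.fp (hh g) j (t + 2 * pi) = fe.W (fe.fp (hh g)) j (t + 2 * pi) + hh g j (t + 2 * pi)"
        by (rule fe.fp_eq[OF hh_bound hh_continuous j])
      ultimately show ?thesis by (simp only: hh_periodic[OF j])
    qed
  qed (rule j)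
  then show ?thesis .
qed

lemma zz_continuous:
  assumes j: "j \<in> {1..n}" shows "continuous_on UNIV (zz g j)"
proof (cases "j \<in> Q")
  case True
  then show ?thesis using fe.fp_cont[OF hh_bound hh_continuous True] zzQ[OF True] by (simp add: fun_eq_iff cong: continuous_on_cong)
next
  case False
  then have jP: "j \<in> P" using j by simp
  have "continuous_on UNIV (\<lambda>t. kx j t * (\<Sum>l\<in>Q. r j l (sx j t) * fe.fp (hh g) l (sx j t)) + g j (xo j) t)"
  proof (intro continuous_on_add continuous_on_mult continuous_on_sum g_time j C1R_continuous[OF C1R_kx])
    fix l assume l: "l \<in> Q"
    then have lo: "l \<in> opp j" using oppP[OF jP] by simp
    show "continuous_on UNIV (\<lambda>t. r j l (sx j t))"
      by (rule C1R_continuous[OF C1R_comp[OF r_C1(1)[OF j lo] C1R_sx[OF j]]])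
    show "continuous_on UNIV (\<lambda>t. fe.fp (hh g) l (sx j t))"
      by (rule continuous_on_compose2[OF fe.fp_cont[OF hh_bound hh_continuous l] continuous_sx[OF j]]) simp_all
  qed
  then show ?thesis using zzP[OF jP, of g] by (simp cong: continuous_on_cong)
qed

lemma zz_periodic:
  assumes j: "j \<in> {1..n}" shows "zz g j (t + 2 * pi) = zz g j t"
proof (cases "j \<in> Q")
  case True then show ?thesis unfolding zzQ[OF True] by (rule fp_periodic)
next
  case False
  then have jP: "j \<in> P" using j by simp
  have "r j l (s + 2 * pi) * fe.fp (hh g) l (s + 2 * pi) = r j l s * fe.fp (hh g) l s" if "l \<in> Q" for l s
    using r_C1(2)[OF j, of l] oppP[OF jP] that fp_periodic[OF that] by (simp add: periodic_real_def)
  then show ?thesis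
    using g(2)[OF j] xo_unit[of j] per_kx[OF j]
    by (simp add: zzP[OF jP] sx_shift[OF j] periodic_real_def periodic_strip_def)
qed

lemma zz_bound:
  assumes S: "S = Ck * Cr * n" and Z: "Z = (1 + S) / (1 - q)" and j: "j \<in> {1..n}"
  shows "\<bar>zz g j t\<bar> \<le> (Z + S * Z + 1) * B"
proof -
  have S0: "S \<ge> 0" using Ck(1) Cr(1) by (simp add: S)
  have Z0: "Z \<ge> 0" using S0 q01 by (simp add: Z)
  have Qb: "\<bar>fe.fp (hh g) j t\<bar> \<le> Z * B" if "j \<in> Q" for j t
  proof -
    have "\<bar>fe.fp (hh g) j t\<bar> \<le> (1 + Ck * Cr * n) * B / (1 - q)"
      by (rule fe.fp_bound[OF hh_bound hh_continuous that])
    then show ?thesis by (simp only: S Z times_divide_eq_left)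
  qed
  have pos: "0 \<le> S * Z * B" "0 \<le> Z * B" using S0 Z0 B0 by simp_all
  show ?thesis
  proof (cases "j \<in> Q")
    case True
    then show ?thesis using Qb[OF True, of t] pos B0 by (simp add: zzQ algebra_simps)
  next
    case False
    then have jP: "j \<in> P" using j by simp
    have "\<bar>kap j (xo j) t * (\<Sum>l\<in>opp j. r j l (sx j t) * fe.fp (hh g) l (sx j t))\<bar> \<le> Ck * Cr * n * (Z * B)"
      by (rule boundary_sum_bound[OF j xo_unit Qb]) (use oppP[OF jP] pos in auto)
    then show ?thesis
      using gB[OF j xo_unit, of j t] pos by (simp add: zzP[OF jP] kx_def oppP[OF jP] S algebra_simps)
  qed
qed

end

end

definition Aop :: "field \<Rightarrow> field" where
  "Aop g = rs n (\<lambda>j x t. kap j x t * (\<Sum>k\<in>opp j. r j k (sig j x t) * zz g k (sig j x t)) + g j x t)"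

text \<open>The equation \<open>u = C u + g\<close>, where \<open>C\<close> transports boundary values along the characteristics.\<close>

definition bsolves where
  "bsolves g u \<longleftrightarrow> u \<in> Cper n \<and> (\<forall>j\<in>{1..n}. \<forall>x\<in>{0..1}. \<forall>t. u j x t = kap j x t * zeta u j (sig j x t) + g j x t)"

lemma bsolves_unique:
  assumes g: "\<And>j. j \<in> {1..n} \<Longrightarrow> cont (g j)" "\<And>j. j \<in> {1..n} \<Longrightarrow> periodic_strip (g j)"
    and u: "bsolves g u" and j: "j \<in> {1..n}" and x: "x \<in> {0..1}"
  shows "u j (xo j) t = zz g j t"
    "u j x t = kap j x t * (\<Sum>k\<in>opp j. r j k (sig j x t) * zz g k (sig j x t)) + g j x t"
proof -
  obtain Ck where Ck: "Ck \<ge> 0" "\<forall>j\<in>{1..n}. \<forall>x\<in>{0..1}. \<forall>t. \<bar>kap j x t\<bar> \<le> Ck" using kap_bound by blast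
  obtain Cr where Cr: "Cr \<ge> 0" "\<forall>j\<in>{1..n}. \<forall>k\<in>opp j. \<forall>t. \<bar>r j k t\<bar> \<le> Cr" using r_bound by blast
  have "\<exists>B\<ge>0. \<forall>j\<in>{1..n}. \<forall>x\<in>{0..1}. \<forall>t. \<bar>g j x t\<bar> \<le> B"
    by (rule periodic_bounds[OF finite_atLeastAtMost g])
  then obtain B where B: "B \<ge> 0" "\<forall>j\<in>{1..n}. \<forall>x\<in>{0..1}. \<forall>t. \<bar>g j x t\<bar> \<le> B" by blast
  have gB: "\<And>j x t. j \<in> {1..n} \<Longrightarrow> x \<in> {0..1} \<Longrightarrow> \<bar>g j x t\<bar> \<le> B" using B(2) by blast
  have hb: "\<bar>hh g j t\<bar> \<le> (1 + Ck * Cr * n) * B" if "j \<in> Q" for j t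
    by (rule hh_bound[OF g gB Ck(1) _ Cr(1) _ B(1) that]) (use Ck(2) Cr(2) in auto)
  have hc: "continuous_on UNIV (hh g j)" if "j \<in> Q" for j
    by (rule hh_continuous[OF g gB that])
  have uC: "u \<in> Cper n" and ueq: "\<And>j x t. j \<in> {1..n} \<Longrightarrow> x \<in> {0..1} \<Longrightarrow> u j x t = kap j x t * zeta u j (sig j x t) + g j x t"
    using u by (auto simp: bsolves_def)
  define y where "y j t = u j (xo j) t" for j t
  have zeta_y: "zeta u j s = (\<Sum>k\<in>opp j. r j k s * y k s)" for j s
    unfolding zeta_def y_def by (rule sum.cong) (simp_all add: opp(2))
  have yeq: "y j t = kx j t * (\<Sum>k\<in>opp j. r j k (sx j t) * y k (sx j t)) + g j (xo j) t" if "j \<in> {1..n}" for j t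
    using ueq[OF that xo_unit, of j t] unfolding zeta_y by (simp add: y_def kx_def sx_def)
  have yP: "y k s = kx k s * (\<Sum>l\<in>Q. r k l (sx k s) * y l (sx k s)) + g k (xo k) s" if "k \<in> P" for k s
    using yeq[of k s] that oppP[OF that] by simp
  have yQ: "y j t = fe.W y j t + hh g j t" if "j \<in> Q" for j t
  proof -
    have jn: "j \<in> {1..n}" using that Qn by auto
    show ?thesis
      using yeq[OF jn, of t] unfolding oppQ[OF that]
      by (rule trans[OF _ elimination[where y = y and w = y and g = g and j = j and t = t, OF yP]])
  qed
  have yfp: "y j t = fe.fp (hh g) j t" if "j \<in> Q" for j t
  proof (rule fe.solution_unique[OF _ yQ fe.fp_bound[OF hb hc] fe.fp_eq[OF hb hc] that])
    show "\<bar>y j t\<bar> \<le> sup_norm n u" if "j \<in> Q" for j t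
      unfolding y_def by (rule sup_norm_upper[OF uC _ xo_unit]) (use that Qn in auto)
  qed
  have yz: "y j t = zz g j t" if "j \<in> {1..n}" for j t
  proof (cases "j \<in> Q")
    case True then show ?thesis by (simp add: yfp zzQ)
  next
    case False
    then have jP: "j \<in> P" using that by simp
    show ?thesis unfolding yP[OF jP, of t] zzP[OF jP, of g t] by (simp add: yfp)
  qed
  show "u j (xo j) t = zz g j t" using yz[OF j] by (simp add: y_def)
  have "(\<Sum>k\<in>opp j. r j k s * y k s) = (\<Sum>k\<in>opp j. r j k s * zz g k s)" for s
    by (rule sum.cong[OF refl]) (simp only: yz[OF opp(1)])
  then show "u j x t = kap j x t * (\<Sum>k\<in>opp j. r j k (sig j x t) * zz g k (sig j x t)) + g j x t"
    using ueq[OF j x, of t] unfolding zeta_y by simp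
qed

lemma Aop_solves:
  "\<exists>CA\<ge>0. \<forall>g\<in>Cper n. bsolves g (Aop g) \<and> sup_norm n (Aop g) \<le> CA * sup_norm n g"
proof -
  obtain Ck where Ck: "Ck \<ge> 0" "\<forall>j\<in>{1..n}. \<forall>x\<in>{0..1}. \<forall>t. \<bar>kap j x t\<bar> \<le> Ck" using kap_bound by blast
  obtain Cr where Cr: "Cr \<ge> 0" "\<forall>j\<in>{1..n}. \<forall>k\<in>opp j. \<forall>t. \<bar>r j k t\<bar> \<le> Cr" using r_bound by blast
  define S' where "S' = Ck * Cr * n"
  define Z' where "Z' = (1 + S') / (1 - q)"
  define Z2 where "Z2 = Z' + S' * Z' + 1"
  have S0: "S' \<ge> 0" using Ck(1) Cr(1) by (simp add: S'_def)
  have Z0: "Z' \<ge> 0" using S0 q01 by (simp add: Z'_def)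
  have Z20: "Z2 \<ge> 0" using S0 Z0 by (simp add: Z2_def)
  have "bsolves g (Aop g) \<and> sup_norm n (Aop g) \<le> (S' * Z2 + 1) * sup_norm n g" if gC: "g \<in> Cper n" for g
  proof -
    let ?B = "sup_norm n g"
    note g = CperD(1)[OF gC] CperD(2)[OF gC] and gB = sup_norm_upper[OF gC]
    note B0 = sup_norm_nonneg[OF gC]
    have CkCr: "\<And>j x t. j \<in> {1..n} \<Longrightarrow> x \<in> {0..1} \<Longrightarrow> \<bar>kap j x t\<bar> \<le> Ck"
      "\<And>j k t. j \<in> {1..n} \<Longrightarrow> k \<in> opp j \<Longrightarrow> \<bar>r j k t\<bar> \<le> Cr" using Ck(2) Cr(2) by auto
    have zc: "continuous_on UNIV (zz g j)" if "j \<in> {1..n}" for j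
      by (rule zz_continuous[OF g gB Ck(1) CkCr(1) Cr(1) CkCr(2) B0 that])
    have zp: "zz g j (t + 2 * pi) = zz g j t" if "j \<in> {1..n}" for j t
      by (rule zz_periodic[OF g gB Ck(1) CkCr(1) Cr(1) CkCr(2) B0 that])
    have ze: "zz g j t = kx j t * (\<Sum>k\<in>opp j. r j k (sx j t) * zz g k (sx j t)) + g j (xo j) t" if "j \<in> {1..n}" for j t
      by (rule zz_eq[OF g gB Ck(1) CkCr(1) Cr(1) CkCr(2) B0 that])
    have zb: "\<bar>zz g j t\<bar> \<le> Z2 * ?B" if "j \<in> {1..n}" for j t
      unfolding Z2_def by (rule zz_bound[OF g gB Ck(1) CkCr(1) Cr(1) CkCr(2) B0 S'_def Z'_def that])
    define u where "u j x t = kap j x t * (\<Sum>k\<in>opp j. r j k (sig j x t) * zz g k (sig j x t)) + g j x t" for j x t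
    have Au: "Aop g = rs n u" by (simp add: Aop_def u_def[abs_def])
    have sumc: "continuous_on UNIV (\<lambda>s. \<Sum>k\<in>opp j. r j k s * zz g k s)" if j: "j \<in> {1..n}" for j
      by (intro continuous_on_sum continuous_on_mult C1R_continuous r_C1(1)[OF j] zc opp(1))
    have uX: "rs n u \<in> Cper n"
    proof (rule rs_in_Cper)
      fix j assume j: "j \<in> {1..n}"
      have "cont (\<lambda>x t. \<Sum>k\<in>opp j. r j k (sig j x t) * zz g k (sig j x t))"
        unfolding case_prod_unfold
        by (rule continuous_on_compose2[OF sumc[OF j], of _ "\<lambda>p. sig j (fst p) (snd p)"])
          (use cont_sig[OF j] in \<open>auto simp: case_prod_unfold\<close>)
      from cont_add[OF cont_mult[OF cont_kap[OF j] this] g(1)[OF j]] show "cont (u j)"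
        by (simp add: u_def[abs_def])
      have "r j k (s + 2 * pi) * zz g k (s + 2 * pi) = r j k s * zz g k s" if "k \<in> opp j" for k s
        using r_C1(2)[OF j that] zp[OF opp(1)[OF that]] by (simp add: periodic_real_def)
      then show "periodic_strip (u j)"
        using per_kap[OF j] g(2)[OF j] by (simp add: periodic_strip_def u_def sig_shift[OF j])
    qed
    have ux: "u k (xo k) s = zz g k s" if "k \<in> {1..n}" for k s
      using ze[OF that, of s] by (simp add: u_def kx_def sx_def)
    have zet: "zeta (Aop g) j s = (\<Sum>k\<in>opp j. r j k s * zz g k s)" for j s
      unfolding zeta_def
    proof (rule sum.cong[OF refl])
      fix k assume k: "k \<in> opp j"
      have "Aop g k (e j) s = u k (xo k) s" unfolding Au opp(2)[OF k, symmetric] by (rule rs_apply[OF opp(1)[OF k] xo_unit])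
      then show "r j k s * Aop g k (e j) s = r j k s * zz g k s" by (simp add: ux[OF opp(1)[OF k]])
    qed
    have 1: "bsolves g (Aop g)"
      unfolding bsolves_def
    proof (intro conjI ballI allI)
      show "Aop g \<in> Cper n" unfolding Au by (rule uX)
      fix j x t assume jx: "j \<in> {1..n}" "x \<in> {0..1::real}"
      show "Aop g j x t = kap j x t * zeta (Aop g) j (sig j x t) + g j x t"
        unfolding zet unfolding Au rs_apply[OF jx] by (simp add: u_def)
    qed
    have "sup_norm n (Aop g) \<le> (S' * Z2 + 1) * ?B"
    proof (rule sup_norm_least)
      fix j x t assume jx: "j \<in> {1..n}" "x \<in> {0..1::real}"
      have "\<bar>kap j x t * (\<Sum>k\<in>opp j. r j k (sig j x t) * zz g k (sig j x t))\<bar> \<le> Ck * Cr * n * (Z2 * ?B)"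
        by (rule boundary_sum_bound[OF g gB Ck(1) CkCr(1) Cr(1) CkCr(2) B0 jx zb[OF opp(1)]]) (use Z20 B0 in auto)
      then show "\<bar>Aop g j x t\<bar> \<le> (S' * Z2 + 1) * ?B"
        unfolding Au rs_apply[OF jx] u_def using gB[OF jx, of t] by (simp add: S'_def algebra_simps)
    qed (use S0 Z20 B0 in simp)
    with 1 show ?thesis by blast
  qed
  then show ?thesis using S0 Z20 by (intro exI[of _ "S' * Z2 + 1"]) auto
qed

text \<open>So \<open>Aop\<close> is the inverse of \<open>I - C\<close>.\<close>

lemma bsolves_iff: "g \<in> Cper n \<Longrightarrow> bsolves g u \<longleftrightarrow> u = Aop g"
proof
  assume gC: "g \<in> Cper n" and u: "bsolves g u"
  have A: "bsolves g (Aop g)" using Aop_solves gC by blast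
  note g = CperD(1)[OF gC] CperD(2)[OF gC]
  show "u = Aop g"
  proof (rule Cper_eqI)
    show "u \<in> Cper n" "Aop g \<in> Cper n" using u A by (auto simp: bsolves_def)
    show "u j x t = Aop g j x t" if jx: "j \<in> {1..n}" "x \<in> {0..1}" for j x t
      using bsolves_unique(2)[OF g u jx, of t] bsolves_unique(2)[OF g A jx, of t] by simp
  qed
next
  assume "g \<in> Cper n" "u = Aop g" then show "bsolves g u" using Aop_solves by blast
qed

text \<open>Time derivatives of the boundary values exist under the same contraction condition for the
  differentiated functional equation.\<close>

lemma boundary_C1:
  assumes gd: "\<And>j. j \<in> {1..n} \<Longrightarrow> t_deriv (g j) (gt j)" and gp: "\<And>j. j \<in> {1..n} \<Longrightarrow> periodic_strip (g j)"
    and u: "bsolves g u"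
    and contr1: "\<And>j t. j \<in> Q \<Longrightarrow> (\<Sum>pr\<in>P \<times> Q. \<bar>Aco j pr t * (TTx (fst pr) (sx j t) * TTx j t)\<bar>) \<le> q"
    and j: "j \<in> {1..n}"
  shows "\<exists>w. t_deriv (u j) w"
proof -
  note g = t_derivD(1)[OF gd] gp
  obtain Ck where Ck: "Ck \<ge> 0" "\<forall>j\<in>{1..n}. \<forall>x\<in>{0..1}. \<forall>t. \<bar>kap j x t\<bar> \<le> Ck" using kap_bound by blast
  obtain Cr where Cr: "Cr \<ge> 0" "\<forall>j\<in>{1..n}. \<forall>k\<in>opp j. \<forall>t. \<bar>r j k t\<bar> \<le> Cr" using r_bound by blast
  have "\<exists>B\<ge>0. \<forall>j\<in>{1..n}. \<forall>x\<in>{0..1}. \<forall>t. \<bar>g j x t\<bar> \<le> B"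
    by (rule periodic_bounds[OF finite_atLeastAtMost g])
  then obtain B where B: "B \<ge> 0" "\<forall>j\<in>{1..n}. \<forall>x\<in>{0..1}. \<forall>t. \<bar>g j x t\<bar> \<le> B" by blast
  have gB: "\<And>j x t. j \<in> {1..n} \<Longrightarrow> x \<in> {0..1} \<Longrightarrow> \<bar>g j x t\<bar> \<le> B" using B(2) by blast
  have hb: "\<bar>hh g j t\<bar> \<le> (1 + Ck * Cr * n) * B" if "j \<in> Q" for j t
    by (rule hh_bound[OF g gB Ck(1) _ Cr(1) _ B(1) that]) (use Ck(2) Cr(2) in auto)
  have hc: "continuous_on UNIV (hh g j)" if "j \<in> Q" for j
    by (rule hh_continuous[OF g gB that])
  have gC1: "C1R (g k (xo k))" if "k \<in> {1..n}" for k by (rule C1R_t_deriv[OF gd[OF that] xo_unit])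
  have hC1: "C1R (hh g j)" if j: "j \<in> Q" for j
  proof -
    have jn: "j \<in> {1..n}" using j Qn by auto
    show ?thesis unfolding hh_def[abs_def]
    proof (intro C1R_add C1R_mult C1R_sum gC1 jn C1R_kx)
      fix k assume k: "k \<in> P"
      then have kn: "k \<in> {1..n}" and ko: "k \<in> opp j" using oppQ[OF j] by auto
      show "C1R (\<lambda>t. r j k (sx j t))" by (rule C1R_comp[OF r_C1(1)[OF jn ko] C1R_sx[OF jn]])
      show "C1R (\<lambda>t. g k (xo k) (sx j t))" by (rule C1R_comp[OF gC1[OF kn] C1R_sx[OF jn]])
    qed
  qed
  have hper: "periodic_real (hh g j)" if "j \<in> Q" for j
    unfolding periodic_real_def by (intro allI hh_periodic[OF g gB that])
  have "\<exists>H'\<ge>0. \<forall>j\<in>Q. \<forall>t. \<bar>deriv (hh g j) t\<bar> \<le> H'"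
    by (rule periodic_real_bounds[OF finQ C1RD(2)[OF hC1] periodic_real_deriv[OF hC1 hper]])
  then obtain H' where H': "\<forall>j\<in>Q. \<forall>t. \<bar>deriv (hh g j) t\<bar> \<le> H'" by blast
  have "\<exists>C\<ge>0. \<forall>j\<in>Q. \<forall>pr\<in>P \<times> Q. \<forall>t. \<bar>deriv (Aco j pr) t\<bar> \<le> C"
  proof (rule uniform_constant[OF finQ])
    fix j assume j: "j \<in> Q"
    show "\<exists>C\<ge>0. \<forall>pr\<in>P \<times> Q. \<forall>t. \<bar>deriv (Aco j pr) t\<bar> \<le> C"
      by (rule periodic_real_bounds[OF fe.fin C1RD(2)[OF C1R_Aco[OF j]] periodic_real_deriv[OF C1R_Aco[OF j] per_Aco[OF j]]])
  qed (meson order_trans)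
  then obtain C where C: "\<forall>j\<in>Q. \<forall>pr\<in>P \<times> Q. \<forall>t. \<bar>deriv (Aco j pr) t\<bar> \<le> C" by blast
  have "\<exists>z'. \<forall>j\<in>Q. continuous_on UNIV (z' j) \<and> (\<forall>t. (fe.fp (hh g) j has_real_derivative z' j t) (at t))"
  proof (rule fe.fp_C1[OF hb hc, where A' = "\<lambda>j pr. deriv (Aco j pr)" and \<theta>' = "\<lambda>j pr t. TTx (fst pr) (sx j t) * TTx j t"
        and h' = "\<lambda>j. deriv (hh g j)" and CA = "card (P \<times> Q) * C" and H' = H'])
    fix j pr t assume j: "j \<in> Q" and pr: "pr \<in> P \<times> Q"
    have jn: "j \<in> {1..n}" "fst pr \<in> {1..n}" using j pr Qn by auto
    show "(Aco j pr has_real_derivative deriv (Aco j pr) t) (at t)" by (rule C1RD(1)[OF C1R_Aco[OF j pr]])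
    show "continuous_on UNIV (deriv (Aco j pr))" by (rule C1RD(2)[OF C1R_Aco[OF j pr]])
    show "(th j pr has_real_derivative TTx (fst pr) (sx j t) * TTx j t) (at t)"
      unfolding th_def[abs_def] by (rule DERIV_chain2[OF sx_deriv[OF jn(2)] sx_deriv[OF jn(1)]])
    show "continuous_on UNIV (\<lambda>t. TTx (fst pr) (sx j t) * TTx j t)"
      by (rule continuous_on_mult[OF continuous_on_compose2[OF continuous_TTx[OF jn(2)] continuous_sx[OF jn(1)]] continuous_TTx[OF jn(1)]]) simp
  next
    fix j t assume j: "j \<in> Q"
    show "(\<Sum>p\<in>P \<times> Q. \<bar>deriv (Aco j p) t\<bar>) \<le> card (P \<times> Q) * C"
      using sum_bounded_above[of "P \<times> Q" "\<lambda>p. \<bar>deriv (Aco j p) t\<bar>" C] C j by blast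
    show "(\<Sum>p\<in>P \<times> Q. \<bar>Aco j p t * (TTx (fst p) (sx j t) * TTx j t)\<bar>) \<le> q" by (rule contr1[OF j])
    show "(hh g j has_real_derivative deriv (hh g j) t) (at t)" by (rule C1RD(1)[OF hC1[OF j]])
    show "continuous_on UNIV (deriv (hh g j))" by (rule C1RD(2)[OF hC1[OF j]])
    show "\<bar>deriv (hh g j) t\<bar> \<le> H'" using H' j by blast
  qed
  then obtain z' where z': "\<forall>j\<in>Q. continuous_on UNIV (z' j) \<and> (\<forall>t. (fe.fp (hh g) j has_real_derivative z' j t) (at t))" by blast
  have fpC1: "C1R (fe.fp (hh g) j)" if "j \<in> Q" for j by (rule C1RI[of _ "z' j"]) (use z' that in auto)
  have zC1: "C1R (zz g j)" if j: "j \<in> {1..n}" for j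
  proof (cases "j \<in> Q")
    case True
    have "zz g j = fe.fp (hh g) j" using zzQ[OF True] by auto
    then show ?thesis using fpC1[OF True] by simp
  next
    case False
    then have jP: "j \<in> P" using j by simp
    have "C1R (\<lambda>t. kx j t * (\<Sum>l\<in>Q. r j l (sx j t) * fe.fp (hh g) l (sx j t)) + g j (xo j) t)"
    proof (intro C1R_add C1R_mult C1R_sum gC1 j C1R_kx)
      fix l assume l: "l \<in> Q"
      then have lo: "l \<in> opp j" using oppP[OF jP] by simp
      show "C1R (\<lambda>t. r j l (sx j t))" by (rule C1R_comp[OF r_C1(1)[OF j lo] C1R_sx[OF j]])
      show "C1R (\<lambda>t. fe.fp (hh g) l (sx j t))" by (rule C1R_comp[OF fpC1[OF l] C1R_sx[OF j]])
    qed
    moreover have "zz g j = (\<lambda>t. kx j t * (\<Sum>l\<in>Q. r j l (sx j t) * fe.fp (hh g) l (sx j t)) + g j (xo j) t)"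
      using zzP[OF jP] by auto
    ultimately show ?thesis by simp
  qed
  interpret SL: slope "F j" "Ft j" by (rule slope_F[OF j])
  obtain pt where pt: "t_deriv (p j) pt" using p_t_deriv[OF j] by blast
  let ?z = "\<lambda>s. \<Sum>k\<in>opp j. r j k s * zz g k s"
  have "C1R ?z" by (intro C1R_sum C1R_mult r_C1(1)[OF j] zC1 opp(1))
  from SL.t_deriv_dsol[OF pt t_deriv_const[of 0] C1RD[OF this] e_unit[of j]]
  obtain w where "t_deriv (D j ?z (\<lambda>_ _. 0)) w" by blast
  from t_deriv_add[OF this gd[OF j]] have "t_deriv (u j) (\<lambda>x t. w x t + gt j x t)"
  proof (rule t_deriv_cong)
    show "D j ?z (\<lambda>_ _. 0) x t + g j x t = u j x t" if x: "x \<in> {0..1}" for x t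
    proof -
      have "u j x t = kap j x t * ?z (sig j x t) + g j x t" by (rule bsolves_unique(2)[OF g u j x])
      then show ?thesis by (simp only: D_entry[OF j x])
    qed
  qed simp
  then show ?thesis by blast
qed

end

section \<open>The contraction constants\<close>

lemma periodic_unif_cont_x:
  assumes g: "cont g" and p: "periodic_strip g" and \<epsilon>: "\<epsilon> > 0"
  shows "\<exists>\<delta>>0. \<forall>x\<in>{0..1}. \<forall>y\<in>{0..1}. \<forall>t. \<bar>x - y\<bar> < \<delta> \<longrightarrow> \<bar>g x t - g y t\<bar> < \<epsilon>"
proof -
  have "uniformly_continuous_on ({0..1} \<times> {0..2 * pi}) (\<lambda>(x, t). g x t)"
    by (intro compact_uniformly_continuous continuous_on_subset[OF g] compact_Times) auto
  then obtain d where d: "d > 0" "\<And>u v. u \<in> {0..1} \<times> {0..2 * pi} \<Longrightarrow> v \<in> {0..1} \<times> {0..2 * pi} \<Longrightarrow>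
      dist u v < d \<Longrightarrow> dist ((\<lambda>(x, t). g x t) u) ((\<lambda>(x, t). g x t) v) < \<epsilon>"
    unfolding uniformly_continuous_on_def using \<epsilon> by blast
  have "\<bar>g x t - g y t\<bar> < \<epsilon>" if xy: "x \<in> {0..1}" "y \<in> {0..1}" and lt: "\<bar>x - y\<bar> < d" for x y t
  proof -
    obtain k :: int where k: "t + 2 * pi * of_int k \<in> {0..2 * pi}" by (rule reduce_to_period)
    have "dist (g x (t + 2 * pi * of_int k)) (g y (t + 2 * pi * of_int k)) < \<epsilon>"
      using d(2)[of "(x, t + 2 * pi * of_int k)" "(y, t + 2 * pi * of_int k)"] k xy lt
      by (simp add: dist_Pair_Pair dist_real_def)
    then show ?thesis
      unfolding periodic_strip_int[OF p xy(1)] periodic_strip_int[OF p xy(2)] dist_real_def .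
  qed
  then show ?thesis using d(1) by blast
qed

lemma SUP_difference_continuous:
  assumes v: "cont v" "periodic_strip v" and w: "cont w" "periodic_strip w"
  shows "\<eta> \<in> {0..1} \<Longrightarrow> bdd_above (range (\<lambda>(\<tau>, t). v \<eta> \<tau> - w \<eta> t))"
    and "continuous_on {0..1} (\<lambda>\<eta>. SUP (\<tau>, t)\<in>UNIV. v \<eta> \<tau> - w \<eta> t)"
proof -
  obtain Bv where Bv: "\<forall>x\<in>{0..1}. \<forall>t. \<bar>v x t\<bar> \<le> Bv" using periodic_bound[OF v] by blast
  obtain Bw where Bw: "\<forall>x\<in>{0..1}. \<forall>t. \<bar>w x t\<bar> \<le> Bw" using periodic_bound[OF w] by blast
  have bdd: "bdd_above (range (\<lambda>(\<tau>, t). v \<eta> \<tau> - w \<eta> t))" if \<eta>: "\<eta> \<in> {0..1}" for \<eta>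
  proof (rule bdd_aboveI2)
    fix p :: "real \<times> real" 
    have "\<bar>v \<eta> (fst p)\<bar> \<le> Bv" "\<bar>w \<eta> (snd p)\<bar> \<le> Bw" using Bv Bw \<eta> by blast+
    then show "(\<lambda>(\<tau>, t). v \<eta> \<tau> - w \<eta> t) p \<le> Bv + Bw" by (simp add: case_prod_unfold abs_le_iff)
  qed
  show "bdd_above (range (\<lambda>(\<tau>, t). v \<eta> \<tau> - w \<eta> t))" if "\<eta> \<in> {0..1}" by (rule bdd[OF that])
  show "continuous_on {0..1} (\<lambda>\<eta>. SUP (\<tau>, t)\<in>UNIV. v \<eta> \<tau> - w \<eta> t)"
  proof (rule continuous_on_iff[THEN iffD2], intro ballI allI impI)
    fix \<eta> \<epsilon> :: real assume \<eta>: "\<eta> \<in> {0..1}" and \<epsilon>: "\<epsilon> > 0"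
    obtain d1 where d1: "d1 > 0" "\<And>x y t. x \<in> {0..1} \<Longrightarrow> y \<in> {0..1} \<Longrightarrow> \<bar>x - y\<bar> < d1 \<Longrightarrow> \<bar>v x t - v y t\<bar> < \<epsilon> / 4"
      using periodic_unif_cont_x[OF v, of "\<epsilon> / 4"] \<epsilon> by auto
    obtain d2 where d2: "d2 > 0" "\<And>x y t. x \<in> {0..1} \<Longrightarrow> y \<in> {0..1} \<Longrightarrow> \<bar>x - y\<bar> < d2 \<Longrightarrow> \<bar>w x t - w y t\<bar> < \<epsilon> / 4"
      using periodic_unif_cont_x[OF w, of "\<epsilon> / 4"] \<epsilon> by auto
    have le: "(SUP (\<tau>, t)\<in>UNIV. v x \<tau> - w x t) \<le> (SUP (\<tau>, t)\<in>UNIV. v y \<tau> - w y t) + \<epsilon> / 2"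
      if xy: "x \<in> {0..1}" "y \<in> {0..1}" "\<bar>x - y\<bar> < min d1 d2" for x y
    proof (rule cSUP_least)
      fix p :: "real \<times> real"
      have "(\<lambda>(\<tau>, t). v y \<tau> - w y t) p \<le> (SUP (\<tau>, t)\<in>UNIV. v y \<tau> - w y t)"
        by (rule cSUP_upper[OF UNIV_I bdd[OF xy(2)]])
      moreover have "\<bar>v x (fst p) - v y (fst p)\<bar> < \<epsilon> / 4" "\<bar>w x (snd p) - w y (snd p)\<bar> < \<epsilon> / 4"
        using d1(2) d2(2) xy by auto
      ultimately show "(\<lambda>(\<tau>, t). v x \<tau> - w x t) p \<le> (SUP (\<tau>, t)\<in>UNIV. v y \<tau> - w y t) + \<epsilon> / 2"
        unfolding case_prod_unfold by linarith
    qed simp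
    have "dist (SUP (\<tau>, t)\<in>UNIV. v \<eta>' \<tau> - w \<eta>' t) (SUP (\<tau>, t)\<in>UNIV. v \<eta> \<tau> - w \<eta> t) < \<epsilon>"
      if "\<eta>' \<in> {0..1}" "dist \<eta>' \<eta> < min d1 d2" for \<eta>'
      using le[OF that(1) \<eta>] le[OF \<eta> that(1)] that(2) \<epsilon> unfolding dist_real_def by (simp add: abs_minus_commute)
    then show "\<exists>d>0. \<forall>\<eta>'\<in>{0..1}. dist \<eta>' \<eta> < d \<longrightarrow>
        dist (SUP (\<tau>, t)\<in>UNIV. v \<eta>' \<tau> - w \<eta>' t) (SUP (\<tau>, t)\<in>UNIV. v \<eta> \<tau> - w \<eta> t) < \<epsilon>"
      using d1(1) d2(1) by (intro exI[of _ "min d1 d2"]) auto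
  qed
qed

text \<open>The two functions are integrated along unrelated curves; the supremum over two independent
  times in the constants accounts for this.\<close>

lemma ig_difference_le_SUP:
  assumes v: "cont v" "periodic_strip v" and w: "cont w" "periodic_strip w"
    and c: "continuous_on {0..1} (\<lambda>\<eta>. v \<eta> (c1 \<eta>))" "continuous_on {0..1} (\<lambda>\<eta>. w \<eta> (c2 \<eta>))"
  shows "ig (\<lambda>\<eta>. v \<eta> (c1 \<eta>)) 0 1 - ig (\<lambda>\<eta>. w \<eta> (c2 \<eta>)) 0 1 \<le> (LBINT \<eta>=0..1. (SUP (\<tau>, t)\<in>UNIV. v \<eta> \<tau> - w \<eta> t))"
proof -
  note S = SUP_difference_continuous(2)[OF v w]
  have 01: "(0::real) \<in> {0..1}" "(1::real) \<in> {0..1}" by auto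
  have "ig (\<lambda>\<eta>. v \<eta> (c1 \<eta>)) 0 1 - ig (\<lambda>\<eta>. w \<eta> (c2 \<eta>)) 0 1 = ig (\<lambda>\<eta>. v \<eta> (c1 \<eta>) - w \<eta> (c2 \<eta>)) 0 1"
    by (rule ig_diff[OF c 01, symmetric])
  also have "\<dots> \<le> ig (\<lambda>\<eta>. SUP (\<tau>, t)\<in>UNIV. v \<eta> \<tau> - w \<eta> t) 0 1"
  proof (rule ig_mono[OF continuous_on_diff[OF c] S])
    fix \<eta> :: real assume \<eta>: "\<eta> \<in> {0..1}"
    show "v \<eta> (c1 \<eta>) - w \<eta> (c2 \<eta>) \<le> (SUP (\<tau>, t)\<in>UNIV. v \<eta> \<tau> - w \<eta> t)"
      using cSUP_upper[OF UNIV_I SUP_difference_continuous(1)[OF v w \<eta>], of "(c1 \<eta>, c2 \<eta>)"] by simp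
  qed
  also have "\<dots> = (LBINT \<eta>=0..1. (SUP (\<tau>, t)\<in>UNIV. v \<eta> \<tau> - w \<eta> t))"
    unfolding zero_ereal_def one_ereal_def by (rule ig_LBINT[OF S 01, symmetric])
  finally show ?thesis .
qed

lemma max_over_upper: "finite A \<Longrightarrow> j \<in> A \<Longrightarrow> g j \<le> max_over A g"
  by (auto simp: max_over_def intro!: Max_ge)

lemma SUP_swap_pair: "(SUP (\<tau>, t)\<in>UNIV. h t \<tau>) = (SUP (\<tau>, t)\<in>UNIV. h \<tau> t :: real)"
proof -
  have "range (\<lambda>(\<tau>, t). h t \<tau>) = range (\<lambda>(\<tau>, t). h \<tau> t)" by auto
  then show ?thesis by simp
qed

context hyp
begin

text \<open>Differentiation in time of \<open>v\<close> in \<open>\<partial>\<^sub>x v + F \<partial>\<^sub>t v + p v = 0\<close> adds \<open>\<partial>\<^sub>t F = - \<partial>\<^sub>t a / a\<^sup>2\<close>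
  to the damping coefficient.\<close>

definition \<omega>1 where "\<omega>1 j x t = p j x t + Ft j x t"

lemma per_Ft: "j \<in> {1..n} \<Longrightarrow> periodic_strip (Ft j)"
  by (rule slope.Ft_per[OF slope_F])

lemma cont_Ft: "j \<in> {1..n} \<Longrightarrow> cont (Ft j)"
  by (rule slope.contFt[OF slope_F])

text \<open>The amplification along a double passage of the interval; \<open>\<omega>\<close> is the logarithmic growth rate
  along the characteristics of the solution, or of its time derivative.\<close>

definition dbl where
  "dbl \<omega> j k t = exp (ig (\<lambda>\<eta>. \<omega> j \<eta> (flow (F j) \<eta> (xo j) t)) (xo j) (e j)) *
     exp (ig (\<lambda>\<eta>. \<omega> k \<eta> (flow (F k) \<eta> (xo k) (sx j t))) (xo k) (e k))" for \<omega> :: field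

lemma dbl_p: "dbl p j k t = kx j t * kx k (sx j t)"
  if "j \<in> {1..n}" "k \<in> {1..n}"
  using that by (simp add: dbl_def kx_def kap_def slope.cw_def[OF slope_F])

lemma dbl_\<omega>1:
  assumes j: "j \<in> {1..n}" and k: "k \<in> {1..n}"
  shows "dbl \<omega>1 j k t = kx j t * kx k (sx j t) * (TTx k (sx j t) * TTx j t)"
proof -
  have *: "exp (ig (\<lambda>\<eta>. \<omega>1 j \<eta> (flow (F j) \<eta> (xo j) t)) (xo j) (e j)) = kx j t * TTx j t" if j: "j \<in> {1..n}" for j t
  proof -
    interpret S: slope "F j" "Ft j" by (rule slope_F[OF j])
    show ?thesis
      unfolding \<omega>1_def kx_def kap_def TTx_def S.cw_def S.TT_def exp_add[symmetric]
      by (subst ig_add[OF S.cont_along[OF cont_p[OF j] xo_unit] S.cont_along[OF cont_Ft[OF j] xo_unit] xo_unit e_unit]) simp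
  qed
  show ?thesis unfolding dbl_def *[OF j] *[OF k] by (simp add: mult_ac)
qed

definition XR where "XR \<omega> j k = exp (LBINT \<eta>=0..1. (SUP (\<tau>, t)\<in>UNIV. \<omega> j \<eta> \<tau> - \<omega> k \<eta> t))" for \<omega> :: field
definition XS where "XS \<omega> j k = exp (LBINT \<eta>=0..1. (SUP (\<tau>, t)\<in>UNIV. \<omega> k \<eta> t - \<omega> j \<eta> \<tau>))" for \<omega> :: field

lemma dbl_le:
  assumes \<omega>: "\<And>j. j \<in> {1..n} \<Longrightarrow> cont (\<omega> j)" "\<And>j. j \<in> {1..n} \<Longrightarrow> periodic_strip (\<omega> j)"
    and j: "j \<in> {1..n}" and k: "k \<in> opp j"
  shows "m < j \<Longrightarrow> dbl \<omega> j k t \<le> XR \<omega> j k" "j \<le> m \<Longrightarrow> dbl \<omega> j k t \<le> XS \<omega> j k"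
proof -
  have kn: "k \<in> {1..n}" by (rule opp(1)[OF k])
  interpret SJ: slope "F j" "Ft j" by (rule slope_F[OF j])
  interpret SK: slope "F k" "Ft k" by (rule slope_F[OF kn])
  let ?cj = "\<lambda>\<eta>. flow (F j) \<eta> (xo j) t" and ?ck = "\<lambda>\<eta>. flow (F k) \<eta> (xo k) (sx j t)"
  note cj = SJ.cont_along[OF \<omega>(1)[OF j] xo_unit[of j], of t] and ck = SK.cont_along[OF \<omega>(1)[OF kn] xo_unit[of k], of "sx j t"]
  have 01: "(0::real) \<in> {0..1}" "(1::real) \<in> {0..1}" by auto
  show "dbl \<omega> j k t \<le> XR \<omega> j k" if mj: "m < j"
  proof -
    have km: "k \<le> m" using k mj by (auto simp: opp_def)
    have "dbl \<omega> j k t = exp (ig (\<lambda>\<eta>. \<omega> j \<eta> (?cj \<eta>)) 0 1 - ig (\<lambda>\<eta>. \<omega> k \<eta> (?ck \<eta>)) 0 1)"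
      using ig_swap[OF ck 01(2,1)] km mj by (simp add: dbl_def e_def xo_def exp_add[symmetric])
    also have "\<dots> \<le> XR \<omega> j k"
      unfolding XR_def exp_le_cancel_iff by (rule ig_difference_le_SUP[OF \<omega>(1)[OF j] \<omega>(2)[OF j] \<omega>(1)[OF kn] \<omega>(2)[OF kn] cj ck])
    finally show ?thesis .
  qed
  show "dbl \<omega> j k t \<le> XS \<omega> j k" if jm: "j \<le> m"
  proof -
    have km: "m < k" using k jm by (auto simp: opp_def)
    have "dbl \<omega> j k t = exp (ig (\<lambda>\<eta>. \<omega> k \<eta> (?ck \<eta>)) 0 1 - ig (\<lambda>\<eta>. \<omega> j \<eta> (?cj \<eta>)) 0 1)"
      using ig_swap[OF cj 01(2,1)] km jm by (simp add: dbl_def e_def xo_def exp_add[symmetric])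
    also have "\<dots> \<le> exp (LBINT \<eta>=0..1. (SUP (\<tau>, t)\<in>UNIV. \<omega> k \<eta> \<tau> - \<omega> j \<eta> t))"
      unfolding exp_le_cancel_iff by (rule ig_difference_le_SUP[OF \<omega>(1)[OF kn] \<omega>(2)[OF kn] \<omega>(1)[OF j] \<omega>(2)[OF j] ck cj])
    also have "\<dots> = XS \<omega> j k"
      unfolding XS_def using SUP_swap_pair[of "\<lambda>\<tau> t. \<omega> k _ \<tau> - \<omega> j _ t"] by (simp add: SUP_swap_pair[of "\<lambda>\<tau> t. \<omega> k x \<tau> - \<omega> j x t" for x])
    finally show ?thesis .
  qed
qed

text \<open>The common shape of the four constants.\<close>

definition Gen where
  "Gen X Q = max_over Q (\<lambda>j. \<Sum>k\<in>{1..n} - Q. X j k * (\<Sum>l\<in>Q. (SUP (\<tau>, t)\<in>UNIV. \<bar>r j k \<tau> * r k l t\<bar>)))"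

lemma J_compl: "{1..n} - {m+1..n} = {1..m}" and I_compl: "{1..n} - {1..m} = {m+1..n}"
  using mn by auto

lemma R0_Gen: "R0 n m a b r = Gen (XR p) {m+1..n}"
  unfolding R0_def Gen_def J_compl XR_def p_def ..

lemma S0_Gen: "S0 n m a b r = Gen (XS p) {1..m}"
  unfolding S0_def Gen_def I_compl XS_def p_def ..

lemma R1_Gen: "R1 n m a b r = Gen (XR \<omega>1) {m+1..n}"
proof -
  have "b j j \<eta> \<tau> / a j \<eta> \<tau> - b k k \<eta> t / a k \<eta> t + deriv (a k \<eta>) t / (a k \<eta> t)\<^sup>2 - deriv (a j \<eta>) \<tau> / (a j \<eta> \<tau>)\<^sup>2
      = \<omega>1 j \<eta> \<tau> - \<omega>1 k \<eta> t" for j k \<eta> \<tau> t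
    by (simp add: \<omega>1_def p_def Ft_def)
  then show ?thesis unfolding R1_def Gen_def J_compl XR_def by simp
qed

lemma S1_Gen: "S1 n m a b r = Gen (XS \<omega>1) {1..m}"
proof -
  have "b k k \<eta> t / a k \<eta> t - b j j \<eta> \<tau> / a j \<eta> \<tau> + deriv (a j \<eta>) \<tau> / (a j \<eta> \<tau>)\<^sup>2 - deriv (a k \<eta>) t / (a k \<eta> t)\<^sup>2
      = \<omega>1 k \<eta> t - \<omega>1 j \<eta> \<tau>" for j k \<eta> \<tau> t
    by (simp add: \<omega>1_def p_def Ft_def)
  then show ?thesis unfolding S1_def Gen_def I_compl XS_def by simp
qed

lemma r_product_le_SUP:
  assumes j: "j \<in> {1..n}" and k: "k \<in> opp j" and l: "l \<in> opp k"
  shows "\<bar>r j k s * r k l s'\<bar> \<le> (SUP (\<tau>, t)\<in>UNIV. \<bar>r j k \<tau> * r k l t\<bar>)"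
proof -
  obtain C where C: "C \<ge> 0" "\<forall>j\<in>{1..n}. \<forall>k\<in>opp j. \<forall>t. \<bar>r j k t\<bar> \<le> C" using r_bound by blast
  have "bdd_above (range (\<lambda>(\<tau>, t). \<bar>r j k \<tau> * r k l t\<bar>))"
  proof (rule bdd_aboveI2)
    fix p :: "real \<times> real"
    have "\<bar>r j k (fst p)\<bar> * \<bar>r k l (snd p)\<bar> \<le> C * C"
      using C j k l opp(1)[OF k] by (intro mult_mono) auto
    then show "(\<lambda>(\<tau>, t). \<bar>r j k \<tau> * r k l t\<bar>) p \<le> C * C" by (simp add: case_prod_unfold abs_mult)
  qed
  from cSUP_upper[OF UNIV_I this, of "(s, s')"] show ?thesis by simp
qed

lemma Gen_bound:
  assumes Q: "Q = {1..m} \<or> Q = {m+1..n}" and j: "j \<in> Q"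
    and X: "\<And>k. k \<in> {1..n} - Q \<Longrightarrow> 0 \<le> w k \<and> w k \<le> X j k"
  shows "(\<Sum>pr\<in>({1..n} - Q) \<times> Q. \<bar>w (fst pr) * (r j (fst pr) s * r (fst pr) (snd pr) (s' (fst pr)))\<bar>) \<le> Gen X Q"
proof -
  have Qn: "Q \<subseteq> {1..n}" using Q mn by auto
  have oj: "opp j = {1..n} - Q" using Q j mn by (auto simp: opp_def)
  have ok: "opp k = Q" if "k \<in> {1..n} - Q" for k using Q that mn by (auto simp: opp_def)
  have jn: "j \<in> {1..n}" using j Qn by blast
  have "(\<Sum>pr\<in>({1..n} - Q) \<times> Q. \<bar>w (fst pr) * (r j (fst pr) s * r (fst pr) (snd pr) (s' (fst pr)))\<bar>)
      = (\<Sum>k\<in>{1..n} - Q. \<Sum>l\<in>Q. \<bar>w k * (r j k s * r k l (s' k))\<bar>)"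
    by (simp add: sum.cartesian_product case_prod_unfold)
  also have "\<dots> \<le> (\<Sum>k\<in>{1..n} - Q. \<Sum>l\<in>Q. X j k * (SUP (\<tau>, t)\<in>UNIV. \<bar>r j k \<tau> * r k l t\<bar>))"
  proof (intro sum_mono)
    fix k l assume k: "k \<in> {1..n} - Q" and l: "l \<in> Q"
    have "\<bar>r j k s * r k l (s' k)\<bar> \<le> (SUP (\<tau>, t)\<in>UNIV. \<bar>r j k \<tau> * r k l t\<bar>)"
      by (rule r_product_le_SUP[OF jn]) (use k l oj ok[OF k] in auto)
    then show "\<bar>w k * (r j k s * r k l (s' k))\<bar> \<le> X j k * (SUP (\<tau>, t)\<in>UNIV. \<bar>r j k \<tau> * r k l t\<bar>)"
      using X[OF k] unfolding abs_mult[of "w k"] by (intro mult_mono) auto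
  qed
  also have "\<dots> = (\<Sum>k\<in>{1..n} - Q. X j k * (\<Sum>l\<in>Q. (SUP (\<tau>, t)\<in>UNIV. \<bar>r j k \<tau> * r k l t\<bar>)))"
    by (simp add: sum_distrib_left)
  also have "\<dots> \<le> Gen X Q"
    unfolding Gen_def by (rule max_over_upper[OF _ j]) (use Qn finite_subset in blast)
  finally show ?thesis .
qed

lemma Gen_nonneg:
  assumes Q: "Q = {1..m} \<or> Q = {m+1..n}" and X: "\<And>j k. 0 \<le> X j k"
  shows "0 \<le> Gen X Q"
proof (cases "Q = {}")
  case True then show ?thesis by (simp add: Gen_def max_over_def)
next
  case False
  then obtain j where j: "j \<in> Q" by blast
  have "0 \<le> (\<Sum>pr\<in>({1..n} - Q) \<times> Q. \<bar>0 * (r j (fst pr) 0 * r (fst pr) (snd pr) 0)\<bar>)" by simp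
  also have "\<dots> \<le> Gen X Q" by (rule Gen_bound[OF Q j, of "\<lambda>_. 0"]) (use X in auto)
  finally show ?thesis .
qed

lemma hypQ_of_constants:
  assumes Q: "(Q = {m+1..n} \<and> R0 n m a b r \<le> q) \<or> (Q = {1..m} \<and> S0 n m a b r \<le> q)" and q: "q < 1"
  shows "hypQ n m a b r Q q"
proof
  have Q': "Q = {1..m} \<or> Q = {m+1..n}" using Q by blast
  then show "Q = {1..m} \<or> Q = {m+1..n}" .
  have "0 \<le> R0 n m a b r" "0 \<le> S0 n m a b r"
    unfolding R0_Gen S0_Gen by (auto intro!: Gen_nonneg simp: XR_def XS_def)
  then show "0 \<le> q" "q < 1" using Q q by auto
  fix j t assume j: "j \<in> Q"
  have jn: "j \<in> {1..n}" using j Q' mn by auto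
  have kn: "k \<in> {1..n}" "k \<in> opp j" if "k \<in> {1..n} - Q" for k using Q' j that mn by (auto simp: opp_def)
  have pos: "0 \<le> kx j t * kx k (sx j t)" if "k \<in> {1..n} - Q" for k
    unfolding dbl_p[OF jn kn(1)[OF that], symmetric] by (simp add: dbl_def)
  have "(\<Sum>pr\<in>({1..n} - Q) \<times> Q. \<bar>(kx j t * kx (fst pr) (sx j t)) * (r j (fst pr) (sx j t) * r (fst pr) (snd pr) (sx (fst pr) (sx j t)))\<bar>) \<le> q"
    using Q
  proof (elim disjE conjE)
    assume Q1: "Q = {m+1..n}" and R: "R0 n m a b r \<le> q"
    have "0 \<le> kx j t * kx k (sx j t) \<and> kx j t * kx k (sx j t) \<le> XR p j k" if k: "k \<in> {1..n} - Q" for k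
      using dbl_le(1)[where \<omega> = p and t = t, OF cont_p per_p jn kn(2)[OF k]] pos[OF k] dbl_p[OF jn kn(1)[OF k], of t] j Q1 by auto
    from Gen_bound[where w = "\<lambda>k. kx j t * kx k (sx j t)" and X = "XR p", OF Q' j this] show ?thesis using R unfolding R0_Gen Q1 by (rule order_trans)
  next
    assume Q1: "Q = {1..m}" and R: "S0 n m a b r \<le> q"
    have "0 \<le> kx j t * kx k (sx j t) \<and> kx j t * kx k (sx j t) \<le> XS p j k" if k: "k \<in> {1..n} - Q" for k
      using dbl_le(2)[where \<omega> = p and t = t, OF cont_p per_p jn kn(2)[OF k]] pos[OF k] dbl_p[OF jn kn(1)[OF k], of t] j Q1 by auto
    from Gen_bound[where w = "\<lambda>k. kx j t * kx k (sx j t)" and X = "XS p", OF Q' j this] show ?thesis using R unfolding S0_Gen Q1 by (rule order_trans)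
  qed
  then show "(\<Sum>pr\<in>({1..n} - Q) \<times> Q. \<bar>kx j t * r j (fst pr) (sx j t) * (kx (fst pr) (sx j t) * r (fst pr) (snd pr) (sx (fst pr) (sx j t)))\<bar>) \<le> q"
    by (simp only: mult_ac)
qed

end

context hypQ
begin

lemma contr1_of_constants:
  assumes Q': "(Q = {m+1..n} \<and> R1 n m a b r \<le> q) \<or> (Q = {1..m} \<and> S1 n m a b r \<le> q)" and j: "j \<in> Q"
  shows "(\<Sum>pr\<in>P \<times> Q. \<bar>Aco j pr t * (TTx (fst pr) (sx j t) * TTx j t)\<bar>) \<le> q"
proof -
  have jn: "j \<in> {1..n}" using j Qn by auto
  have kn: "k \<in> {1..n}" "k \<in> opp j" if "k \<in> P" for k using that oppQ[OF j] by auto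
  have c: "cont (\<omega>1 j)" "periodic_strip (\<omega>1 j)" if "j \<in> {1..n}" for j
    unfolding \<omega>1_def[abs_def] using that by (auto intro!: cont_add cont_p cont_Ft periodic_strip_add per_p per_Ft)
  have pos: "0 \<le> dbl \<omega>1 j k t" for k by (simp add: dbl_def)
  have "(\<Sum>pr\<in>P \<times> Q. \<bar>dbl \<omega>1 j (fst pr) t * (r j (fst pr) (sx j t) * r (fst pr) (snd pr) (sx (fst pr) (sx j t)))\<bar>) \<le> q"
    using Q'
  proof (elim disjE conjE)
    assume Q1: "Q = {m+1..n}" and R: "R1 n m a b r \<le> q"
    have "0 \<le> dbl \<omega>1 j k t \<and> dbl \<omega>1 j k t \<le> XR \<omega>1 j k" if k: "k \<in> P" for k
      using dbl_le(1)[where \<omega> = \<omega>1 and t = t, OF c jn kn(2)[OF k]] pos[of k] j Q1 by auto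
    from Gen_bound[where w = "\<lambda>k. dbl \<omega>1 j k t" and X = "XR \<omega>1", OF Q j this] show ?thesis using R unfolding R1_Gen Q1 by (rule order_trans)
  next
    assume Q1: "Q = {1..m}" and R: "S1 n m a b r \<le> q"
    have "0 \<le> dbl \<omega>1 j k t \<and> dbl \<omega>1 j k t \<le> XS \<omega>1 j k" if k: "k \<in> P" for k
      using dbl_le(2)[where \<omega> = \<omega>1 and t = t, OF c jn kn(2)[OF k]] pos[of k] j Q1 by auto
    from Gen_bound[where w = "\<lambda>k. dbl \<omega>1 j k t" and X = "XS \<omega>1", OF Q j this] show ?thesis using R unfolding S1_Gen Q1 by (rule order_trans)
  qed
  moreover have "Aco j pr t * (TTx (fst pr) (sx j t) * TTx j t)
      = dbl \<omega>1 j (fst pr) t * (r j (fst pr) (sx j t) * r (fst pr) (snd pr) (sx (fst pr) (sx j t)))" if "pr \<in> P \<times> Q" for pr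
  proof -
    have "fst pr \<in> {1..n}" using that by auto
    from dbl_\<omega>1[OF jn this, of t] show ?thesis by (simp only: Aco_def mult_ac)
  qed
  ultimately show ?thesis by simp
qed

end

section \<open>The integral operators\<close>

lemma Ck1_partials:
  assumes "Ck_strip 1 g"
  obtains gx gt where "t_deriv g gt" "cont gx"
    "\<And>x t. x \<in> {0..1} \<Longrightarrow> ((\<lambda>y. g y t) has_real_derivative gx x t) (at x within {0..1})"
proof -
  obtain gx gt where g: "cont g" "cont gx" "cont gt" "\<forall>x\<in>{0..1}. \<forall>t.
      ((\<lambda>y. g y t) has_real_derivative gx x t) (at x within {0..1}) \<and>
      ((\<lambda>s. g x s) has_real_derivative gt x t) (at t)"
    using assms unfolding One_nat_def Ck_strip.simps by blast
  have "t_deriv g gt" using g by (intro t_derivI) auto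
  then show thesis using that[of gt gx] g by blast
qed

lemma (in slope) lipschitz_of_transport:
  assumes v: "t_deriv v vt" and tr: "transport F v g"
    and A: "\<And>x t. x \<in> {0..1} \<Longrightarrow> \<bar>vt x t\<bar> \<le> A" and A': "\<And>x t. x \<in> {0..1} \<Longrightarrow> \<bar>g x t\<bar> \<le> A'"
    and x: "x \<in> {0..1}" and y: "y \<in> {0..1}"
  shows "\<bar>v x s - v y t\<bar> \<le> (A' + (1 + M) * A) * (\<bar>x - y\<bar> + \<bar>s - t\<bar>)"
proof -
  have A0: "0 \<le> A" using A[OF x, of t] by linarith
  have A0': "0 \<le> A'" using A'[OF x, of t] by linarith
  have "norm (v x s - v x t) \<le> A * norm (s - t)"
    by (rule field_differentiable_bound[of UNIV "v x" "vt x"]) (use t_derivD(3)[OF v x] A[OF x] in auto)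
  moreover have "norm (v x t - v y t) \<le> (A' + M * A) * norm (x - y)"
  proof (rule field_differentiable_bound[of "{0..1}" "\<lambda>y. v y t" "\<lambda>y. g y t - F y t * vt y t"])
    show "((\<lambda>y. v y t) has_real_derivative g z t - F z t * vt z t) (at z within {0..1})" if "z \<in> {0..1}" for z
      by (rule x_deriv_of_transport[OF v tr that])
    show "norm (g z t - F z t * vt z t) \<le> A' + M * A" if z: "z \<in> {0..1}" for z
    proof -
      have "\<bar>F z t * vt z t\<bar> \<le> M * A" unfolding abs_mult by (rule mult_mono[OF M(2)[OF z] A[OF z] M(1)]) simp
      then show ?thesis using A'[OF z, of t] by simp
    qed
  qed (use x y in auto)
  ultimately have "\<bar>v x s - v y t\<bar> \<le> A * \<bar>s - t\<bar> + (A' + M * A) * \<bar>x - y\<bar>" by simp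
  also have "\<dots> \<le> (A' + (1 + M) * A) * \<bar>s - t\<bar> + (A' + (1 + M) * A) * \<bar>x - y\<bar>"
    using A0 A0' M(1) by (intro add_mono mult_right_mono) (simp_all add: algebra_simps)
  finally show ?thesis by (simp add: algebra_simps)
qed

context hyp
begin

text \<open>The factor is \<open>\<beta> = b' a\<^sub>k\<close>, since \<open>F\<^sub>j - F\<^sub>k = (a\<^sub>k - a\<^sub>j) / (a\<^sub>j a\<^sub>k)\<close>.\<close>

lemma coupling_quotient:
  assumes j: "j \<in> {1..n}" and k: "k \<in> {1..n}" "j \<noteq> k"
  shows "\<exists>\<beta> \<beta>t \<beta>F. t_deriv \<beta> \<beta>t \<and> transport (F j) \<beta> \<beta>F \<and> cont \<beta>F \<and>
    (\<forall>x\<in>{0..1}. \<forall>t. b j k x t / a j x t = \<beta> x t * (F j x t - F k x t))"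
proof -
  interpret S: slope "F j" "Ft j" by (rule slope_F[OF j])
  obtain b' where b': "Ck_strip 1 b'" "\<forall>x\<in>{0..1}. \<forall>t. b j k x t = b' x t * (a k x t - a j x t)"
    using bt j k by blast
  obtain bx bt' where B: "t_deriv b' bt'" "cont bx"
    "\<And>x t. x \<in> {0..1} \<Longrightarrow> ((\<lambda>y. b' y t) has_real_derivative bx x t) (at x within {0..1})"
    using Ck1_partials[OF b'(1)] by metis
  have "Ck_strip 1 (a k)" using a1 k(1) by blast
  then obtain ax at' where A: "t_deriv (a k) at'" "cont ax"
    "\<And>x t. x \<in> {0..1} \<Longrightarrow> ((\<lambda>y. a k y t) has_real_derivative ax x t) (at x within {0..1})"
    using Ck1_partials by metis
  note tb = S.transport_of_partials[OF B(1,3)] and ta = S.transport_of_partials[OF A(1,3)]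
  have "b j k x t / a j x t = (b' x t * a k x t) * (F j x t - F k x t)" if x: "x \<in> {0..1}" for x t
  proof -
    have "b j k x t = b' x t * (a k x t - a j x t)" using b'(2) x by blast
    then show ?thesis unfolding F_def using a_nz[OF j x, of t] a_nz[OF k(1) x, of t]
      by (simp only:) (simp add: field_simps)
  qed
  moreover have "cont (\<lambda>x t. (bx x t + F j x t * bt' x t) * a k x t + (ax x t + F j x t * at' x t) * b' x t)"
    by (intro cont_add cont_mult B(2) A(2) S.contF t_derivD(1,2)[OF A(1)] t_derivD(1,2)[OF B(1)])
  ultimately show ?thesis
    using t_deriv_mult[OF B(1) A(1)] transport_mult[OF tb ta] by blast
qed

lemma D0:
  assumes "j \<in> {1..n}" "x \<in> {0..1}"
  shows "D j (\<lambda>_. 0) f x t = ig (\<lambda>\<xi>. cwj j \<xi> x t * f \<xi> (flow (F j) \<xi> x t)) (e j) x"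
  using slope.dsol_cw[OF slope_F[OF assms(1)] cont_p[OF assms(1)] assms(2) e_unit, of j "\<lambda>_. 0" f t] by simp

lemma D0_continuous:
  assumes j: "j \<in> {1..n}" and x: "x \<in> {0..1}" and f: "cont f"
  shows "continuous_on {0..1} (\<lambda>\<xi>. cwj j \<xi> x t * f \<xi> (flow (F j) \<xi> x t))"
proof -
  interpret S: slope "F j" "Ft j" by (rule slope_F[OF j])
  have "continuous_on {0..1} (\<lambda>\<xi>. 1 / S.E (p j) x t * (\<lambda>x t. S.E (p j) x t * f x t) \<xi> (flow (F j) \<xi> x t))"
    by (intro continuous_on_mult continuous_on_const S.cont_along[OF cont_mult[OF S.cont_E[OF cont_p[OF j]] f] x])
  then show ?thesis
    by (rule continuous_on_cong[THEN iffD1, rotated -1]) (auto simp: S.cw_E[OF cont_p[OF j] x])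
qed

lemma D_cong:
  assumes j: "j \<in> {1..n}" and x: "x \<in> {0..1}"
    and eq: "\<And>x t. x \<in> {0..1} \<Longrightarrow> f x t = g x t" "\<And>t. z t = y t"
  shows "D j z f x t = D j y g x t"
proof -
  have "D j (\<lambda>_. 0) f x t = D j (\<lambda>_. 0) g x t"
    unfolding D0[OF j x] by (rule ig_cong[OF e_unit x]) (simp add: eq(1))
  then show ?thesis using D_split[OF j x, of z f t] D_split[OF j x, of y g t] by (simp add: eq(2))
qed

lemma D0_add:
  assumes j: "j \<in> {1..n}" and x: "x \<in> {0..1}" and f: "cont f" "cont g"
  shows "D j (\<lambda>_. 0) (\<lambda>x t. f x t + g x t) x t = D j (\<lambda>_. 0) f x t + D j (\<lambda>_. 0) g x t"
  unfolding D0[OF j x] distrib_left by (rule ig_add) (intro D0_continuous j x f e_unit)+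

lemma D0_scale:
  assumes j: "j \<in> {1..n}" and x: "x \<in> {0..1}"
  shows "D j (\<lambda>_. 0) (\<lambda>x t. c * f x t) x t = c * D j (\<lambda>_. 0) f x t"
  unfolding D0[OF j x] by (subst ig_cmult[symmetric]) (simp add: mult_ac)

lemma D0_sum:
  assumes j: "j \<in> {1..n}" and x: "x \<in> {0..1}" and f: "\<And>k. k \<in> K \<Longrightarrow> cont (f k)" and K: "finite K"
  shows "D j (\<lambda>_. 0) (\<lambda>x t. \<Sum>k\<in>K. f k x t) x t = (\<Sum>k\<in>K. D j (\<lambda>_. 0) (f k) x t)"
  using K f
proof (induction K)
  case empty then show ?case by (simp add: D0[OF j x] ig_def)
next
  case (insert k K)
  have "D j (\<lambda>_. 0) (\<lambda>x t. f k x t + (\<Sum>k\<in>K. f k x t)) x t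
      = D j (\<lambda>_. 0) (f k) x t + D j (\<lambda>_. 0) (\<lambda>x t. \<Sum>k\<in>K. f k x t) x t"
    by (rule D0_add[OF j x insert.prems cont_sum[OF insert.prems]]) auto
  then show ?case using insert by simp
qed

lemma D0_bound:
  "\<exists>C\<ge>0. \<forall>j\<in>{1..n}. \<forall>f A. cont f \<longrightarrow> (\<forall>x\<in>{0..1}. \<forall>t. \<bar>f x t\<bar> \<le> A) \<longrightarrow>
     (\<forall>x\<in>{0..1}. \<forall>t. \<bar>D j (\<lambda>_. 0) f x t\<bar> \<le> C * A)"
proof -
  have "\<exists>B\<ge>0. \<forall>j\<in>{1..n}. \<forall>x\<in>{0..1}. \<forall>t. \<bar>p j x t\<bar> \<le> B"
    by (rule periodic_bounds[OF finite_atLeastAtMost cont_p per_p])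
  then obtain Bp where Bp: "Bp \<ge> 0" "\<forall>j\<in>{1..n}. \<forall>x\<in>{0..1}. \<forall>t. \<bar>p j x t\<bar> \<le> Bp" by blast
  have "\<bar>D j (\<lambda>_. 0) f x t\<bar> \<le> exp Bp * A"
    if j: "j \<in> {1..n}" and f: "cont f" and A: "\<forall>x\<in>{0..1}. \<forall>t. \<bar>f x t\<bar> \<le> A" and x: "x \<in> {0..1}" for j f A x t
  proof -
    interpret S: slope "F j" "Ft j" by (rule slope_F[OF j])
    have "\<bar>cwj j \<xi> x t * f \<xi> (flow (F j) \<xi> x t)\<bar> \<le> exp Bp * A" if \<xi>: "\<xi> \<in> {0..1}" for \<xi>
    proof -
      have "\<bar>ig (\<lambda>\<eta>. p j \<eta> (flow (F j) \<eta> x t)) x \<xi>\<bar> \<le> Bp"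
        by (rule ig_bound1[OF S.cont_along[OF cont_p[OF j] x] x \<xi>]) (use Bp(2) j in blast)
      then have "\<bar>cwj j \<xi> x t\<bar> \<le> exp Bp" unfolding S.cw_def by simp
      moreover have "\<bar>f \<xi> (flow (F j) \<xi> x t)\<bar> \<le> A" using A \<xi> by blast
      ultimately show ?thesis unfolding abs_mult by (intro mult_mono) auto
    qed
    then show ?thesis unfolding D0[OF j x] by (intro ig_bound1 D0_continuous j x f e_unit)
  qed
  then show ?thesis by (intro exI[of _ "exp Bp"]) auto
qed

text \<open>Each component is differentiable along its own characteristics.\<close>

definition along_characteristics :: "field \<Rightarrow> field \<Rightarrow> bool" where
  "along_characteristics w g \<longleftrightarrow> (\<forall>k\<in>{1..n}. cont (w k) \<and> periodic_strip (w k) \<and> cont (g k) \<and> periodic_strip (g k) \<and>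
     transport (F k) (w k) (g k))"

text \<open>The estimate on two periods extends to all times because the time derivative of a periodic
  function is periodic.\<close>

lemma smoothing:
  assumes j: "j \<in> {1..n}"
  shows "\<exists>C\<ge>0. \<exists>Z. \<forall>w g. along_characteristics w g \<longrightarrow>
    t_deriv (D j (\<lambda>_. 0) (\<lambda>x t. Bf w j x t / a j x t)) (Z w g) \<and>
    (\<forall>A. (\<forall>k\<in>{1..n}. \<forall>x\<in>{0..1}. \<forall>t. \<bar>w k x t\<bar> \<le> A \<and> \<bar>g k x t\<bar> \<le> A) \<longrightarrow>
      (\<forall>x\<in>{0..1}. \<forall>t. \<bar>Z w g x t\<bar> \<le> C * A))"
proof -
  interpret S: slope "F j" "Ft j" by (rule slope_F[OF j])
  obtain pt where pt: "t_deriv (p j) pt" using p_t_deriv[OF j] by blast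
  let ?K = "{1..n} - {j}"
  define Pk where "Pk k Z C \<longleftrightarrow> C \<ge> 0 \<and> (\<forall>v g. cont v \<longrightarrow> periodic_strip v \<longrightarrow> cont g \<longrightarrow> periodic_strip g \<longrightarrow> transport (F k) v g \<longrightarrow>
      t_deriv (D j (\<lambda>_. 0) (\<lambda>x t. b j k x t / a j x t * v x t)) (Z v g)) \<and>
      (\<forall>v g A. cont v \<longrightarrow> cont g \<longrightarrow> (\<forall>x\<in>{0..1}. \<forall>t. \<bar>v x t\<bar> \<le> A \<and> \<bar>g x t\<bar> \<le> A) \<longrightarrow>
      (\<forall>x\<in>{0..1}. \<forall>t. \<bar>t\<bar> \<le> 2 * pi \<longrightarrow> \<bar>Z v g x t\<bar> \<le> C * A))" for k and C :: real and Z
  have "\<exists>Z C. Pk k Z C" if k: "k \<in> ?K" for k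
  proof -
    have kn: "k \<in> {1..n}" and jk: "j \<noteq> k" using k by auto
    interpret T: two_slopes "F j" "Ft j" "F k" "Ft k"
      unfolding two_slopes_def using slope_F[OF j] slope_F[OF kn] by blast
    obtain \<beta> \<beta>t \<beta>F where \<beta>: "t_deriv \<beta> \<beta>t" "transport (F j) \<beta> \<beta>F" "cont \<beta>F"
      and eq: "\<forall>x\<in>{0..1}. \<forall>t. b j k x t / a j x t = \<beta> x t * (F j x t - F k x t)"
      using coupling_quotient[OF j kn jk] by blast
    obtain Z where ZC: "(\<forall>v g. cont v \<longrightarrow> periodic_strip v \<longrightarrow> cont g \<longrightarrow> periodic_strip g \<longrightarrow> transport (F k) v g \<longrightarrow>
        t_deriv (D j (\<lambda>_. 0) (\<lambda>x t. \<beta> x t * (F j x t - F k x t) * v x t)) (Z v g)) \<and>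
      (\<forall>K. \<exists>C\<ge>0. \<forall>v g A. cont v \<longrightarrow> cont g \<longrightarrow> (\<forall>x\<in>{0..1}. \<forall>t. \<bar>v x t\<bar> \<le> A \<and> \<bar>g x t\<bar> \<le> A) \<longrightarrow>
        (\<forall>x\<in>{0..1}. \<forall>t. \<bar>t\<bar> \<le> K \<longrightarrow> \<bar>Z v g x t\<bar> \<le> C * A))"
      using T.damped_smoothing[OF pt \<beta> e_unit[of j]] by (rule exE)
    note Z = ZC[THEN conjunct1, rule_format]
    from ZC[THEN conjunct2, THEN spec, of "2 * pi"] obtain C where C: "C \<ge> 0 \<and> (\<forall>v g A. cont v \<longrightarrow> cont g \<longrightarrow> (\<forall>x\<in>{0..1}. \<forall>t. \<bar>v x t\<bar> \<le> A \<and> \<bar>g x t\<bar> \<le> A) \<longrightarrow>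
        (\<forall>x\<in>{0..1}. \<forall>t. \<bar>t\<bar> \<le> 2 * pi \<longrightarrow> \<bar>Z v g x t\<bar> \<le> C * A))" by (rule exE)
    have "t_deriv (D j (\<lambda>_. 0) (\<lambda>x t. b j k x t / a j x t * v x t)) (Z v g)"
      if "cont v" "periodic_strip v" "cont g" "periodic_strip g" "transport (F k) v g" for v g
      by (rule t_deriv_cong[OF Z[OF that] D_cong[OF j]]) (use eq in auto)
    then have "Pk k Z C" unfolding Pk_def using C by simp
    then show ?thesis by blast
  qed
  then obtain Z C where ZC: "\<And>k. k \<in> ?K \<Longrightarrow> Pk k (Z k) (C k)" by metis
  have C: "C k \<ge> 0" if "k \<in> ?K" for k using ZC[OF that] unfolding Pk_def by (rule conjunct1)
  note Z = ZC[unfolded Pk_def, THEN conjunct2, THEN conjunct1, rule_format]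
    and Zb = ZC[unfolded Pk_def, THEN conjunct2, THEN conjunct2, rule_format]
  define ZZ where "ZZ w g x t = (\<Sum>k\<in>?K. Z k (w k) (g k) x t)" for w g :: field and x t
  have "t_deriv (D j (\<lambda>_. 0) (\<lambda>x t. Bf w j x t / a j x t)) (ZZ w g) \<and>
    (\<forall>A. (\<forall>k\<in>{1..n}. \<forall>x\<in>{0..1}. \<forall>t. \<bar>w k x t\<bar> \<le> A \<and> \<bar>g k x t\<bar> \<le> A) \<longrightarrow>
      (\<forall>x\<in>{0..1}. \<forall>t. \<bar>ZZ w g x t\<bar> \<le> (\<Sum>k\<in>?K. C k) * A))" if wg: "along_characteristics w g" for w g
  proof (intro conjI allI impI ballI)
    have wk: "cont (w k)" "periodic_strip (w k)" "cont (g k)" "periodic_strip (g k)" "transport (F k) (w k) (g k)"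
      if "k \<in> {1..n}" for k using wg that by (auto simp: along_characteristics_def)
    have Zk: "t_deriv (D j (\<lambda>_. 0) (\<lambda>x t. b j k x t / a j x t * w k x t)) (Z k (w k) (g k))" if k: "k \<in> ?K" for k
    proof -
      have kn: "k \<in> {1..n}" using k by blast
      show ?thesis by (rule Z[OF k wk[OF kn]])
    qed
    have c: "cont (\<lambda>x t. b j k x t / a j x t * w k x t)" if k: "k \<in> ?K" for k
      using k by (intro cont_mult cont_divide cont_b cont_a a_nz j wk) auto
    have eq: "(\<Sum>k\<in>?K. D j (\<lambda>_. 0) (\<lambda>x t. b j k x t / a j x t * w k x t) x t) = D j (\<lambda>_. 0) (\<lambda>x t. Bf w j x t / a j x t) x t"
      if x: "x \<in> {0..1}" for x t
    proof -
      have "D j (\<lambda>_. 0) (\<lambda>x t. Bf w j x t / a j x t) x t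
          = D j (\<lambda>_. 0) (\<lambda>x t. \<Sum>k\<in>?K. b j k x t / a j x t * w k x t) x t"
        by (rule D_cong[OF j x]) (simp_all add: Bf_def sum_divide_distrib)
      also have "\<dots> = (\<Sum>k\<in>?K. D j (\<lambda>_. 0) (\<lambda>x t. b j k x t / a j x t * w k x t) x t)"
        by (rule D0_sum[OF j x c]) simp_all
      finally show ?thesis by (rule sym)
    qed
    show T: "t_deriv (D j (\<lambda>_. 0) (\<lambda>x t. Bf w j x t / a j x t)) (ZZ w g)"
      by (rule t_deriv_cong[OF t_deriv_sum[OF Zk] eq]) (simp_all add: ZZ_def)
    have "periodic_strip (D j (\<lambda>_. 0) (\<lambda>x t. Bf w j x t / a j x t))"
      by (intro per_D j periodic_strip_divide per_Bf per_a wk) (simp_all add: periodic_real_def)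
    note per = periodic_t_deriv[OF this T]
    fix A x t assume A: "\<forall>k\<in>{1..n}. \<forall>x\<in>{0..1}. \<forall>t. \<bar>w k x t\<bar> \<le> A \<and> \<bar>g k x t\<bar> \<le> A" and x: "x \<in> {0..1::real}"
    show "\<bar>ZZ w g x t\<bar> \<le> (\<Sum>k\<in>?K. C k) * A"
    proof (rule periodic_strip_bound_ext[OF per _ x])
      fix t assume t: "\<bar>t\<bar> \<le> 2 * pi"
      have "\<bar>Z k (w k) (g k) x t\<bar> \<le> C k * A" if k: "k \<in> ?K" for k
      proof -
        have kn: "k \<in> {1..n}" using k by blast
        show ?thesis by (rule Zb[OF k wk(1)[OF kn] wk(3)[OF kn] _ x t]) (use A kn in blast)
      qed
      then have "(\<Sum>k\<in>?K. \<bar>Z k (w k) (g k) x t\<bar>) \<le> (\<Sum>k\<in>?K. C k * A)" by (rule sum_mono)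
      from order_trans[OF sum_abs this] show "\<bar>ZZ w g x t\<bar> \<le> (\<Sum>k\<in>?K. C k) * A"
        unfolding ZZ_def sum_distrib_right .
    qed
  qed
  moreover have "0 \<le> (\<Sum>k\<in>?K. C k)" using C by (rule sum_nonneg)
  ultimately show ?thesis by blast
qed

definition Fop :: "field \<Rightarrow> field" where "Fop v = rs n (\<lambda>j. D j (\<lambda>_. 0) (\<lambda>x t. v j x t / a j x t))"
definition Bop :: "field \<Rightarrow> field" where "Bop u = rs n (Bf u)"

lemma a_quotient:
  assumes "v \<in> Cper n" "j \<in> {1..n}"
  shows "cont (\<lambda>x t. v j x t / a j x t)" "periodic_strip (\<lambda>x t. v j x t / a j x t)"
  by (intro cont_divide CperD(1)[OF assms(1)] cont_a a_nz assms(2), assumption)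
    (intro periodic_strip_divide CperD(2)[OF assms(1)] per_a assms(2))

lemma a_inverse_bound: "\<exists>C\<ge>0. \<forall>j\<in>{1..n}. \<forall>x\<in>{0..1}. \<forall>t. \<bar>1 / a j x t\<bar> \<le> C"
proof (rule periodic_bounds[OF finite_atLeastAtMost])
  show "cont (\<lambda>x t. 1 / a j x t)" if "j \<in> {1..n}" for j using that by (intro cont_divide cont_const cont_a a_nz)
  show "periodic_strip (\<lambda>x t. 1 / a j x t)" if "j \<in> {1..n}" for j
    using per_a[OF that] by (simp add: periodic_strip_def)
qed

lemma Fop_in: assumes v: "v \<in> Cper n" shows "Fop v \<in> Cper n"
  unfolding Fop_def
  by (intro rs_in_Cper cont_D per_D a_quotient[OF v] continuous_on_const) (auto simp: periodic_real_def)

lemma Fop_apply: "j \<in> {1..n} \<Longrightarrow> x \<in> {0..1} \<Longrightarrow> Fop v j x t = D j (\<lambda>_. 0) (\<lambda>x t. v j x t / a j x t) x t"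
  unfolding Fop_def by (rule rs_apply)

lemma Bop_apply: "j \<in> {1..n} \<Longrightarrow> x \<in> {0..1} \<Longrightarrow> Bop u j x t = Bf u j x t"
  unfolding Bop_def by (rule rs_apply)

lemma Bop_in: "u \<in> Cper n \<Longrightarrow> Bop u \<in> Cper n"
  unfolding Bop_def by (intro rs_in_Cper cont_Bf per_Bf CperD(1,2))

lemma Bf_bound:
  "\<exists>C\<ge>0. \<forall>u A. (\<forall>k\<in>{1..n}. \<forall>x\<in>{0..1}. \<forall>t. \<bar>u k x t\<bar> \<le> A) \<longrightarrow> 0 \<le> A \<longrightarrow>
     (\<forall>j\<in>{1..n}. \<forall>x\<in>{0..1}. \<forall>t. \<bar>Bf u j x t\<bar> \<le> C * A)"
proof -
  have "\<exists>C\<ge>0. \<forall>j\<in>{1..n}. \<forall>k\<in>{1..n}. \<forall>x\<in>{0..1}. \<forall>t. \<bar>b j k x t\<bar> \<le> C"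
  proof (rule uniform_constant[OF finite_atLeastAtMost])
    show "\<exists>C\<ge>0. \<forall>k\<in>{1..n}. \<forall>x\<in>{0..1}. \<forall>t. \<bar>b j k x t\<bar> \<le> C" if "j \<in> {1..n}" for j
      by (rule periodic_bounds[OF finite_atLeastAtMost cont_b[OF that] per_b[OF that]])
  qed (meson order_trans)
  then obtain C where C: "C \<ge> 0" "\<forall>j\<in>{1..n}. \<forall>k\<in>{1..n}. \<forall>x\<in>{0..1}. \<forall>t. \<bar>b j k x t\<bar> \<le> C" by blast
  have "\<bar>Bf u j x t\<bar> \<le> (n * C) * A"
    if u: "\<forall>k\<in>{1..n}. \<forall>x\<in>{0..1}. \<forall>t. \<bar>u k x t\<bar> \<le> A" and A: "0 \<le> A" and j: "j \<in> {1..n}" and x: "x \<in> {0..1}" for u :: field and A j x t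
  proof -
    have "\<bar>Bf u j x t\<bar> \<le> (\<Sum>k\<in>{1..n} - {j}. \<bar>b j k x t * u k x t\<bar>)" unfolding Bf_def by (rule sum_abs)
    also have "\<dots> \<le> (\<Sum>k\<in>{1..n}. \<bar>b j k x t * u k x t\<bar>)" by (rule sum_mono2) auto
    also have "\<dots> \<le> (\<Sum>k\<in>{1..n}. C * A)"
      unfolding abs_mult using u C j x by (intro sum_mono mult_mono) auto
    finally show ?thesis by (simp add: mult_ac)
  qed
  then show ?thesis using C(1) by (intro exI[of _ "n * C"]) auto
qed

lemma Fop_bound: "\<exists>C\<ge>0. \<forall>v\<in>Cper n. sup_norm n (Fop v) \<le> C * sup_norm n v"
proof -
  obtain C where C: "C \<ge> 0" "\<forall>j\<in>{1..n}. \<forall>f A. cont f \<longrightarrow> (\<forall>x\<in>{0..1}. \<forall>t. \<bar>f x t\<bar> \<le> A) \<longrightarrow>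
     (\<forall>x\<in>{0..1}. \<forall>t. \<bar>D j (\<lambda>_. 0) f x t\<bar> \<le> C * A)" using D0_bound by blast
  obtain Ca where Ca: "Ca \<ge> 0" "\<forall>j\<in>{1..n}. \<forall>x\<in>{0..1}. \<forall>t. \<bar>1 / a j x t\<bar> \<le> Ca" using a_inverse_bound by blast
  have "sup_norm n (Fop v) \<le> (C * Ca) * sup_norm n v" if v: "v \<in> Cper n" for v
  proof (rule sup_norm_least)
    show "0 \<le> (C * Ca) * sup_norm n v" using C(1) Ca(1) sup_norm_nonneg[OF v] by simp
    fix j x t assume jx: "j \<in> {1..n}" "x \<in> {0..1::real}"
    have "\<forall>x\<in>{0..1}. \<forall>t. \<bar>v j x t / a j x t\<bar> \<le> Ca * sup_norm n v"
    proof (intro ballI allI)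
      fix x t assume x: "x \<in> {0..1::real}"
      have "\<bar>1 / a j x t\<bar> * \<bar>v j x t\<bar> \<le> Ca * sup_norm n v"
        using Ca sup_norm_upper[OF v jx(1) x] jx(1) x by (intro mult_mono) auto
      then show "\<bar>v j x t / a j x t\<bar> \<le> Ca * sup_norm n v" by simp
    qed
    then have "\<bar>D j (\<lambda>_. 0) (\<lambda>x t. v j x t / a j x t) x t\<bar> \<le> C * (Ca * sup_norm n v)"
      using C(2) jx a_quotient(1)[OF v jx(1)] by blast
    then show "\<bar>Fop v j x t\<bar> \<le> (C * Ca) * sup_norm n v" unfolding Fop_apply[OF jx] by (simp add: mult_ac)
  qed
  then show ?thesis using C(1) Ca(1) by (intro exI[of _ "C * Ca"]) auto
qed

lemma Bop_bound: "\<exists>C\<ge>0. \<forall>v\<in>Cper n. sup_norm n (Bop v) \<le> C * sup_norm n v"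
proof -
  obtain C where C: "C \<ge> 0" "\<forall>u A. (\<forall>k\<in>{1..n}. \<forall>x\<in>{0..1}. \<forall>t. \<bar>u k x t\<bar> \<le> A) \<longrightarrow> 0 \<le> A \<longrightarrow>
     (\<forall>j\<in>{1..n}. \<forall>x\<in>{0..1}. \<forall>t. \<bar>Bf u j x t\<bar> \<le> C * A)" using Bf_bound by blast
  have "sup_norm n (Bop v) \<le> C * sup_norm n v" if v: "v \<in> Cper n" for v
  proof (rule sup_norm_least)
    show "0 \<le> C * sup_norm n v" using C(1) sup_norm_nonneg[OF v] by simp
    fix j x t assume jx: "j \<in> {1..n}" "x \<in> {0..1::real}"
    have "\<forall>k\<in>{1..n}. \<forall>x\<in>{0..1}. \<forall>t. \<bar>v k x t\<bar> \<le> sup_norm n v" using sup_norm_upper[OF v] by blast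
    then show "\<bar>Bop v j x t\<bar> \<le> C * sup_norm n v"
      unfolding Bop_apply[OF jx] using C(2) sup_norm_nonneg[OF v] jx by blast
  qed
  then show ?thesis using C(1) by blast
qed

lemma Fop_add:
  assumes v: "v \<in> Cper n" and w: "w \<in> Cper n"
  shows "Fop (v + w) = Fop v + Fop w"
proof (rule Cper_eqI)
  show "Fop (v + w) \<in> Cper n" by (rule Fop_in[OF subspace_add[OF subspace_Cper v w]])
  show "Fop v + Fop w \<in> Cper n" by (rule subspace_add[OF subspace_Cper Fop_in[OF v] Fop_in[OF w]])
  fix j x t assume jx: "j \<in> {1..n}" "x \<in> {0..1::real}"
  have "Fop (v + w) j x t = D j (\<lambda>_. 0) (\<lambda>x t. v j x t / a j x t + w j x t / a j x t) x t"
    unfolding Fop_apply[OF jx] by (rule D_cong[OF jx]) (simp_all add: add_divide_distrib)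
  also have "\<dots> = Fop v j x t + Fop w j x t"
    unfolding Fop_apply[OF jx] by (rule D0_add[OF jx a_quotient(1)[OF v jx(1)] a_quotient(1)[OF w jx(1)]])
  finally show "Fop (v + w) j x t = (Fop v + Fop w) j x t" by simp
qed

lemma Fop_scale:
  assumes v: "v \<in> Cper n" shows "Fop (c *\<^sub>R v) = c *\<^sub>R Fop v"
proof (rule Cper_eqI)
  show "Fop (c *\<^sub>R v) \<in> Cper n" by (rule Fop_in[OF subspace_scale[OF subspace_Cper v]])
  show "c *\<^sub>R Fop v \<in> Cper n" by (rule subspace_scale[OF subspace_Cper Fop_in[OF v]])
  fix j x t assume jx: "j \<in> {1..n}" "x \<in> {0..1::real}"
  have "Fop (c *\<^sub>R v) j x t = D j (\<lambda>_. 0) (\<lambda>x t. c * (v j x t / a j x t)) x t"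
    unfolding Fop_apply[OF jx] by (rule D_cong[OF jx]) simp_all
  also have "\<dots> = c * Fop v j x t"
    unfolding Fop_apply[OF jx] by (rule D0_scale[OF jx])
  finally show "Fop (c *\<^sub>R v) j x t = (c *\<^sub>R Fop v) j x t" by simp
qed

lemma linear_Bop: "linear Bop"
proof (rule linearI)
  show "Bop (u + v) = Bop u + Bop v" for u v
    by (auto simp: Bop_def rs_def Bf_def fun_eq_iff distrib_left sum.distrib)
  show "Bop (c *\<^sub>R u) = c *\<^sub>R Bop u" for c u
    by (auto simp: Bop_def rs_def Bf_def fun_eq_iff sum_distrib_left mult_ac)
qed

lemma zeta_add: "zeta (u + v) j t = zeta u j t + zeta v j t"
  by (simp add: zeta_def distrib_left sum.distrib)

lemma zeta_scale: "zeta (c *\<^sub>R u) j t = c * zeta u j t"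
  by (simp add: zeta_def sum_distrib_left mult_ac)

end

section \<open>The Fredholm alternative for the system\<close>

context hypQ
begin

interpretation X: banach_carrier "Cper n" "sup_norm n" by (rule banach_Cper)

abbreviation NN where "NN \<equiv> sup_norm n"

lemma bsolves_Aop: "g \<in> Cper n \<Longrightarrow> bsolves g (Aop g)"
  by (rule iffD2[OF bsolves_iff refl])

lemma Aop_in: assumes "g \<in> Cper n" shows "Aop g \<in> Cper n"
  using bsolves_Aop[OF assms] unfolding bsolves_def by (rule conjunct1)

lemma Aop_add:
  assumes g: "g \<in> Cper n" and h: "h \<in> Cper n" shows "Aop (g + h) = Aop g + Aop h"
proof -
  have "bsolves (g + h) (Aop g + Aop h)"
    unfolding bsolves_def
  proof (intro conjI ballI allI)
    show "Aop g + Aop h \<in> Cper n" by (rule subspace_add[OF subspace_Cper Aop_in[OF g] Aop_in[OF h]])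
    fix j x t assume jx: "j \<in> {1..n}" "x \<in> {0..1::real}"
    have "Aop g j x t = kap j x t * zeta (Aop g) j (sig j x t) + g j x t"
      "Aop h j x t = kap j x t * zeta (Aop h) j (sig j x t) + h j x t"
      using bsolves_Aop[OF g] bsolves_Aop[OF h] jx unfolding bsolves_def by blast+
    then show "(Aop g + Aop h) j x t = kap j x t * zeta (Aop g + Aop h) j (sig j x t) + (g + h) j x t"
      unfolding plus_fun_apply zeta_add distrib_left by linarith
  qed
  from iffD1[OF bsolves_iff[OF subspace_add[OF subspace_Cper g h]] this] show ?thesis by (rule sym)
qed

lemma Aop_scale:
  assumes g: "g \<in> Cper n" shows "Aop (c *\<^sub>R g) = c *\<^sub>R Aop g"
proof -
  have "bsolves (c *\<^sub>R g) (c *\<^sub>R Aop g)"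
    unfolding bsolves_def
  proof (intro conjI ballI allI)
    show "c *\<^sub>R Aop g \<in> Cper n" by (rule subspace_scale[OF subspace_Cper Aop_in[OF g]])
    fix j x t assume jx: "j \<in> {1..n}" "x \<in> {0..1::real}"
    have "Aop g j x t = kap j x t * zeta (Aop g) j (sig j x t) + g j x t"
      using bsolves_Aop[OF g] jx unfolding bsolves_def by blast
    then have "c * Aop g j x t = c * (kap j x t * zeta (Aop g) j (sig j x t) + g j x t)" by (rule arg_cong)
    then show "(c *\<^sub>R Aop g) j x t = kap j x t * zeta (c *\<^sub>R Aop g) j (sig j x t) + (c *\<^sub>R g) j x t"
      unfolding scaleR_fun_apply real_scaleR_def zeta_scale by (simp add: distrib_left mult.left_commute)
  qed
  from iffD1[OF bsolves_iff[OF subspace_scale[OF subspace_Cper g]] this] show ?thesis by (rule sym)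
qed

lemma continuous_solution_bsolves:
  assumes f: "f \<in> Cper n"
  shows "continuous_solution n m a b r f u \<longleftrightarrow> u \<in> Cper n \<and> u = Aop (Fop (f - Bop u))"
proof (cases "u \<in> Cper n")
  case u: True
  have v: "f - Bop u \<in> Cper n" by (rule subspace_diff[OF subspace_Cper f Bop_in[OF u]])
  have "D j (zeta u j) (\<lambda>x t. (f j x t - Bf u j x t) / a j x t) x t
      = kap j x t * zeta u j (sig j x t) + Fop (f - Bop u) j x t" if jx: "j \<in> {1..n}" "x \<in> {0..1}" for j x t
  proof -
    have "D j (\<lambda>_. 0) (\<lambda>x t. (f j x t - Bf u j x t) / a j x t) x t = Fop (f - Bop u) j x t"
      unfolding Fop_apply[OF jx] by (rule D_cong[OF jx]) (simp_all add: Bop_apply[OF jx(1)])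
    then show ?thesis using D_split[OF jx, of "zeta u j" "\<lambda>x t. (f j x t - Bf u j x t) / a j x t" t] by simp
  qed
  note eq = this
  have fc: "cont (f j)" if "j \<in> {1..n}" for j by (rule CperD(1)[OF f that])
  have "continuous_solution n m a b r f u \<longleftrightarrow> u \<in> Cper n \<and>
    (\<forall>j\<in>{1..n}. \<forall>x\<in>{0..1}. \<forall>t. u j x t = D j (zeta u j) (\<lambda>x t. (f j x t - Bf u j x t) / a j x t) x t)"
    by (rule continuous_solution_iff) (rule fc)
  also have "\<dots> \<longleftrightarrow> bsolves (Fop (f - Bop u)) u"
    unfolding bsolves_def by (rule conj_cong[OF refl], rule ball_cong[OF refl], rule ball_cong[OF refl], rule all_cong1) (simp only: eq)
  finally have "continuous_solution n m a b r f u \<longleftrightarrow> bsolves (Fop (f - Bop u)) u" .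
  with u show ?thesis by (simp only: bsolves_iff[OF Fop_in[OF v]] simp_thms)
qed (simp add: continuous_solution_def)

text \<open>The components of \<open>Aop (Fop v)\<close> are differentiable along the characteristics only; the
  second integration turns this into differentiability in all directions.\<close>

lemma compactness:
  "\<exists>K\<ge>0. \<forall>v\<in>Cper n. lipschitz_field n (K * NN v) (Fop (Bop (Aop (Fop v))))"
proof -
  obtain CA where CA: "CA \<ge> 0" "\<forall>g\<in>Cper n. bsolves g (Aop g) \<and> NN (Aop g) \<le> CA * NN g" using Aop_solves by blast
  obtain CF where CF: "CF \<ge> 0" "\<forall>v\<in>Cper n. NN (Fop v) \<le> CF * NN v" using Fop_bound by blast
  obtain CB where CB: "CB \<ge> 0" "\<forall>v\<in>Cper n. NN (Bop v) \<le> CB * NN v" using Bop_bound by blast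
  obtain Ca where Ca: "Ca \<ge> 0" "\<forall>j\<in>{1..n}. \<forall>x\<in>{0..1}. \<forall>t. \<bar>1 / a j x t\<bar> \<le> Ca" using a_inverse_bound by blast
  have "\<exists>B\<ge>0. \<forall>j\<in>{1..n}. \<forall>x\<in>{0..1}. \<forall>t. \<bar>p j x t\<bar> \<le> B"
    by (rule periodic_bounds[OF finite_atLeastAtMost cont_p per_p])
  then obtain Cp where Cp: "Cp \<ge> 0" "\<forall>j\<in>{1..n}. \<forall>x\<in>{0..1}. \<forall>t. \<bar>p j x t\<bar> \<le> Cp" by blast
  \<comment> \<open>Bounds relative to \<open>NN v\<close>: \<open>C1\<close> for \<open>w = Aop (Fop v)\<close> and its derivatives along the
    characteristics, \<open>C2\<close> for those of \<open>Fop (Bop w)\<close>.\<close>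
  define C1 where "C1 = max (CA * CF) (Ca + Cp * (CA * CF))"
  define C2 where "C2 = Ca * (CB * (CA * CF)) + Cp * (CF * (CB * (CA * CF)))"
  have "\<exists>K\<ge>0. \<forall>v\<in>Cper n. \<forall>x\<in>{0..1}. \<forall>y\<in>{0..1}. \<forall>s t. \<bar>Fop (Bop (Aop (Fop v))) j x s - Fop (Bop (Aop (Fop v))) j y t\<bar>
      \<le> (K * NN v) * (\<bar>x - y\<bar> + \<bar>s - t\<bar>)" if j: "j \<in> {1..n}" for j
  proof -
    interpret S: slope "F j" "Ft j" by (rule slope_F[OF j])
    obtain C Z where C: "C \<ge> 0" and Z: "\<forall>w g. along_characteristics w g \<longrightarrow>
      t_deriv (D j (\<lambda>_. 0) (\<lambda>x t. Bf w j x t / a j x t)) (Z w g) \<and>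
      (\<forall>A. (\<forall>k\<in>{1..n}. \<forall>x\<in>{0..1}. \<forall>t. \<bar>w k x t\<bar> \<le> A \<and> \<bar>g k x t\<bar> \<le> A) \<longrightarrow>
        (\<forall>x\<in>{0..1}. \<forall>t. \<bar>Z w g x t\<bar> \<le> C * A))" using smoothing[OF j] by blast
    have "\<bar>Fop (Bop (Aop (Fop v))) j x s - Fop (Bop (Aop (Fop v))) j y t\<bar>
      \<le> ((C2 + (1 + S.M) * (C * C1)) * NN v) * (\<bar>x - y\<bar> + \<bar>s - t\<bar>)"
      if v: "v \<in> Cper n" and x: "x \<in> {0..1}" and y: "y \<in> {0..1}" for v x y s t
    proof -
      define w where "w = Aop (Fop v)"
      note Fv = Fop_in[OF v]
      have w: "w \<in> Cper n" unfolding w_def by (rule Aop_in[OF Fv])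
      have N0: "0 \<le> NN v" by (rule sup_norm_nonneg[OF v])
      have wN: "NN w \<le> (CA * CF) * NN v"
      proof -
        have "NN w \<le> CA * NN (Fop v)" unfolding w_def using CA(2) Fv by blast
        also have "\<dots> \<le> CA * (CF * NN v)" using CF v CA(1) by (intro mult_left_mono) auto
        finally show ?thesis by simp
      qed
      define g where "g k x t = v k x t / a k x t - p k x t * w k x t" for k x t
      have weq: "w k x t = D k (zeta w k) (\<lambda>x t. v k x t / a k x t) x t" if kx: "k \<in> {1..n}" "x \<in> {0..1}" for k x t
      proof -
        have "w k x t = kap k x t * zeta w k (sig k x t) + Fop v k x t"
          using bsolves_Aop[OF Fv] kx unfolding w_def[symmetric] bsolves_def by blast
        then show ?thesis unfolding Fop_apply[OF kx] using D_split[OF kx, of "zeta w k" "\<lambda>x t. v k x t / a k x t" t] by simp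
      qed
      have trw: "transport (F k) (w k) (g k)" if k: "k \<in> {1..n}" for k
        by (rule transport_cong[OF slope.transport_dsol[OF slope_F[OF k] cont_p[OF k] a_quotient(1)[OF v k] e_unit]])
          (simp_all only: g_def weq[OF k])
      have cg: "cont (g k)" "periodic_strip (g k)" if k: "k \<in> {1..n}" for k
        unfolding g_def[abs_def]
        by (intro cont_diff cont_mult a_quotient(1)[OF v k] cont_p k CperD(1)[OF w])
          (intro periodic_strip_diff periodic_strip_mult a_quotient(2)[OF v k] per_p k CperD(2)[OF w])
      have al: "along_characteristics w g"
        unfolding along_characteristics_def using CperD(1,2)[OF w] cg trw by blast
      have va: "\<bar>u k x t / a k x t\<bar> \<le> Ca * NN u" if u: "u \<in> Cper n" and kx: "k \<in> {1..n}" "x \<in> {0..1}" for u k x t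
      proof -
        have "\<bar>1 / a k x t\<bar> * \<bar>u k x t\<bar> \<le> Ca * NN u"
          using Ca sup_norm_upper[OF u kx] kx by (intro mult_mono) auto
        then show ?thesis by simp
      qed
      have pw: "\<bar>p k x t * u k x t\<bar> \<le> Cp * NN u" if u: "u \<in> Cper n" and kx: "k \<in> {1..n}" "x \<in> {0..1}" for u k x t
        unfolding abs_mult using Cp sup_norm_upper[OF u kx] kx by (intro mult_mono) auto
      have A: "\<forall>k\<in>{1..n}. \<forall>x\<in>{0..1}. \<forall>t. \<bar>w k x t\<bar> \<le> C1 * NN v \<and> \<bar>g k x t\<bar> \<le> C1 * NN v"
      proof (intro ballI allI conjI)
        fix k x t assume kx: "k \<in> {1..n}" "x \<in> {0..1::real}"
        have m: "(CA * CF) * NN v \<le> C1 * NN v" "(Ca + Cp * (CA * CF)) * NN v \<le> C1 * NN v"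
          unfolding C1_def using N0 by (auto intro!: mult_right_mono)
        show "\<bar>w k x t\<bar> \<le> C1 * NN v" using sup_norm_upper[OF w kx, of t] wN m(1) by linarith
        have "Cp * NN w \<le> Cp * ((CA * CF) * NN v)" by (rule mult_left_mono[OF wN Cp(1)])
        then have "\<bar>g k x t\<bar> \<le> (Ca + Cp * (CA * CF)) * NN v"
          unfolding g_def distrib_right mult.assoc[of Cp]
          using va[OF v kx, of t] pw[OF w kx, of t] abs_triangle_ineq4[of "v k x t / a k x t" "p k x t * w k x t"] by linarith
        then show "\<bar>g k x t\<bar> \<le> C1 * NN v" using m(2) by linarith
      qed
      let ?h = "D j (\<lambda>_. 0) (\<lambda>x t. Bf w j x t / a j x t)"
      have T: "t_deriv ?h (Z w g)" using Z al by blast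
      have Zb: "\<bar>Z w g x t\<bar> \<le> C * (C1 * NN v)" if "x \<in> {0..1}" for x t using Z al A that by blast
      have heq: "Fop (Bop w) j x t = ?h x t" if x: "x \<in> {0..1}" for x t
        unfolding Fop_apply[OF j x] by (rule D_cong[OF j x]) (simp_all add: Bop_apply[OF j])
      note Bw = Bop_in[OF w]
      have cB: "cont (\<lambda>x t. Bf w j x t / a j x t)" by (intro cont_divide cont_Bf CperD(1)[OF w] cont_a a_nz j)
      note trh = S.transport_dsol[OF cont_p[OF j] cB e_unit[of j], of "\<lambda>_. 0"]
      have gb: "\<bar>Bf w j x t / a j x t - p j x t * ?h x t\<bar> \<le> C2 * NN v" if x: "x \<in> {0..1}" for x t
      proof -
        have BN: "NN (Bop w) \<le> (CB * (CA * CF)) * NN v"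
        proof -
          have "NN (Bop w) \<le> CB * NN w" using CB(2) w by blast
          also have "\<dots> \<le> CB * ((CA * CF) * NN v)" by (rule mult_left_mono[OF wN CB(1)])
          finally show ?thesis by simp
        qed
        have FN: "NN (Fop (Bop w)) \<le> CF * ((CB * (CA * CF)) * NN v)"
        proof -
          have "NN (Fop (Bop w)) \<le> CF * NN (Bop w)" using CF(2) Bw by blast
          also have "\<dots> \<le> CF * ((CB * (CA * CF)) * NN v)" by (rule mult_left_mono[OF BN CF(1)])
          finally show ?thesis .
        qed
        have "\<bar>Bf w j x t / a j x t\<bar> \<le> Ca * NN (Bop w)"
          using va[OF Bw j x, of t] unfolding Bop_apply[OF j x] .
        moreover have "\<bar>p j x t * ?h x t\<bar> \<le> Cp * NN (Fop (Bop w))"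
          using pw[OF Fop_in[OF Bw] j x, of t] unfolding heq[OF x] .
        ultimately have "\<bar>Bf w j x t / a j x t - p j x t * ?h x t\<bar> \<le> Ca * NN (Bop w) + Cp * NN (Fop (Bop w))" by linarith
        also have "\<dots> \<le> Ca * ((CB * (CA * CF)) * NN v) + Cp * (CF * ((CB * (CA * CF)) * NN v))"
          by (rule add_mono[OF mult_left_mono[OF BN Ca(1)] mult_left_mono[OF FN Cp(1)]])
        finally show ?thesis by (simp add: C2_def algebra_simps)
      qed
      have "\<bar>?h x s - ?h y t\<bar> \<le> (C2 * NN v + (1 + S.M) * (C * (C1 * NN v))) * (\<bar>x - y\<bar> + \<bar>s - t\<bar>)"
        by (rule S.lipschitz_of_transport[OF T trh Zb gb x y])
      then show ?thesis unfolding w_def[symmetric] heq[OF x] heq[OF y] by (simp add: distrib_right mult.assoc)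
    qed
    moreover have "0 \<le> C2 + (1 + S.M) * (C * C1)"
      unfolding C1_def C2_def using CA(1) CF(1) CB(1) Ca(1) Cp(1) C S.M(1)
      by (intro add_nonneg_nonneg mult_nonneg_nonneg) (simp_all add: le_max_iff_disj)
    ultimately show ?thesis by blast
  qed
  then have "\<exists>K\<ge>0. \<forall>j\<in>{1..n}. \<forall>v\<in>Cper n. \<forall>x\<in>{0..1}. \<forall>y\<in>{0..1}. \<forall>s t. \<bar>Fop (Bop (Aop (Fop v))) j x s - Fop (Bop (Aop (Fop v))) j y t\<bar>
      \<le> (K * NN v) * (\<bar>x - y\<bar> + \<bar>s - t\<bar>)"
  proof (rule uniform_constant[OF finite_atLeastAtMost])
    fix j and K K' :: real
    assume H: "\<forall>v\<in>Cper n. \<forall>x\<in>{0..1}. \<forall>y\<in>{0..1}. \<forall>s t. \<bar>Fop (Bop (Aop (Fop v))) j x s - Fop (Bop (Aop (Fop v))) j y t\<bar>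
      \<le> (K * NN v) * (\<bar>x - y\<bar> + \<bar>s - t\<bar>)" and le: "K \<le> K'"
    show "\<forall>v\<in>Cper n. \<forall>x\<in>{0..1}. \<forall>y\<in>{0..1}. \<forall>s t. \<bar>Fop (Bop (Aop (Fop v))) j x s - Fop (Bop (Aop (Fop v))) j y t\<bar>
      \<le> (K' * NN v) * (\<bar>x - y\<bar> + \<bar>s - t\<bar>)"
    proof (intro ballI allI)
      fix v and x y s t :: real assume vxy: "v \<in> Cper n" "x \<in> {0..1}" "y \<in> {0..1}"
      have "(K * NN v) * (\<bar>x - y\<bar> + \<bar>s - t\<bar>) \<le> (K' * NN v) * (\<bar>x - y\<bar> + \<bar>s - t\<bar>)"
        using le sup_norm_nonneg[OF vxy(1)] by (intro mult_right_mono) auto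
      moreover have "\<bar>Fop (Bop (Aop (Fop v))) j x s - Fop (Bop (Aop (Fop v))) j y t\<bar> \<le> (K * NN v) * (\<bar>x - y\<bar> + \<bar>s - t\<bar>)"
        using H vxy by blast
      ultimately show "\<bar>Fop (Bop (Aop (Fop v))) j x s - Fop (Bop (Aop (Fop v))) j y t\<bar> \<le> (K' * NN v) * (\<bar>x - y\<bar> + \<bar>s - t\<bar>)"
        by linarith
    qed
  qed
  then show ?thesis unfolding lipschitz_field_def by blast
qed

text \<open>For \<open>Q = Bop \<circ> Aop \<circ> Fop\<close>, \<open>L = Fop \<circ> Q\<close> and a finite-rank operator \<open>S\<close> near the identity
  on Lipschitz functions, the square of \<open>Q\<close> is \<open>Bop \<circ> Aop\<close> applied to the small \<open>L - S L\<close> plus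
  \<open>Bop \<circ> Aop\<close> applied to the finite-rank \<open>S L\<close>.\<close>

lemma fredholm_operators:
  "\<exists>PP. X.bop PP \<and> X.bop Bop \<and> X.index0 (\<lambda>v. v + Bop (PP v)) \<and> (\<forall>v\<in>Cper n. PP v = Aop (Fop v))"
proof -
  obtain CA where CA: "CA \<ge> 0" "\<forall>g\<in>Cper n. bsolves g (Aop g) \<and> NN (Aop g) \<le> CA * NN g" using Aop_solves by blast
  obtain CF where CF: "CF \<ge> 0" "\<forall>v\<in>Cper n. NN (Fop v) \<le> CF * NN v" using Fop_bound by blast
  obtain CB where CB: "CB \<ge> 0" "\<forall>v\<in>Cper n. NN (Bop v) \<le> CB * NN v" using Bop_bound by blast
  obtain Ao where Ao: "linear Ao" "\<forall>g\<in>Cper n. Ao g = Aop g"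
    using linear_extension[where f = Aop, OF subspace_Cper Aop_add Aop_scale] by blast
  obtain Fo where Fo: "linear Fo" "\<forall>v\<in>Cper n. Fo v = Fop v"
    using linear_extension[where f = Fop, OF subspace_Cper Fop_add Fop_scale] by blast
  have bA: "X.bop Ao" by (rule X.bopI[where C = CA]) (use Ao Aop_in CA in auto)
  have bF: "X.bop Fo" by (rule X.bopI[where C = CF]) (use Fo Fop_in CF in auto)
  have bB: "X.bop Bop" by (rule X.bopI[where C = CB]) (use linear_Bop Bop_in CB in auto)
  let ?PP = "\<lambda>v. Ao (Fo v)"
  have bP: "X.bop ?PP" by (rule X.bop_comp[OF bA bF])
  have PPeq: "?PP v = Aop (Fop v)" if "v \<in> Cper n" for v using that Ao(2) Fo(2) Fop_in by simp
  let ?BA = "\<lambda>v. Bop (Ao v)" and ?L = "\<lambda>v. Fo (Bop (Ao (Fo v)))"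
  have bBA: "X.bop ?BA" by (rule X.bop_comp[OF bB bA])
  have bL: "X.bop ?L" by (rule X.bop_comp[OF bF X.bop_comp[OF bB bP]])
  have Leq: "?L v = Fop (Bop (Aop (Fop v)))" if v: "v \<in> Cper n" for v
    using PPeq[OF v] Fo(2) Bop_in[OF Aop_in[OF Fop_in[OF v]]] by simp
  obtain K where K: "K \<ge> 0" "\<forall>v\<in>Cper n. lipschitz_field n (K * NN v) (Fop (Bop (Aop (Fop v))))"
    using compactness by blast
  define C1 where "C1 = CB * CA"
  have C10: "0 \<le> C1" using CB CA by (simp add: C1_def)
  have BAb: "NN (?BA v) \<le> C1 * NN v" if v: "v \<in> Cper n" for v
  proof -
    have "NN (Bop (Aop v)) \<le> CB * NN (Aop v)" using CB(2) Aop_in[OF v] by blast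
    also have "\<dots> \<le> CB * (CA * NN v)" using CA CB(1) v by (intro mult_left_mono) auto
    finally show ?thesis using Ao(2) v by (simp add: C1_def)
  qed
  \<comment> \<open>The error of \<open>S\<close> is at most \<open>2 \<epsilon> K\<close> on the range of \<open>L\<close>; this choice makes the remainder
    smaller than \<open>1 / 2\<close>.\<close>
  define \<epsilon> where "\<epsilon> = min 1 (1 / (4 * (C1 * K + 1)))"
  have CK: "0 \<le> C1 * K" using C10 K(1) by simp
  have \<epsilon>: "0 < \<epsilon>" "\<epsilon> \<le> 1" "\<epsilon> \<le> 1 / (4 * (C1 * K + 1))" using CK by (simp_all add: \<epsilon>_def)
  obtain S where S: "X.frank S" "\<forall>u\<in>Cper n. \<forall>K\<ge>0. lipschitz_field n K u \<longrightarrow> NN (S u - u) \<le> K * (2 * \<epsilon>)"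
    using finite_rank_approximation[OF \<epsilon>(1,2)] by blast
  note bS = X.frank_bop[OF S(1)]
  have inS: "v \<in> Cper n \<Longrightarrow> S v \<in> Cper n" and inL: "v \<in> Cper n \<Longrightarrow> ?L v \<in> Cper n" for v
    using X.bopD(2)[OF bS] X.bopD(2)[OF bL] by auto
  let ?E = "\<lambda>v. Bop (Ao (?L v - S (?L v)))" and ?G = "\<lambda>v. Bop (Ao (S (?L v)))"
  have bE: "X.bop ?E" by (rule X.bop_comp[OF bBA X.bop_diff[OF bL X.bop_comp[OF bS bL]]])
  have fG: "X.frank ?G" by (rule X.frank_comp_left[OF bBA X.frank_comp_right[OF S(1) bL]])
  have linBA: "linear ?BA" by (rule X.bopD(1)[OF bBA])
  have "X.index0 (\<lambda>v. v + Bop (?PP v))"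
  proof (rule X.index0_of_square[OF X.bop_comp[OF bB bP] bE fG])
    fix v assume v: "v \<in> Cper n"
    show "Bop (?PP (Bop (?PP v))) = ?E v + ?G v"
      using linear_add[OF linBA, of "?L v - S (?L v)" "S (?L v)"] by simp
    have d: "S (?L v) - ?L v \<in> Cper n" by (rule subspace_diff[OF subspace_Cper inS[OF inL[OF v]] inL[OF v]])
    have d': "?L v - S (?L v) \<in> Cper n" by (rule subspace_diff[OF subspace_Cper inL[OF v] inS[OF inL[OF v]]])
    have N0: "0 \<le> NN v" by (rule sup_norm_nonneg[OF v])
    have "lipschitz_field n (K * NN v) (?L v)" using K(2) v Leq[OF v] by simp
    then have "NN (S (?L v) - ?L v) \<le> (K * NN v) * (2 * \<epsilon>)" using S(2) inL[OF v] K(1) N0 by simp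
    then have "NN (?L v - S (?L v)) \<le> (K * NN v) * (2 * \<epsilon>)"
      using X.N_diff_commute[OF inL[OF v] inS[OF inL[OF v]]] by simp
    then have "C1 * NN (?L v - S (?L v)) \<le> C1 * ((K * NN v) * (2 * \<epsilon>))" by (rule mult_left_mono[OF _ C10])
    also have "\<dots> = (C1 * K * (2 * \<epsilon>)) * NN v" by simp
    also have "\<dots> \<le> 1 / 2 * NN v"
    proof (rule mult_right_mono[OF _ N0])
      have "C1 * K * (2 * \<epsilon>) \<le> C1 * K * (2 * (1 / (4 * (C1 * K + 1))))" using \<epsilon>(3) CK by (intro mult_left_mono) auto
      also have "\<dots> \<le> 1 / 2" using CK by (simp add: field_simps)
      finally show "C1 * K * (2 * \<epsilon>) \<le> 1 / 2" .
    qed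
    finally show "NN (?E v) \<le> 1 / 2 * NN v" using BAb[OF d'] by linarith
  qed
  then have "X.bop ?PP \<and> X.bop Bop \<and> X.index0 (\<lambda>v. v + Bop (?PP v)) \<and> (\<forall>v\<in>Cper n. ?PP v = Aop (Fop v))"
    using bP bB PPeq by (intro conjI ballI)
  then show ?thesis by (rule exI[of _ ?PP])
qed

theorem fredholm:
  defines "\<K> \<equiv> homogeneous_solutions n m a b r" and "\<R> \<equiv> solvable_rhs n m a b r"
    and "sol \<equiv> continuous_solution n m a b r"
  shows "finite_dim \<K>" "closedin (Cper_top n) \<R>" "has_codim \<R> (Cper n) (dim \<K>)"
    "(dim \<K> > 0) \<noteq> (\<forall>f\<in>Cper n. \<exists>!u. sol f u)"
    "(\<forall>f\<in>Cper n. \<exists>!u. sol f u) \<Longrightarrow> continuous_map (Cper_top n) (Cper_top n) (\<lambda>f. THE u. sol f u)"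
proof -
  obtain PP where *: "X.bop PP \<and> X.bop Bop \<and> X.index0 (\<lambda>v. v + Bop (PP v)) \<and> (\<forall>v\<in>Cper n. PP v = Aop (Fop v))"
    using fredholm_operators by (rule exE)
  note bP = *[THEN conjunct1] and bB = *[THEN conjunct2, THEN conjunct1]
    and I = *[THEN conjunct2, THEN conjunct2, THEN conjunct1]
    and PP = *[THEN conjunct2, THEN conjunct2, THEN conjunct2, rule_format]
  note FA = X.fredholm_alternative[where P = PP and B = Bop, OF bP bB I]
  have sol: "sol f u \<longleftrightarrow> u \<in> Cper n \<and> u = PP (f - Bop u)" if f: "f \<in> Cper n" for f u
  proof (cases "u \<in> Cper n")
    case True
    from PP[OF subspace_diff[OF subspace_Cper f Bop_in[OF True]]] show ?thesis
      unfolding sol_def continuous_solution_bsolves[OF f] by (simp only:)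
  qed (simp add: sol_def continuous_solution_def)
  have zero: "(0 :: field) \<in> Cper n" "(\<lambda>_ _ _. 0 :: real) = (0 :: field)"
    by (rule subspace_0[OF subspace_Cper]) (simp add: fun_eq_iff)
  have K: "\<K> = {u. u \<in> Cper n \<and> u = PP (0 - Bop u)}"
    unfolding \<K>_def homogeneous_solutions_def zero(2) sol_def[symmetric] by (rule Collect_cong, rule sol[OF zero(1)])
  have R: "\<R> = {f \<in> Cper n. \<exists>u. u \<in> Cper n \<and> u = PP (f - Bop u)}"
    unfolding \<R>_def solvable_rhs_def sol_def[symmetric]
    by (rule Collect_cong, rule conj_cong[OF refl], rule ex_cong1, rule sol)
  have all: "(\<forall>f\<in>Cper n. \<exists>!u. sol f u) \<longleftrightarrow> (\<forall>f\<in>Cper n. \<exists>!u. u \<in> Cper n \<and> u = PP (f - Bop u))"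
    by (rule ball_cong[OF refl], rule arg_cong[where f = Ex1], rule ext, rule sol)
  show "finite_dim \<K>" unfolding K by (rule FA(1))
  show "has_codim \<R> (Cper n) (dim \<K>)" unfolding K R by (rule FA(3))
  show "(dim \<K> > 0) \<noteq> (\<forall>f\<in>Cper n. \<exists>!u. sol f u)" unfolding K all by (rule FA(4))
  interpret M: Metric_space "Cper n" "Cper_dist n" by (rule Metric_space_Cper)
  have cl: "X.closedX \<R>" unfolding R by (rule FA(2))
  have RX: "\<R> \<subseteq> Cper n" unfolding R by blast
  show "closedin (Cper_top n) \<R>"
    unfolding Cper_top_def M.metric_closedin_iff_sequentially_closed
  proof (intro conjI RX allI impI, elim conjE)
    fix s f assume s: "range s \<subseteq> \<R>" and lim: "limitin M.mtopology s f sequentially"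
    have f: "f \<in> Cper n" using lim unfolding M.limitin_metric by blast
    have sX: "s k \<in> Cper n" for k using s RX by blast
    have "(\<lambda>k. NN (s k - f)) \<longlonglongrightarrow> 0"
    proof (rule tendstoI)
      fix e :: real assume "e > 0"
      then have "\<forall>\<^sub>F k in sequentially. s k \<in> Cper n \<and> Cper_dist n (s k) f < e"
        using lim unfolding M.limitin_metric by blast
      then show "\<forall>\<^sub>F k in sequentially. dist (NN (s k - f)) 0 < e"
        by (rule eventually_mono)
          (use f sup_norm_nonneg[OF subspace_diff[OF subspace_Cper sX f]] in \<open>auto simp: Cper_dist_def\<close>)
    qed
    moreover have "s k \<in> \<R>" for k using s by blast
    ultimately show "f \<in> \<R>" by (intro X.closedXD[OF cl _ f])
  qed
  show "continuous_map (Cper_top n) (Cper_top n) (\<lambda>f. THE u. sol f u)" if ex: "\<forall>f\<in>Cper n. \<exists>!u. sol f u"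
  proof -
    define T where "T = (\<lambda>f. THE u. sol f u)"
    have T: "sol f (T f)" if "f \<in> Cper n" for f
    proof -
      have "\<exists>!u. sol f u" using ex that by (rule bspec)
      from theI'[OF this] show ?thesis unfolding T_def .
    qed
    have TX: "T f \<in> Cper n \<and> T f = PP (f - Bop (T f))" if f: "f \<in> Cper n" for f
      by (rule iffD1[OF sol[OF f] T[OF f]])
    obtain c where c: "c \<ge> 0 \<and> (\<forall>f\<in>Cper n. \<forall>g\<in>Cper n. \<forall>u v. u \<in> Cper n \<and> u = PP (f - Bop u) \<longrightarrow>
        v \<in> Cper n \<and> v = PP (g - Bop v) \<longrightarrow> NN (u - v) \<le> c * NN (f - g))"
      using FA(5)[OF iffD1[OF all ex]] by (rule exE)
    note c0 = conjunct1[OF c]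
    have lip: "NN (T f - T g) \<le> c * NN (f - g)" if f: "f \<in> Cper n" and g: "g \<in> Cper n" for f g
      by (rule conjunct2[OF c, THEN bspec, OF f, THEN bspec, OF g, THEN spec, THEN spec, THEN mp, OF TX[OF f], THEN mp, OF TX[OF g]])
    show ?thesis
      unfolding T_def[symmetric] Cper_top_def M.continuous_map_to_metric
    proof (intro ballI allI impI)
      fix f and \<epsilon> :: real assume "f \<in> topspace M.mtopology" and \<epsilon>: "\<epsilon> > 0"
      then have f: "f \<in> Cper n" by simp
      let ?U = "M.mball f (\<epsilon> / (c + 1))"
      have fU: "f \<in> ?U" using f \<epsilon> c0 by simp
      have "T g \<in> M.mball (T f) \<epsilon>" if gU: "g \<in> ?U" for g
      proof -
        have g: "g \<in> Cper n" and d: "NN (f - g) < \<epsilon> / (c + 1)" using gU f by (auto simp: Cper_dist_def)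
        have "NN (T f - T g) \<le> c * NN (f - g)" by (rule lip[OF f g])
        also have "\<dots> \<le> (c + 1) * NN (f - g)"
          using sup_norm_nonneg[OF subspace_diff[OF subspace_Cper f g]] by (intro mult_right_mono) auto
        also have "\<dots> < \<epsilon>" using d c0 by (simp add: field_simps)
        finally show ?thesis using conjunct1[OF TX[OF f]] conjunct1[OF TX[OF g]] by (simp add: Cper_dist_def)
      qed
      then show "\<exists>U. openin M.mtopology U \<and> f \<in> U \<and> (\<forall>g\<in>U. T g \<in> M.mball (T f) \<epsilon>)"
        using fU by (intro exI[of _ ?U]) auto
    qed
  qed
qed

end

section \<open>Differentiability of solutions\<close>

lemma t_deriv_deriv:
  assumes "t_deriv g w" shows "t_deriv g (\<lambda>x t. deriv (g x) t)"
  by (rule t_deriv_cong[OF assms refl DERIV_imp_deriv[OF t_derivD(3)[OF assms], symmetric]])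

context hyp
begin

text \<open>Boundary conditions with an inhomogeneity \<open>\<gamma>\<close> are needed for the time derivatives of
  solutions.\<close>

definition gsol :: "field \<Rightarrow> (nat \<Rightarrow> real \<Rightarrow> real) \<Rightarrow> field \<Rightarrow> bool" where
  "gsol f \<gamma> u \<longleftrightarrow> (\<forall>j\<in>{1..n}. cont (u j) \<and> periodic_strip (u j) \<and>
     transport (F j) (u j) (\<lambda>x t. (f j x t - (\<Sum>k\<in>{1..n}. b j k x t * u k x t)) / a j x t) \<and>
     (\<forall>t. u j (e j) t = zeta u j t + \<gamma> j t))"

lemma gsolD:
  assumes "gsol f \<gamma> u" "j \<in> {1..n}"
  shows "cont (u j)" "periodic_strip (u j)"
    "transport (F j) (u j) (\<lambda>x t. (f j x t - (\<Sum>k\<in>{1..n}. b j k x t * u k x t)) / a j x t)"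
    "u j (e j) t = zeta u j t + \<gamma> j t"
  using assms unfolding gsol_def by blast+

lemma all_couplings:
  assumes j: "j \<in> {1..n}"
  shows "(c - (\<Sum>k\<in>{1..n}. b j k x t * u k x t)) / a j x t = (c - Bf u j x t) / a j x t - p j x t * u j x t"
proof -
  have "(\<Sum>k\<in>{1..n}. b j k x t * u k x t) = b j j x t * u j x t + Bf u j x t"
    unfolding Bf_def by (rule sum.remove[OF finite_atLeastAtMost j])
  then show ?thesis by (simp add: p_def diff_divide_distrib add_divide_distrib)
qed

lemma continuous_solution_gsol:
  assumes f: "\<And>j. j \<in> {1..n} \<Longrightarrow> cont (f j)" and u: "continuous_solution n m a b r f u"
  shows "gsol f (\<lambda>_ _. 0) u"
  unfolding gsol_def
proof (intro ballI conjI allI)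
  fix j assume j: "j \<in> {1..n}"
  interpret S: slope "F j" "Ft j" by (rule slope_F[OF j])
  have "u \<in> Cper n \<and> (\<forall>j\<in>{1..n}. \<forall>x\<in>{0..1}. \<forall>t. u j x t = D j (zeta u j) (\<lambda>x t. (f j x t - Bf u j x t) / a j x t) x t)"
    by (rule iffD1[OF continuous_solution_iff u]) (rule f)
  then have uC: "u \<in> Cper n"
    and eq: "\<And>x t. x \<in> {0..1} \<Longrightarrow> u j x t = D j (zeta u j) (\<lambda>x t. (f j x t - Bf u j x t) / a j x t) x t"
    using j by blast+
  show "cont (u j)" "periodic_strip (u j)" by (rule CperD(1)[OF uC j], rule CperD(2)[OF uC j])
  have c: "cont (\<lambda>x t. (f j x t - Bf u j x t) / a j x t)"
    by (intro cont_divide cont_diff f cont_Bf CperD(1)[OF uC] cont_a a_nz j)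
  show "transport (F j) (u j) (\<lambda>x t. (f j x t - (\<Sum>k\<in>{1..n}. b j k x t * u k x t)) / a j x t)"
    unfolding all_couplings[OF j]
    by (rule transport_cong[OF S.transport_dsol[OF cont_p[OF j] c e_unit, of j "zeta u j"]]) (simp_all only: eq)
  show "u j (e j) t = zeta u j t + 0" for t
    using eq[OF e_unit, of j t] S.dsol_entry[OF e_unit[of j]] by simp
qed

lemma gsol_repr:
  assumes u: "gsol f \<gamma> u" and f: "\<And>j. j \<in> {1..n} \<Longrightarrow> cont (f j)" and j: "j \<in> {1..n}" and x: "x \<in> {0..1}"
  shows "u j x t = D j (\<lambda>t. zeta u j t + \<gamma> j t) (\<lambda>x t. (f j x t - Bf u j x t) / a j x t) x t"
proof -
  interpret S: slope "F j" "Ft j" by (rule slope_F[OF j])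
  have c: "cont (\<lambda>x t. (f j x t - Bf u j x t) / a j x t)"
    by (intro cont_divide cont_diff f cont_Bf gsolD(1)[OF u] cont_a a_nz j)
  have "u j x t = D j (u j (e j)) (\<lambda>x t. (f j x t - Bf u j x t) / a j x t) x t"
    by (rule S.dsol_unique[OF cont_p[OF j] c e_unit x gsolD(3)[OF u j, unfolded all_couplings[OF j]]])
  also have "\<dots> = D j (\<lambda>t. zeta u j t + \<gamma> j t) (\<lambda>x t. (f j x t - Bf u j x t) / a j x t) x t"
    by (rule D_cong[OF j x refl gsolD(4)[OF u j]])
  finally show ?thesis .
qed

text \<open>Once the time derivative is known to exist, the equation along the characteristics yields the
  other partial derivative.\<close>

lemma gsol_classical:
  assumes u: "u \<in> Cper n" and g: "gsol f (\<lambda>_ _. 0) u" and f: "\<And>j. j \<in> {1..n} \<Longrightarrow> cont (f j)"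
    and w: "\<And>j. j \<in> {1..n} \<Longrightarrow> \<exists>w. t_deriv (u j) w"
  shows "classical_solution n m a b r f u"
proof -
  define w where "w j x t = deriv (u j x) t" for j x t
  have w: "t_deriv (u j) (w j)" if "j \<in> {1..n}" for j
    unfolding w_def[abs_def] using w[OF that] t_deriv_deriv by blast
  define g' where "g' j x t = (f j x t - (\<Sum>k\<in>{1..n}. b j k x t * u k x t)) / a j x t" for j x t
  have cg: "cont (g' j)" if j: "j \<in> {1..n}" for j
    unfolding g'_def[abs_def] by (intro cont_divide cont_diff f cont_sum cont_mult cont_b gsolD(1)[OF g] cont_a a_nz j)
  define ux where "ux j x t = g' j x t - F j x t * w j x t" for j x t
  have ux: "((\<lambda>y. u j y t) has_real_derivative ux j x t) (at x within {0..1})" if j: "j \<in> {1..n}" and x: "x \<in> {0..1}" for j x t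
    unfolding ux_def g'_def
    by (rule slope.x_deriv_of_transport[OF slope_F[OF j] w[OF j] gsolD(3)[OF g j] x])
  have cux: "cont (ux j)" if j: "j \<in> {1..n}" for j
    unfolding ux_def[abs_def]
    by (intro cont_diff cg cont_mult slope.contF[OF slope_F[OF j]] t_derivD(2)[OF w] j)
  have "Ck_strip 1 (u j)" if j: "j \<in> {1..n}" for j
    unfolding One_nat_def Ck_strip.simps
    using cux[OF j] t_derivD[OF w[OF j]] ux[OF j] by blast
  moreover have "deriv (\<lambda>s. u j x s) t + a j x t * deriv (\<lambda>y. u j y t) x + (\<Sum>k=1..n. b j k x t * u k x t) = f j x t"
    if j: "j \<in> {1..n}" and x: "x \<in> {0<..<1}" for j x t
  proof -
    have x': "x \<in> {0..1}" using x by simp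
    have "at x within {0..1} = at x" using x by (intro at_within_interior) simp
    then have "deriv (\<lambda>y. u j y t) x = ux j x t" using ux[OF j x', of t] by (intro DERIV_imp_deriv) simp
    moreover have "a j x t * ux j x t = f j x t - (\<Sum>k=1..n. b j k x t * u k x t) - w j x t"
      using a_nz[OF j x', of t] by (simp add: ux_def g'_def F_def field_simps)
    ultimately show ?thesis by (simp add: w_def)
  qed
  moreover have "u j x (t + 2 * pi) = u j x t" if "j \<in> {1..n}" "x \<in> {0..1}" for j x t
    using CperD(2)[OF u that(1)] that(2) by (simp add: periodic_strip_def)
  moreover have "u j 0 t = (\<Sum>k=m+1..n. r j k t * u k 0 t)" if "j \<in> {1..m}" for j t
    using gsolD(4)[OF g, of j t] that mn by (simp add: e_def zeta_def opp_def)
  moreover have "u j 1 t = (\<Sum>k=1..m. r j k t * u k 1 t)" if "j \<in> {m+1..n}" for j t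
    using gsolD(4)[OF g, of j t] that mn by (simp add: e_def zeta_def opp_def)
  ultimately show ?thesis unfolding classical_solution_def by (intro conjI ballI allI)
qed

end

context hypQ
begin

text \<open>The part of \<open>u\<close> that is not carried over from the boundary is differentiable in time: the
  part coming from \<open>f\<close> and \<open>\<gamma>\<close> by assumption, the coupling terms by smoothing.\<close>

lemma gsol_t_deriv:
  assumes contr1: "\<And>j t. j \<in> Q \<Longrightarrow> (\<Sum>pr\<in>P \<times> Q. \<bar>Aco j pr t * (TTx (fst pr) (sx j t) * TTx j t)\<bar>) \<le> q"
    and u: "gsol f \<gamma> u" and f: "\<And>j. j \<in> {1..n} \<Longrightarrow> t_deriv (f j) (ft j)" "\<And>j. j \<in> {1..n} \<Longrightarrow> periodic_strip (f j)"
    and \<gamma>: "\<And>j. j \<in> {1..n} \<Longrightarrow> C1R (\<gamma> j)" "\<And>j. j \<in> {1..n} \<Longrightarrow> periodic_real (\<gamma> j)" and j: "j \<in> {1..n}"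
  shows "\<exists>w. t_deriv (u j) w"
proof -
  note uc = gsolD(1)[OF u] and up = gsolD(2)[OF u] and fc = t_derivD(1)[OF f(1)]
  define h where "h j x t = (f j x t - Bf u j x t) / a j x t" for j x t
  define G where "G k x t = (f k x t - (\<Sum>l\<in>{1..n}. b k l x t * u l x t)) / a k x t" for k x t
  have cG: "cont (G k)" if k: "k \<in> {1..n}" for k
    unfolding G_def[abs_def] by (intro cont_divide cont_diff fc cont_sum cont_mult cont_b uc cont_a a_nz k)
  have pG: "periodic_strip (G k)" if k: "k \<in> {1..n}" for k
    unfolding G_def[abs_def]
    by (intro periodic_strip_divide periodic_strip_diff f(2) periodic_strip_sum periodic_strip_mult per_b up per_a k)
  have al: "along_characteristics u G"
    unfolding along_characteristics_def
  proof (intro ballI conjI)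
    fix k assume k: "k \<in> {1..n}"
    show "cont (u k)" "periodic_strip (u k)" "cont (G k)" "periodic_strip (G k)"
      by (rule uc[OF k] up[OF k] cG[OF k] pG[OF k])+
    show "transport (F k) (u k) (G k)" unfolding G_def[abs_def] by (rule gsolD(3)[OF u k])
  qed
  define g where "g j = D j (\<gamma> j) (h j)" for j
  have hc: "cont (h j)" if j: "j \<in> {1..n}" for j
    unfolding h_def[abs_def] by (intro cont_divide cont_diff fc cont_Bf uc cont_a a_nz j)
  have hp: "periodic_strip (h j)" if j: "j \<in> {1..n}" for j
    unfolding h_def[abs_def] by (intro periodic_strip_divide periodic_strip_diff f(2) per_Bf up per_a j)
  have gp: "periodic_strip (g j)" if j: "j \<in> {1..n}" for j
    unfolding g_def by (rule per_D[OF j hp[OF j] \<gamma>(2)[OF j]])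
  have gd: "\<exists>w. t_deriv (g j) w" if j: "j \<in> {1..n}" for j
  proof -
    interpret S: slope "F j" "Ft j" by (rule slope_F[OF j])
    obtain pt where pt: "t_deriv (p j) pt" using p_t_deriv[OF j] by blast
    obtain w1 where w1: "t_deriv (D j (\<gamma> j) (\<lambda>x t. f j x t / a j x t)) w1"
      using S.t_deriv_dsol[OF pt t_deriv_divide[OF f(1)[OF j] a_t_deriv[OF j] a_nz[OF j]] C1RD[OF \<gamma>(1)[OF j]] e_unit[of j]] by blast
    obtain w2 where w2: "t_deriv (D j (\<lambda>_. 0) (\<lambda>x t. Bf u j x t / a j x t)) w2"
      using smoothing[OF j] al by blast
    have "D j (\<gamma> j) (\<lambda>x t. f j x t / a j x t) x t - D j (\<lambda>_. 0) (\<lambda>x t. Bf u j x t / a j x t) x t = g j x t"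
      if x: "x \<in> {0..1}" for x t
    proof -
      have c1: "cont (\<lambda>x t. h j x t + Bf u j x t / a j x t)"
        using hc[OF j] by (intro cont_add cont_divide cont_Bf uc cont_a a_nz j)
      have c2: "cont (\<lambda>x t. Bf u j x t / a j x t)" by (intro cont_divide cont_Bf uc cont_a a_nz j)
      have "D j (\<lambda>_. 0) (\<lambda>x t. f j x t / a j x t) x t = D j (\<lambda>_. 0) (\<lambda>x t. h j x t + Bf u j x t / a j x t) x t"
        by (rule D_cong[OF j x]) (simp_all add: h_def diff_divide_distrib)
      also have "\<dots> = D j (\<lambda>_. 0) (h j) x t + D j (\<lambda>_. 0) (\<lambda>x t. Bf u j x t / a j x t) x t"
        by (rule D0_add[OF j x hc[OF j] c2])
      finally show ?thesis
        using D_split[OF j x, of "\<gamma> j" "\<lambda>x t. f j x t / a j x t" t] D_split[OF j x, of "\<gamma> j" "h j" t]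
        by (simp add: g_def)
    qed
    from t_deriv_cong[OF t_deriv_diff[OF w1 w2] this refl] show ?thesis by blast
  qed
  have gd': "t_deriv (g j) (\<lambda>x t. deriv (g j x) t)" if "j \<in> {1..n}" for j
    using gd[OF that] t_deriv_deriv by blast
  have ze: "zeta (rs n u) j s = zeta u j s" for j s
    unfolding zeta_def
  proof (rule sum.cong[OF refl])
    fix k assume "k \<in> opp j"
    then show "r j k s * rs n u k (e j) s = r j k s * u k (e j) s" by (simp only: rs_apply[OF opp(1) e_unit])
  qed
  have "bsolves g (rs n u)"
    unfolding bsolves_def
  proof (intro conjI ballI allI)
    show "rs n u \<in> Cper n" by (rule rs_in_Cper[OF uc up])
    fix j x t assume jx: "j \<in> {1..n}" "x \<in> {0..1::real}"
    have "u j x t = D j (\<lambda>t. zeta u j t + \<gamma> j t) (h j) x t"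
      unfolding h_def[abs_def] by (rule gsol_repr[OF u fc jx])
    also have "\<dots> = kap j x t * zeta u j (sig j x t) + g j x t"
      using D_split[OF jx, of "\<lambda>t. zeta u j t + \<gamma> j t" "h j" t] D_split[OF jx, of "\<gamma> j" "h j" t]
      by (simp add: g_def distrib_left)
    finally show "rs n u j x t = kap j x t * zeta (rs n u) j (sig j x t) + g j x t"
      unfolding ze rs_apply[OF jx] .
  qed
  from boundary_C1[OF gd' gp this contr1 j] obtain w where "t_deriv (rs n u j) w" by blast
  from t_deriv_cong[OF this rs_apply[OF j] refl] show ?thesis by blast
qed

theorem continuous_solution_classical:
  assumes contr1: "\<And>j t. j \<in> Q \<Longrightarrow> (\<Sum>pr\<in>P \<times> Q. \<bar>Aco j pr t * (TTx (fst pr) (sx j t) * TTx j t)\<bar>) \<le> q"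
    and f: "f \<in> Cper n" "\<And>j. j \<in> {1..n} \<Longrightarrow> C1_in_time (f j)" and u: "continuous_solution n m a b r f u"
  shows "classical_solution n m a b r f u"
proof -
  note fc = CperD(1)[OF f(1)]
  have uC: "u \<in> Cper n" using u unfolding continuous_solution_def by (rule conjunct1)
  have g: "gsol f (\<lambda>_ _. 0) u" by (rule continuous_solution_gsol[OF fc u])
  have "\<exists>w. t_deriv (u j) w" if j: "j \<in> {1..n}" for j
  proof (rule gsol_t_deriv[OF contr1 g _ CperD(2)[OF f(1)] C1R_const _ j])
    show "t_deriv (f j) (\<lambda>x t. deriv (f j x) t)" if "j \<in> {1..n}" for j
      by (rule C1_in_time_deriv[OF fc[OF that] f(2)[OF that]])
    show "periodic_real (\<lambda>_. 0)" by (simp add: periodic_real_def)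
  qed
  from gsol_classical[OF uC g fc this] show ?thesis .
qed

end

section \<open>Higher regularity for time-independent speeds\<close>

lemma Ck_strip_cong:
  assumes "Ck_strip k g" "\<And>x t. x \<in> {0..1} \<Longrightarrow> g x t = h x t" shows "Ck_strip k h"
proof (cases k)
  case 0
  then show ?thesis using assms(1) cont_cong[of g h] assms(2) by simp
next
  case (Suc l)
  then obtain gx gt where g: "cont g" "Ck_strip l gx" "Ck_strip l gt" "\<forall>x\<in>{0..1}. \<forall>t.
      ((\<lambda>y. g y t) has_real_derivative gx x t) (at x within {0..1}) \<and>
      ((\<lambda>s. g x s) has_real_derivative gt x t) (at t)"
    using assms(1) unfolding Suc Ck_strip.simps by blast
  have "cont h" using g(1) cont_cong[of g h] assms(2) by simp
  moreover have "((\<lambda>y. h y t) has_real_derivative gx x t) (at x within {0..1})" if x: "x \<in> {0..1}" for x t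
    by (rule has_field_derivative_transform_within[OF g(4)[rule_format, OF x, THEN conjunct1, of t] zero_less_one x assms(2)])
  moreover have "((\<lambda>s. h x s) has_real_derivative gt x t) (at t)" if x: "x \<in> {0..1}" for x t
  proof -
    have "h x = g x" using assms(2)[OF x] by auto
    then show ?thesis using g(4) x by simp
  qed
  ultimately show ?thesis unfolding Suc Ck_strip.simps using g(2,3) by blast
qed

lemma Ck_strip_cont: "Ck_strip k g \<Longrightarrow> cont g"
  by (cases k) auto

lemma Ck_strip_Suc: "Ck_strip (Suc k) g \<Longrightarrow> Ck_strip k g"
proof (induction k arbitrary: g)
  case 0 then show ?case by simp
next
  case (Suc k)
  obtain gx gt where g: "cont g" "Ck_strip (Suc k) gx" "Ck_strip (Suc k) gt" "\<forall>x\<in>{0..1}. \<forall>t.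
      ((\<lambda>y. g y t) has_real_derivative gx x t) (at x within {0..1}) \<and>
      ((\<lambda>s. g x s) has_real_derivative gt x t) (at t)"
    using Suc.prems unfolding Ck_strip.simps(2)[of "Suc k"] by blast
  then show ?case unfolding Ck_strip.simps(2)[of k] using Suc.IH[OF g(2)] Suc.IH[OF g(3)] by blast
qed

lemma Ck_strip_le: "Ck_strip (i + k) g \<Longrightarrow> Ck_strip k g"
proof (induction i)
  case (Suc i)
  then show ?case using Ck_strip_Suc[of "i + k" g] by (simp only: add_Suc)
qed simp

lemma Ck_strip_SucI:
  assumes "t_deriv g gt" "Ck_strip k gt" "Ck_strip k gx"
    "\<And>x t. x \<in> {0..1} \<Longrightarrow> ((\<lambda>y. g y t) has_real_derivative gx x t) (at x within {0..1})"
  shows "Ck_strip (Suc k) g"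
  unfolding Ck_strip.simps using assms t_derivD[OF assms(1)] by blast

lemma Ck_strip_SucE:
  assumes "Ck_strip (Suc k) g"
  obtains gx gt where "t_deriv g gt" "Ck_strip k gt" "Ck_strip k gx"
    "\<And>x t. x \<in> {0..1} \<Longrightarrow> ((\<lambda>y. g y t) has_real_derivative gx x t) (at x within {0..1})"
proof -
  obtain gx gt where g: "cont g" "Ck_strip k gx" "Ck_strip k gt" "\<forall>x\<in>{0..1}. \<forall>t.
      ((\<lambda>y. g y t) has_real_derivative gx x t) (at x within {0..1}) \<and>
      ((\<lambda>s. g x s) has_real_derivative gt x t) (at t)"
    using assms unfolding Ck_strip.simps by blast
  have "t_deriv g gt" using g Ck_strip_cont[OF g(3)] by (intro t_derivI) auto
  then show thesis using that[of gt gx] g by blast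
qed

lemma Ck_strip_const: "Ck_strip k (\<lambda>x t. c)"
proof (induction k arbitrary: c)
  case 0 show ?case using cont_const[of c] by simp
next
  case (Suc k)
  show ?case by (rule Ck_strip_SucI[OF t_deriv_const Suc[of 0] Suc[of 0] DERIV_const])
qed

lemma Ck_strip_add: "Ck_strip k f \<Longrightarrow> Ck_strip k g \<Longrightarrow> Ck_strip k (\<lambda>x t. f x t + g x t)"
proof (induction k arbitrary: f g)
  case 0 then show ?case using cont_add[of f g] by simp
next
  case (Suc k)
  obtain fx ft where f: "t_deriv f ft" "Ck_strip k ft" "Ck_strip k fx"
    "\<And>x t. x \<in> {0..1} \<Longrightarrow> ((\<lambda>y. f y t) has_real_derivative fx x t) (at x within {0..1})"
    using Ck_strip_SucE[OF Suc.prems(1)] by metis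
  obtain gx gt where g: "t_deriv g gt" "Ck_strip k gt" "Ck_strip k gx"
    "\<And>x t. x \<in> {0..1} \<Longrightarrow> ((\<lambda>y. g y t) has_real_derivative gx x t) (at x within {0..1})"
    using Ck_strip_SucE[OF Suc.prems(2)] by metis
  show ?case
    by (rule Ck_strip_SucI[OF t_deriv_add[OF f(1) g(1)] Suc.IH[OF f(2) g(2)] Suc.IH[OF f(3) g(3)] DERIV_add[OF f(4) g(4)]])
qed

lemma Ck_strip_mult: "Ck_strip k f \<Longrightarrow> Ck_strip k g \<Longrightarrow> Ck_strip k (\<lambda>x t. f x t * g x t)"
proof (induction k arbitrary: f g)
  case 0 then show ?case using cont_mult[of f g] by simp
next
  case (Suc k)
  obtain fx ft where f: "t_deriv f ft" "Ck_strip k ft" "Ck_strip k fx"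
    "\<And>x t. x \<in> {0..1} \<Longrightarrow> ((\<lambda>y. f y t) has_real_derivative fx x t) (at x within {0..1})"
    using Ck_strip_SucE[OF Suc.prems(1)] by metis
  obtain gx gt where g: "t_deriv g gt" "Ck_strip k gt" "Ck_strip k gx"
    "\<And>x t. x \<in> {0..1} \<Longrightarrow> ((\<lambda>y. g y t) has_real_derivative gx x t) (at x within {0..1})"
    using Ck_strip_SucE[OF Suc.prems(2)] by metis
  note f0 = Ck_strip_Suc[OF Suc.prems(1)] and g0 = Ck_strip_Suc[OF Suc.prems(2)]
  show ?case
    by (rule Ck_strip_SucI[OF t_deriv_mult[OF f(1) g(1)] Ck_strip_add[OF Suc.IH[OF f(2) g0] Suc.IH[OF g(2) f0]]
      Ck_strip_add[OF Suc.IH[OF f(3) g0] Suc.IH[OF g(3) f0]] DERIV_mult[OF f(4) g(4)]])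
qed

lemma Ck_strip_inverse:
  "Ck_strip k g \<Longrightarrow> (\<And>x t. x \<in> {0..1} \<Longrightarrow> g x t \<noteq> 0) \<Longrightarrow> Ck_strip k (\<lambda>x t. 1 / g x t)"
proof (induction k)
  case 0 then show ?case using cont_divide[OF cont_const[of 1], of g] by simp
next
  case (Suc k)
  note nz = Suc.prems(2)
  obtain gx gt where g: "t_deriv g gt" "Ck_strip k gt" "Ck_strip k gx"
    "\<And>x t. x \<in> {0..1} \<Longrightarrow> ((\<lambda>y. g y t) has_real_derivative gx x t) (at x within {0..1})"
    using Ck_strip_SucE[OF Suc.prems(1)] by metis
  note I = Suc.IH[OF Ck_strip_Suc[OF Suc.prems(1)] nz]
  have q: "Ck_strip k (\<lambda>x t. (0 * g x t - 1 * h x t) / (g x t * g x t))" if h: "Ck_strip k h" for h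
    by (rule Ck_strip_cong[OF Ck_strip_mult[OF Ck_strip_mult[OF Ck_strip_const[of k "-1"] h] Ck_strip_mult[OF I I]]])
      simp_all
  show ?case
    by (rule Ck_strip_SucI[OF t_deriv_divide[OF t_deriv_const[of 1] g(1) nz] q[OF g(2)] q[OF g(3)]])
      (assumption | rule DERIV_divide[OF DERIV_const g(4) nz])+
qed

text \<open>\<open>i\<close> further time derivatives, each of class \<open>C\<^sup>k\<close>.\<close>

fun tC :: "nat \<Rightarrow> nat \<Rightarrow> (real \<Rightarrow> real \<Rightarrow> real) \<Rightarrow> bool" where
  "tC 0 k g = Ck_strip k g"
| "tC (Suc i) k g = (Ck_strip k g \<and> (\<exists>gt. t_deriv g gt \<and> tC i k gt))"

lemma tC_Ck: "tC i k g \<Longrightarrow> Ck_strip k g" by (cases i) auto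

lemma tC_cong: "tC i k g \<Longrightarrow> (\<And>x t. x \<in> {0..1} \<Longrightarrow> g x t = h x t) \<Longrightarrow> tC i k h"
proof (cases i)
  case 0 then show "tC i k g \<Longrightarrow> (\<And>x t. x \<in> {0..1} \<Longrightarrow> g x t = h x t) \<Longrightarrow> ?thesis"
    using Ck_strip_cong[of k g h] by simp
next
  case (Suc l)
  assume "tC i k g" and eq: "\<And>x t. x \<in> {0..1} \<Longrightarrow> g x t = h x t"
  then obtain gt where g: "Ck_strip k g" "t_deriv g gt" "tC l k gt" using Suc by auto
  have "t_deriv h gt" by (rule t_deriv_cong[OF g(2) eq refl])
  then show ?thesis using Ck_strip_cong[OF g(1) eq] g(3) unfolding Suc tC.simps by blast
qed

lemma tC_deriv:
  assumes "tC (Suc i) k g" "t_deriv g h" shows "tC i k h"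
proof -
  obtain gt where g: "t_deriv g gt" "tC i k gt" using assms(1) by auto
  show ?thesis by (rule tC_cong[OF g(2) t_deriv_unique[OF g(1) assms(2)]])
qed

lemma tC_t_deriv:
  assumes "tC (Suc i) k g" obtains gt where "t_deriv g gt" "tC i k gt"
  using assms by auto

lemma tC_Suc: "tC (Suc i) k g \<Longrightarrow> tC i k g"
  by (induction i arbitrary: g) auto

lemma tC_const: "tC i k (\<lambda>x t. c)"
proof (induction i arbitrary: c)
  case (Suc i) show ?case unfolding tC.simps using Ck_strip_const t_deriv_const Suc by blast
qed (simp add: Ck_strip_const)

lemma tC_add: "tC i k f \<Longrightarrow> tC i k g \<Longrightarrow> tC i k (\<lambda>x t. f x t + g x t)"
proof (induction i arbitrary: f g)
  case 0 then show ?case by (simp add: Ck_strip_add)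
next
  case (Suc i)
  obtain ft where "t_deriv f ft" "tC i k ft" by (rule tC_t_deriv[OF Suc.prems(1)])
  moreover obtain gt where "t_deriv g gt" "tC i k gt" by (rule tC_t_deriv[OF Suc.prems(2)])
  ultimately have "t_deriv (\<lambda>x t. f x t + g x t) (\<lambda>x t. ft x t + gt x t) \<and> tC i k (\<lambda>x t. ft x t + gt x t)"
    using t_deriv_add Suc.IH by simp
  then show ?case unfolding tC.simps
    using Ck_strip_add[OF tC_Ck[OF Suc.prems(1)] tC_Ck[OF Suc.prems(2)]] by blast
qed

lemma tC_mult: "tC i k f \<Longrightarrow> tC i k g \<Longrightarrow> tC i k (\<lambda>x t. f x t * g x t)"
proof (induction i arbitrary: f g)
  case 0 then show ?case by (simp add: Ck_strip_mult)
next
  case (Suc i)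
  obtain ft where f: "t_deriv f ft" "tC i k ft" by (rule tC_t_deriv[OF Suc.prems(1)])
  obtain gt where g: "t_deriv g gt" "tC i k gt" by (rule tC_t_deriv[OF Suc.prems(2)])
  have "tC i k (\<lambda>x t. ft x t * g x t + gt x t * f x t)"
    by (rule tC_add[OF Suc.IH[OF f(2) tC_Suc[OF Suc.prems(2)]] Suc.IH[OF g(2) tC_Suc[OF Suc.prems(1)]]])
  then show ?case unfolding tC.simps
    using t_deriv_mult[OF f(1) g(1)] Ck_strip_mult[OF tC_Ck[OF Suc.prems(1)] tC_Ck[OF Suc.prems(2)]] by blast
qed

lemma tC_minus: "tC i k f \<Longrightarrow> tC i k (\<lambda>x t. - f x t)"
  by (rule tC_cong[OF tC_mult[OF tC_const[of i k "-1"]]]) simp_all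

lemma tC_diff: "tC i k f \<Longrightarrow> tC i k g \<Longrightarrow> tC i k (\<lambda>x t. f x t - g x t)"
  using tC_add[OF _ tC_minus, of i k f g] by simp

lemma tC_sum: "(\<And>l. l \<in> K \<Longrightarrow> tC i k (f l)) \<Longrightarrow> tC i k (\<lambda>x t. \<Sum>l\<in>K. f l x t)"
proof (induction K rule: infinite_finite_induct)
  case (insert l K)
  have "tC i k (\<lambda>x t. f l x t + (\<Sum>l\<in>K. f l x t))" by (intro tC_add insert) auto
  then show ?case using insert(1,2) by simp
qed (simp_all add: tC_const)

lemma tC_slice:
  assumes "x0 \<in> {0..1}" shows "tC i 0 g \<Longrightarrow> tC i 0 (\<lambda>x t. g x0 t)"
proof (induction i arbitrary: g)
  case 0
  then have "cont g" by simp
  from cont_of_time[OF cont_time[OF this assms]] show ?case by simp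
next
  case (Suc i)
  obtain gt where d: "t_deriv g gt" "tC i 0 gt" using Suc.prems by auto
  have c: "cont (\<lambda>x t. g x0 t)" by (rule cont_of_time[OF cont_time[OF t_derivD(1)[OF d(1)] assms]])
  have "t_deriv (\<lambda>x t. g x0 t) (\<lambda>x t. gt x0 t)"
    by (intro t_derivI c cont_of_time[OF cont_time[OF t_derivD(2)[OF d(1)] assms]] t_derivD(3)[OF d(1) assms])
  then show ?case using c Suc.IH[OF d(2)] unfolding tC.simps Ck_strip.simps by blast
qed

lemma smooth_strip_tC:
  assumes "smooth_strip g" shows "tC i k g"
proof -
  have "Ck_strip (i + k) g \<Longrightarrow> tC i k g" for g
  proof (induction i arbitrary: g)
    case (Suc i)
    have "Ck_strip (Suc (i + k)) g" using Suc.prems by (simp only: add_Suc)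
    then obtain gx gt where g: "t_deriv g gt" "Ck_strip (i + k) gt" by (rule Ck_strip_SucE)
    show ?case using Ck_strip_le[OF Suc.prems] g(1) Suc.IH[OF g(2)] unfolding tC.simps by blast
  qed simp
  then show ?thesis using assms by (simp add: smooth_strip_def)
qed

lemma smooth_real_tC: "smooth_real h \<Longrightarrow> tC i 0 (\<lambda>x t. h t)"
proof (induction i arbitrary: h)
  have C1: "C1R h" if h: "smooth_real h" for h
  proof -
    have "h differentiable at t" "deriv h differentiable at t" for t
      using h[unfolded smooth_real_def, THEN spec, of 0] h[unfolded smooth_real_def, THEN spec, of 1] by simp_all
    then have "(h has_real_derivative deriv h t) (at t)" "isCont (deriv h) t" for t
      using DERIV_deriv_iff_real_differentiable differentiable_imp_continuous_within by blast+
    then show ?thesis unfolding C1R_def by (simp add: continuous_at_imp_continuous_on)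
  qed
  {
    case 0
    from cont_of_time[OF C1R_continuous[OF C1[OF 0]]] show ?case by simp
  next
    case (Suc i)
    have "smooth_real (deriv h)"
      unfolding smooth_real_def
    proof (intro allI)
      fix k t
      show "(deriv ^^ k) (deriv h) differentiable at t"
        using Suc.prems[unfolded smooth_real_def, THEN spec, of "Suc k"] by (simp add: funpow_swap1)
    qed
    then show ?case
      using Suc.IH[of "deriv h"] t_deriv_C1R[OF C1[OF Suc.prems]] cont_of_time[OF C1R_continuous[OF C1[OF Suc.prems]]]
      unfolding tC.simps Ck_strip.simps by blast
  }
qed

text \<open>For a slope that does not depend on time, the characteristics are translates of each other, so
  the equation along them can be differentiated with respect to the translation.\<close>

lemma (in slope) transport_t_deriv:
  assumes F0: "\<And>x t s. x \<in> {0..1} \<Longrightarrow> F x t = F x s"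
    and v: "t_deriv v w" and g: "t_deriv g gt" and tr: "transport F v g"
  shows "transport F w gt"
proof (rule transportI)
  fix \<phi> \<xi> assume \<phi>: "curve F \<phi>" and \<xi>: "\<xi> \<in> {0..1::real}"
  have 0: "(0::real) \<in> {0..1}" by simp
  note c\<phi> = curve_continuous[OF \<phi>]
  have curve: "curve F (\<lambda>\<eta>. \<phi> \<eta> + s)" for s
    unfolding curve_def
  proof
    fix \<eta> :: real assume \<eta>: "\<eta> \<in> {0..1}"
    have "((\<lambda>\<eta>. \<phi> \<eta> + s) has_real_derivative F \<eta> (\<phi> \<eta>) + 0) (at \<eta> within {0..1})"
      by (rule DERIV_add[OF curveD[OF \<phi> \<eta>] DERIV_const])
    then show "((\<lambda>\<eta>. \<phi> \<eta> + s) has_real_derivative F \<eta> (\<phi> \<eta> + s)) (at \<eta> within {0..1})"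
      using F0[OF \<eta>, of "\<phi> \<eta>" "\<phi> \<eta> + s"] by simp
  qed
  have gt_along: "continuous_on {0..1} (\<lambda>\<eta>. gt \<eta> (\<phi> \<eta>))"
    by (rule cont_comp[OF t_derivD(2)[OF g] continuous_on_id c\<phi>]) simp
  have eq: "w \<zeta> (\<phi> \<zeta>) - w 0 (\<phi> 0) = ig (\<lambda>\<eta>. gt \<eta> (\<phi> \<eta>)) 0 \<zeta>" if \<zeta>: "\<zeta> \<in> {0..1}" for \<zeta>
  proof -
    have int: "ig (\<lambda>\<eta>. g \<eta> (\<phi> \<eta> + s)) 0 \<zeta> = v \<zeta> (\<phi> \<zeta> + s) - v 0 (\<phi> 0 + s)" for s
      by (rule ig_FTC[of "{0..1}" 0 \<zeta> "\<lambda>\<eta>. v \<eta> (\<phi> \<eta> + s)"]) (use \<zeta> transportD[OF tr curve[of s]] in auto)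
    have shift: "((\<lambda>s. h \<eta> (\<phi> \<eta> + s)) has_real_derivative h' \<eta> (\<phi> \<eta> + s)) (at s)"
      if "t_deriv h h'" "\<eta> \<in> {0..1}" for h h' \<eta> s
      using DERIV_chain2[OF t_derivD(3)[OF that] DERIV_add[OF DERIV_const DERIV_ident]] by simp
    have "((\<lambda>s. ig (\<lambda>\<eta>. g \<eta> (\<phi> \<eta> + s)) 0 \<zeta>) has_real_derivative ig (\<lambda>\<eta>. gt \<eta> (\<phi> \<eta> + 0)) 0 \<zeta>) (at 0 within UNIV)"
    proof (rule ig_leibniz[of UNIV "\<lambda>s \<eta>. g \<eta> (\<phi> \<eta> + s)" "\<lambda>s \<eta>. gt \<eta> (\<phi> \<eta> + s)"])
      show "((\<lambda>s. g \<eta> (\<phi> \<eta> + s)) has_real_derivative gt \<eta> (\<phi> \<eta> + s)) (at s within UNIV)" if "\<eta> \<in> {0..1}" for s \<eta>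
        by (rule shift[OF g that])
      show "continuous_on {0..1} (\<lambda>\<eta>. g \<eta> (\<phi> \<eta> + s))" for s
        by (rule cont_comp[OF t_derivD(1)[OF g] continuous_on_id]) (auto intro!: continuous_intros c\<phi>)
      have "continuous_on (UNIV \<times> {0..1}) (\<lambda>p. gt (snd p) (\<phi> (snd p) + fst p))"
      proof (rule cont_comp[OF t_derivD(2)[OF g]])
        show "continuous_on (UNIV \<times> {0..1}) (\<lambda>p. \<phi> (snd p) + fst p)"
          by (intro continuous_on_add continuous_on_compose2[OF c\<phi>] continuous_on_fst continuous_on_snd continuous_on_id) auto
      qed (auto intro!: continuous_intros)
      then show "continuous_on (UNIV \<times> {0..1}) (\<lambda>(s, \<eta>). gt \<eta> (\<phi> \<eta> + s))" by (simp add: case_prod_unfold)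
    qed (use \<zeta> in auto)
    moreover have "((\<lambda>s. v \<zeta> (\<phi> \<zeta> + s) - v 0 (\<phi> 0 + s)) has_real_derivative w \<zeta> (\<phi> \<zeta> + 0) - w 0 (\<phi> 0 + 0)) (at 0)"
      by (rule DERIV_diff[OF shift[OF v \<zeta>] shift[OF v 0]])
    ultimately show ?thesis unfolding int using DERIV_unique[of _ _ 0] by fastforce
  qed
  have "((\<lambda>\<zeta>. w 0 (\<phi> 0) + ig (\<lambda>\<eta>. gt \<eta> (\<phi> \<eta>)) 0 \<zeta>) has_real_derivative 0 + gt \<xi> (\<phi> \<xi>)) (at \<xi> within {0..1})"
    by (rule DERIV_add[OF DERIV_const ig_deriv[OF gt_along 0 \<xi>]])
  then have "((\<lambda>\<zeta>. w 0 (\<phi> 0) + ig (\<lambda>\<eta>. gt \<eta> (\<phi> \<eta>)) 0 \<zeta>) has_real_derivative gt \<xi> (\<phi> \<xi>)) (at \<xi> within {0..1})" by simp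
  from has_field_derivative_transform_within[OF this zero_less_one \<xi>]
  show "((\<lambda>\<xi>. w \<xi> (\<phi> \<xi>)) has_real_derivative gt \<xi> (\<phi> \<xi>)) (at \<xi> within {0..1})"
    by (simp add: eq[symmetric])
qed

text \<open>The partial derivative \<open>\<partial>\<^sub>x v = g - F \<partial>\<^sub>t v\<close> is as regular as the time derivatives; the
  same applies to \<open>\<partial>\<^sub>t v\<close> in place of \<open>v\<close>.\<close>

lemma (in slope) transport_gain:
  assumes F0: "\<And>x t s. x \<in> {0..1} \<Longrightarrow> F x t = F x s" and Fk: "Ck_strip k F"
  shows "transport F v g \<Longrightarrow> (\<And>i. tC i k v) \<Longrightarrow> (\<And>i. tC i k g) \<Longrightarrow> tC i (Suc k) v"
proof (induction i arbitrary: v g)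
  have Suc0: "Ck_strip (Suc k) v" if tr: "transport F v g" and v: "\<And>i. tC i k v" and g: "\<And>i. tC i k g" for v g
  proof -
    obtain w where w: "t_deriv v w" "tC 0 k w" using tC_t_deriv[OF v[of "Suc 0"]] by blast
    have wk: "Ck_strip k w" using w(2) by simp
    have "Ck_strip k (\<lambda>x t. g x t + (-1) * (F x t * w x t))"
      by (intro Ck_strip_add tC_Ck[OF g] Ck_strip_mult Ck_strip_const Fk wk)
    then have "Ck_strip k (\<lambda>x t. g x t - F x t * w x t)" by simp
    from Ck_strip_SucI[OF w(1) wk this x_deriv_of_transport[OF w(1) tr]] show ?thesis .
  qed
  {
    case 0
    show ?case using Suc0[OF 0] by simp
  next
    case (Suc i)
    obtain w where w: "t_deriv v w" using tC_t_deriv[OF Suc.prems(2)[of "Suc 0"]] by blast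
    obtain gt where gt: "t_deriv g gt" using tC_t_deriv[OF Suc.prems(3)[of "Suc 0"]] by blast
    have "tC i (Suc k) w"
      by (rule Suc.IH[OF transport_t_deriv[OF F0 w gt Suc.prems(1)] tC_deriv[OF Suc.prems(2) w] tC_deriv[OF Suc.prems(3) gt]])
    with w Suc0[OF Suc.prems] show ?case unfolding tC.simps by blast
  }
qed

context hyp
begin

text \<open>Differentiating in time the coupling coefficients and the boundary coefficients produces
  terms without derivatives of \<open>u\<close>, which go into the right-hand sides.\<close>

lemma gsol_step:
  assumes aind: "\<And>j x t s. j \<in> {1..n} \<Longrightarrow> x \<in> {0..1} \<Longrightarrow> a j x t = a j x s"
    and u: "gsol f \<gamma> u" and f: "\<And>j. j \<in> {1..n} \<Longrightarrow> t_deriv (f j) (ft j)"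
    and \<gamma>: "\<And>j. j \<in> {1..n} \<Longrightarrow> C1R (\<gamma> j)" and w: "\<And>j. j \<in> {1..n} \<Longrightarrow> t_deriv (u j) (w j)"
  shows "gsol (\<lambda>j x t. ft j x t - (\<Sum>k\<in>{1..n}. deriv (b j k x) t * u k x t))
    (\<lambda>j t. deriv (\<gamma> j) t + (\<Sum>k\<in>opp j. deriv (r j k) t * u k (e j) t)) w"
  unfolding gsol_def
proof (intro ballI conjI allI)
  fix j assume j: "j \<in> {1..n}"
  interpret S: slope "F j" "Ft j" by (rule slope_F[OF j])
  show "cont (w j)" by (rule t_derivD(2)[OF w[OF j]])
  show "periodic_strip (w j)" by (rule periodic_t_deriv[OF gsolD(2)[OF u j] w[OF j]])
  have F0: "F j x t = F j x s" if "x \<in> {0..1}" for x t s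
    unfolding F_def using aind[OF j that, of t s] by simp
  have a0: "t_deriv (a j) (\<lambda>_ _. 0)"
  proof (rule t_derivI[OF cont_a[OF j] cont_const])
    show "((\<lambda>s. a j x s) has_real_derivative 0) (at t)" if "x \<in> {0..1}" for x t
      using aind[OF j that, of _ 0] DERIV_const[of "a j x 0"] by (metis (no_types, lifting) ext)
  qed
  have N: "t_deriv (\<lambda>x t. f j x t - (\<Sum>k\<in>{1..n}. b j k x t * u k x t))
    (\<lambda>x t. ft j x t - (\<Sum>k\<in>{1..n}. deriv (b j k x) t * u k x t + w k x t * b j k x t))"
    by (intro t_deriv_diff f[OF j] t_deriv_sum t_deriv_mult b_t_deriv[OF j] w)
  have G: "t_deriv (\<lambda>x t. (f j x t - (\<Sum>k\<in>{1..n}. b j k x t * u k x t)) / a j x t)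
    (\<lambda>x t. (ft j x t - (\<Sum>k\<in>{1..n}. deriv (b j k x) t * u k x t) - (\<Sum>k\<in>{1..n}. b j k x t * w k x t)) / a j x t)"
  proof (rule t_deriv_cong[OF t_deriv_divide[OF N a0 a_nz[OF j]] refl])
    fix x t :: real assume x: "x \<in> {0..1}"
    have "(\<Sum>k\<in>{1..n}. deriv (b j k x) t * u k x t + w k x t * b j k x t)
      = (\<Sum>k\<in>{1..n}. deriv (b j k x) t * u k x t) + (\<Sum>k\<in>{1..n}. b j k x t * w k x t)"
      by (simp only: sum.distrib mult.commute)
    then show "((ft j x t - (\<Sum>k\<in>{1..n}. deriv (b j k x) t * u k x t + w k x t * b j k x t)) * a j x t
        - (f j x t - (\<Sum>k\<in>{1..n}. b j k x t * u k x t)) * 0) / (a j x t * a j x t)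
      = (ft j x t - (\<Sum>k\<in>{1..n}. deriv (b j k x) t * u k x t) - (\<Sum>k\<in>{1..n}. b j k x t * w k x t)) / a j x t"
      using a_nz[OF j x, of t] by (simp add: diff_diff_eq)
  qed
  show "transport (F j) (w j) (\<lambda>x t. (ft j x t - (\<Sum>k\<in>{1..n}. deriv (b j k x) t * u k x t)
      - (\<Sum>k\<in>{1..n}. b j k x t * w k x t)) / a j x t)"
    by (rule S.transport_t_deriv[OF F0 w[OF j] G gsolD(3)[OF u j]])
  fix t
  have eq: "u j (e j) = (\<lambda>t. zeta u j t + \<gamma> j t)" by (rule ext, rule gsolD(4)[OF u j])
  have "((\<lambda>t. zeta u j t + \<gamma> j t) has_real_derivative
      (\<Sum>k\<in>opp j. deriv (r j k) t * u k (e j) t + w k (e j) t * r j k t) + deriv (\<gamma> j) t) (at t)"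
    unfolding zeta_def
    by (intro DERIV_add DERIV_sum DERIV_mult C1RD(1)[OF r_C1(1)[OF j]] t_derivD(3)[OF w[OF opp(1)] e_unit] C1RD(1)[OF \<gamma>[OF j]])
  then have "w j (e j) t = (\<Sum>k\<in>opp j. deriv (r j k) t * u k (e j) t + w k (e j) t * r j k t) + deriv (\<gamma> j) t"
    unfolding eq[symmetric] by (rule DERIV_unique[OF t_derivD(3)[OF w[OF j] e_unit]])
  then show "w j (e j) t = zeta w j t + (deriv (\<gamma> j) t + (\<Sum>k\<in>opp j. deriv (r j k) t * u k (e j) t))"
    by (simp add: zeta_def sum.distrib mult.commute)
qed

lemma gsol_gain:
  assumes aind: "\<And>j x t s. j \<in> {1..n} \<Longrightarrow> x \<in> {0..1} \<Longrightarrow> a j x t = a j x s"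
    and sm: "\<And>j. j \<in> {1..n} \<Longrightarrow> smooth_strip (a j)" "\<And>j k. j \<in> {1..n} \<Longrightarrow> k \<in> {1..n} \<Longrightarrow> smooth_strip (b j k)"
      "\<And>j. j \<in> {1..n} \<Longrightarrow> smooth_strip (f j)"
    and u: "gsol f \<gamma> u" and base: "\<And>j i. j \<in> {1..n} \<Longrightarrow> tC i 0 (u j)" and j: "j \<in> {1..n}"
  shows "tC i k (u j)"
  using j
proof (induction k arbitrary: i j)
  case 0 then show ?case by (rule base)
next
  case (Suc k)
  note j = Suc.prems
  interpret S: slope "F j" "Ft j" by (rule slope_F[OF j])
  have F0: "F j x t = F j x s" if "x \<in> {0..1}" for x t s
    unfolding F_def using aind[OF j that, of t s] by simp
  have Fk: "Ck_strip k' (F j)" for k'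
    unfolding F_def[abs_def]
    by (rule Ck_strip_inverse[OF tC_Ck[OF smooth_strip_tC[where i = 0, OF sm(1)[OF j]]] a_nz[OF j]])
  have tF: "tC i k (F j)" for i
    by (rule smooth_strip_tC) (use Fk in \<open>simp add: smooth_strip_def\<close>)
  have "tC i k (\<lambda>x t. (f j x t - (\<Sum>k\<in>{1..n}. b j k x t * u k x t)) * F j x t)" for i
    by (intro tC_mult tC_diff tC_sum tF smooth_strip_tC[OF sm(3)[OF j]] smooth_strip_tC[OF sm(2)[OF j]] Suc.IH)
  then have "tC i k (\<lambda>x t. (f j x t - (\<Sum>k\<in>{1..n}. b j k x t * u k x t)) / a j x t)" for i by (simp add: F_def)
  then show ?case by (intro S.transport_gain[OF F0 Fk gsolD(3)[OF u j] Suc.IH[OF j]])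
qed

end

context hypQ
begin

text \<open>For \<open>\<partial>\<^sub>t F = 0\<close> the factors \<open>TTx\<close> are \<open>1\<close>, so that the contraction condition is its own
  differentiated version and can be used at each order.\<close>

lemma gsol_time_regularity:
  assumes aind: "\<And>j x t s. j \<in> {1..n} \<Longrightarrow> x \<in> {0..1} \<Longrightarrow> a j x t = a j x s"
    and b: "\<And>i j k. j \<in> {1..n} \<Longrightarrow> k \<in> {1..n} \<Longrightarrow> tC i 0 (b j k)"
    and r: "\<And>i j k. j \<in> {1..n} \<Longrightarrow> k \<in> opp j \<Longrightarrow> tC i 0 (\<lambda>x t. r j k t)"
  shows "gsol f \<gamma> u \<Longrightarrow> (\<And>j. j \<in> {1..n} \<Longrightarrow> tC N 0 (f j) \<and> periodic_strip (f j)) \<Longrightarrow>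
    (\<And>j. j \<in> {1..n} \<Longrightarrow> tC N 0 (\<lambda>x t. \<gamma> j t) \<and> periodic_real (\<gamma> j)) \<Longrightarrow> j \<in> {1..n} \<Longrightarrow> tC N 0 (u j)"
proof (induction N arbitrary: f \<gamma> u j)
  case 0
  then show ?case using gsolD(1)[OF 0(1)] by simp
next
  case (Suc N)
  note u = Suc.prems(1) and j = Suc.prems(4)
  have f: "tC (Suc N) 0 (f j)" "periodic_strip (f j)" if "j \<in> {1..n}" for j using Suc.prems(2)[OF that] by blast+
  have \<gamma>: "tC (Suc N) 0 (\<lambda>x t. \<gamma> j t)" "periodic_real (\<gamma> j)" if "j \<in> {1..n}" for j using Suc.prems(3)[OF that] by blast+
  have td: "t_deriv g (\<lambda>x t. deriv (g x) t)" if "tC (Suc N) 0 g" for g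
    by (rule tC_t_deriv[OF that]) (rule t_deriv_deriv)
  have C1: "C1R h" if h: "tC (Suc N) 0 (\<lambda>x t. h t)" for h
    by (rule C1R_t_deriv[OF td[OF h], of 0]) simp
  have fd: "t_deriv (f j) (\<lambda>x t. deriv (f j x) t)" if "j \<in> {1..n}" for j by (rule td[OF f(1)[OF that]])
  have \<gamma>d: "C1R (\<gamma> j)" if "j \<in> {1..n}" for j by (rule C1[OF \<gamma>(1)[OF that]])
  have contr1: "(\<Sum>pr\<in>P \<times> Q. \<bar>Aco j pr t * (TTx (fst pr) (sx j t) * TTx j t)\<bar>) \<le> q" if jQ: "j \<in> Q" for j t
  proof -
    have T1: "TTx k s = 1" if k: "k \<in> {1..n}" for k s
    proof -
      have "deriv (a k x) t = 0" if x: "x \<in> {0..1}" for x t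
      proof -
        have "a k x = (\<lambda>_. a k x 0)" by (rule ext, rule aind[OF k x])
        then show ?thesis by (metis deriv_const)
      qed
      then have "ig (\<lambda>\<eta>. Ft k \<eta> (flow (F k) \<eta> (xo k) s)) (xo k) (e k) = ig (\<lambda>\<eta>. 0 * 0) (xo k) (e k)"
        by (intro ig_cong xo_unit e_unit) (simp add: Ft_def)
      also have "\<dots> = 0" by (simp only: ig_cmult)
      finally show ?thesis unfolding TTx_def slope.TT_def[OF slope_F[OF k]] by simp
    qed
    have jn: "j \<in> {1..n}" using jQ Qn by blast
    have "\<bar>Aco j pr t * (TTx (fst pr) (sx j t) * TTx j t)\<bar> = \<bar>Aco j pr t\<bar>" if "pr \<in> P \<times> Q" for pr
    proof -
      have "fst pr \<in> {1..n}" using that by auto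
      then show ?thesis by (simp only: T1 jn mult_1_right)
    qed
    then have "(\<Sum>pr\<in>P \<times> Q. \<bar>Aco j pr t * (TTx (fst pr) (sx j t) * TTx j t)\<bar>) = (\<Sum>pr\<in>P \<times> Q. \<bar>Aco j pr t\<bar>)"
      by (rule sum.cong[OF refl])
    then show ?thesis using contr[OF jQ, of t] unfolding Aco_def by (simp only:)
  qed
  define w where "w j x t = deriv (u j x) t" for j x t
  have w: "t_deriv (u j) (w j)" if "j \<in> {1..n}" for j
    unfolding w_def[abs_def] using gsol_t_deriv[OF contr1 u fd f(2) \<gamma>d \<gamma>(2) that] t_deriv_deriv by blast
  have uN: "tC N 0 (u j)" if "j \<in> {1..n}" for j
    by (rule Suc.IH[OF u _ _ that]) (use f \<gamma> tC_Suc in blast)+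
  have bN: "tC N 0 (\<lambda>x t. deriv (b j k x) t)" if "j \<in> {1..n}" "k \<in> {1..n}" for j k
    by (rule tC_deriv[OF b[OF that] b_t_deriv[OF that]])
  have rN: "tC N 0 (\<lambda>x t. deriv (r j k) t)" if "j \<in> {1..n}" "k \<in> opp j" for j k
    by (rule tC_deriv[OF r[OF that] t_deriv_C1R[OF r_C1(1)[OF that]]])
  have step: "gsol (\<lambda>j x t. deriv (f j x) t - (\<Sum>k\<in>{1..n}. deriv (b j k x) t * u k x t))
    (\<lambda>j t. deriv (\<gamma> j) t + (\<Sum>k\<in>opp j. deriv (r j k) t * u k (e j) t)) w"
    by (rule gsol_step[OF aind u fd \<gamma>d w])
  have f1: "tC N 0 (\<lambda>x t. deriv (f j x) t - (\<Sum>k\<in>{1..n}. deriv (b j k x) t * u k x t)) \<and>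
      periodic_strip (\<lambda>x t. deriv (f j x) t - (\<Sum>k\<in>{1..n}. deriv (b j k x) t * u k x t))"
    if j: "j \<in> {1..n}" for j
  proof
    show "tC N 0 (\<lambda>x t. deriv (f j x) t - (\<Sum>k\<in>{1..n}. deriv (b j k x) t * u k x t))"
      by (intro tC_diff tC_deriv[OF f(1)[OF j] fd[OF j]] tC_sum tC_mult bN[OF j] uN)
    show "periodic_strip (\<lambda>x t. deriv (f j x) t - (\<Sum>k\<in>{1..n}. deriv (b j k x) t * u k x t))"
      by (intro periodic_strip_diff periodic_strip_sum periodic_strip_mult periodic_t_deriv[OF f(2)[OF j] fd[OF j]]
        periodic_t_deriv[OF per_b[OF j] b_t_deriv[OF j]] gsolD(2)[OF u])
  qed
  have \<gamma>1: "tC N 0 (\<lambda>x t. deriv (\<gamma> j) t + (\<Sum>k\<in>opp j. deriv (r j k) t * u k (e j) t)) \<and>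
      periodic_real (\<lambda>t. deriv (\<gamma> j) t + (\<Sum>k\<in>opp j. deriv (r j k) t * u k (e j) t))"
    if j: "j \<in> {1..n}" for j
  proof
    show "tC N 0 (\<lambda>x t. deriv (\<gamma> j) t + (\<Sum>k\<in>opp j. deriv (r j k) t * u k (e j) t))"
      by (intro tC_add tC_deriv[OF \<gamma>(1)[OF j] t_deriv_C1R[OF \<gamma>d[OF j]]] tC_sum tC_mult rN[OF j] tC_slice[OF e_unit] uN opp(1))
    show "periodic_real (\<lambda>t. deriv (\<gamma> j) t + (\<Sum>k\<in>opp j. deriv (r j k) t * u k (e j) t))"
    proof -
      have "deriv (\<gamma> j) (t + 2 * pi) = deriv (\<gamma> j) t" for t
        using periodic_real_deriv[OF \<gamma>d[OF j] \<gamma>(2)[OF j]] by (simp add: periodic_real_def)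
      moreover have "deriv (r j k) (t + 2 * pi) * u k (e j) (t + 2 * pi) = deriv (r j k) t * u k (e j) t" if k: "k \<in> opp j" for k t
        using periodic_real_deriv[OF r_C1[OF j k]] gsolD(2)[OF u opp(1)[OF k]] e_unit[of j]
        by (simp add: periodic_real_def periodic_strip_def)
      ultimately show ?thesis by (simp add: periodic_real_def)
    qed
  qed
  have "tC N 0 (w j)" by (rule Suc.IH[OF step f1 \<gamma>1 j])
  then show ?case unfolding tC.simps Ck_strip.simps using gsolD(1)[OF u j] w[OF j] by blast
qed

theorem continuous_solution_smooth:
  assumes aind: "\<And>j x t s. j \<in> {1..n} \<Longrightarrow> x \<in> {0..1} \<Longrightarrow> a j x t = a j x s"
    and sm: "\<And>j. j \<in> {1..n} \<Longrightarrow> smooth_strip (a j)" "\<And>j k. j \<in> {1..n} \<Longrightarrow> k \<in> {1..n} \<Longrightarrow> smooth_strip (b j k)"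
      "\<And>j. j \<in> {1..n} \<Longrightarrow> smooth_strip (f j)"
    and r: "\<And>j k. j \<in> {1..n} \<Longrightarrow> k \<in> opp j \<Longrightarrow> smooth_real (r j k)"
    and f: "f \<in> Cper n" and u: "continuous_solution n m a b r f u" and j: "j \<in> {1..n}"
  shows "smooth_strip (u j)"
proof -
  have g: "gsol f (\<lambda>_ _. 0) u" by (rule continuous_solution_gsol[OF CperD(1)[OF f] u])
  have "tC i 0 (u j)" if j: "j \<in> {1..n}" for i j
  proof (rule gsol_time_regularity[OF aind smooth_strip_tC[OF sm(2)] smooth_real_tC[OF r] g _ _ j])
    show "tC i 0 (f j) \<and> periodic_strip (f j)" if "j \<in> {1..n}" for j
      using smooth_strip_tC[OF sm(3)[OF that]] CperD(2)[OF f that] by blast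
    show "tC i 0 (\<lambda>x t. 0) \<and> periodic_real (\<lambda>_. 0)" by (simp add: tC_const periodic_real_def)
  qed
  from gsol_gain[OF aind sm g this j, of 0] show ?thesis by (simp add: smooth_strip_def)
qed

end

section \<open>Solvability and regularity\<close>

theorem theorem1p2:
  fixes n m :: nat
    and a :: "nat \<Rightarrow> real \<Rightarrow> real \<Rightarrow> real"
    and b :: "nat \<Rightarrow> nat \<Rightarrow> real \<Rightarrow> real \<Rightarrow> real"
    and r :: "nat \<Rightarrow> nat \<Rightarrow> real \<Rightarrow> real"
  assumes "m \<le> n"
    and "\<forall>j\<in>{1..n}. Ck_strip 1 (a j) \<and> periodic_strip (a j)"
    and "\<forall>j\<in>{1..n}. \<forall>k\<in>{1..n}. Ck_strip 1 (b j k) \<and> periodic_strip (b j k)"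
    and "\<forall>(j, k) \<in> {1..m} \<times> {m+1..n} \<union> {m+1..n} \<times> {1..m}.
           r j k C1_differentiable_on UNIV \<and> periodic_real (r j k)"
    and "\<forall>j\<in>{1..n}. \<forall>x\<in>{0..1}. \<forall>t. a j x t \<noteq> 0"
    and "\<forall>j\<in>{1..n}. \<forall>k\<in>{1..n}. j \<noteq> k \<longrightarrow>
           (\<exists>b'. Ck_strip 1 b' \<and> (\<forall>x\<in>{0..1}. \<forall>t. b j k x t = b' x t * (a k x t - a j x t)))"
    and "R0 n m a b r < 1 \<or> S0 n m a b r < 1"
  shows
    "finite_dim (homogeneous_solutions n m a b r) \<and>
     closedin (Cper_top n) (solvable_rhs n m a b r) \<and>
     has_codim (solvable_rhs n m a b r) (Cper n)
       (dim (homogeneous_solutions n m a b r)) \<and>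
     (dim (homogeneous_solutions n m a b r) > 0) \<noteq> (\<forall>f\<in>Cper n. \<exists>!u. continuous_solution n m a b r f u) \<and>
     ((\<forall>f\<in>Cper n. \<exists>!u. continuous_solution n m a b r f u) \<longrightarrow>
        continuous_map (Cper_top n) (Cper_top n) (\<lambda>f. THE u. continuous_solution n m a b r f u)) \<and>
     (max (R0 n m a b r) (R1 n m a b r) < 1 \<or> max (S0 n m a b r) (S1 n m a b r) < 1 \<longrightarrow>
        (\<forall>f\<in>Cper n. (\<forall>j\<in>{1..n}. C1_in_time (f j)) \<longrightarrow>
          (\<forall>u. continuous_solution n m a b r f u \<longrightarrow> classical_solution n m a b r f u))) \<and>
     ((\<forall>j\<in>{1..n}. \<forall>x\<in>{0..1}. \<forall>t s. a j x t = a j x s) \<and>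
      (\<forall>j\<in>{1..n}. smooth_strip (a j)) \<and>
      (\<forall>j\<in>{1..n}. \<forall>k\<in>{1..n}. smooth_strip (b j k)) \<and>
      (\<forall>(j, k) \<in> {1..m} \<times> {m+1..n} \<union> {m+1..n} \<times> {1..m}. smooth_real (r j k)) \<longrightarrow>
        (\<forall>f\<in>Cper n. (\<forall>j\<in>{1..n}. smooth_strip (f j)) \<longrightarrow>
          (\<forall>u. continuous_solution n m a b r f u \<longrightarrow> (\<forall>j\<in>{1..n}. smooth_strip (u j)))))"
proof -
  have H: "hyp n m a b r" by (rule hyp.intro[OF assms(1-6)])
  interpret H: hyp n m a b r by (rule H)
  \<comment> \<open>The value of the constant itself is the contraction factor.\<close>
  have data: "\<exists>Q q. hypQ n m a b r Q q"
    using assms(7)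
  proof
    assume "R0 n m a b r < 1"
    then show ?thesis using H.hypQ_of_constants[of "{m+1..n}" "R0 n m a b r"] by blast
  next
    assume "S0 n m a b r < 1"
    then show ?thesis using H.hypQ_of_constants[of "{1..m}" "S0 n m a b r"] by blast
  qed
  then obtain Q q where hQ: "hypQ n m a b r Q q" by blast
  note Fr = hypQ.fredholm[OF hQ]
  have iv: "classical_solution n m a b r f u"
    if mx: "max (R0 n m a b r) (R1 n m a b r) < 1 \<or> max (S0 n m a b r) (S1 n m a b r) < 1"
      and f: "f \<in> Cper n" "\<forall>j\<in>{1..n}. C1_in_time (f j)" and u: "continuous_solution n m a b r f u" for f u
    using mx
  proof
    assume q: "max (R0 n m a b r) (R1 n m a b r) < 1"
    let ?Q = "{m+1..n}" and ?q = "max (R0 n m a b r) (R1 n m a b r)"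
    have hQ: "hypQ n m a b r ?Q ?q" by (rule H.hypQ_of_constants) (use q in auto)
    show ?thesis
      by (rule hypQ.continuous_solution_classical[OF hQ hypQ.contr1_of_constants[OF hQ] f(1) bspec[OF f(2)] u]) auto
  next
    assume q: "max (S0 n m a b r) (S1 n m a b r) < 1"
    let ?Q = "{1..m}" and ?q = "max (S0 n m a b r) (S1 n m a b r)"
    have hQ: "hypQ n m a b r ?Q ?q" by (rule H.hypQ_of_constants) (use q in auto)
    show ?thesis
      by (rule hypQ.continuous_solution_classical[OF hQ hypQ.contr1_of_constants[OF hQ] f(1) bspec[OF f(2)] u]) auto
  qed
  have v: "smooth_strip (u j)"
    if c: "(\<forall>j\<in>{1..n}. \<forall>x\<in>{0..1}. \<forall>t s. a j x t = a j x s) \<and>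
      (\<forall>j\<in>{1..n}. smooth_strip (a j)) \<and>
      (\<forall>j\<in>{1..n}. \<forall>k\<in>{1..n}. smooth_strip (b j k)) \<and>
      (\<forall>(j, k) \<in> {1..m} \<times> {m+1..n} \<union> {m+1..n} \<times> {1..m}. smooth_real (r j k))"
      and f: "f \<in> Cper n" "\<forall>j\<in>{1..n}. smooth_strip (f j)" and u: "continuous_solution n m a b r f u"
      and j: "j \<in> {1..n}" for f u j
  proof (rule hypQ.continuous_solution_smooth[OF hQ _ _ _ bspec[OF f(2)] _ f(1) u j])
    show "a j x t = a j x s" if "j \<in> {1..n}" "x \<in> {0..1}" for j x t s
      using conjunct1[OF c] that by blast
    show "smooth_strip (a j)" if "j \<in> {1..n}" for j using c that by blast
    show "smooth_strip (b j k)" if "j \<in> {1..n}" "k \<in> {1..n}" for j k using c that by blast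
    show "smooth_real (r j k)" if "j \<in> {1..n}" "k \<in> H.opp j" for j k
    proof -
      have "(j, k) \<in> {1..m} \<times> {m+1..n} \<union> {m+1..n} \<times> {1..m}"
        using that by (auto simp: H.opp_def split: if_splits)
      then show ?thesis using c by blast
    qed
  qed
  have c5: "(\<forall>f\<in>Cper n. \<exists>!u. continuous_solution n m a b r f u) \<longrightarrow>
      continuous_map (Cper_top n) (Cper_top n) (\<lambda>f. THE u. continuous_solution n m a b r f u)"
    by (rule impI, rule Fr(5))
  have c6: "max (R0 n m a b r) (R1 n m a b r) < 1 \<or> max (S0 n m a b r) (S1 n m a b r) < 1 \<longrightarrow>
      (\<forall>f\<in>Cper n. (\<forall>j\<in>{1..n}. C1_in_time (f j)) \<longrightarrow>
        (\<forall>u. continuous_solution n m a b r f u \<longrightarrow> classical_solution n m a b r f u))"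
    by (intro impI ballI allI, rule iv)
  have c7: "(\<forall>j\<in>{1..n}. \<forall>x\<in>{0..1}. \<forall>t s. a j x t = a j x s) \<and>
      (\<forall>j\<in>{1..n}. smooth_strip (a j)) \<and>
      (\<forall>j\<in>{1..n}. \<forall>k\<in>{1..n}. smooth_strip (b j k)) \<and>
      (\<forall>(j, k) \<in> {1..m} \<times> {m+1..n} \<union> {m+1..n} \<times> {1..m}. smooth_real (r j k)) \<longrightarrow>
        (\<forall>f\<in>Cper n. (\<forall>j\<in>{1..n}. smooth_strip (f j)) \<longrightarrow>
          (\<forall>u. continuous_solution n m a b r f u \<longrightarrow> (\<forall>j\<in>{1..n}. smooth_strip (u j))))"
    by (intro impI ballI allI, rule v)
  show ?thesis
    by (rule conjI[OF Fr(1) conjI[OF Fr(2) conjI[OF Fr(3) conjI[OF Fr(4) conjI[OF c5 conjI[OF c6 c7]]]]]])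
qed

end
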